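(* Let $X_{14}^4$ be the blow-up of $\mathbb{P}^4$ at $14$ points in general position, with exceptional divisors $E_1,\dots,E_{14}$, let $H$ be the pull-back of the hyperplane class of $\mathbb{P}^4$, and let $D:=2H-E_1-\dots-E_{14}$. Then $4D$ is non-special and the dimension of the base locus $\operatorname{Bs}|4D|$ is at most $0$.
   Context: The ground field is $\mathbb{C}$. "Points in general position" means that the tuple of points lies in a suitable non-empty Zariski open subset of $(\mathbb{P}^4)^{14}$. For a divisor $D=dH-m_1E_1-\dots-m_rE_r$ on the blow-up of $\mathbb{P}^n$ at $r$ points, the virtual dimension is $$v(D)=\binom{d+n}{n}-\sum_{i=1}^r\binom{n+m_i-1}{n}-1,$$ and the expected dimension is $e(D)=\max\{-1,v(D)\}$. The divisor $D$ is called special if $\dim|D|>e(D)$ and non-special otherwise, where $\dim|D|=h^0(D)-1$. The base locus $\operatorname{Bs}|D|$ is the intersection of all the divisors $D'\in|D|$; the empty set is regarded as having dimension less than $0$. *)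

theory Defs
  imports "HOL-Analysis.Analysis" "HOL-Library.Poly_Mapping" "HOL-Library.Function_Algebras"
    "HOL-Library.Numeral_Type"
begin

section \<open>Krull dimension\<close>

definition irreducible_closedin :: "'a topology \<Rightarrow> 'a set \<Rightarrow> bool" where
  "irreducible_closedin T Z \<longleftrightarrow> closedin T Z \<and> Z \<noteq> {} \<and>
     (\<forall>A B. closedin T A \<and> closedin T B \<and> Z = A \<union> B \<longrightarrow> Z = A \<or> Z = B)"

text \<open>The empty space has no chains at all, so its dimension is the supremum of the empty set
  of extended reals, namely \<open>-\<infinity>\<close>.\<close>

definition krull_dim :: "'a topology \<Rightarrow> ereal" where
  "krull_dim T = Sup {ereal (real n) | n. \<exists>Z :: nat \<Rightarrow> 'a set.
     (\<forall>i\<le>n. irreducible_closedin T (Z i)) \<and> (\<forall>i<n. Z i \<subset> Z (Suc i))}"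


section \<open>Zariski topology and regular functions\<close>

text \<open>All varieties below are sets of tuples \<open>\<xi> :: 'i \<Rightarrow> (complex ^ 'n) set\<close> of linear
  subspaces of \<open>V = complex ^ 'n\<close>, each \<open>\<xi> i\<close> having a fixed dimension, i.e. subsets of
  products of Grassmannians. The coordinates on them are polynomials on \<open>V\<^sup>I\<close>, the variable
  \<open>(i, k)\<close> being the \<open>k\<close>-th coordinate of the \<open>i\<close>-th vector.\<close>

type_synonym ('i, 'n) tuple_poly = "('i \<times> 'n \<Rightarrow>\<^sub>0 nat) \<Rightarrow>\<^sub>0 complex"

definition tuple_eval :: "('i, 'n::finite) tuple_poly \<Rightarrow> ('i \<Rightarrow> complex ^ 'n) \<Rightarrow> complex" where
  "tuple_eval F y =
     (\<Sum>a\<in>Poly_Mapping.keys F. Poly_Mapping.lookup F a *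
        (\<Prod>(i, k)\<in>Poly_Mapping.keys a. (y i $ k) ^ Poly_Mapping.lookup a (i, k)))"

text \<open>A polynomial \<open>F\<close> vanishes at the point \<open>\<xi>\<close> if it vanishes on \<open>\<Prod>i. \<xi> i\<close>. For a tuple of
  lines through the origin this says that all multihomogeneous components of \<open>F\<close> vanish at
  \<open>\<xi>\<close>, so one obtains the usual closed sets of a product of projective spaces. In general
  \<open>F\<close> restricts to a section of the (sums of symmetric powers of the) duals of the tautological
  bundles, and its vanishing locus is Zariski closed. All closed sets are intersections of
  such loci.\<close>

definition nonvanishing ::
    "('i \<Rightarrow> (complex ^ 'n::finite) set) set \<Rightarrow> ('i, 'n) tuple_poly \<Rightarrow>
     ('i \<Rightarrow> (complex ^ 'n) set) set" where
  "nonvanishing X F = {\<xi> \<in> X. \<exists>y. (\<forall>i. y i \<in> \<xi> i) \<and> tuple_eval F y \<noteq> 0}"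

definition zariski ::
    "('i \<Rightarrow> (complex ^ 'n::finite) set) set \<Rightarrow> ('i \<Rightarrow> (complex ^ 'n) set) topology" where
  "zariski X = topology_generated_by (range (nonvanishing X))"

text \<open>\<open>g \<eta>\<close> is a function on \<open>\<Prod>i. \<eta> i\<close>. Locally in \<open>\<eta>\<close> it is required to be a quotient of
  polynomials whose denominator does not vanish identically on \<open>\<Prod>i. \<eta> i\<close>.\<close>

definition locally_fraction ::
    "('i \<Rightarrow> (complex ^ 'n::finite) set) set \<Rightarrow> ('i \<Rightarrow> (complex ^ 'n) set) set \<Rightarrow>
     (('i \<Rightarrow> (complex ^ 'n) set) \<Rightarrow> ('i \<Rightarrow> complex ^ 'n) \<Rightarrow> complex) \<Rightarrow> bool" where
  "locally_fraction X U g \<longleftrightarrow>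
     (\<forall>\<xi>\<in>U. \<exists>A B. \<xi> \<in> nonvanishing X B \<and>
        (\<forall>\<eta> \<in> U \<inter> nonvanishing X B. \<forall>y. (\<forall>i. y i \<in> \<eta> i) \<longrightarrow>
            g \<eta> y * tuple_eval B y = tuple_eval A y))"

definition regular_on ::
    "('i \<Rightarrow> (complex ^ 'n::finite) set) set \<Rightarrow> ('i \<Rightarrow> (complex ^ 'n) set) set \<Rightarrow>
     (('i \<Rightarrow> (complex ^ 'n) set) \<Rightarrow> complex) \<Rightarrow> bool" where
  "regular_on X U f \<longleftrightarrow> openin (zariski X) U \<and> locally_fraction X U (\<lambda>\<eta> y. f \<eta>)"

text \<open>\<open>t\<close> generates the ideal sheaf of \<open>E\<close> on \<open>U\<close>.\<close>

definition local_equation ::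
    "('i \<Rightarrow> (complex ^ 'n::finite) set) set \<Rightarrow> ('i \<Rightarrow> (complex ^ 'n) set) set \<Rightarrow>
     ('i \<Rightarrow> (complex ^ 'n) set) set \<Rightarrow> (('i \<Rightarrow> (complex ^ 'n) set) \<Rightarrow> complex) \<Rightarrow> bool" where
  "local_equation X E U t \<longleftrightarrow> regular_on X U t \<and> (\<forall>\<eta>\<in>U \<inter> E. t \<eta> = 0) \<and>
     (\<forall>W g. W \<subseteq> U \<and> regular_on X W g \<and> (\<forall>\<eta>\<in>W \<inter> E. g \<eta> = 0) \<longrightarrow>
        (\<exists>h. regular_on X W h \<and> (\<forall>\<eta>\<in>W. g \<eta> = t \<eta> * h \<eta>)))"


section \<open>Projective space and its blow-up at points\<close>

text \<open>\<open>\<P>(V)\<close> has dimension \<open>CARD('n) - 1\<close>.\<close>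

definition proj_space :: "(complex ^ 'n::finite) set set" where
  "proj_space = {L. vec.subspace L \<and> vec.dim L = 1}"

definition proj_tuples :: "('r \<Rightarrow> (complex ^ 'n::finite) set) set" where
  "proj_tuples = {p. \<forall>i. p i \<in> proj_space}"

text \<open>The blow-up of \<open>\<P>(V)\<close> at a point \<open>q\<close> is the incidence variety of pairs \<open>(x, l)\<close> of a point
  \<open>x\<close> and a projective line \<open>l\<close> (a two-dimensional subspace of \<open>V\<close>) containing \<open>q\<close> and \<open>x\<close>; the
  blow-up at several distinct points is the fibre product over \<open>\<P>(V)\<close> of the blow-ups at the
  single points. The component \<open>\<xi> None\<close> is the image of \<open>\<xi>\<close> in \<open>\<P>(V)\<close>, and \<open>\<xi> (Some i)\<close> is the
  line through the \<open>i\<close>-th point.\<close>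

definition blowup ::
    "('r \<Rightarrow> (complex ^ 'n::finite) set) \<Rightarrow> ('r option \<Rightarrow> (complex ^ 'n) set) set" where
  "blowup p = {\<xi>. \<xi> None \<in> proj_space \<and>
     (\<forall>i. vec.subspace (\<xi> (Some i)) \<and> vec.dim (\<xi> (Some i)) = 2 \<and>
          p i \<subseteq> \<xi> (Some i) \<and> \<xi> None \<subseteq> \<xi> (Some i))}"

definition exceptional ::
    "('r \<Rightarrow> (complex ^ 'n::finite) set) \<Rightarrow> 'r \<Rightarrow> ('r option \<Rightarrow> (complex ^ 'n) set) set" where
  "exceptional p i = {\<xi> \<in> blowup p. \<xi> None = p i}"


section \<open>Divisors and linear systems\<close>

text \<open>The pair \<open>(d, m)\<close> stands for the divisor \<open>d H - (\<Sum>i. m i E\<^sub>i)\<close> with \<open>d\<close> and all \<open>m i\<close>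
  nonnegative.\<close>

type_synonym 'r divisor = "nat \<times> ('r \<Rightarrow> nat)"

definition multiple :: "nat \<Rightarrow> 'r divisor \<Rightarrow> 'r divisor" where
  "multiple k D = (k * fst D, \<lambda>i. k * snd D i)"

text \<open>Sections over \<open>U\<close> of \<open>\<O>(d H)\<close>, the pull-back of \<open>\<O>(d)\<close>. The fibre of \<open>\<O>(d)\<close> at a line
  \<open>L\<close> through the origin consists of the functions on \<open>L\<close> that are homogeneous of degree \<open>d\<close>.\<close>

definition regular_form ::
    "('r option \<Rightarrow> (complex ^ 'n::finite) set) set \<Rightarrow> ('r option \<Rightarrow> (complex ^ 'n) set) set \<Rightarrow> nat \<Rightarrow>
     (('r option \<Rightarrow> (complex ^ 'n) set) \<times> (complex ^ 'n) \<Rightarrow> complex) \<Rightarrow> bool" where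
  "regular_form X U d s \<longleftrightarrow> openin (zariski X) U \<and>
     (\<forall>\<eta>\<in>U. \<forall>v\<in>\<eta> None. \<forall>c. s (\<eta>, c *s v) = c ^ d * s (\<eta>, v)) \<and>
     locally_fraction X U (\<lambda>\<eta> y. s (\<eta>, y None))"

text \<open>On \<open>U\<close>, the section \<open>s\<close> of \<open>\<O>(d H)\<close> is divisible by the product of the \<open>m i\<close>-th powers
  of local equations of the \<open>E\<^sub>i\<close>, with quotient \<open>u\<close>.\<close>

definition local_quotient ::
    "('r::finite \<Rightarrow> (complex ^ 'n::finite) set) \<Rightarrow> 'r divisor \<Rightarrow>
     (('r option \<Rightarrow> (complex ^ 'n) set) \<times> (complex ^ 'n) \<Rightarrow> complex) \<Rightarrow>
     ('r option \<Rightarrow> (complex ^ 'n) set) set \<Rightarrow>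
     (('r option \<Rightarrow> (complex ^ 'n) set) \<times> (complex ^ 'n) \<Rightarrow> complex) \<Rightarrow> bool" where
  "local_quotient p D s U u \<longleftrightarrow> regular_form (blowup p) U (fst D) u \<and>
     (\<exists>t. (\<forall>i. local_equation (blowup p) (exceptional p i) U (t i)) \<and>
          (\<forall>\<eta>\<in>U. \<forall>v\<in>\<eta> None. s (\<eta>, v) = (\<Prod>i\<in>UNIV. t i \<eta> ^ snd D i) * u (\<eta>, v)))"

text \<open>Global sections of \<open>\<O>(d H - (\<Sum>i. m i E\<^sub>i))\<close>, as the subsheaf of \<open>\<O>(d H)\<close> of the sections
  vanishing to order at least \<open>m i\<close> along each \<open>E\<^sub>i\<close>. They are extended by zero off their
  domain, so that equal sections are equal functions.\<close>

definition sections ::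
    "('r::finite \<Rightarrow> (complex ^ 'n::finite) set) \<Rightarrow> 'r divisor \<Rightarrow>
     (('r option \<Rightarrow> (complex ^ 'n) set) \<times> (complex ^ 'n) \<Rightarrow> complex) set" where
  "sections p D = {s.
     (\<forall>\<eta> v. \<not> (\<eta> \<in> blowup p \<and> v \<in> \<eta> None) \<longrightarrow> s (\<eta>, v) = 0) \<and>
     regular_form (blowup p) (blowup p) (fst D) s \<and>
     (\<forall>\<xi>\<in>blowup p. \<exists>U u. \<xi> \<in> U \<and> local_quotient p D s U u)}"

text \<open>The support of the effective divisor \<open>div s - (\<Sum>i. m i E\<^sub>i) \<in> |D|\<close> defined by a nonzero
  section \<open>s\<close>: this divisor is locally the zero divisor of the quotient \<open>u\<close>.\<close>

definition divisor_support ::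
    "('r::finite \<Rightarrow> (complex ^ 'n::finite) set) \<Rightarrow> 'r divisor \<Rightarrow>
     (('r option \<Rightarrow> (complex ^ 'n) set) \<times> (complex ^ 'n) \<Rightarrow> complex) \<Rightarrow>
     ('r option \<Rightarrow> (complex ^ 'n) set) set" where
  "divisor_support p D s = {\<xi> \<in> blowup p. \<exists>U u. \<xi> \<in> U \<and> local_quotient p D s U u \<and>
     (\<forall>v\<in>\<xi> None. u (\<xi>, v) = 0)}"

definition base_locus ::
    "('r::finite \<Rightarrow> (complex ^ 'n::finite) set) \<Rightarrow> 'r divisor \<Rightarrow>
     ('r option \<Rightarrow> (complex ^ 'n) set) set" where
  "base_locus p D = {\<xi> \<in> blowup p. \<forall>s \<in> sections p D. s \<noteq> (\<lambda>_. 0) \<longrightarrow> \<xi> \<in> divisor_support p D s}"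

interpretation cfun: vector_space "\<lambda>(c::complex) (f :: 'a \<Rightarrow> complex) x. c * f x"
  by unfold_locales (auto simp: fun_eq_iff algebra_simps)

definition h0 :: "('r::finite \<Rightarrow> (complex ^ 'n::finite) set) \<Rightarrow> 'r divisor \<Rightarrow> nat" where
  "h0 p D = cfun.dim (sections p D)"

definition dim_linear_system ::
    "('r::finite \<Rightarrow> (complex ^ 'n::finite) set) \<Rightarrow> 'r divisor \<Rightarrow> int" where
  "dim_linear_system p D = int (h0 p D) - 1"

text \<open>In the next two definitions \<open>n\<close> is the dimension of the projective space.\<close>

definition virtual_dim :: "nat \<Rightarrow> 'r::finite divisor \<Rightarrow> int" where
  "virtual_dim n D = int ((fst D + n) choose n) - (\<Sum>i\<in>UNIV. int ((n + snd D i - 1) choose n)) - 1"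

definition expected_dim :: "nat \<Rightarrow> 'r::finite divisor \<Rightarrow> int" where
  "expected_dim n D = max (-1) (virtual_dim n D)"

definition special :: "('r::finite \<Rightarrow> (complex ^ 'n::finite) set) \<Rightarrow> 'r divisor \<Rightarrow> bool" where
  "special p D \<longleftrightarrow> dim_linear_system p D > expected_dim (CARD('n) - 1) D"

end

theory Submission
  imports Defs "HOL-Computational_Algebra.Fundamental_Theorem_Algebra"
begin

text \<open>Sections of \<open>\<O>(8 H - 4 \<Sum> E\<^sub>i)\<close> are octic forms in five variables with multiplicity at least 4 at the
  points. Such a form satisfies \<open>14 * 35 = 490\<close> linear equations, the vanishing of its Hasse
  derivatives of order 3, on 495 coefficients, so the virtual dimension is 4. Non-speciality means that
  these equations are independent, and finiteness of the base locus means that the five octics that remain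
  have finitely many common zeros, both in the projective space and, for their leading forms at each of the points,
  on the exceptional divisors.

  All of these are open conditions given by polynomials with integer coefficients in the coordinates of the points,
  so it is enough to find one configuration where they hold, and this may be done over a finite field:
  an integer polynomial that is nonzero modulo 29 is not the zero polynomial. The independence of the
  equations and a basis of their kernel that depends polynomially on the points come from
  elimination (\<open>elimination\<close>). Finiteness is made an open condition by \<open>finite_cone\<close>: forms have finitely
  many common zeros if, together with a hyperplane, they generate all forms of some degree, and this is
  the injectivity of a matrix (\<open>fills_open\<close>). By \<open>fills_powers\<close> it suffices to represent the powers
  of the coordinates.

  The configuration over the field with 29 elements consists of two orbits of a diagonal matrix of order 7.
  The octics split into seven eigenspaces of dimension 70 or 71, so that independence reduces to seven
  matrices with 70 rows, which are eliminated explicitly; five of them have a kernel of dimension one.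
  The powers \<open>x\<^sub>k ^ 18\<close>, and \<open>x\<^sub>k ^ 6\<close> in the case of the leading forms, which are quartics,
  are given as explicit combinations of the five forms modulo the first coordinate, or the first two
  (\<open>powers_base\<close>, \<open>powers_exceptional\<close>).

  The other half of the proof identifies the sections and their divisors on the blow-up. A regular section is
  restricted to lines and is thereby shown to be a form (\<open>section_form\<close>); its order of vanishing on an
  exceptional divisor is read off along curves that meet this divisor transversally
  (\<open>local_quotient_order\<close>). Conversely, a form of the required multiplicity is divisible by the powers of
  explicit local equations (\<open>height_local_equation\<close>, \<open>form_section_in_sections\<close>).\<close>

section \<open>Polynomial functions\<close>

definition tpoly :: "(('i \<Rightarrow> complex ^ 'n::finite) \<Rightarrow> complex) \<Rightarrow> bool" where
  "tpoly f \<longleftrightarrow> (\<exists>F. f = tuple_eval F)"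

definition tuple_monom :: "('i \<times> 'n \<Rightarrow>\<^sub>0 nat) \<Rightarrow> ('i \<Rightarrow> complex ^ 'n::finite) \<Rightarrow> complex" where
  "tuple_monom a y = (\<Prod>(i, k)\<in>Poly_Mapping.keys a. (y i $ k) ^ Poly_Mapping.lookup a (i, k))"

lemma tuple_monom_superset:
  assumes "finite S" "Poly_Mapping.keys a \<subseteq> S"
  shows "tuple_monom a y = (\<Prod>(i, k)\<in>S. (y i $ k) ^ Poly_Mapping.lookup a (i, k))"
  unfolding tuple_monom_def
  by (rule prod.mono_neutral_left) (use assms in \<open>auto simp: in_keys_iff\<close>)

lemma tuple_monom_add: "tuple_monom (a + b) y = tuple_monom a y * tuple_monom b y"
proof -
  let ?S = "Poly_Mapping.keys a \<union> Poly_Mapping.keys b"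
  have "tuple_monom (a + b) y = (\<Prod>(i, k)\<in>?S. (y i $ k) ^ Poly_Mapping.lookup (a + b) (i, k))"
    by (rule tuple_monom_superset) (auto simp: keys_add)
  also have "\<dots> = (\<Prod>(i, k)\<in>?S. (y i $ k) ^ Poly_Mapping.lookup a (i, k)) *
      (\<Prod>(i, k)\<in>?S. (y i $ k) ^ Poly_Mapping.lookup b (i, k))"
    by (simp add: lookup_add power_add prod.distrib split_def)
  also have "\<dots> = tuple_monom a y * tuple_monom b y"
    by (simp add: tuple_monom_superset[of ?S])
  finally show ?thesis .
qed

lemma tuple_eval_monoms:
  "tuple_eval F y = (\<Sum>a\<in>Poly_Mapping.keys F. Poly_Mapping.lookup F a * tuple_monom a y)"
  by (simp add: tuple_eval_def tuple_monom_def)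

lemma tuple_eval_superset:
  assumes "finite S" "Poly_Mapping.keys F \<subseteq> S"
  shows "tuple_eval F y = (\<Sum>a\<in>S. Poly_Mapping.lookup F a * tuple_monom a y)"
  unfolding tuple_eval_monoms
  by (rule sum.mono_neutral_left) (use assms in \<open>auto simp: in_keys_iff\<close>)

lemma tuple_eval_add: "tuple_eval (F + G) y = tuple_eval F y + tuple_eval G y"
proof -
  let ?S = "Poly_Mapping.keys F \<union> Poly_Mapping.keys G"
  have "tuple_eval (F + G) y = (\<Sum>a\<in>?S. Poly_Mapping.lookup (F + G) a * tuple_monom a y)"
    by (rule tuple_eval_superset) (auto simp: keys_add)
  then show ?thesis
    by (simp add: tuple_eval_superset[of ?S] lookup_add algebra_simps sum.distrib)
qed

lemma tpoly_monom: "tpoly (\<lambda>y. c * tuple_monom a y)"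
proof -
  have "tuple_eval (Poly_Mapping.single a c) y = c * tuple_monom a y" for y
    using tuple_eval_superset[of "{a}" "Poly_Mapping.single a c" y] by simp
  then have "(\<lambda>y. c * tuple_monom a y) = tuple_eval (Poly_Mapping.single a c)" by (rule ext[OF sym])
  then show ?thesis unfolding tpoly_def by (rule exI)
qed

lemma tpoly_eval [simp]: "tpoly (tuple_eval F)"
  by (auto simp: tpoly_def)

lemma tpoly_add [intro]: "tpoly f \<Longrightarrow> tpoly g \<Longrightarrow> tpoly (\<lambda>y. f y + g y)"
proof -
  assume "tpoly f" "tpoly g"
  then obtain F G where "f = tuple_eval F" "g = tuple_eval G" by (auto simp: tpoly_def)
  then have "(\<lambda>y. f y + g y) = tuple_eval (F + G)" by (simp add: fun_eq_iff tuple_eval_add)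
  then show ?thesis unfolding tpoly_def by (rule exI)
qed

lemma tpoly_const [intro]: "tpoly (\<lambda>y. c)"
proof -
  have "tpoly (\<lambda>y. c * tuple_monom 0 y)" by (rule tpoly_monom)
  then show ?thesis by (simp add: tuple_monom_def)
qed

lemma tpoly_coord [intro]: "tpoly (\<lambda>y. y i $ k)"
proof -
  have "tpoly (\<lambda>y. 1 * tuple_monom (Poly_Mapping.single (i, k) 1) y)" by (rule tpoly_monom)
  then show ?thesis by (simp add: tuple_monom_def lookup_single)
qed

lemma tpoly_sum [intro]: "(\<And>a. a \<in> S \<Longrightarrow> tpoly (f a)) \<Longrightarrow> tpoly (\<lambda>y. \<Sum>a\<in>S. f a y)"
  by (induction S rule: infinite_finite_induct) auto

lemma tpoly_mult [intro]:
  assumes "tpoly f" "tpoly g"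
  shows "tpoly (\<lambda>y. f y * g y)"
proof -
  from assms obtain F G where FG: "f = tuple_eval F" "g = tuple_eval G" by (auto simp: tpoly_def)
  have eq: "(\<lambda>y. f y * g y) = (\<lambda>y. \<Sum>a\<in>Poly_Mapping.keys F. \<Sum>b\<in>Poly_Mapping.keys G.
      (Poly_Mapping.lookup F a * Poly_Mapping.lookup G b) * tuple_monom (a + b) y)"
    by (auto simp: fun_eq_iff FG tuple_eval_monoms sum_product tuple_monom_add mult_ac intro!: sum.cong)
  show ?thesis unfolding eq by (intro tpoly_sum tpoly_monom)
qed

lemma tpoly_prod [intro]: "(\<And>a. a \<in> S \<Longrightarrow> tpoly (f a)) \<Longrightarrow> tpoly (\<lambda>y. \<Prod>a\<in>S. f a y)"
  by (induction S rule: infinite_finite_induct) auto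

lemma tpoly_power [intro]: "tpoly f \<Longrightarrow> tpoly (\<lambda>y. f y ^ n)"
  by (induction n) auto

lemma tpoly_diff [intro]: "tpoly f \<Longrightarrow> tpoly g \<Longrightarrow> tpoly (\<lambda>y. f y - g y)"
  using tpoly_add[OF _ tpoly_mult[OF tpoly_const[of "- 1"]], of f g] by simp

lemma tpoly_induct [consumes 1, case_names const coord add mult]:
  fixes f :: "('i \<Rightarrow> complex ^ 'n::finite) \<Rightarrow> complex"
  assumes f: "tpoly f" and c: "\<And>c. P (\<lambda>y. c)" and v: "\<And>i k. P (\<lambda>y. y i $ k)"
    and add: "\<And>f g. P f \<Longrightarrow> P g \<Longrightarrow> P (\<lambda>y. f y + g y)"
    and mult: "\<And>f g. P f \<Longrightarrow> P g \<Longrightarrow> P (\<lambda>y. f y * g y)"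
  shows "P f"
proof -
  from f obtain F where F: "f = tuple_eval F" by (auto simp: tpoly_def)
  have sum: "P (\<lambda>y. \<Sum>a\<in>S. g a y)" if "\<And>a. a \<in> S \<Longrightarrow> P (g a)" for S :: "'z set" and g
    using that by (induction S rule: infinite_finite_induct) (auto intro: c add)
  have prod: "P (\<lambda>y. \<Prod>a\<in>S. g a y)" if "\<And>a. a \<in> S \<Longrightarrow> P (g a)" for S :: "'z set" and g
    using that by (induction S rule: infinite_finite_induct) (auto intro: c mult)
  have pow: "P (\<lambda>y. g y ^ n)" if "P g" for g and n :: nat
    using that by (induction n) (auto intro: c mult)
  show ?thesis
    unfolding F tuple_eval_def[abs_def] split_def by (intro sum prod mult c pow v)
qed

text \<open>Restriction to a line reduces statements about \<open>tpoly\<close> to polynomials in one variable.\<close>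

definition upoly :: "(complex \<Rightarrow> complex) \<Rightarrow> bool" where
  "upoly f \<longleftrightarrow> (\<exists>P. f = poly P)"

lemma upoly_const [intro]: "upoly (\<lambda>s. c)"
  unfolding upoly_def by (rule exI[of _ "[:c:]"]) auto

lemma upoly_id [intro]: "upoly (\<lambda>s. s)"
  unfolding upoly_def by (rule exI[of _ "[:0, 1:]"]) auto

lemma upoly_add [intro]: "upoly f \<Longrightarrow> upoly g \<Longrightarrow> upoly (\<lambda>s. f s + g s)"
proof -
  assume "upoly f" "upoly g"
  then obtain P Q where "f = poly P" "g = poly Q" by (auto simp: upoly_def)
  then have "(\<lambda>s. f s + g s) = poly (P + Q)" by (simp add: fun_eq_iff)
  then show ?thesis unfolding upoly_def by (rule exI)
qed

lemma upoly_mult [intro]: "upoly f \<Longrightarrow> upoly g \<Longrightarrow> upoly (\<lambda>s. f s * g s)"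
proof -
  assume "upoly f" "upoly g"
  then obtain P Q where "f = poly P" "g = poly Q" by (auto simp: upoly_def)
  then have "(\<lambda>s. f s * g s) = poly (P * Q)" by (simp add: fun_eq_iff)
  then show ?thesis unfolding upoly_def by (rule exI)
qed

lemma upoly_diff [intro]: "upoly f \<Longrightarrow> upoly g \<Longrightarrow> upoly (\<lambda>s. f s - g s)"
proof -
  assume "upoly f" "upoly g"
  then obtain P Q where "f = poly P" "g = poly Q" by (auto simp: upoly_def)
  then have "(\<lambda>s. f s - g s) = poly (P - Q)" by (simp add: fun_eq_iff)
  then show ?thesis unfolding upoly_def by (rule exI)
qed

lemma upoly_power [intro]: "upoly f \<Longrightarrow> upoly (\<lambda>s. f s ^ n)"
  by (induction n) auto

lemma upoly_sum [intro]: "(\<And>a. a \<in> S \<Longrightarrow> upoly (f a)) \<Longrightarrow> upoly (\<lambda>s. \<Sum>a\<in>S. f a s)"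
  by (induction S rule: infinite_finite_induct) auto

lemma upoly_prod [intro]: "(\<And>a. a \<in> S \<Longrightarrow> upoly (f a)) \<Longrightarrow> upoly (\<lambda>s. \<Prod>a\<in>S. f a s)"
  by (induction S rule: infinite_finite_induct) auto

lemma upoly_finite_zeros:
  assumes "upoly f" "f s0 \<noteq> 0"
  shows "finite {s. f s = 0}"
proof -
  from assms obtain P where "f = poly P" by (auto simp: upoly_def)
  moreover from this assms(2) have "P \<noteq> 0" by auto
  ultimately show ?thesis using poly_roots_finite[of P] by simp
qed

lemma eventually_at_finite:
  assumes "finite {s. \<not> Q s}"
  shows "\<forall>\<^sub>F s in at (0::complex). Q s"
proof -
  have "finite ({s. \<not> Q s} - {0})" using assms by simp
  then have "open (- ({s. \<not> Q s} - {0}))" by (intro open_Compl finite_imp_closed)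
  then show ?thesis unfolding eventually_at_topological
    by (intro exI[of _ "- ({s. \<not> Q s} - {0})"]) auto
qed

lemma upoly_eventually_nonzero:
  assumes "upoly f" "f 0 \<noteq> 0"
  shows "\<forall>\<^sub>F s in at 0. f s \<noteq> 0"
  using eventually_at_finite[of "\<lambda>s. f s \<noteq> 0"] upoly_finite_zeros[OF assms] by simp

lemma upoly_tendsto: "upoly f \<Longrightarrow> (f \<longlongrightarrow> f 0) (at 0)"
  unfolding upoly_def using poly_isCont[where x = 0] by (auto simp: isCont_def)

lemma upoly_zero:
  assumes "upoly f" "\<forall>\<^sub>F s in at 0. f s = 0"
  shows "f s = 0"
proof (rule ccontr)
  assume "f s \<noteq> 0"
  with assms have "finite {s. f s = 0}" by (intro upoly_finite_zeros)
  then have "\<forall>\<^sub>F s in at 0. f s \<noteq> 0" by (intro eventually_at_finite) auto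
  with assms(2) have "\<forall>\<^sub>F s in at (0::complex). False" by eventually_elim auto
  then show False by simp
qed

lemma upoly_eq:
  assumes "upoly f" "upoly g" "\<forall>\<^sub>F s in at 0. f s = g s"
  shows "f s = g s"
  using upoly_zero[of "\<lambda>s. f s - g s" s] assms by auto

lemma upoly_tpoly:
  assumes "tpoly f" "\<And>i k. upoly (\<lambda>s. Y s i $ k)"
  shows "upoly (\<lambda>s. f (Y s))"
  using assms(1) by (induction rule: tpoly_induct) (use assms(2) in auto)

text \<open>Polynomial functions on a linear space, such as the product of the components of a tuple of
  subspaces, have no zero divisors: restrict to the line through two points.\<close>

definition tprod :: "('i \<Rightarrow> (complex ^ 'n::finite) set) \<Rightarrow> ('i \<Rightarrow> complex ^ 'n) set" where
  "tprod \<xi> = {y. \<forall>i. y i \<in> \<xi> i}"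

definition subspaces :: "('i \<Rightarrow> (complex ^ 'n::finite) set) \<Rightarrow> bool" where
  "subspaces \<xi> \<longleftrightarrow> (\<forall>i. vec.subspace (\<xi> i))"

definition tline :: "('i \<Rightarrow> complex ^ 'n::finite) \<Rightarrow> ('i \<Rightarrow> complex ^ 'n) \<Rightarrow> complex \<Rightarrow> 'i \<Rightarrow> complex ^ 'n" where
  "tline y z s = (\<lambda>i. y i + s *s (z i - y i))"

lemma tline_simps [simp]: "tline y z 0 = y" "tline y z 1 = z"
  by (auto simp: tline_def fun_eq_iff)

lemma tline_in: "subspaces \<xi> \<Longrightarrow> y \<in> tprod \<xi> \<Longrightarrow> z \<in> tprod \<xi> \<Longrightarrow> tline y z s \<in> tprod \<xi>"
  by (auto simp: subspaces_def tprod_def tline_def vec.subspace_add vec.subspace_scale vec.subspace_diff)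

lemma upoly_tline: "tpoly f \<Longrightarrow> upoly (\<lambda>s. f (tline y z s))"
  by (rule upoly_tpoly) (auto simp: tline_def intro!: upoly_add upoly_mult)

lemma tprod_nonzero_mult:
  assumes "subspaces \<xi>" "tpoly f" "tpoly g" "y \<in> tprod \<xi>" "f y \<noteq> 0" "z \<in> tprod \<xi>" "g z \<noteq> 0"
  obtains x where "x \<in> tprod \<xi>" "f x \<noteq> 0" "g x \<noteq> 0"
proof -
  have "finite {s. f (tline y z s) = 0}" "finite {s. g (tline y z s) = 0}"
    using upoly_finite_zeros[OF upoly_tline[OF assms(2)], of y z 0]
      upoly_finite_zeros[OF upoly_tline[OF assms(3)], of y z 1] assms(5,7) by simp_all
  then have "finite ({s. f (tline y z s) = 0} \<union> {s. g (tline y z s) = 0})" by auto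
  then obtain s where "s \<notin> {s. f (tline y z s) = 0} \<union> {s. g (tline y z s) = 0}"
    using ex_new_if_finite[OF infinite_UNIV_char_0] by blast
  with tline_in[OF assms(1,4,6)] show ?thesis by (intro that) auto
qed

text \<open>A linear space is irreducible: a polynomial that vanishes where \<open>g\<close> does not must vanish
  identically, unless \<open>g\<close> does.\<close>

lemma tprod_zero:
  assumes "subspaces \<xi>" "tpoly f" "tpoly g" "z \<in> tprod \<xi>" "g z \<noteq> 0"
    and "\<And>x. x \<in> tprod \<xi> \<Longrightarrow> g x \<noteq> 0 \<Longrightarrow> f x = 0" "y \<in> tprod \<xi>"
  shows "f y = 0"
  using tprod_nonzero_mult[OF assms(1-3) \<open>y \<in> tprod \<xi>\<close> _ assms(4,5)] assms(6) by metis

section \<open>The Zariski topology\<close>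

definition nv :: "('i \<Rightarrow> (complex ^ 'n::finite) set) set \<Rightarrow> (('i \<Rightarrow> complex ^ 'n) \<Rightarrow> complex) \<Rightarrow>
    ('i \<Rightarrow> (complex ^ 'n) set) set" where
  "nv X f = {\<xi> \<in> X. \<exists>y\<in>tprod \<xi>. f y \<noteq> 0}"

lemma nonvanishing_nv: "nonvanishing X F = nv X (tuple_eval F)"
  by (auto simp: nonvanishing_def nv_def tprod_def)

lemma openin_nv [intro]: "tpoly f \<Longrightarrow> openin (zariski X) (nv X f)"
  unfolding tpoly_def zariski_def
  by (auto simp: nonvanishing_nv[symmetric] intro: topology_generated_by_Basis)

text \<open>Basic open sets are closed under intersections, because linear spaces are irreducible; hence they
  form a base of the topology.\<close>

lemma nv_mult:
  assumes "\<And>\<xi>. \<xi> \<in> X \<Longrightarrow> subspaces \<xi>" "tpoly f" "tpoly g"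
  shows "nv X (\<lambda>y. f y * g y) = nv X f \<inter> nv X g"
proof
  show "nv X f \<inter> nv X g \<subseteq> nv X (\<lambda>y. f y * g y)"
  proof
    fix \<xi> assume "\<xi> \<in> nv X f \<inter> nv X g"
    then obtain y z where *: "\<xi> \<in> X" "y \<in> tprod \<xi>" "f y \<noteq> 0" "z \<in> tprod \<xi>" "g z \<noteq> 0"
      by (auto simp: nv_def)
    obtain x where "x \<in> tprod \<xi>" "f x \<noteq> 0" "g x \<noteq> 0"
      by (rule tprod_nonzero_mult[OF assms(1)[OF *(1)] assms(2,3) *(2-5)])
    with *(1) show "\<xi> \<in> nv X (\<lambda>y. f y * g y)" by (auto simp: nv_def)
  qed
qed (auto simp: nv_def)

lemma nv_one: "(\<And>\<xi>. \<xi> \<in> X \<Longrightarrow> subspaces \<xi>) \<Longrightarrow> nv X (\<lambda>y. 1) = X"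
  by (auto simp: nv_def tprod_def subspaces_def intro!: exI[of _ "\<lambda>_. 0"] vec.subspace_0)

lemma openin_zariski_nv:
  assumes X: "\<And>\<xi>. \<xi> \<in> X \<Longrightarrow> subspaces \<xi>" and U: "openin (zariski X) U" and "\<xi> \<in> U"
  obtains f where "tpoly f" "\<xi> \<in> nv X f" "nv X f \<subseteq> U"
proof -
  have "generate_topology_on (range (nonvanishing X)) U"
    using U unfolding zariski_def openin_topology_generated_by_iff .
  then have "\<xi> \<in> U \<Longrightarrow> \<exists>f. tpoly f \<and> \<xi> \<in> nv X f \<and> nv X f \<subseteq> U"
  proof (induction)
    case (Int a b)
    then obtain f g where "tpoly f" "\<xi> \<in> nv X f" "nv X f \<subseteq> a" "tpoly g" "\<xi> \<in> nv X g" "nv X g \<subseteq> b"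
      by auto
    then have "tpoly (\<lambda>y. f y * g y) \<and> \<xi> \<in> nv X (\<lambda>y. f y * g y) \<and> nv X (\<lambda>y. f y * g y) \<subseteq> a \<inter> b"
      using nv_mult[OF X, where f = f and g = g] tpoly_mult[of f g] by simp blast
    then show ?case by (rule exI[of _ "\<lambda>y. f y * g y"])
  next
    case (UN K)
    then obtain k where k: "k \<in> K" "\<xi> \<in> k" by auto
    from UN.IH[OF this] obtain f where "tpoly f" "\<xi> \<in> nv X f" "nv X f \<subseteq> k" by auto
    with k show ?case by blast
  next
    case (Basis s)
    then obtain F where "s = nv X (tuple_eval F)" by (auto simp: nonvanishing_nv)
    with Basis.prems show ?case by (intro exI[of _ "tuple_eval F"]) simp
  qed auto
  with \<open>\<xi> \<in> U\<close> that show ?thesis by blast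
qed

lemma openin_zariski_space:
  assumes "\<And>\<xi>. \<xi> \<in> X \<Longrightarrow> subspaces \<xi>"
  shows "openin (zariski X) X"
  using openin_nv[of "\<lambda>y. 1" X] nv_one[of X] assms by auto

lemma openin_zariski_subset: "openin (zariski X) U \<Longrightarrow> U \<subseteq> X"
  using openin_subset[of "zariski X" U]
  by (auto simp: zariski_def nonvanishing_def)

section \<open>Forms and their Taylor coefficients\<close>

definition exps :: "nat \<Rightarrow> ('n::finite \<Rightarrow> nat) set" where
  "exps d = {a. sum a UNIV = d}"

definition xpow :: "('n::finite \<Rightarrow> nat) \<Rightarrow> ('n \<Rightarrow> 'a::comm_ring_1) \<Rightarrow> 'a" where
  "xpow a x = (\<Prod>k\<in>UNIV. x k ^ a k)"

definition form :: "nat \<Rightarrow> (('n::finite \<Rightarrow> nat) \<Rightarrow> 'a::comm_ring_1) \<Rightarrow> ('n \<Rightarrow> 'a) \<Rightarrow> 'a" where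
  "form d c x = (\<Sum>a\<in>exps d. c a * xpow a x)"

text \<open>The coefficient of \<open>w ^ b\<close> in the expansion of a form at \<open>x + w\<close>. In contrast to derivatives, these are
  meaningful in every characteristic.\<close>

definition hasse :: "nat \<Rightarrow> (('n::finite \<Rightarrow> nat) \<Rightarrow> 'a::comm_ring_1) \<Rightarrow> ('n \<Rightarrow> nat) \<Rightarrow> ('n \<Rightarrow> 'a) \<Rightarrow> 'a" where
  "hasse d c b x = (\<Sum>a\<in>exps d. c a * (of_nat (\<Prod>k\<in>UNIV. a k choose b k) * xpow (\<lambda>k. a k - b k) x))"

definition tay :: "nat \<Rightarrow> (('n::finite \<Rightarrow> nat) \<Rightarrow> 'a::comm_ring_1) \<Rightarrow> nat \<Rightarrow> ('n \<Rightarrow> 'a) \<Rightarrow> ('n \<Rightarrow> 'a) \<Rightarrow> 'a" where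
  "tay d c j x w = form j (\<lambda>b. hasse d c b x) w"

lemma exps_le: "a \<in> exps d \<Longrightarrow> a k \<le> d"
  unfolding exps_def using member_le_sum[of k UNIV a] by auto

lemma finite_exps [simp, intro]: "finite (exps d :: ('n::finite \<Rightarrow> nat) set)"
proof (rule finite_subset)
  show "exps d \<subseteq> PiE (UNIV :: 'n set) (\<lambda>_. {..d})" using exps_le by auto
  show "finite (PiE (UNIV :: 'n set) (\<lambda>_. {..d}))" by (intro finite_PiE) auto
qed

lemma exps_add: "a \<in> exps d \<Longrightarrow> b \<in> exps e \<Longrightarrow> (\<lambda>k. a k + b k) \<in> exps (d + e)"
  by (auto simp: exps_def sum.distrib)

lemma xpow_add: "xpow (\<lambda>k. a k + b k) x = xpow a x * xpow b x"
  by (simp add: xpow_def power_add prod.distrib)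

lemma xpow_scale: "a \<in> exps d \<Longrightarrow> xpow a (\<lambda>k. t * x k) = t ^ d * xpow a x"
  by (auto simp: xpow_def power_mult_distrib prod.distrib exps_def power_sum)

lemma form_scale: "form d c (\<lambda>k. t * x k) = t ^ d * form d c x"
  by (auto simp: form_def xpow_scale sum_distrib_left mult_ac intro!: sum.cong)

lemma form_tay:
  fixes x w :: "'n::finite \<Rightarrow> 'a::comm_ring_1"
  shows "form d c (\<lambda>k. t * x k + s * w k) = (\<Sum>j\<le>d. t ^ (d - j) * s ^ j * tay d c j x w)"
proof -
  define B where "B = (\<Union>j\<in>{..d}. exps j :: ('n \<Rightarrow> nat) set)"
  let ?ch = "\<lambda>a b. of_nat (\<Prod>k\<in>UNIV. a k choose b k) :: 'a"
  have B: "finite B" by (auto simp: B_def)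
  have xpow: "xpow a (\<lambda>k. t * x k + s * w k) =
     (\<Sum>b\<in>B. ?ch a b * (xpow b w * s ^ sum b UNIV) * (xpow (\<lambda>k. a k - b k) x * t ^ (d - sum b UNIV)))"
    if a: "a \<in> exps d" for a
  proof -
    have "xpow a (\<lambda>k. t * x k + s * w k) =
       (\<Prod>k\<in>UNIV. \<Sum>r\<le>a k. of_nat (a k choose r) * (s * w k) ^ r * (t * x k) ^ (a k - r))"
      unfolding xpow_def by (intro prod.cong refl) (subst add.commute, rule binomial_ring)
    also have "\<dots> = (\<Sum>b\<in>PiE UNIV (\<lambda>k. {..a k}). \<Prod>k\<in>UNIV. of_nat (a k choose b k) * (s * w k) ^ b k * (t * x k) ^ (a k - b k))"
      by (rule prod_sum_PiE) auto
    also have "\<dots> = (\<Sum>b\<in>PiE UNIV (\<lambda>k. {..a k}). ?ch a b * (xpow b w * s ^ sum b UNIV) * (xpow (\<lambda>k. a k - b k) x * t ^ (d - sum b UNIV)))"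
    proof (rule sum.cong[OF refl])
      fix b assume b: "b \<in> PiE UNIV (\<lambda>k. {..a k})"
      then have le: "b k \<le> a k" for k by auto
      have "(\<Sum>k\<in>UNIV. a k - b k) = d - sum b UNIV"
        using a by (simp add: exps_def sum_subtractf_nat le)
      then show "(\<Prod>k\<in>UNIV. of_nat (a k choose b k) * (s * w k) ^ b k * (t * x k) ^ (a k - b k)) =
          ?ch a b * (xpow b w * s ^ sum b UNIV) * (xpow (\<lambda>k. a k - b k) x * t ^ (d - sum b UNIV))"
        by (simp add: prod.distrib xpow_def power_mult_distrib power_sum[symmetric] of_nat_prod mult_ac)
    qed
    also have "\<dots> = (\<Sum>b\<in>B. ?ch a b * (xpow b w * s ^ sum b UNIV) * (xpow (\<lambda>k. a k - b k) x * t ^ (d - sum b UNIV)))"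
    proof (rule sum.mono_neutral_left[OF B])
      show "PiE UNIV (\<lambda>k. {..a k}) \<subseteq> B"
      proof
        fix b assume "b \<in> PiE UNIV (\<lambda>k. {..a k})"
        then have "sum b UNIV \<le> sum a UNIV" by (intro sum_mono) auto
        with a show "b \<in> B" by (auto simp: B_def exps_def)
      qed
      show "\<forall>b\<in>B - PiE UNIV (\<lambda>k. {..a k}). ?ch a b * (xpow b w * s ^ sum b UNIV) * (xpow (\<lambda>k. a k - b k) x * t ^ (d - sum b UNIV)) = 0"
      proof
        fix b assume "b \<in> B - PiE UNIV (\<lambda>k. {..a k})"
        then obtain k where "a k < b k" by (auto simp: PiE_def Pi_def not_le)
        then have "(\<Prod>k\<in>UNIV. a k choose b k) = 0" by (auto intro!: prod_zero bexI[of _ k] simp: binomial_eq_0)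
        then show "?ch a b * (xpow b w * s ^ sum b UNIV) * (xpow (\<lambda>k. a k - b k) x * t ^ (d - sum b UNIV)) = 0"
          by (metis mult_zero_left of_nat_0)
      qed
    qed
    finally show ?thesis .
  qed
  have "form d c (\<lambda>k. t * x k + s * w k) = (\<Sum>a\<in>exps d. \<Sum>b\<in>B. c a * (?ch a b * (xpow b w * s ^ sum b UNIV) * (xpow (\<lambda>k. a k - b k) x * t ^ (d - sum b UNIV))))"
    unfolding form_def by (intro sum.cong refl) (simp add: xpow sum_distrib_left)
  also have "\<dots> = (\<Sum>b\<in>B. \<Sum>a\<in>exps d. c a * (?ch a b * (xpow b w * s ^ sum b UNIV) * (xpow (\<lambda>k. a k - b k) x * t ^ (d - sum b UNIV))))"
    by (rule sum.swap)
  also have "\<dots> = (\<Sum>b\<in>B. t ^ (d - sum b UNIV) * s ^ sum b UNIV * (hasse d c b x * xpow b w))"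
    by (intro sum.cong refl) (simp add: hasse_def sum_distrib_left sum_distrib_right mult_ac)
  also have "\<dots> = (\<Sum>j\<le>d. \<Sum>b\<in>exps j. t ^ (d - sum b UNIV) * s ^ sum b UNIV * (hasse d c b x * xpow b w))"
    unfolding B_def by (rule sum.UNION_disjoint, simp, simp) (auto simp: exps_def)
  also have "\<dots> = (\<Sum>j\<le>d. t ^ (d - j) * s ^ j * tay d c j x w)"
    by (intro sum.cong refl) (simp add: tay_def form_def sum_distrib_left, auto simp: exps_def intro!: sum.cong)
  finally show ?thesis .
qed

lemma poly_sums_zero:
  fixes C :: "nat \<Rightarrow> complex"
  assumes "finite R" "\<And>t. (\<Sum>r\<in>R. C r * t ^ r) = 0" "r \<in> R"
  shows "C r = 0"
proof -
  define N where "N = Max R"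
  have "(\<Sum>i\<le>N. (if i \<in> R then C i else 0) * t ^ i) = (\<Sum>r\<in>R. C r * t ^ r)" for t
  proof -
    have "(\<Sum>i\<le>N. (if i \<in> R then C i else 0) * t ^ i) = (\<Sum>i\<in>R. (if i \<in> R then C i else 0) * t ^ i)"
      by (rule sum.mono_neutral_right) (use assms(1) in \<open>auto simp: N_def\<close>)
    then show ?thesis by (simp cong: sum.cong)
  qed
  then have "\<forall>i\<le>N. (if i \<in> R then C i else 0) = 0"
    using polyfun_eq_0[of "\<lambda>i. if i \<in> R then C i else 0" N] assms(2) by simp
  moreover have "r \<le> N" using assms by (auto simp: N_def)
  ultimately show ?thesis using assms(3) by (meson)
qed

text \<open>A form is determined by its values because a polynomial in one variable is: the proof fixes the exponent
  of one variable after the other.\<close>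

lemma form_zero_coeffs:
  fixes c :: "('n::finite \<Rightarrow> nat) \<Rightarrow> complex"
  assumes "\<And>x. form d c x = 0" "a \<in> exps d"
  shows "c a = 0"
proof -
  have "(\<Sum>b\<in>{b\<in>exps d. \<forall>k\<in>S. b k = a k}. c b * (\<Prod>k\<in>-S. x k ^ b k)) = 0" for S and x :: "'n \<Rightarrow> complex"
  proof -
    have "finite S" by simp
    then show ?thesis
    proof (induction S arbitrary: x)
      case empty
      then show ?case using assms(1)[of x] by (simp add: form_def xpow_def)
    next
      case (insert m S)
      let ?A = "{b\<in>exps d. \<forall>k\<in>S. b k = a k}"
      define C where "C r = (\<Sum>b\<in>{b\<in>?A. b m = r}. c b * (\<Prod>k\<in>-insert m S. x k ^ b k))" for r
      have fin: "finite ?A" by simp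
      have "(\<Sum>r\<in>(\<lambda>b. b m) ` ?A. C r * t ^ r) = 0" for t
      proof -
        have "(\<Sum>r\<in>(\<lambda>b. b m) ` ?A. C r * t ^ r) =
            (\<Sum>r\<in>(\<lambda>b. b m) ` ?A. \<Sum>b\<in>{b\<in>?A. b m = r}. c b * (\<Prod>k\<in>-S. (x(m := t)) k ^ b k))"
        proof (intro sum.cong refl)
          fix r
          have "-S = insert m (- insert m S)" using insert.hyps by auto
          moreover have "(\<Prod>k\<in>-insert m S. (x(m := t)) k ^ b k) = (\<Prod>k\<in>-insert m S. x k ^ b k)" for b :: "'n \<Rightarrow> nat"
            by (intro prod.cong) auto
          ultimately have "(\<Prod>k\<in>-S. (x(m := t)) k ^ b k) = t ^ b m * (\<Prod>k\<in>-insert m S. x k ^ b k)" for b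
            by simp
          then show "C r * t ^ r = (\<Sum>b\<in>{b\<in>?A. b m = r}. c b * (\<Prod>k\<in>-S. (x(m := t)) k ^ b k))"
            unfolding C_def sum_distrib_right by (intro sum.cong refl) simp
        qed
        also have "\<dots> = (\<Sum>b\<in>?A. c b * (\<Prod>k\<in>-S. (x(m := t)) k ^ b k))"
          by (rule sum.image_gen[OF fin, symmetric])
        also have "\<dots> = 0" by (rule insert.IH)
        finally show ?thesis .
      qed
      then have "C (a m) = 0"
        by (rule poly_sums_zero[rotated]) (use fin assms(2) in auto)
      moreover have "{b\<in>?A. b m = a m} = {b\<in>exps d. \<forall>k\<in>insert m S. b k = a k}" by auto
      ultimately show ?case by (simp add: C_def)
    qed
  qed
  from this[of "\<lambda>_. 0" UNIV] have "(\<Sum>b\<in>{b\<in>exps d. b = a}. c b) = 0"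
    by (simp add: fun_eq_iff)
  moreover have "{b\<in>exps d. b = a} = {a}" using assms(2) by auto
  ultimately show ?thesis by simp
qed

text \<open>Euler's relation between the Hasse derivatives of consecutive orders.\<close>

lemma hasse_euler:
  fixes x :: "'n::finite \<Rightarrow> 'a::comm_ring_1"
  assumes b: "b \<in> exps j" and "j \<le> d"
  shows "(\<Sum>k\<in>UNIV. x k * (of_nat (Suc (b k)) * hasse d c (b(k := Suc (b k))) x)) = of_nat (d - j) * hasse d c b x"
proof -
  let ?ch = "\<lambda>a b. of_nat (\<Prod>k\<in>UNIV. a k choose b k) :: 'a"
  have step: "x k * (of_nat (Suc (b k)) * (?ch a (b(k := Suc (b k))) * xpow (\<lambda>l. a l - (b(k := Suc (b k))) l) x)) =
      of_nat (a k - b k) * (?ch a b * xpow (\<lambda>k. a k - b k) x)" for a :: "'n \<Rightarrow> nat" and k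
  proof (cases "b k < a k")
    case True
    have U: "UNIV = insert k (UNIV - {k})" by auto
    have ch: "Suc (b k) * (\<Prod>l\<in>UNIV. a l choose (b(k := Suc (b k))) l) = (a k - b k) * (\<Prod>l\<in>UNIV. a l choose b l)"
    proof -
      have "(\<Prod>l\<in>UNIV. a l choose (b(k := Suc (b k))) l) = (a k choose Suc (b k)) * (\<Prod>l\<in>UNIV - {k}. a l choose b l)"
        by (subst U, subst prod.insert) auto
      moreover have "(\<Prod>l\<in>UNIV. a l choose b l) = (a k choose b k) * (\<Prod>l\<in>UNIV - {k}. a l choose b l)"
        by (subst U, subst prod.insert) auto
      moreover have "Suc (b k) * (a k choose Suc (b k)) = (a k - b k) * (a k choose b k)"
        by (simp only: binomial_absorb_comp binomial_absorption)
      ultimately show ?thesis by (metis mult.assoc)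
    qed
    have m: "x k * xpow (\<lambda>l. a l - (b(k := Suc (b k))) l) x = xpow (\<lambda>k. a k - b k) x"
    proof -
      have "xpow (\<lambda>l. a l - (b(k := Suc (b k))) l) x = x k ^ (a k - Suc (b k)) * (\<Prod>l\<in>UNIV - {k}. x l ^ (a l - b l))"
        unfolding xpow_def by (subst U, subst prod.insert) auto
      moreover have "xpow (\<lambda>k. a k - b k) x = x k ^ (a k - b k) * (\<Prod>l\<in>UNIV - {k}. x l ^ (a l - b l))"
        unfolding xpow_def by (subst U, subst prod.insert) auto
      moreover have "x k * x k ^ (a k - Suc (b k)) = x k ^ (a k - b k)"
        using True by (metis Suc_diff_Suc power_Suc)
      ultimately show ?thesis by (simp add: mult.assoc[symmetric])
    qed
    have "x k * (of_nat (Suc (b k)) * (?ch a (b(k := Suc (b k))) * xpow (\<lambda>l. a l - (b(k := Suc (b k))) l) x)) =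
        of_nat (Suc (b k) * (\<Prod>l\<in>UNIV. a l choose (b(k := Suc (b k))) l)) * (x k * xpow (\<lambda>l. a l - (b(k := Suc (b k))) l) x)"
      by (simp only: of_nat_mult mult_ac)
    also have "\<dots> = of_nat (a k - b k) * (?ch a b * xpow (\<lambda>k. a k - b k) x)"
      unfolding ch m by (simp only: of_nat_mult mult_ac)
    finally show ?thesis .
  next
    case False
    then have P0: "(\<Prod>l\<in>UNIV. a l choose (b(k := Suc (b k))) l) = 0"
      by (intro prod_zero bexI[of _ k]) (auto simp: binomial_eq_0)
    from False have "a k - b k = 0" by simp
    then show ?thesis unfolding P0 by simp
  qed
  have tot: "(\<Sum>k\<in>UNIV. of_nat (a k - b k) * (?ch a b * xpow (\<lambda>k. a k - b k) x)) =
      of_nat (d - j) * (?ch a b * xpow (\<lambda>k. a k - b k) x)" if a: "a \<in> exps d" for a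
  proof (cases "\<forall>k. b k \<le> a k")
    case True
    then have "(\<Sum>k\<in>UNIV. a k - b k) = d - j" using a b by (simp add: exps_def sum_subtractf_nat)
    then show ?thesis by (simp flip: sum_distrib_right of_nat_sum)
  next
    case False
    then have "(\<Prod>l\<in>UNIV. a l choose b l) = 0"
      by (auto simp: binomial_eq_0 not_le)
    then have "?ch a b = 0" by (metis of_nat_0)
    then show ?thesis by simp
  qed
  have "(\<Sum>k\<in>UNIV. x k * (of_nat (Suc (b k)) * hasse d c (b(k := Suc (b k))) x)) =
     (\<Sum>k\<in>UNIV. \<Sum>a\<in>exps d. c a * (x k * (of_nat (Suc (b k)) * (?ch a (b(k := Suc (b k))) * xpow (\<lambda>l. a l - (b(k := Suc (b k))) l) x))))"
    unfolding hasse_def sum_distrib_left by (intro sum.cong refl) (simp only: mult_ac)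
  also have "\<dots> = (\<Sum>a\<in>exps d. \<Sum>k\<in>UNIV. c a * (of_nat (a k - b k) * (?ch a b * xpow (\<lambda>k. a k - b k) x)))"
    unfolding step by (rule sum.swap)
  also have "\<dots> = (\<Sum>a\<in>exps d. c a * (of_nat (d - j) * (?ch a b * xpow (\<lambda>k. a k - b k) x)))"
    unfolding sum_distrib_left[symmetric] by (intro sum.cong refl) (simp only: tot)
  also have "\<dots> = of_nat (d - j) * hasse d c b x"
    unfolding hasse_def sum_distrib_left by (intro sum.cong refl) (simp only: mult_ac)
  finally show ?thesis .
qed

text \<open>By Euler's relation the equations of the highest order imply all the others. So multiplicity \<open>m + 1\<close>
  is expressed by the derivatives of order \<open>m\<close> alone.\<close>

lemma hasse_descend:
  fixes x :: "'n::finite \<Rightarrow> complex"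
  assumes "\<And>b. b \<in> exps m \<Longrightarrow> hasse d c b x = 0" "j \<le> m" "m \<le> d" "b \<in> exps j"
  shows "hasse d c b x = 0"
proof -
  have "\<forall>b\<in>exps (m - i). hasse d c b x = 0" if "i \<le> m" for i
    using that
  proof (induction i)
    case (Suc i)
    show ?case
    proof
      fix b :: "'n \<Rightarrow> nat" assume b: "b \<in> exps (m - Suc i)"
      have "b(k := Suc (b k)) \<in> exps (m - i)" for k
      proof -
        have U: "UNIV = insert k (UNIV - {k})" by auto
        have "sum (b(k := Suc (b k))) UNIV = Suc (sum b UNIV)"
          by (subst U, subst sum.insert, simp, simp, subst (2) U, subst sum.insert) auto
        with b Suc.prems show ?thesis by (simp add: exps_def)
      qed
      with Suc have "hasse d c (b(k := Suc (b k))) x = 0" for k by auto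
      with hasse_euler[OF b, of d x c] assms(3) have "of_nat (d - (m - Suc i)) * hasse d c b x = 0" by simp
      moreover have "d - (m - Suc i) \<noteq> 0" using Suc.prems assms(3) by auto
      ultimately show "hasse d c b x = 0" by simp
    qed
  qed (use assms(1) in simp)
  from this[of "m - j"] assms(2,4) show ?thesis by simp
qed

definition is_form :: "nat \<Rightarrow> (complex ^ 'n::finite \<Rightarrow> complex) \<Rightarrow> bool" where
  "is_form d f \<longleftrightarrow> (\<exists>c. \<forall>v. f v = form d c (\<lambda>k. v $ k))"

lemma is_form_add: "is_form d f \<Longrightarrow> is_form d g \<Longrightarrow> is_form d (\<lambda>v. f v + g v)"
  unfolding is_form_def
proof (elim exE)
  fix b c assume "\<forall>v. f v = form d b (($) v)" "\<forall>v. g v = form d c (($) v)"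
  then show "\<exists>c. \<forall>v. f v + g v = form d c (($) v)"
    by (intro exI[of _ "\<lambda>a. b a + c a"]) (simp add: form_def algebra_simps sum.distrib)
qed

lemma is_form_zero: "is_form d (\<lambda>v. 0)"
  unfolding is_form_def by (rule exI[of _ "\<lambda>_. 0"]) (simp add: form_def)

lemma is_form_monom: "a \<in> exps d \<Longrightarrow> is_form d (\<lambda>v. c * xpow a (\<lambda>k. v $ k))"
  unfolding is_form_def form_def
proof (intro exI[of _ "\<lambda>b. if b = a then c else 0"] allI)
  fix v :: "complex ^ 'a" assume "a \<in> exps d"
  then show "c * xpow a (($) v) = (\<Sum>aa\<in>exps d. (if aa = a then c else 0) * xpow aa (($) v))"
    by (simp add: if_distrib[of "\<lambda>x. x * _"] cong: if_cong)
qed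

lemma is_form_sum: "(\<And>a. a \<in> S \<Longrightarrow> is_form d (f a)) \<Longrightarrow> is_form d (\<lambda>v. \<Sum>a\<in>S. f a v)"
  by (induction S rule: infinite_finite_induct) (auto intro: is_form_zero is_form_add)

lemma is_form_mult:
  assumes "is_form d f" "is_form e g"
  shows "is_form (d + e) (\<lambda>v. f v * g v)"
proof -
  from assms obtain b c where f: "f v = form d b (\<lambda>k. v $ k)" and g: "g v = form e c (\<lambda>k. v $ k)" for v
    by (auto simp: is_form_def)
  have eq: "(\<lambda>v. f v * g v) = (\<lambda>v. \<Sum>a\<in>exps d. \<Sum>a'\<in>exps e. (b a * c a') * xpow (\<lambda>k. a k + a' k) (\<lambda>k. v $ k))"
    by (simp add: fun_eq_iff f g form_def sum_product xpow_add mult_ac)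
  show ?thesis unfolding eq by (intro is_form_sum is_form_monom exps_add)
qed

lemma is_form_const: "is_form 0 (\<lambda>v. c)"
  using is_form_monom[of "\<lambda>_. 0" 0 c] by (simp add: xpow_def exps_def)

lemma is_form_scale: "is_form d f \<Longrightarrow> is_form d (\<lambda>v. c * f v)"
  using is_form_mult[OF is_form_const[of c], of d f] by simp

lemma is_form_coord: "is_form 1 (\<lambda>v. v $ k)"
proof -
  have "is_form 1 (\<lambda>v. 1 * xpow (\<lambda>l. if l = k then 1 else 0) (\<lambda>l. v $ l))"
    by (rule is_form_monom) (simp add: exps_def)
  moreover have "xpow (\<lambda>l. if l = k then 1 else 0) (\<lambda>l. v $ l) = v $ k" for v :: "complex ^ 'a"
    unfolding xpow_def by (subst prod.cong[OF refl, of _ _ "\<lambda>l. if l = k then v $ l else 1"]) auto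
  ultimately show ?thesis by simp
qed

lemma upoly_form: "(\<And>k. upoly (\<lambda>s. x s k)) \<Longrightarrow> upoly (\<lambda>s. form d c (x s))"
  unfolding form_def xpow_def by (intro upoly_sum upoly_mult upoly_const upoly_prod upoly_power)

lemma tpoly_form: "(\<And>k. tpoly (\<lambda>y. x y k)) \<Longrightarrow> tpoly (\<lambda>y. form d c (x y))"
  unfolding form_def xpow_def by (intro tpoly_sum tpoly_mult tpoly_const tpoly_prod tpoly_power)

text \<open>The components of \<open>F (y u)\<close> that are homogeneous in \<open>u\<close>, where \<open>y\<close> is an affine map.\<close>

lemma tpoly_graded:
  fixes F :: "('i \<Rightarrow> complex ^ 'm::finite) \<Rightarrow> complex"
    and y :: "complex ^ 'n::finite \<Rightarrow> 'i \<Rightarrow> complex ^ 'm"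
  assumes F: "tpoly F"
    and y: "\<And>i k. \<exists>\<alpha> g. is_form 1 g \<and> (\<forall>u. y u i $ k = \<alpha> + g u)"
  shows "\<exists>g. (\<forall>k. is_form k (g k)) \<and> (\<forall>u. \<exists>P. (\<forall>s. poly P s = F (y (s *s u))) \<and> (\<forall>k. coeff P k = g k u))"
  using F
proof (induction rule: tpoly_induct)
  case (const c)
  have "is_form k (\<lambda>u. if k = 0 then c else 0)" for k
    by (cases k) (auto intro: is_form_const is_form_zero)
  moreover have "\<exists>P. (\<forall>s. poly P s = c) \<and> (\<forall>k. coeff P k = (if k = 0 then c else 0))"
    by (rule exI[of _ "[:c:]"]) (auto simp: coeff_pCons split: nat.split)
  ultimately show ?case by (intro exI[of _ "\<lambda>k u. if k = 0 then c else 0"] conjI allI)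
next
  case (coord i l)
  from y obtain \<alpha> h where h: "is_form 1 h" "\<And>u. y u i $ l = \<alpha> + h u" by metis
  from h(1) obtain c where c: "\<And>v. h v = form 1 c (\<lambda>k. v $ k)" by (auto simp: is_form_def)
  have hs: "h (s *s u) = s * h u" for s u using form_scale[of 1 c s "\<lambda>k. u $ k"] by (simp add: c)
  let ?g = "\<lambda>k u. if k = 0 then \<alpha> else if k = 1 then h u else 0"
  have "is_form k (?g k)" for k
  proof -
    consider "k = 0" | "k = 1" | "1 < k" by linarith
    then show ?thesis
      by cases (use h(1) is_form_const[of \<alpha>] is_form_zero[of k] in simp_all)
  qed
  moreover have "\<exists>P. (\<forall>s. poly P s = y (s *s u) i $ l) \<and> (\<forall>k. coeff P k = ?g k u)" for u
    by (rule exI[of _ "[:\<alpha>, h u:]"]) (auto simp: h(2) hs coeff_pCons split: nat.split)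
  ultimately show ?case by (intro exI[of _ ?g]) auto
next
  case (add f1 f2)
  then obtain g1 g2 where 1: "\<And>k. is_form k (g1 k)" "\<And>u. \<exists>P. (\<forall>s. poly P s = f1 (y (s *s u))) \<and> (\<forall>k. coeff P k = g1 k u)"
    and 2: "\<And>k. is_form k (g2 k)" "\<And>u. \<exists>P. (\<forall>s. poly P s = f2 (y (s *s u))) \<and> (\<forall>k. coeff P k = g2 k u)"
    by blast
  have "\<exists>P. (\<forall>s. poly P s = f1 (y (s *s u)) + f2 (y (s *s u))) \<and> (\<forall>k. coeff P k = g1 k u + g2 k u)" for u
  proof -
    obtain P Q where "\<forall>s. poly P s = f1 (y (s *s u))" "\<forall>k. coeff P k = g1 k u"
      "\<forall>s. poly Q s = f2 (y (s *s u))" "\<forall>k. coeff Q k = g2 k u" using 1(2) 2(2) by metis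
    then show ?thesis by (intro exI[of _ "P + Q"]) auto
  qed
  with 1(1) 2(1) show ?case by (intro exI[of _ "\<lambda>k u. g1 k u + g2 k u"]) (auto intro: is_form_add)
next
  case (mult f1 f2)
  then obtain g1 g2 where 1: "\<And>k. is_form k (g1 k)" "\<And>u. \<exists>P. (\<forall>s. poly P s = f1 (y (s *s u))) \<and> (\<forall>k. coeff P k = g1 k u)"
    and 2: "\<And>k. is_form k (g2 k)" "\<And>u. \<exists>P. (\<forall>s. poly P s = f2 (y (s *s u))) \<and> (\<forall>k. coeff P k = g2 k u)"
    by blast
  let ?g = "\<lambda>k u. \<Sum>i\<le>k. g1 i u * g2 (k - i) u"
  have "\<exists>P. (\<forall>s. poly P s = f1 (y (s *s u)) * f2 (y (s *s u))) \<and> (\<forall>k. coeff P k = ?g k u)" for u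
  proof -
    obtain P Q where "\<forall>s. poly P s = f1 (y (s *s u))" "\<forall>k. coeff P k = g1 k u"
      "\<forall>s. poly Q s = f2 (y (s *s u))" "\<forall>k. coeff Q k = g2 k u" using 1(2) 2(2) by metis
    then show ?thesis by (intro exI[of _ "P * Q"]) (auto simp: coeff_mult)
  qed
  moreover have "is_form k (?g k)" for k
  proof (rule is_form_sum)
    fix i assume "i \<in> {..k}"
    then show "is_form k (\<lambda>u. g1 i u * g2 (k - i) u)"
      using is_form_mult[OF 1(1)[of i] 2(1)[of "k - i"]] by simp
  qed
  ultimately show ?case by (intro exI[of _ ?g]) auto
qed

section \<open>Curves in the blow-up\<close>

definition dotp :: "complex ^ 'n::finite \<Rightarrow> complex ^ 'n \<Rightarrow> complex" where
  "dotp a v = (\<Sum>k\<in>UNIV. a $ k * v $ k)"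

lemma dotp_simps [simp]:
  "dotp a (v + w) = dotp a v + dotp a w" "dotp a (v - w) = dotp a v - dotp a w"
  "dotp a (c *s v) = c * dotp a v" "dotp a 0 = 0"
  by (simp_all add: dotp_def algebra_simps sum.distrib sum_subtractf sum_distrib_left)

lemma tpoly_dotp: "tpoly (\<lambda>y. dotp a (y i))"
  unfolding dotp_def by (intro tpoly_sum tpoly_mult tpoly_const tpoly_coord)

lemma upoly_dotp: "(\<And>k. upoly (\<lambda>s. x s $ k)) \<Longrightarrow> upoly (\<lambda>s. dotp a (x s))"
  unfolding dotp_def by (intro upoly_sum upoly_mult upoly_const)

lemma span1: "v \<in> vec.span {x} \<longleftrightarrow> (\<exists>c. v = c *s x)" for x :: "complex ^ 'n::finite"
  by (auto simp: vec.span_singleton)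

lemma span2: "v \<in> vec.span {x, y} \<longleftrightarrow> (\<exists>a b. v = a *s x + b *s y)" for x :: "complex ^ 'n::finite"
proof
  assume "v \<in> vec.span {x, y}"
  then obtain k where "v - k *s x \<in> vec.span {y}" by (auto simp: vec.span_breakdown_eq)
  then obtain c where "v - k *s x = c *s y" by (auto simp: span1)
  then have "v = k *s x + c *s y" by (simp add: algebra_simps)
  then show "\<exists>a b. v = a *s x + b *s y" by blast
next
  assume "\<exists>a b. v = a *s x + b *s y"
  then show "v \<in> vec.span {x, y}" by (auto intro!: vec.span_add vec.span_scale intro: vec.span_base)
qed

lemma separating_form:
  fixes x w :: "complex ^ 'n::finite"
  assumes "x \<noteq> 0" "w \<notin> vec.span {x}"
  obtains a where "dotp a x = 0" "dotp a w = 1"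
proof -
  from \<open>x \<noteq> 0\<close> obtain k where k: "x $ k \<noteq> 0" by (auto simp: vec_eq_iff)
  have "\<exists>l. x $ k * w $ l \<noteq> x $ l * w $ k"
  proof (rule ccontr)
    assume "\<not> ?thesis"
    then have "w = (w $ k / x $ k) *s x" using k by (auto simp: vec_eq_iff field_simps)
    with assms(2) show False by (auto simp: span1)
  qed
  then obtain l where l: "x $ k * w $ l - x $ l * w $ k \<noteq> 0" by auto
  define D where "D = x $ k * w $ l - x $ l * w $ k"
  define a where "a = (\<chi> m. (if m = l then x $ k / D else 0) - (if m = k then x $ l / D else 0))"
  have a: "dotp a v = (x $ k * v $ l - x $ l * v $ k) / D" for v
    unfolding dotp_def a_def
    by (simp add: left_diff_distrib sum_subtractf if_distrib[of "\<lambda>z. z * _"] diff_divide_distrib cong: if_cong)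
  show ?thesis by (rule that[of a]) (use l in \<open>simp_all add: a D_def\<close>)
qed

lemma subspace_span_pair:
  fixes x w :: "complex ^ 'n::finite"
  assumes "vec.subspace S" "vec.dim S = 2" "x \<in> S" "w \<in> S" "x \<noteq> 0" "w \<notin> vec.span {x}"
  shows "S = vec.span {x, w}"
proof -
  have "vec.independent {w, x}" using assms(5,6) by (auto simp: vec.independent_insert)
  moreover have "card {w, x} = 2" using assms(6) by (auto simp: card_insert_if vec.span_base)
  ultimately have "vec.dim (vec.span {w, x}) = 2" by (simp add: vec.dim_eq_card_independent)
  then show ?thesis
    using vec.subspace_dim_equal[of "vec.span {w, x}" S] assms
    by (simp add: vec.span_minimal insert_commute)
qed

lemma dim_span_pair:
  fixes x w :: "complex ^ 'n::finite"
  assumes "x \<noteq> 0" "w \<notin> vec.span {x}"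
  shows "vec.dim {x, w} = 2"
proof -
  have "vec.independent {w, x}" using assms by (auto simp: vec.independent_insert)
  moreover have "card {w, x} = 2" using assms by (auto simp: card_insert_if vec.span_base)
  ultimately have "vec.dim (vec.span {w, x}) = 2" by (simp add: vec.dim_eq_card_independent)
  then show ?thesis by (simp add: insert_commute)
qed

lemma in_span1_sym:
  fixes x w :: "complex ^ 'n::finite"
  assumes "w \<notin> vec.span {x}" "x \<noteq> 0" shows "x \<notin> vec.span {w}"
proof
  assume "x \<in> vec.span {w}"
  then obtain c where c: "x = c *s w" by (auto simp: span1)
  with \<open>x \<noteq> 0\<close> have "c \<noteq> 0" by auto
  with c have "w = inverse c *s x" by (simp add: vector_smult_assoc)
  with assms(1) show False by (auto simp: span1)
qed

text \<open>Distinct points of the projective space, with chosen representatives.\<close>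

locale blown_points =
  fixes q :: "'r::finite \<Rightarrow> complex ^ 'n::finite" and p :: "'r \<Rightarrow> (complex ^ 'n) set"
  assumes p_def: "p i = vec.span {q i}" and q_nz: "q i \<noteq> 0" and q_notin: "i \<noteq> j \<Longrightarrow> q i \<notin> p j"
begin

abbreviation X where "X \<equiv> blowup p"

definition off :: "complex ^ 'n \<Rightarrow> bool" where
  "off v \<longleftrightarrow> (\<forall>i. v \<notin> p i)"

text \<open>The inverse of the blow-down map away from the exceptional divisors.\<close>

definition lft :: "complex ^ 'n \<Rightarrow> 'r option \<Rightarrow> (complex ^ 'n) set" where
  "lft v o' = (case o' of None \<Rightarrow> vec.span {v} | Some i \<Rightarrow> vec.span {q i, v})"

lemma lft_simps [simp]: "lft v None = vec.span {v}" "lft v (Some i) = vec.span {q i, v}"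
  by (simp_all add: lft_def)

lemma off_nz: "off v \<Longrightarrow> v \<noteq> 0"
  by (auto simp: off_def p_def vec.span_zero)

lemma off_scale:
  assumes "off v" "c \<noteq> 0"
  shows "off (c *s v)"
  unfolding off_def
proof (intro allI notI)
  fix i assume "c *s v \<in> p i"
  then obtain e where "c *s v = e *s q i" by (auto simp: p_def span1)
  then have "v = (e / c) *s q i" using assms(2) by (simp add: vec_eq_iff field_simps)
  with assms(1) show False by (auto simp: off_def p_def span1)
qed

lemma lft_in: "off v \<Longrightarrow> lft v \<in> X"
proof -
  assume v: "off v"
  have "vec.dim (vec.span {v}) = 1"
    using off_nz[OF v] vec.dim_span_eq_card_independent[of "{v}"] by simp
  with v show ?thesis
    by (auto simp: blowup_def proj_space_def dim_span_pair q_nz off_def p_def intro: vec.span_mono[THEN subsetD])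
qed

lemma X_subspaces: "\<xi> \<in> X \<Longrightarrow> subspaces \<xi>"
  unfolding subspaces_def by (intro allI) (case_tac i; auto simp: blowup_def proj_space_def)

lemma X_Some: "\<xi> \<in> X \<Longrightarrow> vec.subspace (\<xi> (Some i)) \<and> vec.dim (\<xi> (Some i)) = 2 \<and> q i \<in> \<xi> (Some i) \<and> \<xi> None \<subseteq> \<xi> (Some i)"
  unfolding blowup_def p_def by (auto intro: vec.span_base)

lemma X_None:
  assumes "\<xi> \<in> X" "v \<in> \<xi> None" "v \<noteq> 0"
  shows "\<xi> None = vec.span {v}"
proof -
  have s: "vec.subspace (\<xi> None)" "vec.dim (\<xi> None) = 1" using assms(1) by (auto simp: blowup_def proj_space_def)
  moreover have "vec.dim (vec.span {v}) = 1" using assms vec.dim_span_eq_card_independent[of "{v}"] by simp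
  ultimately show ?thesis using vec.subspace_dim_equal[of "vec.span {v}" "\<xi> None"] assms
    by (simp add: vec.span_minimal)
qed

lemma X_None_nz: "\<xi> \<in> X \<Longrightarrow> \<exists>v\<in>\<xi> None. v \<noteq> 0"
proof (rule ccontr)
  assume "\<xi> \<in> X" and *: "\<not> (\<exists>v\<in>\<xi> None. v \<noteq> 0)"
  then have "vec.dim (\<xi> None) = 1" "vec.subspace (\<xi> None)" by (auto simp: blowup_def proj_space_def)
  moreover from * this(2) have "\<xi> None = vec.span {}" by (auto simp: vec.subspace_0)
  ultimately show False by (metis vec.dim_span vec.dim_empty zero_neq_one)
qed

lemma X_plane:
  assumes "\<xi> \<in> X" "v \<in> \<xi> None" "v \<notin> p i"
  shows "\<xi> (Some i) = vec.span {q i, v}"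
  using subspace_span_pair[of "\<xi> (Some i)" "q i" v] X_Some[OF assms(1), of i] assms q_nz[of i]
  by (auto simp: p_def)

lemma X_eq_lft: "\<xi> \<in> X \<Longrightarrow> v \<in> \<xi> None \<Longrightarrow> off v \<Longrightarrow> \<xi> = lft v"
proof
  fix o' assume *: "\<xi> \<in> X" "v \<in> \<xi> None" "off v"
  then show "\<xi> o' = lft v o'"
    using X_None[OF *(1,2) off_nz[OF *(3)]] X_plane[OF *(1,2)] by (cases o') (auto simp: off_def)
qed

lemma lft_scale: "off v \<Longrightarrow> c \<noteq> 0 \<Longrightarrow> lft (c *s v) = lft v"
  by (rule X_eq_lft[OF lft_in, symmetric]) (auto intro: off_scale vec.span_scale vec.span_base)

lemma p_disj: "v \<in> p i \<Longrightarrow> v \<in> p j \<Longrightarrow> v \<noteq> 0 \<Longrightarrow> i = j"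
proof (rule ccontr)
  assume v: "v \<in> p i" "v \<in> p j" "v \<noteq> 0" and "i \<noteq> j"
  then obtain c where c: "v = c *s q i" by (auto simp: p_def span1)
  with v have "c \<noteq> 0" by auto
  then have "q i = inverse c *s v" by (simp add: c vector_smult_assoc)
  with v(2) have "q i \<in> p j" by (auto simp: p_def intro: vec.span_scale)
  with q_notin[OF \<open>i \<noteq> j\<close>] show False by simp
qed

text \<open>Directions \<open>w\<close> such that the curve \<open>s \<mapsto> lft (x + s w)\<close> tends to \<open>\<xi>\<close> for \<open>s \<rightarrow> 0\<close>.\<close>

definition arc :: "('r option \<Rightarrow> (complex ^ 'n) set) \<Rightarrow> complex ^ 'n \<Rightarrow> complex ^ 'n \<Rightarrow> bool" where
  "arc \<xi> x w \<longleftrightarrow> \<xi> \<in> X \<and> x \<in> \<xi> None \<and> x \<noteq> 0 \<and> (off x \<or> (\<exists>i. x \<in> p i \<and> w \<in> \<xi> (Some i) \<and> w \<notin> p i))"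

lemma eventually_off:
  assumes "arc \<xi> x w"
  shows "\<forall>\<^sub>F s in at 0. off (x + s *s w)"
proof -
  have "\<forall>\<^sub>F s in at 0. x + s *s w \<notin> p j" for j
  proof (cases "x \<in> p j")
    case False
    then obtain a where a: "dotp a (q j) = 0" "dotp a x = 1"
      using separating_form[OF q_nz[of j], of x] by (auto simp: p_def)
    have "upoly (\<lambda>s. dotp a (x + s *s w))"
      by (rule upoly_dotp) (simp, intro upoly_add upoly_mult upoly_const upoly_id)
    then have "\<forall>\<^sub>F s in at 0. dotp a (x + s *s w) \<noteq> 0"
      by (rule upoly_eventually_nonzero) (simp add: a)
    then show ?thesis
    proof (rule eventually_mono)
      fix s assume *: "dotp a (x + s *s w) \<noteq> 0"
      show "x + s *s w \<notin> p j"
      proof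
        assume "x + s *s w \<in> p j"
        then obtain c where "x + s *s w = c *s q j" by (auto simp: p_def span1)
        then have "dotp a (x + s *s w) = dotp a (c *s q j)" by (rule arg_cong)
        with * show False by (simp only: dotp_simps a)  simp
      qed
    qed
  next
    case True
    from assms have "x \<noteq> 0" by (simp add: arc_def)
    with assms True have w: "w \<notin> p j" unfolding arc_def off_def using p_disj[OF _ True] by blast
    have "\<forall>\<^sub>F s in at 0. s \<noteq> (0::complex)" by (simp add: eventually_at_filter)
    then show ?thesis
    proof (rule eventually_mono)
      fix s :: complex assume "s \<noteq> 0"
      show "x + s *s w \<notin> p j"
      proof
        assume "x + s *s w \<in> p j"
        with True have "inverse s *s (x + s *s w - x) \<in> p j"
          unfolding p_def by (intro vec.span_scale vec.span_diff)
        with \<open>s \<noteq> 0\<close> w show False by (simp add: vector_smult_assoc)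
      qed
    qed
  qed
  then show ?thesis unfolding off_def by (simp add: eventually_all_finite)
qed

text \<open>The curve has a polynomial lift to tuples of vectors which at \<open>s = 0\<close> takes any prescribed value \<open>y\<close>. It is
  this lift that allows local fractions to be evaluated along the curve.\<close>

lemma arc_lift:
  assumes "arc \<xi> x w" "y \<in> tprod \<xi>"
  obtains Y c where "y None = c *s x" "Y 0 = y" "\<And>i k. upoly (\<lambda>s. Y s i $ k)"
    "\<And>s. off (x + s *s w) \<Longrightarrow> Y s \<in> tprod (lft (x + s *s w))" "\<And>s. Y s None = c *s (x + s *s w)"
proof -
  from assms(1) have xi: "\<xi> \<in> X" "x \<in> \<xi> None" "x \<noteq> 0" by (auto simp: arc_def)
  have "y None \<in> vec.span {x}" using assms(2) X_None[OF xi] by (auto simp: tprod_def)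
  then obtain c where c: "y None = c *s x" by (auto simp: span1)
  have "\<exists>a b. x \<notin> p j \<longrightarrow> y (Some j) = a *s q j + b *s x" for j
  proof (cases "x \<in> p j")
    case False
    have "y (Some j) \<in> \<xi> (Some j)" using assms(2) by (simp add: tprod_def)
    then show ?thesis using X_plane[OF xi(1,2) False] by (simp add: span2)
  qed simp
  then obtain \<alpha> \<beta> where ab: "\<And>j. x \<notin> p j \<Longrightarrow> y (Some j) = \<alpha> j *s q j + \<beta> j *s x" by metis
  define Y where "Y s o' = (case o' of None \<Rightarrow> c *s (x + s *s w) | Some j \<Rightarrow>
      if x \<in> p j then y (Some j) else \<alpha> j *s q j + \<beta> j *s (x + s *s w))" for s o'
  show ?thesis
  proof (rule that[of c Y])
    show "Y 0 = y"
      by (rule ext, case_tac x) (auto simp: Y_def c ab)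
    show "upoly (\<lambda>s. Y s i $ k)" for i k
    proof (cases i)
      case None
      have "upoly (\<lambda>s. c * (x $ k + s * w $ k))" by (intro upoly_add upoly_mult upoly_const upoly_id)
      with None show ?thesis by (simp add: Y_def algebra_simps)
    next
      case (Some j)
      have "upoly (\<lambda>s. \<alpha> j * q j $ k + \<beta> j * (x $ k + s * w $ k))" by (intro upoly_add upoly_mult upoly_const upoly_id)
      moreover have "upoly (\<lambda>s. y (Some j) $ k)" by (rule upoly_const)
      ultimately show ?thesis using Some by (cases "x \<in> p j") (simp_all add: Y_def algebra_simps)
    qed
    fix s assume s: "off (x + s *s w)"
    show "Y s \<in> tprod (lft (x + s *s w))"
      unfolding tprod_def
    proof (intro CollectI allI)
      fix o'
      show "Y s o' \<in> lft (x + s *s w) o'"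
      proof (cases o')
        case None
        have "c *s (x + s *s w) \<in> vec.span {x + s *s w}" by (intro vec.span_scale vec.span_base) simp
        with None show ?thesis by (simp add: Y_def)
      next
        case (Some j)
        show ?thesis
        proof (cases "x \<in> p j")
          case False
          with Some show ?thesis unfolding Y_def lft_def by (auto simp: span2)
        next
          case True
          then have "\<not> off x" by (auto simp: off_def)
          with assms(1) obtain i where i: "x \<in> p i" "w \<in> \<xi> (Some i)" "w \<notin> p i" by (auto simp: arc_def)
          with p_disj[OF True i(1) xi(3)] have w: "w \<in> \<xi> (Some j)" "w \<notin> p j" by auto
          have "\<xi> (Some j) = vec.span {q j, w}"
            using subspace_span_pair[of "\<xi> (Some j)" "q j" w] X_Some[OF xi(1), of j] w q_nz[of j] by (auto simp: p_def)
          moreover have "y (Some j) \<in> \<xi> (Some j)" using assms(2) by (simp add: tprod_def)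
          ultimately obtain a b where abj: "y (Some j) = a *s q j + b *s w"
            by (auto simp: span2)
          from True obtain e where e: "x = e *s q j" by (auto simp: p_def span1)
          have "s \<noteq> 0" using s \<open>\<not> off x\<close> by auto
          then have "y (Some j) = (a - b * e / s) *s q j + (b / s) *s (x + s *s w)"
            by (simp add: abj e vec_eq_iff field_simps)
          then have "y (Some j) \<in> vec.span {q j, x + s *s w}" unfolding span2 by blast
          then show ?thesis using True Some by (simp add: Y_def)
        qed
      qed
    qed
  qed (auto simp: c Y_def)
qed

lemma X_nv_lft: "off v \<Longrightarrow> y \<in> tprod (lft v) \<Longrightarrow> f y \<noteq> 0 \<Longrightarrow> lft v \<in> nv X f"
  using lft_in by (auto simp: nv_def)

lemma arc_open:
  assumes "arc \<xi> x w" "openin (zariski X) U" "\<xi> \<in> U"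
  shows "\<forall>\<^sub>F s in at 0. lft (x + s *s w) \<in> U"
proof -
  obtain f where f: "tpoly f" "\<xi> \<in> nv X f" "nv X f \<subseteq> U"
    by (rule openin_zariski_nv[OF X_subspaces assms(2,3)])
  then obtain y where y: "y \<in> tprod \<xi>" "f y \<noteq> 0" by (auto simp: nv_def)
  obtain Y c where "y None = c *s x" and Y: "Y 0 = y" "\<And>i k. upoly (\<lambda>s. Y s i $ k)"
    "\<And>s. off (x + s *s w) \<Longrightarrow> Y s \<in> tprod (lft (x + s *s w))" and "\<And>s. Y s None = c *s (x + s *s w)"
    by (rule arc_lift[OF assms(1) y(1)]) blast
  have "\<forall>\<^sub>F s in at 0. f (Y s) \<noteq> 0"
    using upoly_eventually_nonzero[OF upoly_tpoly[OF f(1), of Y]] Y(1,2) y(2) by simp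
  with eventually_off[OF assms(1)] show ?thesis
  proof eventually_elim
    case (elim s)
    then have "lft (x + s *s w) \<in> nv X f" using Y(3) by (intro X_nv_lft[of _ "Y s"])
    with f(3) show ?case by blast
  qed
qed

text \<open>Along the curve a local fraction is a quotient of polynomials in \<open>s\<close> whose denominator does not vanish at
  \<open>s = 0\<close>, so the values on an exceptional divisor are limits of values outside it.\<close>

lemma arc_fraction:
  assumes "arc \<xi> x w" "openin (zariski X) U" "\<xi> \<in> U" "locally_fraction X U g"
  obtains c a b Y where "c \<noteq> 0" "upoly a" "upoly b" "b 0 \<noteq> 0"
    "Y 0 \<in> tprod \<xi>" "Y 0 None = c *s x" "g \<xi> (Y 0) * b 0 = a 0" "\<And>s. Y s None = c *s (x + s *s w)"
    "\<And>s. off (x + s *s w) \<Longrightarrow> b s \<noteq> 0 \<Longrightarrow> lft (x + s *s w) \<in> U \<and>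
       Y s \<in> tprod (lft (x + s *s w)) \<and> g (lft (x + s *s w)) (Y s) * b s = a s"
proof -
  from assms(1) have xi: "\<xi> \<in> X" "x \<in> \<xi> None" "x \<noteq> 0" by (auto simp: arc_def)
  have sub: "subspaces \<xi>" using X_subspaces[OF xi(1)] .
  from assms(3,4) obtain A B where AB: "\<xi> \<in> nv X (tuple_eval B)"
    "\<And>\<eta> y. \<eta> \<in> U \<inter> nv X (tuple_eval B) \<Longrightarrow> y \<in> tprod \<eta> \<Longrightarrow> g \<eta> y * tuple_eval B y = tuple_eval A y"
    unfolding locally_fraction_def nonvanishing_nv tprod_def by blast
  obtain C where C: "tpoly C" "\<xi> \<in> nv X C" "nv X C \<subseteq> U"
    by (rule openin_zariski_nv[OF X_subspaces assms(2,3)])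
  define BC where "BC y = tuple_eval B y * C y" for y
  have BC: "tpoly BC" unfolding BC_def[abs_def] by (intro tpoly_mult tpoly_eval C)
  have "\<xi> \<in> nv X BC"
    unfolding BC_def[abs_def] using nv_mult[OF X_subspaces tpoly_eval C(1)] AB(1) C(2) by simp
  then obtain y0 where y0: "y0 \<in> tprod \<xi>" "BC y0 \<noteq> 0" by (auto simp: nv_def)
  obtain k where k: "x $ k \<noteq> 0" using xi(3) by (auto simp: vec_eq_iff)
  let ?z = "\<lambda>o'. if o' = None then x else 0"
  have z: "?z \<in> tprod \<xi>" "?z None $ k \<noteq> 0"
    using xi k sub by (auto simp: tprod_def subspaces_def vec.subspace_0)
  obtain y where y: "y \<in> tprod \<xi>" "BC y \<noteq> 0" "y None $ k \<noteq> 0"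
    by (rule tprod_nonzero_mult[where f = BC and g = "\<lambda>y. y None $ k", OF sub BC tpoly_coord y0 z])
  obtain Y c where Y: "y None = c *s x" "Y 0 = y" "\<And>i k. upoly (\<lambda>s. Y s i $ k)"
    "\<And>s. off (x + s *s w) \<Longrightarrow> Y s \<in> tprod (lft (x + s *s w))" "\<And>s. Y s None = c *s (x + s *s w)"
    by (rule arc_lift[OF assms(1) y(1)]) (rule that; assumption)
  show ?thesis
  proof (rule that[of c "\<lambda>s. tuple_eval A (Y s) * C (Y s)" "\<lambda>s. BC (Y s)" Y])
    show "upoly (\<lambda>s. tuple_eval A (Y s) * C (Y s))" "upoly (\<lambda>s. BC (Y s))"
      using upoly_tpoly[OF BC, of Y] upoly_tpoly[OF tpoly_eval, of Y A] upoly_tpoly[OF C(1), of Y] Y(3)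
      by (simp_all add: upoly_mult)
    show "c \<noteq> 0" using y(3) Y(1) by auto
    show "g \<xi> (Y 0) * BC (Y 0) = tuple_eval A (Y 0) * C (Y 0)"
      unfolding BC_def Y(2) mult.assoc[symmetric] using AB(2)[of \<xi> y] AB(1) assms(3) y(1) by simp
    fix s assume s: "off (x + s *s w)" "BC (Y s) \<noteq> 0"
    then have Ys: "Y s \<in> tprod (lft (x + s *s w))" using Y(4) by blast
    from s(2) have "C (Y s) \<noteq> 0" "tuple_eval B (Y s) \<noteq> 0" by (auto simp: BC_def)
    then have "lft (x + s *s w) \<in> nv X C" "lft (x + s *s w) \<in> nv X (tuple_eval B)"
      using X_nv_lft[OF s(1) Ys, of C] X_nv_lft[OF s(1) Ys, of "tuple_eval B"] by blast+
    with C(3) have U: "lft (x + s *s w) \<in> U \<inter> nv X (tuple_eval B)" by auto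
    have "g (lft (x + s *s w)) (Y s) * BC (Y s) = tuple_eval A (Y s) * C (Y s)"
      unfolding BC_def mult.assoc[symmetric] AB(2)[OF U Ys] ..
    with Ys U show "lft (x + s *s w) \<in> U \<and> Y s \<in> tprod (lft (x + s *s w)) \<and>
        g (lft (x + s *s w)) (Y s) * BC (Y s) = tuple_eval A (Y s) * C (Y s)" by blast
  qed (use Y y in auto)
qed

lemma arc_regular:
  assumes "arc \<xi> x w" "regular_on X U f" "\<xi> \<in> U"
  obtains a b where "upoly a" "upoly b" "b 0 \<noteq> 0" "f \<xi> * b 0 = a 0"
    "\<And>s. off (x + s *s w) \<Longrightarrow> b s \<noteq> 0 \<Longrightarrow> f (lft (x + s *s w)) * b s = a s"
proof -
  have *: "openin (zariski X) U" "locally_fraction X U (\<lambda>\<eta> y. f \<eta>)" using assms(2) by (auto simp: regular_on_def)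
  show ?thesis
  proof (rule arc_fraction[OF assms(1) *(1) assms(3) *(2)])
    fix c a b Y
    assume "upoly a" "upoly b" "b 0 \<noteq> 0" "f \<xi> * b 0 = a 0"
      "\<And>s. off (x + s *s w) \<Longrightarrow> b s \<noteq> 0 \<Longrightarrow> lft (x + s *s w) \<in> U \<and>
        Y s \<in> tprod (lft (x + s *s w)) \<and> f (lft (x + s *s w)) * b s = a s"
    then show thesis by (intro that[of a b]) auto
  qed
qed

lemma arc_regular_form:
  assumes "arc \<xi> x w" "regular_form X U d u" "\<xi> \<in> U"
  obtains a b where "upoly a" "upoly b" "b 0 \<noteq> 0" "u (\<xi>, x) * b 0 = a 0"
    "\<And>s. off (x + s *s w) \<Longrightarrow> b s \<noteq> 0 \<Longrightarrow> u (lft (x + s *s w), x + s *s w) * b s = a s"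
proof -
  have *: "openin (zariski X) U" "locally_fraction X U (\<lambda>\<eta> y. u (\<eta>, y None))"
    and hom: "\<And>\<eta> v c. \<eta> \<in> U \<Longrightarrow> v \<in> \<eta> None \<Longrightarrow> u (\<eta>, c *s v) = c ^ d * u (\<eta>, v)"
    using assms(2) by (auto simp: regular_form_def)
  have x: "x \<in> \<xi> None" using assms(1) by (simp add: arc_def)
  show ?thesis
  proof (rule arc_fraction[OF assms(1) *(1) assms(3) *(2)])
    fix c a b Y
    assume Y: "c \<noteq> 0" "upoly a" "upoly b" "b 0 \<noteq> 0" "Y 0 None = c *s x" "u (\<xi>, Y 0 None) * b 0 = a 0"
      "\<And>s. Y s None = c *s (x + s *s w)"
      and ev: "\<And>s. off (x + s *s w) \<Longrightarrow> b s \<noteq> 0 \<Longrightarrow> lft (x + s *s w) \<in> U \<and>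
        Y s \<in> tprod (lft (x + s *s w)) \<and> u (lft (x + s *s w), Y s None) * b s = a s"
    show thesis
    proof (rule that[of a "\<lambda>s. c ^ d * b s"])
      fix s assume s: "off (x + s *s w)" "c ^ d * b s \<noteq> 0"
      have "x + s *s w \<in> lft (x + s *s w) None" by (simp add: vec.span_base)
      with ev[of s] s hom[of "lft (x + s *s w)" "x + s *s w" c]
      show "u (lft (x + s *s w), x + s *s w) * (c ^ d * b s) = a s" by (simp only: Y(7)) (simp add: mult_ac)
    next
      show "u (\<xi>, x) * (c ^ d * b 0) = a 0"
        using Y(6) hom[OF assms(3) x, of c] by (simp add: Y(5) mult_ac)
    qed (use Y in auto)
  qed
qed

lemma arc_eventually:
  assumes "arc \<xi> x w" "upoly b" "b 0 \<noteq> 0"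
  shows "\<forall>\<^sub>F s in at 0. off (x + s *s w) \<and> b s \<noteq> 0"
  using eventually_off[OF assms(1)] upoly_eventually_nonzero[OF assms(2,3)] by (rule eventually_conj)

end

section \<open>Sections of line bundles on the blow-up are forms\<close>

text \<open>A homogeneous system with fewer equations than unknowns has a nonzero solution.\<close>

lemma homogeneous_solution:
  fixes M :: "'e \<Rightarrow> 'x \<Rightarrow> 'a::field"
  assumes "finite E" "finite S" "card E < card S"
  shows "\<exists>c. (\<exists>x\<in>S. c x \<noteq> 0) \<and> (\<forall>e\<in>E. (\<Sum>x\<in>S. c x * M e x) = 0)"
  using assms
proof (induction E arbitrary: S M rule: finite_induct)
  case empty
  then have "S \<noteq> {}" by auto
  then show ?case by (intro exI[of _ "\<lambda>_. 1"]) auto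
next
  case (insert e E)
  show ?case
  proof (cases "\<forall>x\<in>S. M e x = 0")
    case True
    from insert.IH[of S M] insert.prems insert.hyps
    obtain c where "\<exists>x\<in>S. c x \<noteq> 0" "\<forall>e\<in>E. (\<Sum>x\<in>S. c x * M e x) = 0" by auto
    with True show ?thesis by (intro exI[of _ c]) auto
  next
    case False
    then obtain z where z: "z \<in> S" "M e z \<noteq> 0" by auto
    let ?N = "\<lambda>e' x. M e' x - M e x / M e z * M e' z"
    have "card E < card (S - {z})" using insert.prems insert.hyps z(1) by simp
    from insert.IH[OF _ this, of ?N] insert.prems(1)
    obtain c where c: "\<exists>x\<in>S - {z}. c x \<noteq> 0" "\<forall>e'\<in>E. (\<Sum>x\<in>S - {z}. c x * ?N e' x) = 0" by auto
    define c' where "c' = c(z := - (\<Sum>x\<in>S - {z}. c x * M e x) / M e z)"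
    have S: "S = insert z (S - {z})" using z(1) by auto
    have *: "(\<Sum>x\<in>S. c' x * M e' x) = (\<Sum>x\<in>S - {z}. c x * M e' x) - (\<Sum>x\<in>S - {z}. c x * M e x) / M e z * M e' z" for e'
    proof -
      have "(\<Sum>x\<in>S. c' x * M e' x) = c' z * M e' z + (\<Sum>x\<in>S - {z}. c' x * M e' x)"
        by (subst S, subst sum.insert) (use insert.prems(1) in auto)
      also have "(\<Sum>x\<in>S - {z}. c' x * M e' x) = (\<Sum>x\<in>S - {z}. c x * M e' x)"
        by (intro sum.cong) (auto simp: c'_def)
      finally show ?thesis by (simp add: c'_def)
    qed
    have "(\<Sum>x\<in>S. c' x * M e' x) = 0" if "e' \<in> E" for e'
    proof -
      have "(\<Sum>x\<in>S - {z}. c x * ?N e' x) = (\<Sum>x\<in>S - {z}. c x * M e' x) - (\<Sum>x\<in>S - {z}. c x * M e x) / M e z * M e' z"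
        by (simp add: right_diff_distrib sum_subtractf sum_distrib_right sum_divide_distrib mult.assoc)
      with c(2) that show ?thesis by (simp add: *)
    qed
    moreover have "(\<Sum>x\<in>S. c' x * M e x) = 0" using z(2) by (simp add: *)
    moreover have "\<exists>x\<in>S. c' x \<noteq> 0" using c(1) by (auto simp: c'_def)
    ultimately show ?thesis by (intro exI[of _ c']) auto
  qed
qed

lemma dotp_avoid:
  fixes a :: "'i \<Rightarrow> complex ^ 'n::finite"
  assumes "finite I" "\<And>i. i \<in> I \<Longrightarrow> a i \<noteq> 0"
  shows "\<exists>w. \<forall>i\<in>I. dotp (a i) w \<noteq> 0"
  using assms
proof (induction I rule: finite_induct)
  case (insert i I)
  then obtain w where w: "\<forall>i\<in>I. dotp (a i) w \<noteq> 0" by auto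
  from insert.prems obtain k where k: "a i $ k \<noteq> 0" by (auto simp: vec_eq_iff)
  define e where "e = (axis k 1 :: complex ^ 'n)"
  have e: "dotp (a i) e \<noteq> 0"
    using k by (simp add: dotp_def e_def axis_def if_distrib[of "\<lambda>z. _ * z"] cong: if_cong)
  have up: "upoly (\<lambda>s. dotp (a j) (w + s *s e))" for j
    by (rule upoly_dotp) (simp, intro upoly_add upoly_mult upoly_const upoly_id)
  have "finite {s. dotp (a j) (w + s *s e) = 0}" if "j \<in> insert i I" for j
  proof (cases "j = i")
    case True
    have "\<exists>s. dotp (a i) (w + s *s e) \<noteq> 0"
      by (rule exI[of _ "(1 - dotp (a i) w) / dotp (a i) e"]) (use e in simp)
    with True show ?thesis using upoly_finite_zeros[OF up] by blast
  next
    case False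
    with that w show ?thesis by (intro upoly_finite_zeros[OF up, of _ 0]) auto
  qed
  then have "finite (\<Union>j\<in>insert i I. {s. dotp (a j) (w + s *s e) = 0})"
    using insert.hyps by blast
  then obtain s where "s \<notin> (\<Union>j\<in>insert i I. {s. dotp (a j) (w + s *s e) = 0})"
    using ex_new_if_finite[OF infinite_UNIV_char_0] by blast
  then show ?case by (intro exI[of _ "w + s *s e"]) blast
qed simp

text \<open>Lines that avoid the blown-up points exist because a vector space over an infinite field is not a finite
  union of proper subspaces.\<close>

lemma avoid_spans:
  fixes x y z :: "'i::finite \<Rightarrow> complex ^ 'n::finite"
  assumes "CARD('n) \<ge> 4"
  shows "\<exists>w. \<forall>i a b c. w \<noteq> a *s x i + b *s y i + c *s z i"
proof -
  have "\<exists>a. a \<noteq> 0 \<and> dotp a (x i) = 0 \<and> dotp a (y i) = 0 \<and> dotp a (z i) = 0" for i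
  proof -
    have "card {x i, y i, z i} \<le> 3" by (simp add: card_insert_if)
    then obtain c where c: "\<exists>k. c k \<noteq> 0" "\<forall>e\<in>{x i, y i, z i}. (\<Sum>k\<in>UNIV. c k * e $ k) = 0"
      using homogeneous_solution[of "{x i, y i, z i}" "UNIV :: 'n set" "\<lambda>e k. e $ k"] assms by auto
    then show ?thesis by (intro exI[of _ "\<chi> k. c k"]) (auto simp: dotp_def vec_eq_iff)
  qed
  then obtain a where a: "\<And>i. a i \<noteq> 0" "\<And>i. dotp (a i) (x i) = 0" "\<And>i. dotp (a i) (y i) = 0" "\<And>i. dotp (a i) (z i) = 0"
    by metis
  obtain w where w: "\<And>i. dotp (a i) w \<noteq> 0" using dotp_avoid[of UNIV a] a(1) by auto
  have "w \<noteq> \<alpha> *s x i + \<beta> *s y i + \<gamma> *s z i" for i \<alpha> \<beta> \<gamma>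
    using w[of i] by (auto simp: a)
  then show ?thesis by blast
qed

lemma upoly_poly [simp]: "upoly (poly P)"
  by (auto simp: upoly_def)

lemma upoly_cofinite_eq:
  assumes "upoly f" "upoly g" "finite {s. f s \<noteq> g s}"
  shows "f s = g s"
  using upoly_eq[OF assms(1,2) eventually_at_finite] assms(3) by auto

text \<open>A function that is locally a quotient of polynomials is a polynomial: the denominator of
  lowest degree has no root.\<close>

lemma rational_imp_upoly:
  assumes loc: "\<And>s0. \<exists>a b. upoly a \<and> upoly b \<and> b s0 \<noteq> 0 \<and> (\<forall>s. b s \<noteq> 0 \<longrightarrow> \<phi> s * b s = a s)"
  shows "upoly \<phi>"
proof -
  have descent: "\<exists>P'. finite {s. \<phi> s \<noteq> poly P' s}"
    if "Q \<noteq> 0" "finite {s. \<phi> s * poly Q s \<noteq> poly P s}" for P Q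
    using that
  proof (induction "degree Q" arbitrary: P Q rule: less_induct)
    case less
    show ?case
    proof (cases "degree Q = 0")
      case True
      then obtain e where e: "Q = [:e:]" by (rule degree_eq_zeroE)
      with less.prems(1) have "e \<noteq> 0" by auto
      then have "{s. \<phi> s \<noteq> poly (smult (1 / e) P) s} = {s. \<phi> s * poly Q s \<noteq> poly P s}"
        by (auto simp: e field_simps)
      with less.prems(2) show ?thesis by (intro exI[of _ "smult (1 / e) P"]) simp
    next
      case False
      then have "\<not> constant (poly Q)" by (simp add: constant_degree)
      then obtain s1 where s1: "poly Q s1 = 0" using fundamental_theorem_of_algebra by blast
      obtain a b where ab: "upoly a" "upoly b" "b s1 \<noteq> 0" "\<And>s. b s \<noteq> 0 \<Longrightarrow> \<phi> s * b s = a s"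
        using loc by blast
      have "poly P s1 * b s1 = a s1 * poly Q s1"
      proof (rule upoly_cofinite_eq[where f = "\<lambda>s. poly P s * b s" and g = "\<lambda>s. a s * poly Q s"])
        show "upoly (\<lambda>s. poly P s * b s)" "upoly (\<lambda>s. a s * poly Q s)"
          by (intro upoly_mult upoly_poly ab)+
        have "{s. poly P s * b s \<noteq> a s * poly Q s} \<subseteq> {s. b s = 0} \<union> {s. \<phi> s * poly Q s \<noteq> poly P s}"
        proof
          fix s assume "s \<in> {s. poly P s * b s \<noteq> a s * poly Q s}"
          then show "s \<in> {s. b s = 0} \<union> {s. \<phi> s * poly Q s \<noteq> poly P s}"
            using ab(4)[of s, symmetric] by (auto simp: mult_ac)
        qed
        then show "finite {s. poly P s * b s \<noteq> a s * poly Q s}"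
          using finite_subset less.prems(2) upoly_finite_zeros[OF ab(2,3)] by blast
      qed
      with s1 ab(3) have "poly P s1 = 0" by simp
      then obtain P1 where P1: "P = [:- s1, 1:] * P1" by (auto simp: poly_eq_0_iff_dvd elim: dvdE)
      from s1 obtain Q1 where Q1: "Q = [:- s1, 1:] * Q1" by (auto simp: poly_eq_0_iff_dvd elim: dvdE)
      have "Q1 \<noteq> 0" using Q1 less.prems(1) by auto
      have deg: "degree Q1 < degree Q"
        unfolding Q1 using \<open>Q1 \<noteq> 0\<close> by (subst degree_mult_eq) auto
      have "{s. \<phi> s * poly Q1 s \<noteq> poly P1 s} \<subseteq> insert s1 {s. \<phi> s * poly Q s \<noteq> poly P s}"
      proof
        fix s assume s: "s \<in> {s. \<phi> s * poly Q1 s \<noteq> poly P1 s}"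
        have "s = s1" if "\<phi> s * poly Q s = poly P s"
        proof -
          from that have "(s - s1) * (\<phi> s * poly Q1 s - poly P1 s) = 0" by (simp add: P1 Q1 algebra_simps)
          with s show ?thesis by simp
        qed
        then show "s \<in> insert s1 {s. \<phi> s * poly Q s \<noteq> poly P s}" by auto
      qed
      then have "finite {s. \<phi> s * poly Q1 s \<noteq> poly P1 s}" using less.prems(2) finite_subset by blast
      from less.hyps[OF deg \<open>Q1 \<noteq> 0\<close> this] show ?thesis .
    qed
  qed
  obtain a b where ab: "upoly a" "upoly b" "b 0 \<noteq> 0" "\<And>s. b s \<noteq> 0 \<Longrightarrow> \<phi> s * b s = a s"
    using loc by blast
  then obtain P Q where PQ: "a = poly P" "b = poly Q" by (auto simp: upoly_def)
  with ab have "Q \<noteq> 0" by auto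
  moreover have "finite {s. \<phi> s * poly Q s \<noteq> poly P s}"
  proof (rule finite_subset[OF _ upoly_finite_zeros[OF ab(2,3)]])
    show "{s. \<phi> s * poly Q s \<noteq> poly P s} \<subseteq> {s. b s = 0}" using ab(4) unfolding PQ by blast
  qed
  ultimately have "\<exists>P'. finite {s. \<phi> s \<noteq> poly P' s}" by (rule descent)
  then obtain P' where P': "finite {s. \<phi> s \<noteq> poly P' s}" ..
  have "\<phi> s1 = poly P' s1" for s1
  proof -
    obtain a b where ab: "upoly a" "upoly b" "b s1 \<noteq> 0" "\<And>s. b s \<noteq> 0 \<Longrightarrow> \<phi> s * b s = a s"
      using loc by blast
    have "poly P' s1 * b s1 = a s1"
    proof (rule upoly_cofinite_eq[where f = "\<lambda>s. poly P' s * b s" and g = a])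
      show "upoly (\<lambda>s. poly P' s * b s)" "upoly a" by (intro upoly_mult upoly_poly ab)+
      have "{s. poly P' s * b s \<noteq> a s} \<subseteq> {s. b s = 0} \<union> {s. \<phi> s \<noteq> poly P' s}"
      proof
        fix s assume "s \<in> {s. poly P' s * b s \<noteq> a s}"
        then show "s \<in> {s. b s = 0} \<union> {s. \<phi> s \<noteq> poly P' s}" using ab(4)[of s] by auto
      qed
      then show "finite {s. poly P' s * b s \<noteq> a s}"
        using finite_subset P' upoly_finite_zeros[OF ab(2,3)] by blast
    qed
    with ab(4)[OF ab(3)] have "\<phi> s1 * b s1 = poly P' s1 * b s1" by simp
    with ab(3) show ?thesis by simp
  qed
  then have "\<phi> = poly P'" by auto
  then show ?thesis by (auto simp: upoly_def)
qed

lemma upoly_compose: "upoly f \<Longrightarrow> upoly g \<Longrightarrow> upoly (\<lambda>s. f (g s))"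
proof -
  assume "upoly f" "upoly g"
  then obtain P Q where "f = poly P" "g = poly Q" by (auto simp: upoly_def)
  then have "(\<lambda>s. f (g s)) = poly (pcompose P Q)" by (simp add: poly_pcompose fun_eq_iff)
  then show ?thesis unfolding upoly_def by (rule exI)
qed

text \<open>Comparing a section on the line from \<open>v0\<close> to \<open>w\<close> in the two affine charts bounds its degree and
  identifies its value at \<open>w\<close>.\<close>

lemma coeff_reversal:
  fixes P R :: "complex poly"
  assumes "\<And>s. s \<noteq> 0 \<Longrightarrow> poly P s = s ^ d * poly R (1 / s)"
  shows "coeff P d = poly R 0"
proof (cases "R = 0")
  case True
  have "poly P s = poly 0 s" for s
  proof (rule upoly_cofinite_eq[where f = "poly P" and g = "poly 0"])
    have "{s. poly P s \<noteq> poly 0 s} \<subseteq> {0}" using assms True by auto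
    then show "finite {s. poly P s \<noteq> poly 0 s}" by (rule finite_subset) simp
  qed simp_all
  then have "P = 0" by (simp add: poly_eq_poly_eq_iff[symmetric] fun_eq_iff)
  with True show ?thesis by simp
next
  case False
  have "poly (monom 1 (degree R) * P) s = poly (monom 1 d * reflect_poly R) s" for s
  proof (rule upoly_cofinite_eq[where f = "poly (monom 1 (degree R) * P)" and g = "poly (monom 1 d * reflect_poly R)"])
    have "poly (monom 1 (degree R) * P) s = poly (monom 1 d * reflect_poly R) s" if "s \<noteq> 0" for s
      using assms[OF that] that by (simp add: poly_monom poly_reflect_poly_nz inverse_eq_divide)
    then have "{s. poly (monom 1 (degree R) * P) s \<noteq> poly (monom 1 d * reflect_poly R) s} \<subseteq> {0}" by blast
    then show "finite {s. poly (monom 1 (degree R) * P) s \<noteq> poly (monom 1 d * reflect_poly R) s}"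
      by (rule finite_subset) simp
  qed (auto simp: upoly_def)
  then have "monom 1 (degree R) * P = monom 1 d * reflect_poly R"
    by (simp add: poly_eq_poly_eq_iff[symmetric] fun_eq_iff)
  then have "coeff (monom 1 (degree R) * P) (degree R + d) = coeff (monom 1 d * reflect_poly R) (degree R + d)"
    by simp
  then show ?thesis by (simp add: coeff_monom_mult coeff_reflect_poly poly_0_coeff_0)
qed

context blown_points
begin

text \<open>Every point of the blow-up is a limit of points outside the exceptional divisors.\<close>

lemma arc_exists:
  assumes "\<xi> \<in> X" "x \<in> \<xi> None" "x \<noteq> 0"
  obtains w where "arc \<xi> x w"
proof (cases "off x")
  case True
  with assms that show ?thesis by (auto simp: arc_def)
next
  case False
  then obtain i where i: "x \<in> p i" by (auto simp: off_def)
  have "\<not> \<xi> (Some i) \<subseteq> p i"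
  proof
    assume "\<xi> (Some i) \<subseteq> p i"
    then have "vec.dim (\<xi> (Some i)) \<le> vec.dim (p i)" by (rule vec.dim_subset)
    moreover have "vec.dim (p i) = 1" unfolding p_def using q_nz[of i] by (simp add: vec.dim_eq_card_independent)
    ultimately show False using X_Some[OF assms(1), of i] by simp
  qed
  with i assms that show ?thesis by (auto simp: arc_def)
qed

lemma arc_lft: "off x \<Longrightarrow> arc (lft x) x w"
  using lft_in off_nz by (auto simp: arc_def vec.span_base)

context
  fixes s d
  assumes s: "regular_form X X d s"
begin

lemma section_hom: "\<xi> \<in> X \<Longrightarrow> v \<in> \<xi> None \<Longrightarrow> s (\<xi>, c *s v) = c ^ d * s (\<xi>, v)"
  using s by (auto simp: regular_form_def)

lemma section_line:
  assumes "\<And>t. off (v0 + t *s v1)"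
  shows "upoly (\<lambda>t. s (lft (v0 + t *s v1), v0 + t *s v1))"
proof (rule rational_imp_upoly)
  fix t0
  let ?x = "v0 + t0 *s v1"
  obtain a b where ab: "upoly a" "upoly b" "b 0 \<noteq> 0" and "s (lft ?x, ?x) * b 0 = a 0" and ab4:
    "\<And>t. off (?x + t *s v1) \<Longrightarrow> b t \<noteq> 0 \<Longrightarrow> s (lft (?x + t *s v1), ?x + t *s v1) * b t = a t"
    by (rule arc_regular_form[OF arc_lft[OF assms, of t0 v1] s lft_in[OF assms]]) (rule that; assumption)
  have x: "?x + (t - t0) *s v1 = v0 + t *s v1" for t by (simp add: vec_eq_iff algebra_simps)
  have up: "upoly (\<lambda>t. f (t - t0))" if "upoly f" for f
    using that by (rule upoly_compose) (intro upoly_diff upoly_id upoly_const)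
  have "s (lft (v0 + t *s v1), v0 + t *s v1) * b (t - t0) = a (t - t0)" if "b (t - t0) \<noteq> 0" for t
    using ab4[of "t - t0"] that assms[of t] unfolding x by blast
  then show "\<exists>a b. upoly a \<and> upoly b \<and> b t0 \<noteq> 0 \<and>
      (\<forall>t. b t \<noteq> 0 \<longrightarrow> s (lft (v0 + t *s v1), v0 + t *s v1) * b t = a t)"
    using up[OF ab(1)] up[OF ab(2)] ab(3)
    by (intro exI[of _ "\<lambda>t. a (t - t0)"] exI[of _ "\<lambda>t. b (t - t0)"]) simp
qed

text \<open>Along the line \<open>v0 + t w\<close> the section is a polynomial of degree at most \<open>d\<close> in \<open>t\<close>, and its
  value at \<open>w\<close> is the coefficient of \<open>t ^ d\<close>. The coefficients of the Taylor series of a quotient of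
  polynomials at \<open>v0\<close> are forms.\<close>

lemma section_generic_form:
  assumes v0: "off v0"
  shows "\<exists>F. is_form d F \<and> (\<forall>w. (\<forall>i. w \<notin> vec.span {v0, q i}) \<longrightarrow> s (lft w, w) = F w)"
proof -
  define good where "good w \<longleftrightarrow> (\<forall>i. w \<notin> vec.span {v0, q i})" for w
  have off1: "off (v0 + t *s w)" if "good w" for t w
    unfolding off_def
  proof (intro allI notI)
    fix i assume "v0 + t *s w \<in> p i"
    then obtain e where e: "v0 + t *s w = e *s q i" by (auto simp: p_def span1)
    show False
    proof (cases "t = 0")
      case True
      with e v0 show False by (auto simp: off_def p_def span1)
    next
      case False
      then have "w = (- 1 / t) *s v0 + (e / t) *s q i" using e by (simp add: vec_eq_iff field_simps)
      then have "w \<in> vec.span {v0, q i}" unfolding span2 by blast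
      with that show False by (simp add: good_def)
    qed
  qed
  have off2: "off (w + t *s v0)" if "good w" for t w
    unfolding off_def
  proof (intro allI notI)
    fix i assume "w + t *s v0 \<in> p i"
    then obtain e where "w + t *s v0 = e *s q i" by (auto simp: p_def span1)
    then have "w = (- t) *s v0 + e *s q i" by (simp add: vec_eq_iff algebra_simps)
    then have "w \<in> vec.span {v0, q i}" unfolding span2 by blast
    with that show False by (simp add: good_def)
  qed
  define f where "f v = s (lft v, v)" for v
  have hom: "f (e *s v) = e ^ d * f v" if "off v" "e \<noteq> 0" for e v
    unfolding f_def lft_scale[OF that] using section_hom[OF lft_in[OF that(1)], of v e] by (simp add: vec.span_base)
  have "\<exists>P. \<forall>t. poly P t = f (v0 + t *s w)" if "good w" for w
  proof -
    from section_line[of v0 w, OF off1[OF that]]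
    obtain P where "(\<lambda>t. f (v0 + t *s w)) = poly P" unfolding upoly_def f_def by blast
    then show ?thesis by (intro exI[of _ P]) (simp add: fun_eq_iff)
  qed
  then obtain \<Phi> where \<Phi>: "\<And>w t. good w \<Longrightarrow> poly (\<Phi> w) t = f (v0 + t *s w)" by metis
  have lead: "coeff (\<Phi> w) d = f w" if w: "good w" for w
  proof -
    from section_line[of w v0, OF off2[OF w]]
    obtain R where "(\<lambda>t. f (w + t *s v0)) = poly R" unfolding upoly_def f_def by blast
    then have R: "poly R t = f (w + t *s v0)" for t by (simp add: fun_eq_iff)
    have "poly (\<Phi> w) t = t ^ d * poly R (1 / t)" if "t \<noteq> 0" for t
    proof -
      have "v0 + t *s w = t *s (w + (1 / t) *s v0)" using that by (simp add: vec_eq_iff field_simps)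
      then have "f (v0 + t *s w) = f (t *s (w + (1 / t) *s v0))" by (rule arg_cong)
      also have "\<dots> = t ^ d * f (w + (1 / t) *s v0)" by (rule hom[OF off2[OF w] that])
      finally show ?thesis by (simp only: \<Phi>[OF w] R)
    qed
    from coeff_reversal[OF this] show ?thesis by (simp add: R)
  qed
  have arc0: "arc (lft v0) v0 w" for w using arc_lft[OF v0] .
  obtain A B where AB: "lft v0 \<in> nv X (tuple_eval B)"
    "\<And>\<eta> y. \<eta> \<in> nv X (tuple_eval B) \<Longrightarrow> y \<in> tprod \<eta> \<Longrightarrow> s (\<eta>, y None) * tuple_eval B y = tuple_eval A y"
  proof -
    have "locally_fraction X X (\<lambda>\<eta> y. s (\<eta>, y None))" using s by (simp add: regular_form_def)
    then obtain A B where "lft v0 \<in> nv X (tuple_eval B)"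
      "\<And>\<eta> y. \<eta> \<in> X \<inter> nv X (tuple_eval B) \<Longrightarrow> y \<in> tprod \<eta> \<Longrightarrow> s (\<eta>, y None) * tuple_eval B y = tuple_eval A y"
      unfolding locally_fraction_def nonvanishing_nv tprod_def using lft_in[OF v0] by blast
    then show ?thesis by (intro that[of B A]) (auto simp: nv_def)
  qed
  then obtain y0 where y0: "y0 \<in> tprod (lft v0)" "tuple_eval B y0 \<noteq> 0" by (auto simp: nv_def)
  obtain k where k: "v0 $ k \<noteq> 0" using off_nz[OF v0] by (auto simp: vec_eq_iff)
  let ?z = "\<lambda>o'. if o' = None then v0 else 0"
  have z: "?z \<in> tprod (lft v0)" "?z None $ k \<noteq> 0"
    using k by (auto simp: tprod_def lft_def vec.span_base vec.span_zero split: option.split)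
  obtain y where y: "y \<in> tprod (lft v0)" "tuple_eval B y \<noteq> 0" "y None $ k \<noteq> 0"
    by (rule tprod_nonzero_mult[where f = "tuple_eval B" and g = "\<lambda>y. y None $ k", OF X_subspaces[OF lft_in[OF v0]] tpoly_eval tpoly_coord y0 z])
  have "y None \<in> vec.span {v0}" using y(1) by (auto simp: tprod_def dest: spec[of _ None])
  then obtain c where c: "y None = c *s v0" by (auto simp: span1)
  have "c \<noteq> 0" using y(3) c by auto
  have "\<exists>\<alpha> \<beta>. y (Some j) = \<alpha> *s q j + \<beta> *s v0" for j
  proof -
    have "y (Some j) \<in> vec.span {q j, v0}" using y(1) by (auto simp: tprod_def dest: spec[of _ "Some j"])
    then show ?thesis by (simp add: span2)
  qed
  then obtain \<alpha> \<beta> where ab: "\<And>j. y (Some j) = \<alpha> j *s q j + \<beta> j *s v0" by metis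
  define Y where "Y u = case_option (c *s (v0 + u)) (\<lambda>j. \<alpha> j *s q j + \<beta> j *s (v0 + u))" for u
  have Y0: "Y 0 = y" by (rule ext, case_tac x) (auto simp: Y_def c ab)
  have Yin: "Y u \<in> tprod (lft (v0 + u))" for u
    unfolding tprod_def
  proof (intro CollectI allI)
    fix o' show "Y u o' \<in> lft (v0 + u) o'"
    proof (cases o')
      case None
      have "c *s (v0 + u) \<in> vec.span {v0 + u}" by (intro vec.span_scale vec.span_base) simp
      with None show ?thesis by (simp add: Y_def)
    next
      case (Some j)
      have "\<alpha> j *s q j + \<beta> j *s (v0 + u) \<in> vec.span {q j, v0 + u}" unfolding span2 by blast
      with Some show ?thesis by (simp add: Y_def)
    qed
  qed
  have aff: "\<exists>\<alpha> g. is_form 1 g \<and> (\<forall>u. Y u i $ l = \<alpha> + g u)" for i l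
  proof (cases i)
    case None
    have "is_form 1 (\<lambda>u. c * u $ l)" by (rule is_form_scale[OF is_form_coord])
    with None show ?thesis
      by (intro exI[of _ "c * v0 $ l"] exI[of _ "\<lambda>u. c * u $ l"]) (simp add: Y_def algebra_simps)
  next
    case (Some j)
    have "is_form 1 (\<lambda>u. \<beta> j * u $ l)" by (rule is_form_scale[OF is_form_coord])
    with Some show ?thesis
      by (intro exI[of _ "\<alpha> j * q j $ l + \<beta> j * v0 $ l"] exI[of _ "\<lambda>u. \<beta> j * u $ l"]) (simp add: Y_def algebra_simps)
  qed
  obtain gA where gA: "\<And>k. is_form k (gA k)"
    "\<And>u. \<exists>P. (\<forall>t. poly P t = tuple_eval A (Y (t *s u))) \<and> (\<forall>k. coeff P k = gA k u)"
    using tpoly_graded[where y = Y, OF tpoly_eval[of A] aff] by blast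
  obtain gB where gB: "\<And>k. is_form k (gB k)"
    "\<And>u. \<exists>P. (\<forall>t. poly P t = tuple_eval B (Y (t *s u))) \<and> (\<forall>k. coeff P k = gB k u)"
    using tpoly_graded[where y = Y, OF tpoly_eval[of B] aff] by blast
  define b0 where "b0 = c ^ d * tuple_eval B y"
  have "b0 \<noteq> 0" using \<open>c \<noteq> 0\<close> y(2) by (simp add: b0_def)
  have rel: "(\<Sum>i\<le>k. coeff (\<Phi> w) i * (c ^ d * gB (k - i) w)) = gA k w" and gB0: "c ^ d * gB 0 w = b0"
    if w: "good w" for k w
  proof -
    obtain PA where PA: "\<And>t. poly PA t = tuple_eval A (Y (t *s w))" "\<And>k. coeff PA k = gA k w"
      using gA(2) by blast
    obtain PB where PB: "\<And>t. poly PB t = tuple_eval B (Y (t *s w))" "\<And>k. coeff PB k = gB k w"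
      using gB(2) by blast
    have "gB 0 w = tuple_eval B y" using PB(1)[of 0] PB(2)[of 0] Y0 by (simp add: poly_0_coeff_0)
    then show "c ^ d * gB 0 w = b0" by (simp add: b0_def)
    have eq: "poly (\<Phi> w * smult (c ^ d) PB) t = poly PA t" if t: "poly PB t \<noteq> 0" for t
    proof -
      have o: "off (v0 + t *s w)" using off1[OF w] .
      have "s (lft (v0 + t *s w), Y (t *s w) None) * tuple_eval B (Y (t *s w)) = tuple_eval A (Y (t *s w))"
        using AB(2)[OF X_nv_lft[OF o Yin[of "t *s w"]] Yin[of "t *s w"], of ] t PB(1) by simp
      moreover have "s (lft (v0 + t *s w), Y (t *s w) None) = c ^ d * f (v0 + t *s w)"
        using section_hom[OF lft_in[OF o], of "v0 + t *s w" c] by (simp add: Y_def f_def vec.span_base del: vec.scale_right_distrib)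
      ultimately show ?thesis by (simp add: \<Phi>[OF w] PA(1) PB(1) mult_ac)
    qed
    have "poly PB 0 \<noteq> 0" using PB(1)[of 0] Y0 y(2) by simp
    then have "finite {t. poly PB t = 0}" by (intro upoly_finite_zeros[of _ 0]) (auto simp: upoly_def)
    then have "finite {t. poly (\<Phi> w * smult (c ^ d) PB) t \<noteq> poly PA t}"
      by (rule rev_finite_subset) (use eq in auto)
    then have "poly (\<Phi> w * smult (c ^ d) PB) t = poly PA t" for t
      by (intro upoly_cofinite_eq[where f = "poly (\<Phi> w * smult (c ^ d) PB)" and g = "poly PA"]) simp_all
    then have "\<Phi> w * smult (c ^ d) PB = PA" by (simp add: poly_eq_poly_eq_iff[symmetric] fun_eq_iff)
    then have "coeff (\<Phi> w * smult (c ^ d) PB) k = coeff PA k" by simp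
    then show "(\<Sum>i\<le>k. coeff (\<Phi> w) i * (c ^ d * gB (k - i) w)) = gA k w"
      unfolding coeff_mult PA(2) by (simp add: PB(2))
  qed
  have "\<exists>E. is_form k E \<and> (\<forall>w. good w \<longrightarrow> coeff (\<Phi> w) k = E w)" for k
  proof (induction k rule: less_induct)
    case (less k)
    then have "\<forall>i\<in>{..<k}. \<exists>E. is_form i E \<and> (\<forall>w. good w \<longrightarrow> coeff (\<Phi> w) i = E w)" by auto
    then obtain E where E: "\<And>i. i < k \<Longrightarrow> is_form i (E i)" "\<And>i w. i < k \<Longrightarrow> good w \<Longrightarrow> coeff (\<Phi> w) i = E i w"
      unfolding bchoice_iff by auto
    let ?G = "\<lambda>w. (1 / b0) * (gA k w + (- 1) * (\<Sum>i<k. E i w * (c ^ d * gB (k - i) w)))"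
    have "is_form k ?G"
    proof (intro is_form_scale is_form_add is_form_sum gA)
      fix i assume "i \<in> {..<k}"
      then show "is_form k (\<lambda>w. E i w * (c ^ d * gB (k - i) w))"
        using is_form_mult[OF E(1)[of i] is_form_scale[OF gB(1)[of "k - i"], of "c ^ d"]] by simp
    qed
    moreover have "coeff (\<Phi> w) k = ?G w" if w: "good w" for w
    proof -
      have "{..k} = insert k {..<k}" by auto
      then have "gA k w = coeff (\<Phi> w) k * b0 + (\<Sum>i<k. coeff (\<Phi> w) i * (c ^ d * gB (k - i) w))"
        using rel[OF w, of k] gB0[OF w] by simp
      also have "(\<Sum>i<k. coeff (\<Phi> w) i * (c ^ d * gB (k - i) w)) = (\<Sum>i<k. E i w * (c ^ d * gB (k - i) w))"
        using E(2) w by (intro sum.cong) auto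
      finally show ?thesis using \<open>b0 \<noteq> 0\<close> by (simp add: field_simps)
    qed
    ultimately show ?case by (intro exI[of _ ?G]) blast
  qed
  then obtain F where "is_form d F" "\<And>w. good w \<Longrightarrow> coeff (\<Phi> w) d = F w" by blast
  then show ?thesis using lead unfolding good_def f_def by (intro exI[of _ F]) auto
qed

lemma section_form_on_arc:
  assumes F: "\<And>x. off x \<Longrightarrow> P x \<Longrightarrow> s (lft x, x) = form d c (\<lambda>k. x $ k)"
    and arc: "arc \<xi> x w" and ev: "\<forall>\<^sub>F t in at 0. P (x + t *s w)"
  shows "s (\<xi>, x) = form d c (\<lambda>k. x $ k)"
proof -
  have "\<xi> \<in> X" using arc by (simp add: arc_def)
  obtain a b where ab: "upoly a" "upoly b" "b 0 \<noteq> 0" "s (\<xi>, x) * b 0 = a 0"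
    "\<And>t. off (x + t *s w) \<Longrightarrow> b t \<noteq> 0 \<Longrightarrow> s (lft (x + t *s w), x + t *s w) * b t = a t"
    by (rule arc_regular_form[OF arc s \<open>\<xi> \<in> X\<close>]) (rule that; assumption)
  let ?F = "\<lambda>t. form d c (\<lambda>k. (x + t *s w) $ k)"
  have up: "upoly ?F"
    by (rule upoly_form) (simp, intro upoly_add upoly_mult upoly_const upoly_id)
  have "\<forall>\<^sub>F t in at 0. ?F t * b t = a t"
    using arc_eventually[OF arc ab(2,3)] ev
  proof eventually_elim
    case (elim t)
    then show ?case using F[of "x + t *s w"] ab(5)[of t] by simp
  qed
  then have "?F 0 * b 0 = a 0"
    by (rule upoly_eq[OF upoly_mult[OF up ab(2)] ab(1)])
  with ab(4) have "s (\<xi>, x) * b 0 = form d c (\<lambda>k. x $ k) * b 0" by simp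
  with ab(3) show ?thesis by (simp only: mult_cancel_right) simp
qed

text \<open>The generic form agrees with the section at points in general position relative to \<open>v0\<close>, and then
  everywhere by passing to the limit along curves.\<close>

theorem section_form:
  assumes n: "CARD('n) \<ge> 4"
  shows "\<exists>c. \<forall>\<xi>\<in>X. \<forall>v\<in>\<xi> None. s (\<xi>, v) = form d c (\<lambda>k. v $ k)"
proof -
  obtain v0 where v0: "off v0"
    using avoid_spans[OF n, of q "\<lambda>_. 0" "\<lambda>_. 0"] by (auto simp: off_def p_def span1)
  obtain F where F: "is_form d F" "\<And>w. \<forall>i. w \<notin> vec.span {v0, q i} \<Longrightarrow> s (lft w, w) = F w"
    using section_generic_form[OF v0] by blast
  then obtain c where c: "\<And>v. F v = form d c (\<lambda>k. v $ k)" by (auto simp: is_form_def)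
  have off: "s (lft x, x) = form d c (\<lambda>k. x $ k)" if x: "off x" for x
  proof -
    obtain w where w: "\<And>i a b e. w \<noteq> a *s v0 + b *s q i + e *s x"
      using avoid_spans[OF n, of "\<lambda>_. v0" q "\<lambda>_. x"] by blast
    have good: "\<forall>i. x + t *s w \<notin> vec.span {v0, q i}" if t: "t \<noteq> 0" for t
    proof (intro allI notI)
      fix i assume "x + t *s w \<in> vec.span {v0, q i}"
      then obtain a b where "x + t *s w = a *s v0 + b *s q i" by (auto simp: span2)
      then have "x $ k + t * w $ k = a * v0 $ k + b * q i $ k" for k by (simp add: vec_eq_iff)
      then have "w $ k = (a * v0 $ k + b * q i $ k - x $ k) / t" for k
        using t by (simp add: field_simps)
      then have "w = (a / t) *s v0 + (b / t) *s q i + (- 1 / t) *s x"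
        by (simp add: vec_eq_iff diff_divide_distrib add_divide_distrib)
      with w show False by blast
    qed
    show ?thesis
    proof (rule section_form_on_arc[OF _ arc_lft[OF x, of w]])
      show "\<forall>\<^sub>F t in at 0. \<forall>i. x + t *s w \<notin> vec.span {v0, q i}"
        using good by (simp add: eventually_at_filter)
    qed (simp add: F(2) c)
  qed
  have "s (\<xi>, v) = form d c (\<lambda>k. v $ k)" if "\<xi> \<in> X" and v: "v \<in> \<xi> None" for \<xi> v
  proof -
    obtain x where x: "x \<in> \<xi> None" "x \<noteq> 0" using X_None_nz[OF \<open>\<xi> \<in> X\<close>] by blast
    obtain w where w: "arc \<xi> x w" by (rule arc_exists[OF \<open>\<xi> \<in> X\<close> x])
    have "s (\<xi>, x) = form d c (\<lambda>k. x $ k)"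
      by (rule section_form_on_arc[OF _ w, of "\<lambda>_. True"]) (simp_all add: off)
    moreover obtain e where "v = e *s x" using v X_None[OF \<open>\<xi> \<in> X\<close> x] by (auto simp: span1)
    ultimately show ?thesis
      using section_hom[OF \<open>\<xi> \<in> X\<close> x(1), of e] form_scale[of d c e "\<lambda>k. x $ k"] by simp
  qed
  then show ?thesis by blast
qed

end

text \<open>A local quotient of a section by the equation of an exceptional divisor, restricted to a curve
  through that divisor, shows the order of vanishing of the form.\<close>

lemma low_coeffs_zero:
  fixes T :: "nat \<Rightarrow> complex"
  assumes "upoly b" "upoly r" "b 0 \<noteq> 0" "\<And>t. (\<Sum>j\<le>d. t ^ j * T j) * b t = t ^ m * r t"
  shows "j < m \<Longrightarrow> j \<le> d \<Longrightarrow> T j = 0" "r 0 = 0 \<Longrightarrow> m \<le> d \<Longrightarrow> T m = 0"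
proof -
  from assms obtain B R where BR: "b = poly B" "r = poly R" by (auto simp: upoly_def)
  define P where "P = (\<Sum>j\<le>d. monom (T j) j)"
  have coeff: "coeff P j = (if j \<le> d then T j else 0)" for j
    by (simp add: P_def coeff_sum)
  have "poly (P * B) t = poly (monom 1 m * R) t" for t
    using assms(4)[of t] by (simp add: P_def BR poly_sum poly_monom mult.commute)
  then have "P * B = monom 1 m * R" by (simp add: poly_eq_poly_eq_iff[symmetric] fun_eq_iff)
  then have eq: "coeff (P * B) k = coeff (monom 1 m * R) k" for k by simp
  have B0: "coeff B 0 \<noteq> 0" using assms(3) BR by (simp add: poly_0_coeff_0)
  have low: "coeff P k = 0" if "k < m \<or> (k = m \<and> r 0 = 0)" for k
    using that
  proof (induction k rule: less_induct)
    case (less k)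
    have "coeff (P * B) k = coeff P k * coeff B 0 + (\<Sum>i<k. coeff P i * coeff B (k - i))"
    proof -
      have "{..k} = insert k {..<k}" by auto
      then show ?thesis by (simp add: coeff_mult)
    qed
    also have "(\<Sum>i<k. coeff P i * coeff B (k - i)) = 0"
      using less by (intro sum.neutral) auto
    finally have "coeff P k * coeff B 0 = coeff (monom 1 m * R) k" using eq[of k] by simp
    also have "\<dots> = 0" using less.prems BR by (auto simp: coeff_monom_mult poly_0_coeff_0)
    finally show ?case using B0 by simp
  qed
  show "j < m \<Longrightarrow> j \<le> d \<Longrightarrow> T j = 0" using low[of j] coeff[of j] by auto
  show "r 0 = 0 \<Longrightarrow> m \<le> d \<Longrightarrow> T m = 0" using low[of m] coeff[of m] by auto
qed

lemma form_line:
  fixes x w :: "complex ^ 'm::finite"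
  shows "form d c (\<lambda>k. (x + t *s w) $ k) = (\<Sum>j\<le>d. t ^ j * tay d c j (\<lambda>k. x $ k) (\<lambda>k. w $ k))"
  using form_tay[of d c 1 "\<lambda>k. x $ k" t "\<lambda>k. w $ k"] by simp

lemma local_quotient_order:
  assumes lq: "local_quotient p (d, m) s U u" and xi: "\<xi> \<in> U" "\<xi> \<in> exceptional p i"
    and w: "w \<in> \<xi> (Some i)" "w \<notin> p i"
    and c: "\<And>\<xi> v. \<xi> \<in> X \<Longrightarrow> v \<in> \<xi> None \<Longrightarrow> s (\<xi>, v) = form d c (\<lambda>k. v $ k)"
  shows "j < m i \<Longrightarrow> j \<le> d \<Longrightarrow> tay d c j (\<lambda>k. q i $ k) (\<lambda>k. w $ k) = 0"
    and "u (\<xi>, q i) = 0 \<Longrightarrow> m i \<le> d \<Longrightarrow> tay d c (m i) (\<lambda>k. q i $ k) (\<lambda>k. w $ k) = 0"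
proof -
  from lq obtain t where u: "regular_form X U d u" and t: "\<And>i. local_equation X (exceptional p i) U (t i)"
    and fac: "\<And>\<eta> v. \<eta> \<in> U \<Longrightarrow> v \<in> \<eta> None \<Longrightarrow> s (\<eta>, v) = (\<Prod>i\<in>UNIV. t i \<eta> ^ m i) * u (\<eta>, v)"
    by (auto simp: local_quotient_def)
  have X: "\<xi> \<in> X" "\<xi> None = p i" using xi by (auto simp: exceptional_def)
  have arc: "arc \<xi> (q i) w"
    using X w q_nz[of i] by (auto simp: arc_def p_def vec.span_base)
  have U: "openin (zariski X) U" using u by (simp add: regular_form_def)
  have "\<exists>a b. upoly a \<and> upoly b \<and> b 0 \<noteq> 0 \<and> t j \<xi> * b 0 = a 0 \<and>
      (\<forall>e. off (q i + e *s w) \<longrightarrow> b e \<noteq> 0 \<longrightarrow> t j (lft (q i + e *s w)) * b e = a e)" for j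
  proof -
    have "regular_on X U (t j)" using t[of j] by (simp add: local_equation_def)
    then show ?thesis by (rule arc_regular[OF arc _ xi(1)]) blast
  qed
  then obtain a b where ab: "\<And>j. upoly (a j)" "\<And>j. upoly (b j)" "\<And>j. b j 0 \<noteq> 0" "\<And>j. t j \<xi> * b j 0 = a j 0"
    "\<And>j e. off (q i + e *s w) \<Longrightarrow> b j e \<noteq> 0 \<Longrightarrow> t j (lft (q i + e *s w)) * b j e = a j e" by metis
  obtain au bu where abu: "upoly au" "upoly bu" "bu 0 \<noteq> 0" "u (\<xi>, q i) * bu 0 = au 0"
    "\<And>e. off (q i + e *s w) \<Longrightarrow> bu e \<noteq> 0 \<Longrightarrow> u (lft (q i + e *s w), q i + e *s w) * bu e = au e"
    by (rule arc_regular_form[OF arc u xi(1)]) (rule that; assumption)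
  have "t i \<xi> = 0" using t[of i] xi by (auto simp: local_equation_def)
  then have "a i 0 = 0" using ab(4)[of i] by simp
  moreover obtain Q where Q: "a i = poly Q" using ab(1)[of i] by (auto simp: upoly_def)
  ultimately obtain Q' where Q': "Q = [:0, 1:] * Q'" by (auto simp: poly_eq_0_iff_dvd elim: dvdE)
  define a' where "a' = (\<lambda>j. if j = i then poly Q' else a j)"
  have a': "upoly (a' j)" for j using ab(1) by (auto simp: a'_def upoly_def)
  have ai: "a i e = e * a' i e" for e by (simp add: a'_def Q Q')
  define r where "r e = (\<Prod>j\<in>UNIV. a' j e ^ m j) * au e" for e
  define bb where "bb e = (\<Prod>j\<in>UNIV. b j e ^ m j) * bu e" for e
  have up: "upoly r" "upoly bb"
    unfolding r_def[abs_def] bb_def[abs_def] by (intro upoly_mult upoly_prod upoly_power a' abu ab)+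
  have bb0: "bb 0 \<noteq> 0" using ab(3) abu(3) by (simp add: bb_def)
  have prod_a: "(\<Prod>j\<in>UNIV. a j e ^ m j) = e ^ m i * (\<Prod>j\<in>UNIV. a' j e ^ m j)" for e
  proof -
    have *: "UNIV = insert i (UNIV - {i})" by auto
    have "(\<Prod>j\<in>UNIV. a j e ^ m j) = a i e ^ m i * (\<Prod>j\<in>UNIV - {i}. a j e ^ m j)"
      by (subst *, subst prod.insert) auto
    also have "(\<Prod>j\<in>UNIV - {i}. a j e ^ m j) = (\<Prod>j\<in>UNIV - {i}. a' j e ^ m j)"
      by (intro prod.cong) (auto simp: a'_def)
    also have "a i e ^ m i * \<dots> = e ^ m i * (\<Prod>j\<in>UNIV. a' j e ^ m j)"
      by (subst (2) *, subst prod.insert) (auto simp: ai power_mult_distrib)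
    finally show ?thesis .
  qed
  let ?F = "\<lambda>e. \<Sum>j\<le>d. e ^ j * tay d c j (\<lambda>k. q i $ k) (\<lambda>k. w $ k)"
  have "\<forall>\<^sub>F e in at 0. ?F e * bb e = e ^ m i * r e"
    using arc_eventually[OF arc up(2) bb0] arc_open[OF arc U xi(1)]
  proof eventually_elim
    case (elim e)
    let ?x = "q i + e *s w"
    have x: "?x \<in> lft ?x None" by (simp add: vec.span_base)
    have nz: "b j e \<noteq> 0 \<or> m j = 0" "bu e \<noteq> 0" for j
      using elim by (auto simp: bb_def)
    have "?F e = s (lft ?x, ?x)" using c[OF lft_in x] elim by (simp only: form_line)
    also have "\<dots> = (\<Prod>j\<in>UNIV. t j (lft ?x) ^ m j) * u (lft ?x, ?x)" using fac[of "lft ?x" ?x] x elim by simp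
    finally have "?F e * bb e = (\<Prod>j\<in>UNIV. t j (lft ?x) ^ m j * b j e ^ m j) * (u (lft ?x, ?x) * bu e)"
      by (simp add: bb_def prod.distrib)
    also have "(\<Prod>j\<in>UNIV. t j (lft ?x) ^ m j * b j e ^ m j) = (\<Prod>j\<in>UNIV. a j e ^ m j)"
    proof (intro prod.cong refl)
      fix j show "t j (lft ?x) ^ m j * b j e ^ m j = a j e ^ m j"
        using nz(1)[of j] ab(5)[of e j] elim by (auto simp: power_mult_distrib[symmetric])
    qed
    also have "u (lft ?x, ?x) * bu e = au e" using abu(5) nz(2) elim by blast
    finally show ?case by (simp add: prod_a r_def)
  qed
  then have eq: "?F e * bb e = e ^ m i * r e" for e
    by (intro upoly_eq[of "\<lambda>e. ?F e * bb e" "\<lambda>e. e ^ m i * r e"]) (auto intro!: upoly_mult upoly_sum upoly_power up)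
  show "j < m i \<Longrightarrow> j \<le> d \<Longrightarrow> tay d c j (\<lambda>k. q i $ k) (\<lambda>k. w $ k) = 0"
    by (rule low_coeffs_zero(1)[OF up(2,1) bb0 eq])
  assume "u (\<xi>, q i) = 0"
  then have "r 0 = 0" using abu(4) by (simp add: r_def)
  then show "m i \<le> d \<Longrightarrow> tay d c (m i) (\<lambda>k. q i $ k) (\<lambda>k. w $ k) = 0"
    by (rule low_coeffs_zero(2)[OF up(2,1) bb0 eq])
qed

end

section \<open>Local equations of the exceptional divisors\<close>

context blown_points
begin

lemma local_equation_away:
  assumes "openin (zariski X) U" "U \<inter> exceptional p i = {}"
  shows "local_equation X (exceptional p i) U (\<lambda>_. 1)"
proof -
  have "tuple_eval 0 y = 0" for y :: "'r option \<Rightarrow> complex ^ 'n" by (simp add: tuple_eval_def)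
  have "tpoly (\<lambda>y :: 'r option \<Rightarrow> complex ^ 'n. 1)" by (rule tpoly_const)
  then obtain I where I: "(\<lambda>y :: 'r option \<Rightarrow> complex ^ 'n. 1) = tuple_eval I" by (auto simp: tpoly_def)
  have "locally_fraction X U (\<lambda>\<eta> y. 1)"
    unfolding locally_fraction_def nonvanishing_nv
  proof
    fix \<xi> assume "\<xi> \<in> U"
    then have "\<xi> \<in> X" using openin_zariski_subset[OF assms(1)] by auto
    then have "\<xi> \<in> nv X (tuple_eval I)" unfolding I[symmetric] using nv_one[of X] X_subspaces by blast
    then show "\<exists>A B. \<xi> \<in> nv X (tuple_eval B) \<and> (\<forall>\<eta>\<in>U \<inter> nv X (tuple_eval B). \<forall>y. (\<forall>i. y i \<in> \<eta> i) \<longrightarrow> 1 * tuple_eval B y = tuple_eval A y)"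
      by (intro exI[of _ I] conjI) auto
  qed
  with assms show ?thesis unfolding local_equation_def regular_on_def by auto
qed

text \<open>A polynomial that vanishes after the shift \<open>y \<mapsto> y - (\<tau> / e) v\<close> is, up to powers of \<open>e\<close>,
  divisible by \<open>\<tau>\<close>.\<close>

lemma tpoly_shift:
  fixes P :: "('i \<Rightarrow> complex ^ 'm::finite) \<Rightarrow> complex"
  assumes "tpoly P" "tpoly \<tau>" "tpoly e" "\<And>i k. tpoly (\<lambda>y. V y i $ k)"
  shows "\<exists>K R. tpoly R \<and> (\<forall>y. e y \<noteq> 0 \<longrightarrow>
    e y ^ K * (P y - P (\<lambda>i. y i - (\<tau> y / e y) *s V y i)) = \<tau> y * R y)"
proof -
  define sh where "sh y = (\<lambda>i. y i - (\<tau> y / e y) *s V y i)" for y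
  have "tpoly P \<and> (\<exists>K R. tpoly R \<and> (\<forall>y. e y \<noteq> 0 \<longrightarrow> e y ^ K * (P y - P (sh y)) = \<tau> y * R y))"
    using assms(1)
  proof (induction rule: tpoly_induct)
    case (const c)
    show ?case by (intro conjI tpoly_const exI[of _ 0] exI[of _ "\<lambda>_. 0"]) auto
  next
    case (coord i k)
    show ?case by (intro conjI tpoly_coord exI[of _ 1] exI[of _ "\<lambda>y. V y i $ k"]) (use assms in \<open>auto simp: sh_def\<close>)
  next
    case (add f g)
    then obtain K1 R1 K2 R2 where fg: "tpoly f" "tpoly g"
      and 1: "tpoly R1" "\<And>y. e y \<noteq> 0 \<Longrightarrow> e y ^ K1 * (f y - f (sh y)) = \<tau> y * R1 y"
      and 2: "tpoly R2" "\<And>y. e y \<noteq> 0 \<Longrightarrow> e y ^ K2 * (g y - g (sh y)) = \<tau> y * R2 y" by blast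
    show ?case
    proof (intro conjI exI[of _ "K1 + K2"] exI[of _ "\<lambda>y. e y ^ K2 * R1 y + e y ^ K1 * R2 y"] allI impI)
      show "tpoly (\<lambda>y. f y + g y)" using fg by (rule tpoly_add)
      show "tpoly (\<lambda>y. e y ^ K2 * R1 y + e y ^ K1 * R2 y)"
        by (intro tpoly_add tpoly_mult tpoly_power 1 2 assms)
      fix y assume y: "e y \<noteq> 0"
      have "e y ^ (K1 + K2) * (f y + g y - (f (sh y) + g (sh y))) =
          e y ^ K2 * (e y ^ K1 * (f y - f (sh y))) + e y ^ K1 * (e y ^ K2 * (g y - g (sh y)))"
        by (simp add: power_add algebra_simps)
      also have "\<dots> = \<tau> y * (e y ^ K2 * R1 y + e y ^ K1 * R2 y)"
        unfolding 1(2)[OF y] 2(2)[OF y] by (simp add: algebra_simps)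
      finally show "e y ^ (K1 + K2) * (f y + g y - (f (sh y) + g (sh y))) =
          \<tau> y * (e y ^ K2 * R1 y + e y ^ K1 * R2 y)" .
    qed
  next
    case (mult f g)
    then obtain K1 R1 K2 R2 where fg: "tpoly f" "tpoly g"
      and 1: "tpoly R1" "\<And>y. e y \<noteq> 0 \<Longrightarrow> e y ^ K1 * (f y - f (sh y)) = \<tau> y * R1 y"
      and 2: "tpoly R2" "\<And>y. e y \<noteq> 0 \<Longrightarrow> e y ^ K2 * (g y - g (sh y)) = \<tau> y * R2 y" by blast
    let ?R = "\<lambda>y. e y ^ K1 * f y * R2 y + (e y ^ K2 * g y - \<tau> y * R2 y) * R1 y"
    show ?case
    proof (intro conjI exI[of _ "K1 + K2"] exI[of _ ?R] allI impI)
      show "tpoly (\<lambda>y. f y * g y)" using fg by (rule tpoly_mult)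
      show "tpoly ?R"
        by (intro tpoly_add tpoly_diff tpoly_mult tpoly_power 1 2 fg assms)
      fix y assume y: "e y \<noteq> 0"
      have g': "e y ^ K2 * g (sh y) = e y ^ K2 * g y - \<tau> y * R2 y"
        using 2(2)[OF y] by (simp add: algebra_simps)
      have "e y ^ (K1 + K2) * (f y * g y - f (sh y) * g (sh y)) =
          e y ^ K1 * f y * (e y ^ K2 * (g y - g (sh y))) + (e y ^ K2 * g (sh y)) * (e y ^ K1 * (f y - f (sh y)))"
        by (simp add: power_add algebra_simps)
      also have "\<dots> = \<tau> y * ?R y"
        unfolding 1(2)[OF y] 2(2)[OF y] g' by (simp add: algebra_simps)
      finally show "e y ^ (K1 + K2) * (f y * g y - f (sh y) * g (sh y)) = \<tau> y * ?R y" .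
    qed
  qed
  then show ?thesis unfolding sh_def by blast
qed

lemma X_intro:
  assumes "vec.subspace L" "vec.dim L = 1"
    "\<And>j. vec.subspace (S j) \<and> vec.dim (S j) = 2 \<and> q j \<in> S j \<and> L \<subseteq> S j"
  shows "case_option L S \<in> X"
  using assms unfolding blowup_def proj_space_def p_def by (auto simp: vec.span_minimal dest: vec.span_minimal[THEN subsetD, rotated -1])

lemma dim_p: "vec.dim (p i) = 1"
  unfolding p_def using q_nz[of i] by (simp add: vec.dim_eq_card_independent)

context
  fixes i :: 'r and lam mu :: "complex ^ 'n" and nu :: "'r \<Rightarrow> complex ^ 'n"
  assumes lam: "dotp lam (q i) = 0" and mu: "dotp mu (q i) = 1"
    and nu: "\<And>j. j \<noteq> i \<Longrightarrow> dotp (nu j) (q j) = 0" "\<And>j. j \<noteq> i \<Longrightarrow> dotp (nu j) (q i) = 1"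
begin

text \<open>On the chart \<open>kap \<noteq> 0\<close> the direction of the line through the point \<open>i\<close> is normalised by \<open>lam\<close>,
  while \<open>mu\<close> and \<open>nu\<close> keep the other points away.\<close>

definition kap :: "('r option \<Rightarrow> complex ^ 'n) \<Rightarrow> complex" where
  "kap y = dotp mu (y None) * dotp lam (y (Some i)) * (\<Prod>j\<in>UNIV - {i}. dotp (nu j) (y None))"

definition chart :: "('r option \<Rightarrow> (complex ^ 'n) set) set" where
  "chart = nv X kap"

definition dir :: "('r option \<Rightarrow> (complex ^ 'n) set) \<Rightarrow> complex ^ 'n" where
  "dir \<eta> = (SOME w. w \<in> \<eta> (Some i) \<and> dotp lam w = 1 \<and> dotp mu w = 0)"

text \<open>The ratio of the linear forms \<open>lam\<close> and \<open>mu\<close>, a local equation of the exceptional divisor on the chart.\<close>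

definition height :: "('r option \<Rightarrow> (complex ^ 'n) set) \<Rightarrow> complex" where
  "height \<eta> = (SOME t. \<forall>z\<in>\<eta> None. t * dotp mu z = dotp lam z)"

lemma tpoly_kap: "tpoly kap"
  unfolding kap_def[abs_def] by (intro tpoly_mult tpoly_prod tpoly_dotp)

lemma chart_open: "openin (zariski X) chart"
  unfolding chart_def by (rule openin_nv[OF tpoly_kap])

lemma chart_X: "\<eta> \<in> chart \<Longrightarrow> \<eta> \<in> X"
  by (simp add: chart_def nv_def)

lemma chart_None:
  assumes "\<eta> \<in> chart" "z \<in> \<eta> None" "z \<noteq> 0"
  shows "dotp mu z \<noteq> 0" "j \<noteq> i \<Longrightarrow> dotp (nu j) z \<noteq> 0"
proof -
  obtain y where y: "y \<in> tprod \<eta>" "kap y \<noteq> 0" using assms(1) by (auto simp: chart_def nv_def)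
  have "y None \<in> vec.span {z}" using y(1) X_None[OF chart_X[OF assms(1)] assms(2,3)] by (auto simp: tprod_def)
  then obtain c where "y None = c *s z" by (auto simp: span1)
  with y(2) show "dotp mu z \<noteq> 0" "j \<noteq> i \<Longrightarrow> dotp (nu j) z \<noteq> 0" by (auto simp: kap_def)
qed

lemma chart_None_notin: "\<eta> \<in> chart \<Longrightarrow> z \<in> \<eta> None \<Longrightarrow> z \<noteq> 0 \<Longrightarrow> j \<noteq> i \<Longrightarrow> z \<notin> p j"
  using chart_None(2)[of \<eta> z j] nu(1)[of j] by (auto simp: p_def span1)

lemma dir:
  assumes "\<eta> \<in> chart"
  shows "dir \<eta> \<in> \<eta> (Some i)" "dotp lam (dir \<eta>) = 1" "dotp mu (dir \<eta>) = 0" "dir \<eta> \<notin> p i"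
proof -
  obtain y where y: "y \<in> tprod \<eta>" "kap y \<noteq> 0" using assms by (auto simp: chart_def nv_def)
  let ?m = "y (Some i)"
  have m: "?m \<in> \<eta> (Some i)" "dotp lam ?m \<noteq> 0" using y by (auto simp: tprod_def kap_def)
  note S = X_Some[OF chart_X[OF assms], of i]
  let ?w = "(1 / dotp lam ?m) *s (?m - dotp mu ?m *s q i)"
  have "?w \<in> \<eta> (Some i)" using m(1) S by (intro vec.subspace_scale vec.subspace_diff) auto
  moreover have "dotp lam ?w = 1" "dotp mu ?w = 0" using m(2) by (simp_all add: lam mu)
  ultimately have "dir \<eta> \<in> \<eta> (Some i) \<and> dotp lam (dir \<eta>) = 1 \<and> dotp mu (dir \<eta>) = 0"
    unfolding dir_def by (intro someI[of "\<lambda>w. w \<in> \<eta> (Some i) \<and> dotp lam w = 1 \<and> dotp mu w = 0"]) blast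
  then show "dir \<eta> \<in> \<eta> (Some i)" "dotp lam (dir \<eta>) = 1" "dotp mu (dir \<eta>) = 0" "dir \<eta> \<notin> p i"
    by (auto simp: p_def span1 lam)
qed

lemma chart_Some:
  assumes "\<eta> \<in> chart" "m \<in> \<eta> (Some i)"
  shows "m = dotp mu m *s q i + dotp lam m *s dir \<eta>"
proof -
  have "\<eta> (Some i) = vec.span {q i, dir \<eta>}"
    using subspace_span_pair[of "\<eta> (Some i)" "q i" "dir \<eta>"] X_Some[OF chart_X[OF assms(1)], of i]
      dir[OF assms(1)] q_nz[of i] by (simp add: p_def)
  with assms(2) obtain a b where "m = a *s q i + b *s dir \<eta>" by (auto simp: span2)
  then show ?thesis by (simp add: lam mu dir[OF assms(1)])
qed

lemma height:
  assumes "\<eta> \<in> chart" "z \<in> \<eta> None"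
  shows "height \<eta> * dotp mu z = dotp lam z"
proof -
  obtain x where x: "x \<in> \<eta> None" "x \<noteq> 0" using X_None_nz[OF chart_X[OF assms(1)]] by blast
  have "\<forall>z\<in>\<eta> None. dotp lam x / dotp mu x * dotp mu z = dotp lam z"
    using X_None[OF chart_X[OF assms(1)] x] chart_None(1)[OF assms(1) x] by (auto simp: span1)
  then have "\<forall>z\<in>\<eta> None. height \<eta> * dotp mu z = dotp lam z"
    unfolding height_def by (rule someI)
  with assms(2) show ?thesis by blast
qed

lemma chart_vec:
  assumes "\<eta> \<in> chart" "z \<in> \<eta> None"
  shows "z = dotp mu z *s (q i + height \<eta> *s dir \<eta>)"
  using chart_Some[OF assms(1), of z] X_Some[OF chart_X[OF assms(1)], of i] assms(2) height[OF assms]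
  by (auto simp: vec.scale_right_distrib mult.commute)

lemma height_zero: "\<eta> \<in> chart \<Longrightarrow> height \<eta> = 0 \<longleftrightarrow> \<eta> None = p i"
proof
  assume eta: "\<eta> \<in> chart" "height \<eta> = 0"
  obtain x where x: "x \<in> \<eta> None" "x \<noteq> 0" using X_None_nz[OF chart_X[OF eta(1)]] by blast
  have "x = dotp mu x *s q i" using chart_vec[OF eta(1) x(1)] eta(2) by simp
  then have "x \<in> p i" by (auto simp: p_def span1)
  moreover from x(2) this have "p i = vec.span {x}"
    using vec.subspace_dim_equal[of "vec.span {x}" "p i"] dim_p[of i]
    by (simp add: p_def vec.span_minimal vec.dim_eq_card_independent)
  ultimately show "\<eta> None = p i" using X_None[OF chart_X[OF eta(1)] x] by simp
next
  assume "\<eta> \<in> chart" "\<eta> None = p i"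
  then show "height \<eta> = 0" using height[of \<eta> "q i"] lam mu by (simp add: p_def vec.span_base)
qed

lemma chart_arc: "\<eta> \<in> chart \<Longrightarrow> \<eta> None = p i \<Longrightarrow> arc \<eta> (q i) (dir \<eta>)"
  using dir[of \<eta>] chart_X[of \<eta>] q_nz[of i] by (auto simp: arc_def p_def vec.span_base)

lemma chart_curve:
  assumes "lft (q i + s *s dir \<eta>) \<in> chart" "\<eta> \<in> chart"
  shows "height (lft (q i + s *s dir \<eta>)) = s"
  using height[OF assms(1), of "q i + s *s dir \<eta>"] dir[OF assms(2)] by (simp add: lam mu vec.span_base)

lemma height_regular: "W \<subseteq> chart \<Longrightarrow> openin (zariski X) W \<Longrightarrow> regular_on X W height"
proof -
  assume W: "W \<subseteq> chart" "openin (zariski X) W"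
  obtain A where A: "(\<lambda>y :: 'r option \<Rightarrow> complex ^ 'n. dotp lam (y None)) = tuple_eval A" using tpoly_dotp[of lam None] unfolding tpoly_def by blast
  obtain B where B: "(\<lambda>y :: 'r option \<Rightarrow> complex ^ 'n. dotp mu (y None)) = tuple_eval B" using tpoly_dotp[of mu None] unfolding tpoly_def by blast
  show ?thesis
    unfolding regular_on_def locally_fraction_def nonvanishing_nv
  proof (intro conjI ballI W(2))
    fix \<xi> assume "\<xi> \<in> W"
    then have "\<xi> \<in> chart" using W by auto
    then have "\<xi> \<in> nv X (tuple_eval B)" unfolding B[symmetric] by (auto simp: chart_def nv_def kap_def)
    moreover have "height \<eta> * tuple_eval B y = tuple_eval A y" if "\<eta> \<in> W" "\<forall>i. y i \<in> \<eta> i" for \<eta> y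
      unfolding A[symmetric] B[symmetric] using height[of \<eta> "y None"] that W(1) by blast
    ultimately show "\<exists>A B. \<xi> \<in> nv X (tuple_eval B) \<and> (\<forall>\<eta>\<in>W \<inter> nv X (tuple_eval B). \<forall>y. (\<forall>i. y i \<in> \<eta> i) \<longrightarrow> height \<eta> * tuple_eval B y = tuple_eval A y)"
      by (intro exI[of _ A] exI[of _ B]) blast
  qed
qed

text \<open>The point \<open>y - (\<lambda> / \<kappa>) V\<close> lies over the exceptional divisor.\<close>

definition shiftv :: "('r option \<Rightarrow> complex ^ 'n) \<Rightarrow> 'r option \<Rightarrow> complex ^ 'n" where
  "shiftv y o' = (case o' of
      None \<Rightarrow> (dotp mu (y None) * (\<Prod>l\<in>UNIV - {i}. dotp (nu l) (y None)))
    | Some j \<Rightarrow> if j = i then 0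
        else (dotp (nu j) (y (Some j)) * dotp mu (y None) * (\<Prod>l\<in>UNIV - {i, j}. dotp (nu l) (y None))))
    *s (y (Some i) - dotp mu (y (Some i)) *s q i)"

lemma tpoly_shiftv: "tpoly (\<lambda>y. shiftv y o' $ k)"
proof -
  have n: "tpoly (\<lambda>y. y (Some i) $ k - dotp mu (y (Some i)) * q i $ k)"
    by (intro tpoly_diff tpoly_mult tpoly_coord tpoly_dotp tpoly_const)
  show ?thesis
  proof (cases o')
    case None
    have "tpoly (\<lambda>y. dotp mu (y None) * (\<Prod>l\<in>UNIV - {i}. dotp (nu l) (y None)) * (y (Some i) $ k - dotp mu (y (Some i)) * q i $ k))"
      by (intro tpoly_mult tpoly_prod tpoly_dotp n)
    with None show ?thesis by (simp add: shiftv_def algebra_simps)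
  next
    case (Some j)
    have "tpoly (\<lambda>y. dotp (nu j) (y (Some j)) * dotp mu (y None) * (\<Prod>l\<in>UNIV - {i, j}. dotp (nu l) (y None)) * (y (Some i) $ k - dotp mu (y (Some i)) * q i $ k))"
      by (intro tpoly_mult tpoly_prod tpoly_dotp n)
    with Some show ?thesis by (cases "j = i") (simp_all add: shiftv_def tpoly_const algebra_simps)
  qed
qed

text \<open>Sliding a point of the chart along the line through the blown-up point moves it onto the exceptional divisor. Hence
  a polynomial that vanishes on the divisor satisfies the hypothesis of \<open>tpoly_shift\<close>, with the
  equation of the divisor as \<open>\<tau>\<close>.\<close>

lemma retraction:
  assumes eta: "\<eta> \<in> chart" and y: "y \<in> tprod \<eta>" "kap y \<noteq> 0"
  obtains \<eta>' where "\<eta>' \<in> chart" "\<eta>' None = p i"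
    "(\<lambda>o'. y o' - (dotp lam (y None) / kap y) *s shiftv y o') \<in> tprod \<eta>'"
proof -
  define z where "z = y None"
  define m where "m = y (Some i)"
  define w where "w = dir \<eta>"
  have z: "z \<in> \<eta> None" and m: "m \<in> \<eta> (Some i)" using y(1) by (auto simp: tprod_def z_def m_def)
  have nz: "dotp mu z \<noteq> 0" "dotp lam m \<noteq> 0" "\<And>j. j \<noteq> i \<Longrightarrow> dotp (nu j) z \<noteq> 0"
    using y(2) by (auto simp: kap_def z_def m_def)
  then have z0: "z \<noteq> 0" by auto
  have zi: "z \<in> \<eta> (Some i)" using X_Some[OF chart_X[OF eta], of i] z by auto
  have zw: "z = dotp mu z *s q i + dotp lam z *s w" using chart_Some[OF eta zi] by (simp add: w_def)
  have mw: "m - dotp mu m *s q i = dotp lam m *s w" using chart_Some[OF eta m] by (simp add: w_def algebra_simps)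
  define \<eta>' where "\<eta>' = case_option (p i) (\<lambda>j. if j = i then \<eta> (Some i) else vec.span {q j, q i})"
  have X': "\<eta>' \<in> X"
    unfolding \<eta>'_def
  proof (rule X_intro)
    show "vec.subspace (p i)" by (simp add: p_def)
    show "vec.dim (p i) = 1" by (rule dim_p)
    fix j
    show "vec.subspace (if j = i then \<eta> (Some i) else vec.span {q j, q i}) \<and>
        vec.dim (if j = i then \<eta> (Some i) else vec.span {q j, q i}) = 2 \<and>
        q j \<in> (if j = i then \<eta> (Some i) else vec.span {q j, q i}) \<and>
        p i \<subseteq> (if j = i then \<eta> (Some i) else vec.span {q j, q i})"
    proof (cases "j = i")
      case True
      then show ?thesis using X_Some[OF chart_X[OF eta], of i] by (auto simp: p_def vec.span_minimal dest: vec.span_minimal[THEN subsetD, rotated -1])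
    next
      case False
      then have "vec.dim {q j, q i} = 2" using dim_span_pair[OF q_nz[of j], of "q i"] q_notin[of i j] by (auto simp: p_def)
      with False show ?thesis by (simp add: p_def vec.span_base vec.span_mono)
    qed
  qed
  let ?y = "\<lambda>o'. if o' = None then q i else if o' = Some i then m else 0"
  have "?y o' \<in> \<eta>' o'" for o'
    by (cases o') (auto simp: \<eta>'_def p_def vec.span_base m vec.span_zero)
  then have "?y \<in> tprod \<eta>'" by (simp add: tprod_def)
  moreover have "kap ?y \<noteq> 0" using nz(2) by (simp add: kap_def mu nu)
  ultimately have chart: "\<eta>' \<in> chart" using X' by (auto simp: chart_def nv_def)
  have coef0: "dotp lam z / kap y * (dotp mu z * (\<Prod>l\<in>UNIV - {i}. dotp (nu l) z)) = dotp lam z / dotp lam m"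
  proof -
    have "(\<Prod>l\<in>UNIV - {i}. dotp (nu l) z) \<noteq> 0" using nz(3) by simp
    then show ?thesis using nz by (simp add: kap_def z_def[symmetric] m_def[symmetric] field_simps)
  qed
  have coefj: "dotp lam z / kap y * (g * dotp mu z * (\<Prod>l\<in>UNIV - {i, j}. dotp (nu l) z)) = dotp lam z * g / (dotp lam m * dotp (nu j) z)"
    if j: "j \<noteq> i" for j g
  proof -
    have *: "UNIV - {i} = insert j (UNIV - {i, j})" using j by auto
    have "(\<Prod>l\<in>UNIV - {i}. dotp (nu l) z) = dotp (nu j) z * (\<Prod>l\<in>UNIV - {i, j}. dotp (nu l) z)"
      by (subst *, subst prod.insert) auto
    moreover have "(\<Prod>l\<in>UNIV - {i, j}. dotp (nu l) z) \<noteq> 0" using nz(3) by simp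
    ultimately show ?thesis using nz j by (simp add: kap_def z_def[symmetric] m_def[symmetric] field_simps)
  qed
  have "y o' - (dotp lam z / kap y) *s shiftv y o' \<in> \<eta>' o'" for o'
  proof (cases o')
    case None
    have "shiftv y None = (dotp mu z * (\<Prod>l\<in>UNIV - {i}. dotp (nu l) z)) *s (dotp lam m *s w)"
      unfolding shiftv_def z_def[symmetric] m_def[symmetric] mw by simp
    then have "(dotp lam z / kap y) *s shiftv y None = (dotp lam z / dotp lam m) *s (dotp lam m *s w)"
      by (simp only: vector_smult_assoc[of "dotp lam z / kap y"] coef0)
    also have "\<dots> = dotp lam z *s w" using nz(2) by simp
    finally have "y None - (dotp lam z / kap y) *s shiftv y None = dotp mu z *s q i"
      using zw unfolding z_def[symmetric] by (metis add_diff_cancel_right')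
    with None show ?thesis by (auto simp: \<eta>'_def p_def span1)
  next
    case (Some j)
    show ?thesis
    proof (cases "j = i")
      case True
      with Some m show ?thesis by (simp add: shiftv_def \<eta>'_def m_def)
    next
      case False
      have "y (Some j) \<in> vec.span {q j, z}"
        using y(1) X_plane[OF chart_X[OF eta] z chart_None_notin[OF eta z z0 False]] by (auto simp: tprod_def)
      then obtain b g where bg: "y (Some j) = b *s q j + g *s z" by (auto simp: span2)
      then have nj: "dotp (nu j) (y (Some j)) = g * dotp (nu j) z" using nu(1)[OF False] by simp
      have "shiftv y (Some j) = (g * dotp (nu j) z * dotp mu z * (\<Prod>l\<in>UNIV - {i, j}. dotp (nu l) z)) *s (dotp lam m *s w)"
        unfolding shiftv_def z_def[symmetric] m_def[symmetric] mw using False by (simp add: nj)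
      then have "(dotp lam z / kap y) *s shiftv y (Some j) = (dotp lam z * (g * dotp (nu j) z) / (dotp lam m * dotp (nu j) z)) *s (dotp lam m *s w)"
        by (simp only: vector_smult_assoc[of "dotp lam z / kap y"] coefj[OF False])
      also have "\<dots> = (g * dotp lam z) *s w" using nz(2) nz(3)[OF False] by simp
      finally have "y (Some j) - (dotp lam z / kap y) *s shiftv y (Some j) = b *s q j + g *s (z - dotp lam z *s w)"
        by (simp add: bg algebra_simps)
      also have "z - dotp lam z *s w = dotp mu z *s q i" using zw by (metis add_diff_cancel_right')
      finally have "y (Some j) - (dotp lam z / kap y) *s shiftv y (Some j) = b *s q j + (g * dotp mu z) *s q i" by simp
      then have "y (Some j) - (dotp lam z / kap y) *s shiftv y (Some j) \<in> vec.span {q j, q i}" unfolding span2 by blast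
      with Some False show ?thesis by (simp add: \<eta>'_def)
    qed
  qed
  then have "(\<lambda>o'. y o' - (dotp lam (y None) / kap y) *s shiftv y o') \<in> tprod \<eta>'" by (simp add: tprod_def z_def)
  moreover have "\<eta>' None = p i" by (simp add: \<eta>'_def)
  ultimately show ?thesis using that chart by blast
qed

text \<open>On the divisor itself the quotient by the local equation is defined as a limit along the normal curve.\<close>

definition divided :: "(('r option \<Rightarrow> (complex ^ 'n) set) \<Rightarrow> complex) \<Rightarrow> ('r option \<Rightarrow> (complex ^ 'n) set) \<Rightarrow> complex" where
  "divided g \<eta> = (if \<eta> None \<noteq> p i then g \<eta> / height \<eta>
     else Lim (at 0) (\<lambda>s. g (lft (q i + s *s dir \<eta>)) / s))"

lemma divided_fraction:
  assumes W: "W \<subseteq> chart" "openin (zariski X) W"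
    and g: "locally_fraction X W (\<lambda>\<eta> y. g \<eta>)" "\<And>\<eta>. \<eta> \<in> W \<Longrightarrow> \<eta> None = p i \<Longrightarrow> g \<eta> = 0"
  shows "locally_fraction X W (\<lambda>\<eta> y. divided g \<eta>)"
  unfolding locally_fraction_def
proof
  fix \<xi> assume xi: "\<xi> \<in> W"
  note X_sub = X_subspaces
  from g(1) xi obtain A B where AB: "\<xi> \<in> nv X (tuple_eval B)"
    "\<And>\<eta> y. \<eta> \<in> W \<inter> nv X (tuple_eval B) \<Longrightarrow> y \<in> tprod \<eta> \<Longrightarrow> g \<eta> * tuple_eval B y = tuple_eval A y"
    unfolding locally_fraction_def nonvanishing_nv tprod_def by blast
  obtain C where C: "tpoly C" "\<xi> \<in> nv X C" "nv X C \<subseteq> W"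
    by (rule openin_zariski_nv[OF X_sub W(2) xi])
  define a where "a = tuple_eval A" define b where "b = tuple_eval B"
  have ab: "tpoly a" "tpoly b" by (simp_all add: a_def b_def)
  have AB': "g \<eta> * b y = a y" if "\<eta> \<in> W" "\<eta> \<in> nv X b" "y \<in> tprod \<eta>" for \<eta> y
    using AB(2)[of \<eta> y] that by (simp add: a_def b_def)
  define P where "P y = a y * b y * C y" for y
  define M where "M y = b y * b y * C y" for y
  have P: "tpoly P" and M: "tpoly M"
    unfolding P_def[abs_def] M_def[abs_def] by (intro tpoly_mult ab C)+
  define ret where "ret y = (\<lambda>o'. y o' - (dotp lam (y None) / kap y) *s shiftv y o')" for y
  have "\<exists>K R. tpoly R \<and> (\<forall>y. kap y \<noteq> 0 \<longrightarrow> kap y ^ K * (P y - P (ret y)) = dotp lam (y None) * R y)"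
    unfolding ret_def by (rule tpoly_shift[OF P tpoly_dotp[of lam None] tpoly_kap tpoly_shiftv])
  then obtain K R where R: "tpoly R" "\<And>y. kap y \<noteq> 0 \<Longrightarrow> kap y ^ K * (P y - P (ret y)) = dotp lam (y None) * R y"
    by blast
  have P_zero: "P y = 0" if "\<eta> \<in> chart" "\<eta> None = p i" "y \<in> tprod \<eta>" for \<eta> y
  proof (rule ccontr)
    assume "P y \<noteq> 0"
    then have nz: "a y \<noteq> 0" "b y \<noteq> 0" "C y \<noteq> 0" by (auto simp: P_def)
    with that have "\<eta> \<in> nv X C" "\<eta> \<in> nv X b" using chart_X by (auto simp: nv_def)
    with C(3) AB'[of \<eta> y] g(2)[of \<eta>] that nz show False by auto
  qed
  have PR: "kap y ^ Suc K * P y = dotp lam (y None) * (kap y * R y)" if e: "\<eta> \<in> chart" "y \<in> tprod \<eta>" for \<eta> y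
  proof (cases "kap y = 0")
    case False
    obtain \<eta>' where "\<eta>' \<in> chart" "\<eta>' None = p i" "ret y \<in> tprod \<eta>'"
      unfolding ret_def by (rule retraction[OF e False])
    then have "P (ret y) = 0" by (rule P_zero)
    with R(2)[OF False] have "kap y ^ K * P y = dotp lam (y None) * R y" by simp
    then show ?thesis by (simp add: mult_ac)
  qed simp
  define N where "N y = dotp mu (y None) * (kap y * R y)" for y
  define D where "D y = kap y ^ Suc K * M y" for y
  have N: "tpoly N" and D: "tpoly D"
    unfolding N_def[abs_def] D_def[abs_def] by (intro tpoly_mult tpoly_power tpoly_kap tpoly_dotp R M)+
  have Dnv: "nv X D \<subseteq> nv X b"
    by (auto simp: nv_def D_def M_def)
  have xiD: "\<xi> \<in> nv X D"
  proof -
    have "\<xi> \<in> nv X kap" using xi W(1) by (auto simp: chart_def)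
    moreover have "\<xi> \<in> nv X b" using AB(1) by (simp add: b_def)
    ultimately have "\<xi> \<in> nv X (\<lambda>y. (kap y * b y) * C y)"
      using nv_mult[where f = "\<lambda>y. kap y * b y" and g = C, OF X_sub tpoly_mult[OF tpoly_kap ab(2)] C(1)]
        nv_mult[where f = kap and g = b, OF X_sub tpoly_kap ab(2)] C(2) by simp
    then show ?thesis by (auto simp: nv_def D_def M_def)
  qed
  have off_E: "divided g \<eta> * D y = N y"
    if eta: "\<eta> \<in> W" "\<eta> \<in> nv X b" "\<eta> None \<noteq> p i" and y: "y \<in> tprod \<eta>" for \<eta> y
  proof -
    have ch: "\<eta> \<in> chart" using eta W by auto
    have h0: "height \<eta> \<noteq> 0" using height_zero[OF ch] eta(3) by simp
    have "g \<eta> * M y = P y" unfolding M_def P_def mult.assoc[symmetric] AB'[OF eta(1,2) y] ..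
    then have "g \<eta> * D y = kap y ^ Suc K * P y" by (simp add: D_def mult_ac)
    also have "\<dots> = height \<eta> * N y"
      unfolding PR[OF ch y] N_def using height[OF ch, of "y None"] y by (simp add: tprod_def)
    finally have "divided g \<eta> * D y * height \<eta> = N y * height \<eta>"
      using h0 eta(3) by (simp add: divided_def field_simps)
    with h0 show ?thesis by simp
  qed
  have on_E1: "divided g \<eta> * D y = N y"
    if eta: "\<eta> \<in> W" "\<eta> \<in> nv X b" "\<eta> None = p i" and y: "y \<in> tprod \<eta>" "D y \<noteq> 0" for \<eta> y
  proof -
    have ch: "\<eta> \<in> chart" using eta W by auto
    let ?x = "\<lambda>s. q i + s *s dir \<eta>"
    have arc: "arc \<eta> (q i) (dir \<eta>)" using chart_arc[OF ch eta(3)] .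
    obtain Y c where "y None = c *s q i" and Y: "Y 0 = y" "\<And>i k. upoly (\<lambda>s. Y s i $ k)"
      "\<And>s. off (?x s) \<Longrightarrow> Y s \<in> tprod (lft (?x s))" and "\<And>s. Y s None = c *s ?x s"
      by (rule arc_lift[OF arc y(1)]) (rule that; assumption)
    have up: "upoly (\<lambda>s. N (Y s))" "upoly (\<lambda>s. D (Y s))"
      using upoly_tpoly[OF N, of Y] upoly_tpoly[OF D, of Y] Y(2) by auto
    have "openin (zariski X) (W \<inter> nv X b)" using W(2) ab(2) by (intro openin_Int openin_nv)
    then have "\<forall>\<^sub>F s in at 0. lft (?x s) \<in> W \<inter> nv X b" by (rule arc_open[OF arc]) (use eta in auto)
    moreover have "\<forall>\<^sub>F s in at 0. off (?x s) \<and> D (Y s) \<noteq> 0"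
      by (rule arc_eventually[OF arc up(2)]) (simp add: Y(1) y(2))
    ultimately have ev: "\<forall>\<^sub>F s in at 0. g (lft (?x s)) / s = N (Y s) / D (Y s)"
    proof eventually_elim
      case (elim s)
      then have ch': "lft (?x s) \<in> chart" using W(1) by auto
      have h: "height (lft (?x s)) = s" by (rule chart_curve[OF ch' ch])
      have "lft (?x s) None \<noteq> p i" using elim by (auto simp: off_def vec.span_base dest: equalityD1)
      with off_E[of "lft (?x s)" "Y s"] Y(3)[of s] elim
      have "divided g (lft (?x s)) * D (Y s) = N (Y s)" "divided g (lft (?x s)) = g (lft (?x s)) / s"
        by (auto simp: divided_def h)
      with elim show ?case by (simp add: field_simps)
    qed
    have "((\<lambda>s. N (Y s) / D (Y s)) \<longlongrightarrow> N (Y 0) / D (Y 0)) (at 0)"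
      using y(2) Y(1) by (intro tendsto_divide upoly_tendsto[of "\<lambda>s. N (Y s)"] upoly_tendsto[of "\<lambda>s. D (Y s)"] up) simp
    then have "((\<lambda>s. g (lft (?x s)) / s) \<longlongrightarrow> N y / D y) (at 0)"
      using tendsto_cong[OF ev] by (simp add: Y(1))
    then have "divided g \<eta> = N y / D y"
      using eta(3) by (simp add: divided_def tendsto_Lim)
    with y(2) show ?thesis by simp
  qed
  have main: "divided g \<eta> * D y = N y" if eta: "\<eta> \<in> W" "\<eta> \<in> nv X D" and y: "y \<in> tprod \<eta>" for \<eta> y
  proof (cases "\<eta> None = p i")
    case False
    with off_E[of \<eta> y] Dnv eta y show ?thesis by auto
  next
    case True
    have "\<eta> \<in> X" using eta by (simp add: nv_def)
    obtain z where z: "z \<in> tprod \<eta>" "D z \<noteq> 0" using eta(2) by (auto simp: nv_def)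
    have "divided g \<eta> * D y - N y = 0"
    proof (rule tprod_zero[where f = "\<lambda>y. divided g \<eta> * D y - N y" and g = D, OF X_sub[OF \<open>\<eta> \<in> X\<close>] _ D z _ y])
      show "tpoly (\<lambda>y. divided g \<eta> * D y - N y)" by (intro tpoly_diff tpoly_mult tpoly_const N D)
      fix x assume "x \<in> tprod \<eta>" "D x \<noteq> 0"
      then show "divided g \<eta> * D x - N x = 0" using on_E1[of \<eta> x] True Dnv eta by auto
    qed
    then show ?thesis by simp
  qed
  obtain FN FD where "N = tuple_eval FN" "D = tuple_eval FD" using N D by (auto simp: tpoly_def)
  then show "\<exists>A B. \<xi> \<in> nonvanishing X B \<and> (\<forall>\<eta>\<in>W \<inter> nonvanishing X B. \<forall>y. (\<forall>i. y i \<in> \<eta> i) \<longrightarrow>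
      divided g \<eta> * tuple_eval B y = tuple_eval A y)"
    using xiD main by (intro exI[of _ FN] exI[of _ FD]) (auto simp: nonvanishing_nv tprod_def)
qed

text \<open>Regular functions vanishing on the divisor are divisible by \<open>height\<close> by \<open>divided_fraction\<close>.\<close>

lemma height_local_equation: "local_equation X (exceptional p i) chart height"
  unfolding local_equation_def
proof (intro conjI allI impI ballI)
  show "regular_on X chart height" by (rule height_regular) (simp_all add: chart_open)
  show "height \<eta> = 0" if "\<eta> \<in> chart \<inter> exceptional p i" for \<eta>
    using that height_zero[of \<eta>] by (simp add: exceptional_def)
  fix W g assume *: "W \<subseteq> chart \<and> regular_on X W g \<and> (\<forall>\<eta>\<in>W \<inter> exceptional p i. g \<eta> = 0)"
  then have W: "W \<subseteq> chart" "openin (zariski X) W" "locally_fraction X W (\<lambda>\<eta> y. g \<eta>)"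
    by (auto simp: regular_on_def)
  have zero: "g \<eta> = 0" if "\<eta> \<in> W" "\<eta> None = p i" for \<eta>
    using * that chart_X[of \<eta>] by (auto simp: exceptional_def)
  have "regular_on X W (divided g)"
    unfolding regular_on_def using divided_fraction[OF W zero] W(2) by blast
  moreover have "g \<eta> = height \<eta> * divided g \<eta>" if "\<eta> \<in> W" for \<eta>
  proof (cases "\<eta> None = p i")
    case True
    then show ?thesis using zero[OF that] height_zero[of \<eta>] that W(1) by auto
  next
    case False
    then show ?thesis using height_zero[of \<eta>] that W(1) by (auto simp: divided_def)
  qed
  ultimately show "\<exists>h. regular_on X W h \<and> (\<forall>\<eta>\<in>W. g \<eta> = height \<eta> * h \<eta>)" by blast
qed

text \<open>The quotient of a form by the power of the local equation.\<close>

definition formq :: "nat \<Rightarrow> nat \<Rightarrow> (('n \<Rightarrow> nat) \<Rightarrow> complex) \<Rightarrow> ('r option \<Rightarrow> (complex ^ 'n) set) \<times> (complex ^ 'n) \<Rightarrow> complex" where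
  "formq d m c = (\<lambda>(\<eta>, v). dotp mu v ^ d * (\<Sum>j\<in>{m..d}. height \<eta> ^ (j - m) * tay d c j (\<lambda>k. q i $ k) (\<lambda>k. dir \<eta> $ k)))"

lemma form_formq:
  assumes tay0: "\<And>j w. j < m \<Longrightarrow> j \<le> d \<Longrightarrow> tay d c j (\<lambda>k. q i $ k) w = 0"
    and eta: "\<eta> \<in> chart" "v \<in> \<eta> None"
  shows "form d c (\<lambda>k. v $ k) = height \<eta> ^ m * formq d m c (\<eta>, v)"
proof -
  let ?T = "\<lambda>j. tay d c j (\<lambda>k. q i $ k) (\<lambda>k. dir \<eta> $ k)"
  have "(\<lambda>k. v $ k) = (\<lambda>k. dotp mu v * q i $ k + (dotp mu v * height \<eta>) * dir \<eta> $ k)"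
    by (subst chart_vec[OF eta]) (simp add: fun_eq_iff algebra_simps)
  then have "form d c (\<lambda>k. v $ k) = (\<Sum>j\<le>d. dotp mu v ^ (d - j) * (dotp mu v * height \<eta>) ^ j * ?T j)"
    by (simp only: form_tay)
  also have "\<dots> = (\<Sum>j\<le>d. dotp mu v ^ d * (height \<eta> ^ j * ?T j))"
  proof (intro sum.cong refl)
    fix j assume "j \<in> {..d}"
    then have "dotp mu v ^ (d - j) * dotp mu v ^ j = dotp mu v ^ d" by (simp flip: power_add)
    then show "dotp mu v ^ (d - j) * (dotp mu v * height \<eta>) ^ j * ?T j = dotp mu v ^ d * (height \<eta> ^ j * ?T j)"
      by (simp add: power_mult_distrib mult.assoc[symmetric])
  qed
  also have "\<dots> = (\<Sum>j\<in>{m..d}. dotp mu v ^ d * (height \<eta> ^ j * ?T j))"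
    by (rule sum.mono_neutral_right) (use tay0 in auto)
  also have "\<dots> = height \<eta> ^ m * formq d m c (\<eta>, v)"
    unfolding formq_def prod.case sum_distrib_left
  proof (intro sum.cong refl)
    fix j assume "j \<in> {m..d}"
    then have "height \<eta> ^ m * height \<eta> ^ (j - m) = height \<eta> ^ j" by (simp flip: power_add)
    then show "dotp mu v ^ d * (height \<eta> ^ j * ?T j) = height \<eta> ^ m * (dotp mu v ^ d * (height \<eta> ^ (j - m) * ?T j))"
      by (simp add: mult_ac) 
  qed
  finally show ?thesis .
qed

lemma formq_regular: "regular_form X chart d (formq d m c)"
  unfolding regular_form_def
proof (intro conjI ballI allI chart_open)
  show "formq d m c (\<eta>, e *s v) = e ^ d * formq d m c (\<eta>, v)" for \<eta> v e
    by (simp add: formq_def power_mult_distrib mult_ac)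
  define n where "n y = y (Some i) - dotp mu (y (Some i)) *s q i" for y :: "'r option \<Rightarrow> complex ^ 'n"
  have n: "tpoly (\<lambda>y. n y $ k)" for k
  proof -
    have "tpoly (\<lambda>y. y (Some i) $ k - dotp mu (y (Some i)) * q i $ k)"
      by (intro tpoly_diff tpoly_mult tpoly_coord tpoly_dotp tpoly_const)
    then show ?thesis by (simp add: n_def)
  qed
  define N where "N y = (\<Sum>j\<in>{m..d}. dotp mu (y None) ^ d * (dotp mu (y None) ^ (d - (j - m)) * dotp lam (y None) ^ (j - m)) *
      (dotp lam (y (Some i)) ^ (d - j) * tay d c j (\<lambda>k. q i $ k) (\<lambda>k. n y $ k)))" for y
  define D where "D y = dotp mu (y None) ^ d * dotp lam (y (Some i)) ^ d" for y :: "'r option \<Rightarrow> complex ^ 'n"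
  have N: "tpoly N" unfolding N_def[abs_def] tay_def
    by (intro tpoly_sum tpoly_mult tpoly_power tpoly_dotp tpoly_form n)
  have D: "tpoly D" unfolding D_def[abs_def] by (intro tpoly_mult tpoly_power tpoly_dotp)
  have main: "formq d m c (\<eta>, y None) * D y = N y" if eta: "\<eta> \<in> chart" and y: "y \<in> tprod \<eta>" for \<eta> y
  proof -
    have y': "y None \<in> \<eta> None" "y (Some i) \<in> \<eta> (Some i)" using y by (auto simp: tprod_def)
    have n: "n y = dotp lam (y (Some i)) *s dir \<eta>" using chart_Some[OF eta y'(2)] by (simp add: n_def algebra_simps)
    show ?thesis
      unfolding formq_def D_def N_def prod.case sum_distrib_left sum_distrib_right
    proof (intro sum.cong refl)
      fix j assume j: "j \<in> {m..d}"
      let ?mu = "dotp mu (y None)" let ?l = "dotp lam (y (Some i))" let ?T = "tay d c j (\<lambda>k. q i $ k) (\<lambda>k. dir \<eta> $ k)"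
      have 1: "tay d c j (\<lambda>k. q i $ k) (\<lambda>k. n y $ k) = ?l ^ j * ?T"
      proof -
        have "(\<lambda>k. n y $ k) = (\<lambda>k. ?l * dir \<eta> $ k)" by (simp add: n)
        then show ?thesis unfolding tay_def by (simp only: form_scale)
      qed
      have 2: "?l ^ (d - j) * ?l ^ j = ?l ^ d" using j by (simp flip: power_add)
      have 3: "?mu ^ (d - (j - m)) * dotp lam (y None) ^ (j - m) = ?mu ^ d * height \<eta> ^ (j - m)"
      proof -
        have "?mu ^ (d - (j - m)) * ?mu ^ (j - m) = ?mu ^ d" using j by (simp flip: power_add)
        moreover have "dotp lam (y None) = height \<eta> * ?mu" using height[OF eta y'(1)] by simp
        ultimately show ?thesis by (simp add: power_mult_distrib mult_ac)
      qed
      have eq: "?mu ^ d * (?mu ^ (d - (j - m)) * dotp lam (y None) ^ (j - m)) * (?l ^ (d - j) * tay d c j (\<lambda>k. q i $ k) (\<lambda>k. n y $ k)) =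
          ?mu ^ d * (?mu ^ d * height \<eta> ^ (j - m)) * (?l ^ d * ?T)"
        unfolding 1 3 mult.assoc[of "?l ^ (d - j)" "?l ^ j" ?T, symmetric] 2 ..
      show "?mu ^ d * (height \<eta> ^ (j - m) * ?T) * (?mu ^ d * ?l ^ d) =
         ?mu ^ d * (?mu ^ (d - (j - m)) * dotp lam (y None) ^ (j - m)) * (?l ^ (d - j) * tay d c j (\<lambda>k. q i $ k) (\<lambda>k. n y $ k))"
        unfolding eq by (simp only: mult_ac)
    qed
  qed
  obtain FN FD where F: "N = tuple_eval FN" "D = tuple_eval FD" using N D by (auto simp: tpoly_def)
  show "locally_fraction X chart (\<lambda>\<eta> y. formq d m c (\<eta>, y None))"
    unfolding locally_fraction_def nonvanishing_nv
  proof
    fix \<xi> assume "\<xi> \<in> chart"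
    then have "\<xi> \<in> nv X D" by (auto simp: chart_def nv_def kap_def D_def)
    with F main show "\<exists>A B. \<xi> \<in> nv X (tuple_eval B) \<and> (\<forall>\<eta>\<in>chart \<inter> nv X (tuple_eval B). \<forall>y. (\<forall>i. y i \<in> \<eta> i) \<longrightarrow>
        formq d m c (\<eta>, y None) * tuple_eval B y = tuple_eval A y)"
      by (intro exI[of _ FN] exI[of _ FD]) (auto simp: tprod_def)
  qed
qed

end

definition form_section :: "nat \<Rightarrow> (('n \<Rightarrow> nat) \<Rightarrow> complex) \<Rightarrow> ('r option \<Rightarrow> (complex ^ 'n) set) \<times> (complex ^ 'n) \<Rightarrow> complex" where
  "form_section d c = (\<lambda>(\<eta>, v). if \<eta> \<in> X \<and> v \<in> \<eta> None then form d c (\<lambda>k. v $ k) else 0)"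

lemma form_section_regular:
  assumes "openin (zariski X) U"
  shows "regular_form X U d (form_section d c)"
  unfolding regular_form_def
proof (intro conjI ballI allI assms)
  fix \<eta> v e assume "\<eta> \<in> U" "v \<in> \<eta> None"
  then have *: "\<eta> \<in> X" "v \<in> \<eta> None" "e *s v \<in> \<eta> None"
    using openin_zariski_subset[OF assms] X_subspaces[of \<eta>] by (auto simp: subspaces_def vec.subspace_scale)
  have "(\<lambda>k. (e *s v) $ k) = (\<lambda>k. e * v $ k)" by simp
  then have "form d c (\<lambda>k. (e *s v) $ k) = e ^ d * form d c (\<lambda>k. v $ k)" by (simp only: form_scale)
  with * show "form_section d c (\<eta>, e *s v) = e ^ d * form_section d c (\<eta>, v)"
    by (simp add: form_section_def del: vector_smult_component)
next
  have "tpoly (\<lambda>y :: 'r option \<Rightarrow> complex ^ 'n. form d c (\<lambda>k. y None $ k))" by (intro tpoly_form tpoly_coord)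
  then obtain A where A: "(\<lambda>y :: 'r option \<Rightarrow> complex ^ 'n. form d c (\<lambda>k. y None $ k)) = tuple_eval A" unfolding tpoly_def by blast
  have "tpoly (\<lambda>y :: 'r option \<Rightarrow> complex ^ 'n. 1)" by (rule tpoly_const)
  then obtain B where B: "(\<lambda>y :: 'r option \<Rightarrow> complex ^ 'n. 1) = tuple_eval B" by (auto simp: tpoly_def)
  show "locally_fraction X U (\<lambda>\<eta> y. form_section d c (\<eta>, y None))"
    unfolding locally_fraction_def nonvanishing_nv
  proof
    fix \<xi> assume "\<xi> \<in> U"
    then have "\<xi> \<in> X" using openin_zariski_subset[OF assms] by auto
    then have "\<xi> \<in> nv X (tuple_eval B)" unfolding B[symmetric] using nv_one[of X] X_subspaces by blast
    then show "\<exists>A B. \<xi> \<in> nv X (tuple_eval B) \<and> (\<forall>\<eta>\<in>U \<inter> nv X (tuple_eval B). \<forall>y. (\<forall>i. y i \<in> \<eta> i) \<longrightarrow>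
        form_section d c (\<eta>, y None) * tuple_eval B y = tuple_eval A y)"
      by (intro exI[of _ A] exI[of _ B]) (auto simp: A[symmetric] B[symmetric] form_section_def nv_def)
  qed
qed

text \<open>Near a point of the exceptional divisor \<open>i\<close> the required quotient is \<open>formq\<close>, and away from these
  divisors, where all local equations are 1, it is the form itself.\<close>

theorem form_section_in_sections:
  assumes tay0: "\<And>i j w. j < m i \<Longrightarrow> j \<le> d \<Longrightarrow> tay d c j (\<lambda>k. q i $ k) w = 0"
  shows "form_section d c \<in> sections p (d, m)"
proof -
  have "\<exists>U u. \<xi> \<in> U \<and> local_quotient p (d, m) (form_section d c) U u" if xi: "\<xi> \<in> X" for \<xi>
  proof -
    obtain x where x: "x \<in> \<xi> None" "x \<noteq> 0" using X_None_nz[OF xi] by blast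
    show ?thesis
    proof (cases "off x")
      case True
      have "\<exists>a. dotp a (q j) = 0 \<and> dotp a x = 1" for j
        using separating_form[OF q_nz[of j], of x] True by (metis off_def p_def)
      then obtain \<nu> where nu: "\<And>j. dotp (\<nu> j) (q j) = 0" "\<And>j. dotp (\<nu> j) x = 1" by metis
      define k where "k = (\<lambda>y :: 'r option \<Rightarrow> complex ^ 'n. \<Prod>j\<in>UNIV. dotp (\<nu> j) (y None))"
      have k: "tpoly k" unfolding k_def by (intro tpoly_prod tpoly_dotp)
      define U where "U = nv X k"
      have U: "openin (zariski X) U" unfolding U_def by (rule openin_nv[OF k])
      have xU: "\<xi> \<in> U"
      proof -
        let ?y = "\<lambda>o'. if o' = None then x else 0"
        have "?y \<in> tprod \<xi>" using x X_subspaces[OF xi] by (auto simp: tprod_def subspaces_def vec.subspace_0)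
        moreover have "k ?y \<noteq> 0" by (simp add: k_def nu)
        ultimately show ?thesis using xi by (auto simp: U_def nv_def)
      qed
      have disj: "U \<inter> exceptional p j = {}" for j
      proof (rule ccontr)
        assume "U \<inter> exceptional p j \<noteq> {}"
        then obtain \<eta> y where "\<eta> None = p j" "y \<in> tprod \<eta>" "k y \<noteq> 0" by (auto simp: U_def nv_def exceptional_def)
        then have "y None \<in> p j" "dotp (\<nu> j) (y None) \<noteq> 0" by (auto simp: tprod_def k_def)
        then show False using nu(1)[of j] by (auto simp: p_def span1)
      qed
      have "local_quotient p (d, m) (form_section d c) U (form_section d c)"
        unfolding local_quotient_def fst_conv snd_conv
        by (intro conjI exI[of _ "\<lambda>_ _. 1"] allI form_section_regular[OF U] local_equation_away[OF U disj]) simp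
      with xU show ?thesis by blast
    next
      case False
      then obtain i where i: "x \<in> p i" by (auto simp: off_def)
      obtain w where w: "w \<in> \<xi> (Some i)" "w \<notin> p i"
      proof -
        obtain w where "arc \<xi> x w" by (rule arc_exists[OF xi x])
        with False obtain j where "x \<in> p j" "w \<in> \<xi> (Some j)" "w \<notin> p j" by (auto simp: arc_def)
        moreover from this have "j = i" using p_disj[OF _ i x(2)] by blast
        ultimately show ?thesis using that by blast
      qed
      have w': "w \<notin> vec.span {q i}" using w(2) by (simp add: p_def)
      then have w0: "w \<noteq> 0" by (auto simp: vec.span_zero)
      obtain lam where lam: "dotp lam (q i) = 0" "dotp lam w = 1" by (rule separating_form[OF q_nz[of i] w'])
      obtain mu where mu: "dotp mu w = 0" "dotp mu (q i) = 1"
        by (rule separating_form[OF w0 in_span1_sym[OF w' q_nz[of i]]])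
      have "\<exists>a. j \<noteq> i \<longrightarrow> dotp a (q j) = 0 \<and> dotp a (q i) = 1" for j
        using separating_form[OF q_nz[of j], of "q i"] q_notin[of i j] by (metis p_def)
      then obtain \<nu> where nu: "\<And>j. j \<noteq> i \<Longrightarrow> dotp (\<nu> j) (q j) = 0" "\<And>j. j \<noteq> i \<Longrightarrow> dotp (\<nu> j) (q i) = 1" by metis
      note ch = lam(1) mu(2) nu
      let ?U = "chart i lam mu \<nu>"
      have None: "\<xi> None = p i"
        using X_None[OF xi x] i x(2) vec.subspace_dim_equal[of "vec.span {x}" "p i"] dim_p[of i]
        by (simp add: p_def vec.span_minimal vec.dim_eq_card_independent)
      have xU: "\<xi> \<in> ?U"
      proof -
        let ?y = "\<lambda>o'. if o' = None then q i else if o' = Some i then w else 0"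
        have "?y \<in> tprod \<xi>"
          using w(1) None X_subspaces[OF xi] by (auto simp: tprod_def subspaces_def vec.subspace_0 p_def vec.span_base)
        moreover have "kap i lam mu \<nu> ?y \<noteq> 0" using lam mu nu by (simp add: kap_def[OF ch])
        ultimately show ?thesis using xi by (auto simp: chart_def[OF ch] nv_def)
      qed
      have disj: "?U \<inter> exceptional p j = {}" if "j \<noteq> i" for j
      proof (rule ccontr)
        assume "?U \<inter> exceptional p j \<noteq> {}"
        then obtain \<eta> where eta: "\<eta> \<in> ?U" "\<eta> None = p j" by (auto simp: exceptional_def)
        have "q j \<in> \<eta> None" using eta(2) by (simp add: p_def vec.span_base)
        from chart_None_notin[OF ch eta(1) this q_nz[of j] that] show False by (simp add: p_def vec.span_base)
      qed
      let ?h = "height lam mu"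
      let ?t = "\<lambda>j. if j = i then ?h else (\<lambda>_. 1)"
      have "local_quotient p (d, m) (form_section d c) ?U (formq i lam mu d (m i) c)"
        unfolding local_quotient_def fst_conv snd_conv
      proof (intro conjI exI[of _ ?t] allI ballI formq_regular[OF ch])
        show "local_equation X (exceptional p j) ?U (?t j)" for j
        proof (cases "j = i")
          case True
          then show ?thesis using height_local_equation[OF ch] by simp
        next
          case False
          then show ?thesis using local_equation_away[OF chart_open[OF ch] disj[OF False]] by simp
        qed
        fix \<eta> v assume eta: "\<eta> \<in> ?U" "v \<in> \<eta> None"
        have "(\<Prod>j\<in>UNIV. ?t j \<eta> ^ m j) = ?h \<eta> ^ m i"
        proof -
          have *: "UNIV = insert i (UNIV - {i})" by auto
          show ?thesis by (subst *, subst prod.insert) auto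
        qed
        then show "form_section d c (\<eta>, v) = (\<Prod>j\<in>UNIV. ?t j \<eta> ^ m j) * formq i lam mu d (m i) c (\<eta>, v)"
          using form_formq[OF ch tay0 eta] chart_X[OF ch eta(1)] eta(2) by (simp add: form_section_def)
      qed
      with xU show ?thesis by blast
    qed
  qed
  then show ?thesis
    unfolding sections_def using form_section_regular[OF openin_zariski_space[OF X_subspaces]]
    by (auto simp: form_section_def)
qed

end

section \<open>Linear systems and their base loci in terms of forms\<close>

lemma vanishing_form:
  fixes S :: "(complex ^ 'n::finite) set"
  assumes "vec.subspace S" "v \<notin> S"
  obtains a where "\<And>x. x \<in> S \<Longrightarrow> dotp a x = 0" "dotp a v \<noteq> 0"
proof -
  obtain B where B: "B \<subseteq> S" "vec.independent B" "S \<subseteq> vec.span B" by (rule vec.basis_exists[of S])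
  have "vec.span B \<subseteq> S" using B(1) assms(1) by (rule vec.span_minimal)
  with assms(2) B(2) have ind: "vec.independent (insert v B)" by (auto simp: vec.independent_insert)
  obtain k :: 'n where True by simp
  obtain g where g: "Vector_Spaces.linear (\<lambda>c x. c *s x) (\<lambda>c x. c *s x) g"
    "\<And>x. x \<in> insert v B \<Longrightarrow> g x = (if x = v then axis k 1 else 0 :: complex ^ 'n)"
    using vec.linear_independent_extend[OF ind, of "\<lambda>x. if x = v then axis k 1 else 0"] by blast
  have dot: "dotp (matrix g $ k) x = g x $ k" for x
    using matrix_works[OF g(1), of x] by (simp add: dotp_def matrix_vector_mult_def vec_eq_iff)
  show ?thesis
  proof (rule that[of "matrix g $ k"])
    show "dotp (matrix g $ k) v \<noteq> 0" using g(2)[of v] by (simp add: dot axis_def)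
    fix x assume "x \<in> S"
    with B(3) have "x \<in> vec.span B" by auto
    then have "dotp (matrix g $ k) x = 0"
    proof (induction rule: vec.span_induct_alt)
      case (step c x y)
      have "x \<noteq> v" using step(1) B(1) assms(2) by auto
      then have "dotp (matrix g $ k) x = 0" using g(2)[of x] step(1) by (simp add: dot)
      with step show ?case by simp
    qed simp
    then show "dotp (matrix g $ k) x = 0" .
  qed
qed

text \<open>In a finite space with closed points, irreducible closed sets are single points.\<close>

lemma krull_dim_discrete:
  assumes "finite (topspace T)" "\<And>x. x \<in> topspace T \<Longrightarrow> closedin T {x}"
  shows "krull_dim T \<le> 0"
proof -
  have single: "\<exists>x. Z = {x}" if Z: "irreducible_closedin T Z" for Z
  proof -
    from Z obtain a where a: "a \<in> Z" by (auto simp: irreducible_closedin_def)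
    have sub: "Z \<subseteq> topspace T" using Z closedin_subset by (auto simp: irreducible_closedin_def)
    have "closedin T (\<Union>x\<in>Z - {a}. {x})"
      using assms finite_subset[OF sub assms(1)] sub by (intro closedin_Union) auto
    then have c: "closedin T (Z - {a})" by simp
    have "closedin T {a}" using a sub assms(2) by auto
    moreover have "Z = {a} \<union> (Z - {a})" using a by auto
    ultimately have "Z = {a} \<or> Z = Z - {a}" using Z c unfolding irreducible_closedin_def by blast
    with a show ?thesis by blast
  qed
  show ?thesis
    unfolding krull_dim_def
  proof (rule Sup_least)
    fix e assume "e \<in> {ereal (real n) | n. \<exists>Z :: nat \<Rightarrow> 'a set.
     (\<forall>i\<le>n. irreducible_closedin T (Z i)) \<and> (\<forall>i<n. Z i \<subset> Z (Suc i))}"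
    then obtain n and Z :: "nat \<Rightarrow> 'a set" where e: "e = ereal (real n)"
      and Z: "\<And>i. i \<le> n \<Longrightarrow> irreducible_closedin T (Z i)" "\<And>i. i < n \<Longrightarrow> Z i \<subset> Z (Suc i)" by blast
    have "n = 0"
    proof (rule ccontr)
      assume "n \<noteq> 0"
      then obtain x y where "Z 0 = {x}" "Z 1 = {y}" using single[OF Z(1)[of 0]] single[OF Z(1)[of 1]] by auto
      with Z(2)[of 0] \<open>n \<noteq> 0\<close> show False by auto
    qed
    with e show "e \<le> 0" by simp
  qed
qed

lemma sum_apply: "(\<Sum>b\<in>B. f b) x = (\<Sum>b\<in>B. f b x)" for f :: "'b \<Rightarrow> 'x \<Rightarrow> complex"
  by (induction B rule: infinite_finite_induct) simp_all

context blown_points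
begin

lemma zariski_topspace: "topspace (zariski X) = X"
  using openin_zariski_subset[OF openin_topspace] openin_subset[OF openin_zariski_space[OF X_subspaces]] by blast

lemma closedin_point:
  assumes "\<xi> \<in> X"
  shows "closedin (zariski X) {\<xi>}"
proof -
  have ex: "\<exists>U. openin (zariski X) U \<and> \<eta> \<in> U \<and> \<xi> \<notin> U" if eta: "\<eta> \<in> X" "\<eta> \<noteq> \<xi>" for \<eta>
  proof -
    obtain o' where o': "\<eta> o' \<noteq> \<xi> o'" using eta(2) by (auto simp: fun_eq_iff)
    have sub: "vec.subspace (\<eta> o')" "vec.subspace (\<xi> o')" using X_subspaces eta(1) assms by (auto simp: subspaces_def)
    have "vec.dim (\<eta> o') = vec.dim (\<xi> o')"
      using eta(1) assms by (cases o') (auto simp: blowup_def proj_space_def)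
    then have "\<not> \<eta> o' \<subseteq> \<xi> o'" using vec.subspace_dim_equal[OF sub] o' by auto
    then obtain v where v: "v \<in> \<eta> o'" "v \<notin> \<xi> o'" by auto
    obtain a where a: "\<And>x. x \<in> \<xi> o' \<Longrightarrow> dotp a x = 0" "dotp a v \<noteq> 0" by (rule vanishing_form[OF sub(2) v(2)]) (rule that; assumption)
    let ?f = "\<lambda>y :: 'r option \<Rightarrow> complex ^ 'n. dotp a (y o')"
    let ?y = "\<lambda>l. if l = o' then v else 0"
    have "?y \<in> tprod \<eta>" using v(1) X_subspaces[OF eta(1)] by (auto simp: tprod_def subspaces_def vec.subspace_0)
    moreover have "?f ?y \<noteq> 0" using a(2) by simp
    ultimately have "\<eta> \<in> nv X ?f" using eta(1) unfolding nv_def by (intro CollectI conjI bexI[of _ ?y])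
    moreover have "\<xi> \<notin> nv X ?f" using a(1) by (auto simp: nv_def tprod_def)
    ultimately show ?thesis using openin_nv[OF tpoly_dotp[of a o'], of X] by (intro exI[of _ "nv X ?f"] conjI)
  qed
  then have "\<exists>U. openin (zariski X) U \<and> \<eta> \<in> U \<and> U \<subseteq> X - {\<xi>}" if e: "\<eta> \<in> X - {\<xi>}" for \<eta>
  proof -
    from e have "\<eta> \<in> X" "\<eta> \<noteq> \<xi>" by auto
    from ex[OF this] obtain U where U: "openin (zariski X) U" "\<eta> \<in> U" "\<xi> \<notin> U" by blast
    from openin_zariski_subset[OF U(1)] U(3) have "U \<subseteq> X - {\<xi>}" by blast
    with U show ?thesis by (intro exI[of _ U] conjI)
  qed
  then have "\<forall>\<eta>\<in>X - {\<xi>}. \<exists>U. openin (zariski X) U \<and> \<eta> \<in> U \<and> U \<subseteq> X - {\<xi>}" by (rule ballI)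
  then have "openin (zariski X) (X - {\<xi>})" by (simp only: openin_subopen[of "zariski X" "X - {\<xi>}"])
  with assms show ?thesis by (simp add: closedin_def zariski_topspace)
qed

lemma krull_dim_finite:
  assumes "finite S" "S \<subseteq> X"
  shows "krull_dim (subtopology (zariski X) S) \<le> 0"
proof (rule krull_dim_discrete)
  have top: "topspace (subtopology (zariski X) S) = S" using assms(2) by (auto simp: zariski_topspace)
  then show "finite (topspace (subtopology (zariski X) S))" using assms(1) by simp
  fix x assume "x \<in> topspace (subtopology (zariski X) S)"
  with top have "x \<in> S" by simp
  with closedin_point[of x] assms(2) show "closedin (subtopology (zariski X) S) {x}"
    by (auto simp: closedin_subtopology intro!: exI[of _ "{x}"])
qed

definition forms_with_mult :: "nat \<Rightarrow> ('r \<Rightarrow> nat) \<Rightarrow> (('n \<Rightarrow> nat) \<Rightarrow> complex) set" where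
  "forms_with_mult d m = {c. \<forall>i j w. j < m i \<longrightarrow> j \<le> d \<longrightarrow> tay d c j (\<lambda>k. q i $ k) w = 0}"

text \<open>A section is a form by \<open>section_form\<close>. Its Taylor coefficients vanish in all directions that occur as
  tangent directions, that is outside the line of the point, and by continuity in all directions.\<close>

lemma sections_forms:
  assumes n: "CARD('n) \<ge> 4" and s: "s \<in> sections p (d, m)"
  shows "\<exists>c\<in>forms_with_mult d m. s = form_section d c"
proof -
  have reg: "regular_form X X d s"
    and zero: "\<And>\<eta> v. \<not> (\<eta> \<in> X \<and> v \<in> \<eta> None) \<Longrightarrow> s (\<eta>, v) = 0"
    and loc: "\<And>\<xi>. \<xi> \<in> X \<Longrightarrow> \<exists>U u. \<xi> \<in> U \<and> local_quotient p (d, m) s U u"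
    using s by (auto simp: sections_def)
  obtain c where c: "\<And>\<xi> v. \<xi> \<in> X \<Longrightarrow> v \<in> \<xi> None \<Longrightarrow> s (\<xi>, v) = form d c (\<lambda>k. v $ k)"
    using section_form[OF reg n] by blast
  have "s = form_section d c"
    using c zero by (auto simp: form_section_def fun_eq_iff)
  moreover have "tay d c j (\<lambda>k. q i $ k) w = 0" if j: "j < m i" "j \<le> d" for i j w
  proof -
    have off: "tay d c j (\<lambda>k. q i $ k) (\<lambda>k. w $ k) = 0" if w: "w \<notin> p i" for w
    proof -
      let ?x = "case_option (p i) (\<lambda>l. if l = i then vec.span {q i, w} else vec.span {q l, q i})"
      have w': "w \<notin> vec.span {q i}" using w by (simp add: p_def)
      have x: "?x \<in> X"
      proof (rule X_intro)
        show "vec.subspace (p i)" by (simp add: p_def)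
        show "vec.dim (p i) = 1" by (rule dim_p)
        fix l
        show "vec.subspace (if l = i then vec.span {q i, w} else vec.span {q l, q i}) \<and>
          vec.dim (if l = i then vec.span {q i, w} else vec.span {q l, q i}) = 2 \<and>
          q l \<in> (if l = i then vec.span {q i, w} else vec.span {q l, q i}) \<and>
          p i \<subseteq> (if l = i then vec.span {q i, w} else vec.span {q l, q i})"
        proof (cases "l = i")
          case True
          then show ?thesis using dim_span_pair[OF q_nz[of i] w'] by (simp add: p_def vec.span_base vec.span_mono)
        next
          case False
          then have "vec.dim {q l, q i} = 2" using dim_span_pair[OF q_nz[of l], of "q i"] q_notin[of i l] by (auto simp: p_def)
          with False show ?thesis by (simp add: p_def vec.span_base vec.span_mono)
        qed
      qed
      then obtain U u where U: "?x \<in> U" "local_quotient p (d, m) s U u" using loc by blast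
      have "?x \<in> exceptional p i" using x by (simp add: exceptional_def)
      from local_quotient_order(1)[OF U(2,1) this _ w c j] show ?thesis by (simp add: vec.span_base)
    qed
    obtain w1 where w1: "w1 \<notin> p i"
    proof -
      have "vec.dim (p i) < vec.dim (UNIV :: (complex ^ 'n) set)"
        using n by (simp only: dim_p vec_dim_card)
      then have "p i \<noteq> UNIV" by auto
      then show ?thesis using that by blast
    qed
    define v where "v = (\<chi> k. w k)"
    show ?thesis
    proof (cases "v \<in> p i")
      case False
      from off[OF this] show ?thesis by (simp add: v_def)
    next
      case True
      have notin: "v + t *s w1 \<notin> p i" if "t \<noteq> 0" for t
      proof
        assume "v + t *s w1 \<in> p i"
        with True have "inverse t *s ((v + t *s w1) - v) \<in> p i"
          unfolding p_def by (intro vec.span_scale vec.span_diff)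
        with that w1 show False by (simp add: vector_smult_assoc)
      qed
      have "upoly (\<lambda>t. tay d c j (\<lambda>k. q i $ k) (\<lambda>k. (v + t *s w1) $ k))"
        unfolding tay_def by (rule upoly_form) (simp, intro upoly_add upoly_mult upoly_const upoly_id)
      moreover have "\<forall>\<^sub>F t in at 0. tay d c j (\<lambda>k. q i $ k) (\<lambda>k. (v + t *s w1) $ k) = 0"
        using off[OF notin] by (simp add: eventually_at_filter)
      ultimately have "tay d c j (\<lambda>k. q i $ k) (\<lambda>k. (v + 0 *s w1) $ k) = 0"
        by (rule upoly_zero)
      then show ?thesis by (simp add: v_def)
    qed
  qed
  ultimately show ?thesis by (auto simp: forms_with_mult_def)
qed

lemma h0_le:
  assumes n: "CARD('n) \<ge> 4" and B: "finite B"
    and span: "\<And>c. c \<in> forms_with_mult d m \<Longrightarrow> \<exists>t. \<forall>a\<in>exps d. c a = (\<Sum>b\<in>B. t b * k b a)"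
  shows "h0 p (d, m) \<le> card B"
proof -
  have "sections p (d, m) \<subseteq> cfun.span ((\<lambda>b. form_section d (k b)) ` B)"
  proof
    fix s assume "s \<in> sections p (d, m)"
    from sections_forms[OF n this] obtain c where c: "c \<in> forms_with_mult d m" "s = form_section d c" by blast
    from span[OF c(1)] obtain t where t: "\<And>a. a \<in> exps d \<Longrightarrow> c a = (\<Sum>b\<in>B. t b * k b a)" by blast
    have "form d c x = (\<Sum>b\<in>B. t b * form d (k b) x)" for x
    proof -
      have "form d c x = (\<Sum>a\<in>exps d. \<Sum>b\<in>B. t b * (k b a * xpow a x))"
        unfolding form_def by (intro sum.cong refl) (simp add: t sum_distrib_right mult.assoc)
      also have "\<dots> = (\<Sum>b\<in>B. t b * form d (k b) x)"
        unfolding form_def sum_distrib_left by (rule sum.swap)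
      finally show ?thesis .
    qed
    then have "s = (\<lambda>x. \<Sum>b\<in>B. t b * form_section d (k b) x)"
      by (auto simp: c(2) form_section_def fun_eq_iff)
    also have "\<dots> = (\<Sum>b\<in>B. (\<lambda>x. t b * form_section d (k b) x))"
      by (simp add: fun_eq_iff sum_apply)
    also have "\<dots> \<in> cfun.span ((\<lambda>b. form_section d (k b)) ` B)"
      by (intro cfun.span_sum cfun.span_scale cfun.span_base) auto
    finally show "s \<in> cfun.span ((\<lambda>b. form_section d (k b)) ` B)" .
  qed
  then have "h0 p (d, m) \<le> card ((\<lambda>b. form_section d (k b)) ` B)"
    unfolding h0_def using B by (intro cfun.dim_le_card) auto
  also have "\<dots> \<le> card B" by (rule card_image_le[OF B])
  finally show ?thesis .
qed

text \<open>At a point of an exceptional divisor, to belong to the divisor of the section means that the leading form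
  vanishes in the corresponding direction.\<close>

lemma base_locus_vanishing:
  assumes xi: "\<xi> \<in> base_locus p (d, m)" and c: "c \<in> forms_with_mult d m"
  shows "x \<in> \<xi> None \<Longrightarrow> off x \<Longrightarrow> form d c (\<lambda>k. x $ k) = 0"
    and "\<xi> None = p i \<Longrightarrow> w \<in> \<xi> (Some i) \<Longrightarrow> w \<notin> p i \<Longrightarrow> m i \<le> d \<Longrightarrow>
      tay d c (m i) (\<lambda>k. q i $ k) (\<lambda>k. w $ k) = 0"
proof -
  have sec: "form_section d c \<in> sections p (d, m)"
    by (rule form_section_in_sections) (use c in \<open>auto simp: forms_with_mult_def\<close>)
  have X: "\<xi> \<in> X" using xi by (simp add: base_locus_def)
  have fs: "form_section d c (\<eta>, v) = form d c (\<lambda>k. v $ k)" if "\<eta> \<in> X" "v \<in> \<eta> None" for \<eta> v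
    using that by (simp add: form_section_def)
  show "form d c (\<lambda>k. x $ k) = 0" if x: "x \<in> \<xi> None" "off x"
  proof (cases "form_section d c = (\<lambda>_. 0)")
    case True
    then show ?thesis using fs[OF X x(1)] by simp
  next
    case False
    with xi sec obtain U u where U: "\<xi> \<in> U" "local_quotient p (d, m) (form_section d c) U u" "\<forall>v\<in>\<xi> None. u (\<xi>, v) = 0"
      by (auto simp: base_locus_def divisor_support_def)
    from U(2) obtain t where "\<forall>\<eta>\<in>U. \<forall>v\<in>\<eta> None. form_section d c (\<eta>, v) = (\<Prod>i\<in>UNIV. t i \<eta> ^ m i) * u (\<eta>, v)"
      by (auto simp: local_quotient_def)
    with U x(1) have "form_section d c (\<xi>, x) = 0" by simp
    then show ?thesis using fs[OF X x(1)] by simp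
  qed
  show "tay d c (m i) (\<lambda>k. q i $ k) (\<lambda>k. w $ k) = 0"
    if w: "\<xi> None = p i" "w \<in> \<xi> (Some i)" "w \<notin> p i" "m i \<le> d"
  proof -
    have E: "\<xi> \<in> exceptional p i" using X w(1) by (simp add: exceptional_def)
    have qi: "q i \<in> \<xi> None" using w(1) by (simp add: p_def vec.span_base)
    have "\<exists>U u. \<xi> \<in> U \<and> local_quotient p (d, m) (form_section d c) U u \<and> u (\<xi>, q i) = 0"
      if "form_section d c \<noteq> (\<lambda>_. 0)"
    proof -
      have "\<xi> \<in> divisor_support p (d, m) (form_section d c)" using xi sec that by (auto simp: base_locus_def)
      then show ?thesis using qi unfolding divisor_support_def by blast
    qed
    moreover have ?thesis if z: "form_section d c = (\<lambda>_. 0)"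
    proof -
      have arc: "arc \<xi> (q i) w" using X w q_nz[of i] by (auto simp: arc_def p_def vec.span_base)
      let ?T = "\<lambda>j. tay d c j (\<lambda>k. q i $ k) (\<lambda>k. w $ k)"
      have "\<forall>\<^sub>F t in at 0. (\<Sum>j\<le>d. t ^ j * ?T j) = 0"
        using eventually_off[OF arc]
      proof eventually_elim
        case (elim t)
        have "form d c (\<lambda>k. (q i + t *s w) $ k) = form_section d c (lft (q i + t *s w), q i + t *s w)"
          using lft_in[OF elim] by (subst fs) (auto simp: vec.span_base)
        with z show ?case by (simp only: form_line)
      qed
      then have "(\<Sum>j\<le>d. t ^ j * ?T j) = 0" for t
        by (intro upoly_zero[of "\<lambda>t. \<Sum>j\<le>d. t ^ j * ?T j"]) (auto intro!: upoly_sum upoly_mult upoly_power)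
      then have "(\<Sum>j\<in>{..d}. ?T j * t ^ j) = 0" for t by (simp add: mult.commute)
      from poly_sums_zero[OF _ this, of "m i"] w(4) show ?thesis by simp
    qed
    moreover have ?thesis if "\<xi> \<in> U" "local_quotient p (d, m) (form_section d c) U u" "u (\<xi>, q i) = 0" for U u
      by (rule local_quotient_order(2)[OF that(2,1) E w(2,3) _ that(3) w(4)]) (rule fs)
    ultimately show ?thesis by blast
  qed
qed

text \<open>A point outside the exceptional divisors is determined by its image, and a point on the divisor \<open>i\<close> by
  its tangent direction, because the points are distinct.\<close>

lemma base_locus_finite:
  assumes m: "\<And>i. m i \<le> d"
    and A0: "finite A0" "\<And>x. off x \<Longrightarrow> (\<And>c. c \<in> forms_with_mult d m \<Longrightarrow> form d c (\<lambda>k. x $ k) = 0) \<Longrightarrow> \<exists>a\<in>A0. x \<in> vec.span {a}"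
    and A1: "\<And>i. finite (A1 i)" "\<And>i w. w \<notin> p i \<Longrightarrow>
      (\<And>c. c \<in> forms_with_mult d m \<Longrightarrow> tay d c (m i) (\<lambda>k. q i $ k) (\<lambda>k. w $ k) = 0) \<Longrightarrow> \<exists>a\<in>A1 i. w \<in> vec.span {q i, a}"
  shows "finite (base_locus p (d, m))"
proof -
  define E where "E i a = case_option (p i) (\<lambda>l. if l = i then vec.span {q i, a} else vec.span {q l, q i})" for i a
  have "base_locus p (d, m) \<subseteq> lft ` A0 \<union> (\<Union>i\<in>UNIV. E i ` A1 i)"
  proof
    fix \<xi> assume xi: "\<xi> \<in> base_locus p (d, m)"
    then have X: "\<xi> \<in> X" by (simp add: base_locus_def)
    obtain x where x: "x \<in> \<xi> None" "x \<noteq> 0" using X_None_nz[OF X] by blast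
    show "\<xi> \<in> lft ` A0 \<union> (\<Union>i\<in>UNIV. E i ` A1 i)"
    proof (cases "off x")
      case True
      from A0(2)[OF this base_locus_vanishing(1)[OF xi _ x(1) True]] obtain a where a: "a \<in> A0" "x \<in> vec.span {a}" by blast
      then obtain e where e: "x = e *s a" by (auto simp: span1)
      with x(2) have "e \<noteq> 0" by auto
      then have "a = inverse e *s x" by (simp add: e vector_smult_assoc)
      then have "lft a = lft x" using lft_scale[OF True, of "inverse e"] \<open>e \<noteq> 0\<close> by simp
      with X_eq_lft[OF X x(1) True] have "\<xi> = lft a" by simp
      with a(1) show ?thesis by blast
    next
      case False
      obtain w where "arc \<xi> x w" by (rule arc_exists[OF X x])
      with False obtain i where i: "x \<in> p i" "w \<in> \<xi> (Some i)" "w \<notin> p i" by (auto simp: arc_def)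
      have None: "\<xi> None = p i"
        using X_None[OF X x] i(1) x(2) vec.subspace_dim_equal[of "vec.span {x}" "p i"] dim_p[of i]
        by (simp add: p_def vec.span_minimal vec.dim_eq_card_independent)
      from A1(2)[OF i(3) base_locus_vanishing(2)[OF xi _ None i(2,3) m]]
      obtain a where a: "a \<in> A1 i" "w \<in> vec.span {q i, a}" by blast
      have wi: "w \<notin> vec.span {q i}" using i(3) by (simp add: p_def)
      have Si: "\<xi> (Some i) = vec.span {q i, w}"
        using subspace_span_pair[of "\<xi> (Some i)" "q i" w] X_Some[OF X, of i] i(2) wi q_nz[of i] by auto
      obtain \<alpha> \<beta> where ab: "w = \<alpha> *s q i + \<beta> *s a" using a(2) by (auto simp: span2)
      have "a \<notin> vec.span {q i}"
      proof
        assume "a \<in> vec.span {q i}"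
        then have "w \<in> vec.span {q i}" unfolding ab by (intro vec.span_add vec.span_scale) (auto simp: vec.span_base)
        with wi show False by simp
      qed
      then have "vec.dim (vec.span {q i, a}) = 2" using dim_span_pair[OF q_nz[of i]] by simp
      then have Sa: "vec.span {q i, a} = vec.span {q i, w}"
        using subspace_span_pair[of "vec.span {q i, a}" "q i" w] a(2) wi q_nz[of i] by (simp add: vec.span_base)
      have "\<xi> = E i a"
      proof
        fix o'
        show "\<xi> o' = E i a o'"
        proof (cases o')
          case (Some l)
          show ?thesis
          proof (cases "l = i")
            case False
            have "q i \<in> \<xi> None" using None by (simp add: p_def vec.span_base)
            from X_plane[OF X this q_notin, of l] False Some show ?thesis by (simp add: E_def)
          qed (simp add: Some E_def Si Sa)
        qed (simp add: None E_def)
      qed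
      with a(1) show ?thesis by blast
    qed
  qed
  moreover have "finite (lft ` A0 \<union> (\<Union>i\<in>UNIV. E i ` A1 i))" using A0(1) A1(1) by auto
  ultimately show ?thesis by (rule finite_subset)
qed

end

section \<open>Elimination with polynomial parameters\<close>

text \<open>Polynomial expressions with integer coefficients, which can be evaluated in every commutative
  ring.\<close>

datatype 'v pexp = Par 'v | Con int | Add "'v pexp" "'v pexp" | Mul "'v pexp" "'v pexp"

primrec pev :: "('v \<Rightarrow> 'a::comm_ring_1) \<Rightarrow> 'v pexp \<Rightarrow> 'a" where
  "pev \<rho> (Par v) = \<rho> v"
| "pev \<rho> (Con n) = of_int n"
| "pev \<rho> (Add e f) = pev \<rho> e + pev \<rho> f"
| "pev \<rho> (Mul e f) = pev \<rho> e * pev \<rho> f"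

definition Sub :: "'v pexp \<Rightarrow> 'v pexp \<Rightarrow> 'v pexp" where
  "Sub e f = Add e (Mul (Con (- 1)) f)"

definition Sum :: "('i \<Rightarrow> 'v pexp) \<Rightarrow> 'i set \<Rightarrow> 'v pexp" where
  "Sum f I = foldr (\<lambda>i. Add (f i)) (SOME xs. distinct xs \<and> set xs = I) (Con 0)"

definition Prod :: "('i \<Rightarrow> 'v pexp) \<Rightarrow> 'i set \<Rightarrow> 'v pexp" where
  "Prod f I = foldr (\<lambda>i. Mul (f i)) (SOME xs. distinct xs \<and> set xs = I) (Con 1)"

primrec Pow :: "'v pexp \<Rightarrow> nat \<Rightarrow> 'v pexp" where
  "Pow e 0 = Con 1"
| "Pow e (Suc n) = Mul e (Pow e n)"

lemma some_list: "finite I \<Longrightarrow> distinct (SOME xs. distinct xs \<and> set xs = I) \<and> set (SOME xs. distinct xs \<and> set xs = I) = I"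
  by (rule someI_ex) (metis finite_distinct_list)

lemma pev_Sub [simp]: "pev \<rho> (Sub e f) = pev \<rho> e - pev \<rho> f"
  by (simp add: Sub_def)

lemma pev_Pow [simp]: "pev \<rho> (Pow e n) = pev \<rho> e ^ n"
  by (induction n) auto

lemma pev_Sum [simp]: "finite I \<Longrightarrow> pev \<rho> (Sum f I) = (\<Sum>i\<in>I. pev \<rho> (f i))"
proof -
  assume "finite I"
  have "pev \<rho> (foldr (\<lambda>i. Add (f i)) xs (Con 0)) = (\<Sum>i\<leftarrow>xs. pev \<rho> (f i))" for xs
    by (induction xs) auto
  moreover have "(\<Sum>i\<leftarrow>(SOME xs. distinct xs \<and> set xs = I). pev \<rho> (f i)) = (\<Sum>i\<in>I. pev \<rho> (f i))"
    using some_list[OF \<open>finite I\<close>] by (simp add: sum_list_distinct_conv_sum_set)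
  ultimately show ?thesis by (simp add: Sum_def)
qed

lemma pev_Prod [simp]: "finite I \<Longrightarrow> pev \<rho> (Prod f I) = (\<Prod>i\<in>I. pev \<rho> (f i))"
proof -
  assume "finite I"
  have "pev \<rho> (foldr (\<lambda>i. Mul (f i)) xs (Con 1)) = (\<Prod>i\<leftarrow>xs. pev \<rho> (f i))" for xs
    by (induction xs) auto
  moreover have "(\<Prod>i\<leftarrow>(SOME xs. distinct xs \<and> set xs = I). pev \<rho> (f i)) = (\<Prod>i\<in>I. pev \<rho> (f i))"
    using some_list[OF \<open>finite I\<close>] by (simp flip: prod.distinct_set_conv_list)
  ultimately show ?thesis by (simp add: Prod_def)
qed

lemma pev_of_int: "pev (\<lambda>v. of_int (\<rho> v)) e = of_int (pev \<rho> e)"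
  by (induction e) auto

text \<open>The kernel of the system of linear equations with coefficient matrix \<open>r\<close>, rows \<open>I\<close> and
  columns \<open>J\<close>.\<close>

definition ker :: "('v \<Rightarrow> 'a::field) \<Rightarrow> ('i \<Rightarrow> 'j \<Rightarrow> 'v pexp) \<Rightarrow> 'i set \<Rightarrow> 'j set \<Rightarrow> ('j \<Rightarrow> 'a) set" where
  "ker \<rho> r I J = {c. \<forall>i\<in>I. (\<Sum>j\<in>J. pev \<rho> (r i j) * c j) = 0}"

definition onto :: "('v \<Rightarrow> 'a::field) \<Rightarrow> ('i \<Rightarrow> 'j \<Rightarrow> 'v pexp) \<Rightarrow> 'i set \<Rightarrow> 'j set \<Rightarrow> bool" where
  "onto \<rho> r I J \<longleftrightarrow> (\<forall>d. \<exists>c. \<forall>i\<in>I. (\<Sum>j\<in>J. pev \<rho> (r i j) * c j) = d i)"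

definition spanned :: "('v \<Rightarrow> 'a::field) \<Rightarrow> ('b \<Rightarrow> 'j \<Rightarrow> 'v pexp) \<Rightarrow> 'b set \<Rightarrow> 'j set \<Rightarrow> ('j \<Rightarrow> 'a) \<Rightarrow> bool" where
  "spanned \<rho> k B J c \<longleftrightarrow> (\<exists>t. \<forall>j\<in>J. c j = (\<Sum>b\<in>B. t b * pev \<rho> (k b j)))"

text \<open>Eliminating one equation at a time gives, for all values of the parameters at once, a basis
  of the kernel at \<open>\<rho>\<^sub>0\<close> that continues to span the kernel wherever \<open>\<delta>\<close> does not vanish. The
  pivots are nonzero at \<open>\<rho>\<^sub>0\<close>. The parameters may take values in two different fields.\<close>

lemma elimination:
  fixes \<rho>\<^sub>0 :: "'v \<Rightarrow> 'b::field" and r :: "'i \<Rightarrow> 'j \<Rightarrow> 'v pexp"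
  assumes "finite I" "finite J"
  shows "\<exists>(B::'j set) k \<delta>. finite B \<and> pev \<rho>\<^sub>0 \<delta> \<noteq> 0 \<and>
     (\<forall>b\<in>B. (\<lambda>j. pev \<rho>\<^sub>0 (k b j)) \<in> ker \<rho>\<^sub>0 r I J) \<and>
     (\<forall>t. (\<forall>j\<in>J. (\<Sum>b\<in>B. t b * pev \<rho>\<^sub>0 (k b j)) = 0) \<longrightarrow> (\<forall>b\<in>B. t b = 0)) \<and>
     (\<forall>c\<in>ker \<rho>\<^sub>0 r I J. spanned \<rho>\<^sub>0 k B J c) \<and>
     (\<forall>\<rho> :: 'v \<Rightarrow> 'a::field. pev \<rho> \<delta> \<noteq> 0 \<longrightarrow> (\<forall>c\<in>ker \<rho> r I J. spanned \<rho> k B J c)) \<and>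
     (onto \<rho>\<^sub>0 r I J \<longrightarrow> card B + card I = card J \<and>
        (\<forall>\<rho> :: 'v \<Rightarrow> 'a. \<forall>b\<in>B. (\<lambda>j. pev \<rho> (k b j)) \<in> ker \<rho> r I J) \<and>
        (\<forall>\<rho> :: 'v \<Rightarrow> 'a. pev \<rho> \<delta> \<noteq> 0 \<longrightarrow> onto \<rho> r I J))"
  using assms(1)
proof (induction I rule: finite_induct)
  case empty
  let ?k = "\<lambda>b j :: 'j. Con (if b = j then 1 else 0) :: 'v pexp"
  have k: "(\<Sum>b\<in>J. t b * pev \<rho> (?k b j)) = t j" if "j \<in> J" for t :: "'j \<Rightarrow> 'c::field" and \<rho> j
    using that assms(2) by (simp add: if_distrib[of of_int] if_distrib[of "\<lambda>x. _ * x"] cong: if_cong)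
  have sp: "spanned \<rho> ?k J J c" for \<rho> :: "'v \<Rightarrow> 'c::field" and c
    unfolding spanned_def by (intro exI[of _ c] ballI k[symmetric])
  have ind: "t b = 0" if "\<forall>j\<in>J. (\<Sum>b\<in>J. t b * pev \<rho>\<^sub>0 (?k b j)) = 0" "b \<in> J" for t b
    using k[OF that(2), of t \<rho>\<^sub>0] that by metis
  have one: "pev \<rho>\<^sub>0 (Con 1) = 1" by simp
  show ?case
    by (rule exI[of _ J], rule exI[of _ ?k], rule exI[of _ "Con 1"])
      (use assms(2) sp ind one in \<open>auto simp: ker_def onto_def simp del: pev.simps(2) intro: sp\<close>)
next
  case (insert i I)
  from insert.IH obtain B :: "'j set" and k \<delta> where B: "finite B" "pev \<rho>\<^sub>0 \<delta> \<noteq> 0"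
    and ker0': "\<forall>b\<in>B. (\<lambda>j. pev \<rho>\<^sub>0 (k b j)) \<in> ker \<rho>\<^sub>0 r I J"
    and ind': "\<forall>t. (\<forall>j\<in>J. (\<Sum>b\<in>B. t b * pev \<rho>\<^sub>0 (k b j)) = 0) \<longrightarrow> (\<forall>b\<in>B. t b = 0)"
    and span0': "\<forall>c\<in>ker \<rho>\<^sub>0 r I J. spanned \<rho>\<^sub>0 k B J c"
    and span': "\<forall>\<rho> :: 'v \<Rightarrow> 'a. pev \<rho> \<delta> \<noteq> 0 \<longrightarrow> (\<forall>c\<in>ker \<rho> r I J. spanned \<rho> k B J c)"
    and onto': "onto \<rho>\<^sub>0 r I J \<longrightarrow> card B + card I = card J \<and>
        (\<forall>\<rho> :: 'v \<Rightarrow> 'a. \<forall>b\<in>B. (\<lambda>j. pev \<rho> (k b j)) \<in> ker \<rho> r I J) \<and>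
        (\<forall>\<rho> :: 'v \<Rightarrow> 'a. pev \<rho> \<delta> \<noteq> 0 \<longrightarrow> onto \<rho> r I J)"
    by (elim exE conjE) (rule that; assumption)
  note ker0 = ker0'[rule_format] and span0 = span0'[rule_format] and span = span'[rule_format] and onto = onto'[THEN mp]
  have ind: "t b = 0" if "\<And>j. j \<in> J \<Longrightarrow> (\<Sum>b\<in>B. t b * pev \<rho>\<^sub>0 (k b j)) = 0" "b \<in> B" for t b
    using ind' that by blast
  define s where "s b = Sum (\<lambda>j. Mul (r i j) (k b j)) J" for b
  have s: "pev \<rho> (s b) = (\<Sum>j\<in>J. pev \<rho> (r i j) * pev \<rho> (k b j))" for \<rho> :: "'v \<Rightarrow> 'c::field" and b
    by (simp add: s_def assms(2))
  have row: "(\<Sum>j\<in>J. pev \<rho> (r i j) * c j) = (\<Sum>b\<in>B. t b * pev \<rho> (s b))"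
    if "\<And>j. j \<in> J \<Longrightarrow> c j = (\<Sum>b\<in>B. t b * pev \<rho> (k b j))" for \<rho> :: "'v \<Rightarrow> 'c::field" and c t
  proof -
    have "(\<Sum>j\<in>J. pev \<rho> (r i j) * c j) = (\<Sum>j\<in>J. \<Sum>b\<in>B. t b * (pev \<rho> (r i j) * pev \<rho> (k b j)))"
      by (intro sum.cong refl) (simp add: that sum_distrib_left mult_ac)
    also have "\<dots> = (\<Sum>b\<in>B. t b * pev \<rho> (s b))"
      unfolding s sum_distrib_left by (rule sum.swap)
    finally show ?thesis .
  qed
  have ker_insert: "ker \<rho> r (insert i I) J = {c \<in> ker \<rho> r I J. (\<Sum>j\<in>J. pev \<rho> (r i j) * c j) = 0}"
    for \<rho> :: "'v \<Rightarrow> 'c::field" by (auto simp: ker_def)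
  show ?case
  proof (cases "\<exists>z\<in>B. pev \<rho>\<^sub>0 (s z) \<noteq> 0")
    case False
    have "\<not> onto \<rho>\<^sub>0 r (insert i I) J"
    proof
      assume "onto \<rho>\<^sub>0 r (insert i I) J"
      then have "\<exists>c. \<forall>l\<in>insert i I. (\<Sum>j\<in>J. pev \<rho>\<^sub>0 (r l j) * c j) = (\<lambda>l. if l = i then 1 else 0) l"
        unfolding onto_def by (rule spec)
      then obtain c where c: "\<forall>l\<in>insert i I. (\<Sum>j\<in>J. pev \<rho>\<^sub>0 (r l j) * c j) = (if l = i then 1 else 0)"
        by blast
      then have "c \<in> ker \<rho>\<^sub>0 r I J" using insert.hyps(2) by (auto simp: ker_def)
      from span0[OF this] obtain t where "\<And>j. j \<in> J \<Longrightarrow> c j = (\<Sum>b\<in>B. t b * pev \<rho>\<^sub>0 (k b j))"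
        by (auto simp: spanned_def)
      from row[OF this] c False show False by simp
    qed
    moreover have "(\<lambda>j. pev \<rho>\<^sub>0 (k b j)) \<in> ker \<rho>\<^sub>0 r (insert i I) J" if "b \<in> B" for b
      using ker0[OF that] False that by (simp add: ker_insert s)
    ultimately show ?thesis
    proof -
      assume n: "\<not> onto \<rho>\<^sub>0 r (insert i I) J"
        and k: "\<And>b. b \<in> B \<Longrightarrow> (\<lambda>j. pev \<rho>\<^sub>0 (k b j)) \<in> ker \<rho>\<^sub>0 r (insert i I) J"
      show ?thesis
      proof (rule exI[of _ B], rule exI[of _ k], rule exI[of _ \<delta>], intro conjI)
        show "\<forall>b\<in>B. (\<lambda>j. pev \<rho>\<^sub>0 (k b j)) \<in> ker \<rho>\<^sub>0 r (insert i I) J" using k by blast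
        show "\<forall>c\<in>ker \<rho>\<^sub>0 r (insert i I) J. spanned \<rho>\<^sub>0 k B J c" using span0 by (simp add: ker_insert)
        show "\<forall>\<rho> :: 'v \<Rightarrow> 'a. pev \<rho> \<delta> \<noteq> 0 \<longrightarrow> (\<forall>c\<in>ker \<rho> r (insert i I) J. spanned \<rho> k B J c)"
          using span by (simp add: ker_insert)
      qed (use B ind' n in blast)+
    qed
  next
    case True
    then obtain z where z: "z \<in> B" "pev \<rho>\<^sub>0 (s z) \<noteq> 0" by blast
    define B' where "B' = B - {z}"
    define k' where "k' b j = Sub (Mul (s z) (k b j)) (Mul (s b) (k z j))" for b j
    have BB: "B = insert z B'" "z \<notin> B'" "finite B'" using z(1) B(1) by (auto simp: B'_def)
    have k': "pev \<rho> (k' b j) = pev \<rho> (s z) * pev \<rho> (k b j) - pev \<rho> (s b) * pev \<rho> (k z j)"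
      for \<rho> :: "'v \<Rightarrow> 'c::field" and b j by (simp add: k'_def)
    have lin: "(\<Sum>j\<in>J. pev \<rho> (r l j) * pev \<rho> (k' b j)) =
        pev \<rho> (s z) * (\<Sum>j\<in>J. pev \<rho> (r l j) * pev \<rho> (k b j)) - pev \<rho> (s b) * (\<Sum>j\<in>J. pev \<rho> (r l j) * pev \<rho> (k z j))"
      for \<rho> :: "'v \<Rightarrow> 'c::field" and b l
      by (simp add: k' right_diff_distrib sum_subtractf sum_distrib_left mult_ac)
    have ker': "(\<lambda>j. pev \<rho> (k' b j)) \<in> ker \<rho> r (insert i I) J"
      if that1: "\<And>b. b \<in> B \<Longrightarrow> (\<lambda>j. pev \<rho> (k b j)) \<in> ker \<rho> r I J" "b \<in> B'" for \<rho> :: "'v \<Rightarrow> 'c::field" and b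
    proof -
      have "(\<lambda>j. pev \<rho> (k b j)) \<in> ker \<rho> r I J" "(\<lambda>j. pev \<rho> (k z j)) \<in> ker \<rho> r I J"
        using that1 z(1) by (auto simp: B'_def)
      then show ?thesis unfolding ker_insert by (simp add: ker_def lin s[symmetric])
    qed
    have span': "spanned \<rho> k' B' J c"
      if sp: "\<And>c. c \<in> ker \<rho> r I J \<Longrightarrow> spanned \<rho> k B J c" and sz: "pev \<rho> (s z) \<noteq> 0" and ck: "c \<in> ker \<rho> r (insert i I) J"
      for \<rho> :: "'v \<Rightarrow> 'c::field" and c
    proof -
      from sp[of c] ck obtain t where t: "\<And>j. j \<in> J \<Longrightarrow> c j = (\<Sum>b\<in>B. t b * pev \<rho> (k b j))"
        by (auto simp: spanned_def ker_insert)
      have "(\<Sum>b\<in>B. t b * pev \<rho> (s b)) = 0" using row[OF t] ck by (simp add: ker_insert)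
      then have tz: "t z * pev \<rho> (s z) = - (\<Sum>b\<in>B'. t b * pev \<rho> (s b))"
        unfolding BB(1) using BB by (simp add: eq_neg_iff_add_eq_0)
      have "c j = (\<Sum>b\<in>B'. (t b / pev \<rho> (s z)) * pev \<rho> (k' b j))" if j: "j \<in> J" for j
      proof -
        have "(\<Sum>b\<in>B'. (t b / pev \<rho> (s z)) * pev \<rho> (k' b j)) =
            (\<Sum>b\<in>B'. t b * pev \<rho> (k b j)) + - (\<Sum>b\<in>B'. t b * pev \<rho> (s b)) * (pev \<rho> (k z j) / pev \<rho> (s z))"
        proof -
          have "(t b / pev \<rho> (s z)) * pev \<rho> (k' b j) = t b * pev \<rho> (k b j) - t b * pev \<rho> (s b) * (pev \<rho> (k z j) / pev \<rho> (s z))" for b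
            using sz by (simp add: k' field_simps)
          then show ?thesis by (simp add: sum_subtractf sum_distrib_right sum_divide_distrib)
        qed
        also have "- (\<Sum>b\<in>B'. t b * pev \<rho> (s b)) * (pev \<rho> (k z j) / pev \<rho> (s z)) = t z * pev \<rho> (k z j)"
          unfolding tz[symmetric] using sz by (simp only: times_divide_eq_right mult.assoc) simp
        also have "(\<Sum>b\<in>B'. t b * pev \<rho> (k b j)) + t z * pev \<rho> (k z j) = c j"
          unfolding t[OF j] BB(1) sum.insert[OF BB(3,2)] by (rule add.commute)
        finally show ?thesis by (rule sym)
      qed
      then show ?thesis unfolding spanned_def by (intro exI[of _ "\<lambda>b. t b / pev \<rho> (s z)"] ballI)
    qed
    have ind': "t b = 0" if t: "\<And>j. j \<in> J \<Longrightarrow> (\<Sum>b\<in>B'. t b * pev \<rho>\<^sub>0 (k' b j)) = 0" and b: "b \<in> B'" for t b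
    proof -
      define u where "u b = (if b = z then - (\<Sum>b\<in>B'. t b * pev \<rho>\<^sub>0 (s b)) else t b * pev \<rho>\<^sub>0 (s z))" for b
      have "(\<Sum>b\<in>B. u b * pev \<rho>\<^sub>0 (k b j)) = 0" if j: "j \<in> J" for j
      proof -
        have "(\<Sum>b\<in>B. u b * pev \<rho>\<^sub>0 (k b j)) = u z * pev \<rho>\<^sub>0 (k z j) + (\<Sum>b\<in>B'. u b * pev \<rho>\<^sub>0 (k b j))"
          unfolding BB(1) using BB by simp
        also have "(\<Sum>b\<in>B'. u b * pev \<rho>\<^sub>0 (k b j)) = (\<Sum>b\<in>B'. t b * pev \<rho>\<^sub>0 (s z) * pev \<rho>\<^sub>0 (k b j))"
          using BB(2) by (intro sum.cong) (auto simp: u_def)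
        also have "u z * pev \<rho>\<^sub>0 (k z j) + \<dots> = (\<Sum>b\<in>B'. t b * pev \<rho>\<^sub>0 (k' b j))"
          by (simp add: u_def k' right_diff_distrib sum_subtractf sum_distrib_left mult_ac)
        finally show ?thesis using t[OF j] by simp
      qed
      then have "u b = 0" using ind[of u b] b by (simp add: B'_def)
      moreover have "b \<noteq> z" using b BB(2) by auto
      ultimately show ?thesis using z(2) by (simp add: u_def)
    qed
    have onto': "card B' + card (insert i I) = card J \<and>
        (\<forall>\<rho> :: 'v \<Rightarrow> 'a. \<forall>b\<in>B'. (\<lambda>j. pev \<rho> (k' b j)) \<in> ker \<rho> r (insert i I) J) \<and>
        (\<forall>\<rho> :: 'v \<Rightarrow> 'a. pev \<rho> (Mul \<delta> (s z)) \<noteq> 0 \<longrightarrow> onto \<rho> r (insert i I) J)"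
      if "onto \<rho>\<^sub>0 r (insert i I) J"
    proof -
      have o: "onto \<rho>\<^sub>0 r I J" unfolding onto_def
      proof
        fix d
        from that have "\<exists>c. \<forall>l\<in>insert i I. (\<Sum>j\<in>J. pev \<rho>\<^sub>0 (r l j) * c j) = d l" unfolding onto_def by (rule spec)
        then show "\<exists>c. \<forall>l\<in>I. (\<Sum>j\<in>J. pev \<rho>\<^sub>0 (r l j) * c j) = d l" by auto
      qed
      have card: "card B' + card (insert i I) = card J"
        using onto[OF o] insert.hyps BB by simp
      have k0: "(\<lambda>j. pev \<rho> (k b j)) \<in> ker \<rho> r I J" if "b \<in> B" for \<rho> :: "'v \<Rightarrow> 'a" and b
        using onto[OF o, THEN conjunct2, THEN conjunct1] that by simp
      have ker: "(\<lambda>j. pev \<rho> (k' b j)) \<in> ker \<rho> r (insert i I) J" if "b \<in> B'" for \<rho> :: "'v \<Rightarrow> 'a" and b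
        by (rule ker'[OF k0 that])
      have "onto \<rho> r (insert i I) J" if nz: "pev \<rho> (Mul \<delta> (s z)) \<noteq> 0" for \<rho> :: "'v \<Rightarrow> 'a"
        unfolding onto_def
      proof
        fix e :: "'i \<Rightarrow> 'a"
        have "onto \<rho> r I J" using onto[OF o] nz by simp
        then have "\<exists>c. \<forall>l\<in>I. (\<Sum>j\<in>J. pev \<rho> (r l j) * c j) = e l" unfolding onto_def by (rule spec)
        then obtain c where c: "\<And>l. l \<in> I \<Longrightarrow> (\<Sum>j\<in>J. pev \<rho> (r l j) * c j) = e l" by blast
        define x where "x = (e i - (\<Sum>j\<in>J. pev \<rho> (r i j) * c j)) / pev \<rho> (s z)"
        have add: "(\<Sum>j\<in>J. pev \<rho> (r l j) * (c j + x * pev \<rho> (k z j))) =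
            (\<Sum>j\<in>J. pev \<rho> (r l j) * c j) + x * (\<Sum>j\<in>J. pev \<rho> (r l j) * pev \<rho> (k z j))" for l
          by (simp add: distrib_left sum.distrib sum_distrib_left mult_ac)
        have "(\<lambda>j. pev \<rho> (k z j)) \<in> ker \<rho> r I J" by (rule k0[OF z(1)])
        then have "(\<Sum>j\<in>J. pev \<rho> (r l j) * (c j + x * pev \<rho> (k z j))) = e l" if "l \<in> insert i I" for l
          using that nz c unfolding add by (auto simp: ker_def s[symmetric] x_def)
        then show "\<exists>c. \<forall>l\<in>insert i I. (\<Sum>j\<in>J. pev \<rho> (r l j) * c j) = e l"
          by (intro exI[of _ "\<lambda>j. c j + x * pev \<rho> (k z j)"] ballI)
      qed
      with card ker show ?thesis by (intro conjI allI ballI impI)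
    qed
    show ?thesis
    proof (intro exI[of _ B'] exI[of _ k'] exI[of _ "Mul \<delta> (s z)"] conjI)
      show "finite B'" by (rule BB)
      show "pev \<rho>\<^sub>0 (Mul \<delta> (s z)) \<noteq> 0" using B(2) z(2) by simp
      show "\<forall>b\<in>B'. (\<lambda>j. pev \<rho>\<^sub>0 (k' b j)) \<in> ker \<rho>\<^sub>0 r (insert i I) J" by (intro ballI ker'[OF ker0])
      show "\<forall>t. (\<forall>j\<in>J. (\<Sum>b\<in>B'. t b * pev \<rho>\<^sub>0 (k' b j)) = 0) \<longrightarrow> (\<forall>b\<in>B'. t b = 0)"
        by (intro allI impI ballI, rule ind') (erule bspec, assumption+)
      show "\<forall>c\<in>ker \<rho>\<^sub>0 r (insert i I) J. spanned \<rho>\<^sub>0 k' B' J c" by (intro ballI span'[OF span0 z(2)])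
      show "\<forall>\<rho> :: 'v \<Rightarrow> 'a. pev \<rho> (Mul \<delta> (s z)) \<noteq> 0 \<longrightarrow> (\<forall>c\<in>ker \<rho> r (insert i I) J. spanned \<rho> k' B' J c)"
      proof (intro allI impI ballI)
        fix \<rho> :: "'v \<Rightarrow> 'a" and c assume "pev \<rho> (Mul \<delta> (s z)) \<noteq> 0" and c: "c \<in> ker \<rho> r (insert i I) J"
        then have "pev \<rho> \<delta> \<noteq> 0" "pev \<rho> (s z) \<noteq> 0" by auto
        from span'[OF span[OF this(1)] this(2) c] show "spanned \<rho> k' B' J c" .
      qed
      show "onto \<rho>\<^sub>0 r (insert i I) J \<longrightarrow> card B' + card (insert i I) = card J \<and>
        (\<forall>\<rho> :: 'v \<Rightarrow> 'a. \<forall>b\<in>B'. (\<lambda>j. pev \<rho> (k' b j)) \<in> ker \<rho> r (insert i I) J) \<and>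
        (\<forall>\<rho> :: 'v \<Rightarrow> 'a. pev \<rho> (Mul \<delta> (s z)) \<noteq> 0 \<longrightarrow> onto \<rho> r (insert i I) J)"
        by (rule impI) (rule onto')
    qed
  qed
qed

text \<open>In particular, to have only the zero solution is an open condition.\<close>

lemma trivial_kernel_open:
  fixes \<rho>\<^sub>0 :: "'v \<Rightarrow> 'b::field" and r :: "'i \<Rightarrow> 'j \<Rightarrow> 'v pexp"
  assumes "finite I" "finite J" and triv: "\<And>c j. c \<in> ker \<rho>\<^sub>0 r I J \<Longrightarrow> j \<in> J \<Longrightarrow> c j = 0"
  shows "\<exists>\<delta>. pev \<rho>\<^sub>0 \<delta> \<noteq> 0 \<and> (\<forall>\<rho> :: 'v \<Rightarrow> 'a::field. pev \<rho> \<delta> \<noteq> 0 \<longrightarrow> (\<forall>c\<in>ker \<rho> r I J. \<forall>j\<in>J. c j = 0))"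
proof -
  obtain B :: "'j set" and k \<delta> where B: "finite B" "pev \<rho>\<^sub>0 \<delta> \<noteq> 0"
    and ker0: "\<forall>b\<in>B. (\<lambda>j. pev \<rho>\<^sub>0 (k b j)) \<in> ker \<rho>\<^sub>0 r I J"
    and ind: "\<forall>t. (\<forall>j\<in>J. (\<Sum>b\<in>B. t b * pev \<rho>\<^sub>0 (k b j)) = 0) \<longrightarrow> (\<forall>b\<in>B. t b = 0)"
    and span: "\<forall>\<rho> :: 'v \<Rightarrow> 'a. pev \<rho> \<delta> \<noteq> 0 \<longrightarrow> (\<forall>c\<in>ker \<rho> r I J. spanned \<rho> k B J c)"
    using elimination[OF assms(1,2), where ?\<rho>\<^sub>0 = \<rho>\<^sub>0 and r = r and 'a = 'a]
    by (elim exE conjE) (rule that; assumption)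
  have zero: "pev \<rho>\<^sub>0 (k b j) = 0" if "b \<in> B" "j \<in> J" for b j
    using triv[of "\<lambda>j. pev \<rho>\<^sub>0 (k b j)" j] ker0 that by simp
  have "B = {}" using ind[rule_format, of "\<lambda>_. 1"] zero by auto
  with span B(2) show ?thesis by (intro exI[of _ \<delta>]) (auto simp: spanned_def)
qed

section \<open>Finiteness of zero sets as an open condition\<close>

definition unitv :: "'n \<Rightarrow> 'n \<Rightarrow> nat" where
  "unitv k = (\<lambda>l. if l = k then 1 else 0)"

lemma unitv_exps: "(\<lambda>l. n * unitv k l) \<in> exps n" for k :: "'n::finite"
  by (simp add: exps_def unitv_def if_distrib[of "\<lambda>x. _ * x"] cong: if_cong)

lemma xpow_unitv: "xpow (\<lambda>l. n * unitv k l) x = x k ^ n" for k :: "'n::finite"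
proof -
  have U: "UNIV = insert k (UNIV - {k})" by auto
  have "(\<Prod>l\<in>UNIV - {k}. x l ^ (n * unitv k l)) = 1" by (intro prod.neutral) (auto simp: unitv_def)
  then show ?thesis unfolding xpow_def by (subst U, subst prod.insert) (auto simp: unitv_def)
qed

text \<open>A functional on the forms of degree \<open>N\<close>, given by its values on the monomials, annihilates
  the part of degree \<open>N\<close> of the ideal generated by forms of degree \<open>deg g\<close>.\<close>

definition annih :: "'g set \<Rightarrow> ('g \<Rightarrow> nat) \<Rightarrow> ('g \<Rightarrow> ('n::finite \<Rightarrow> nat) \<Rightarrow> 'a::comm_ring_1) \<Rightarrow> nat \<Rightarrow> (('n \<Rightarrow> nat) \<Rightarrow> 'a) \<Rightarrow> bool" where
  "annih G deg co N \<mu> \<longleftrightarrow> (\<forall>g\<in>G. \<forall>m\<in>exps (N - deg g). (\<Sum>a\<in>exps (deg g). co g a * \<mu> (\<lambda>k. a k + m k)) = 0)"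

definition fills :: "'g set \<Rightarrow> ('g \<Rightarrow> nat) \<Rightarrow> ('g \<Rightarrow> ('n::finite \<Rightarrow> nat) \<Rightarrow> 'a::comm_ring_1) \<Rightarrow> nat \<Rightarrow> bool" where
  "fills G deg co N \<longleftrightarrow> (\<forall>\<mu>. annih G deg co N \<mu> \<longrightarrow> (\<forall>a\<in>exps N. \<mu> a = 0))"

lemma annih_point:
  fixes x :: "'n::finite \<Rightarrow> 'a::comm_ring_1"
  assumes "\<And>g. g \<in> G \<Longrightarrow> form (deg g) (co g) x = 0"
  shows "annih G deg co N (\<lambda>a. xpow a x)"
  unfolding annih_def
proof (intro ballI)
  fix g and m :: "'n \<Rightarrow> nat" assume "g \<in> G"
  have "(\<Sum>a\<in>exps (deg g). co g a * xpow (\<lambda>k. a k + m k) x) = form (deg g) (co g) x * xpow m x"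
    by (simp add: form_def xpow_add sum_distrib_right mult.assoc)
  with assms[OF \<open>g \<in> G\<close>] show "(\<Sum>a\<in>exps (deg g). co g a * xpow (\<lambda>k. a k + m k) x) = 0" by simp
qed

text \<open>Distinct values have linearly independent sequences of powers, by Lagrange interpolation.\<close>

lemma vandermonde_zero:
  fixes c :: "complex \<Rightarrow> complex"
  assumes "finite T" "\<And>r. (\<Sum>v\<in>T. c v * v ^ r) = 0" "v0 \<in> T"
  shows "c v0 = 0"
proof -
  have poly: "(\<Sum>v\<in>T. c v * poly P v) = 0" for P
  proof -
    have "(\<Sum>v\<in>T. c v * poly P v) = (\<Sum>v\<in>T. \<Sum>i\<le>degree P. coeff P i * (c v * v ^ i))"
      by (intro sum.cong refl) (simp add: poly_altdef sum_distrib_left mult_ac)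
    also have "\<dots> = (\<Sum>i\<le>degree P. coeff P i * (\<Sum>v\<in>T. c v * v ^ i))"
      unfolding sum_distrib_left by (rule sum.swap)
    finally show ?thesis using assms(2) by simp
  qed
  let ?P = "\<Prod>w\<in>T - {v0}. [:- w, 1:]"
  have "(\<Sum>v\<in>T. c v * poly ?P v) = c v0 * poly ?P v0 + (\<Sum>v\<in>T - {v0}. c v * poly ?P v)"
    by (rule sum.remove[OF assms(1,3)])
  also have "(\<Sum>v\<in>T - {v0}. c v * poly ?P v) = 0"
    using assms(1) by (intro sum.neutral) (auto simp: poly_prod)
  finally have "c v0 * poly ?P v0 = 0" using poly[of ?P] by simp
  moreover have "poly ?P v0 \<noteq> 0" using assms(1) by (auto simp: poly_prod)
  ultimately show ?thesis by simp
qed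

text \<open>If the forms \<open>G\<close> and the coordinate \<open>x k\<close> generate all forms of degree \<open>N\<close>, then on the
  common zeros of \<open>G\<close> with \<open>x k = 1\<close> every polynomial function agrees with one of degree below \<open>N\<close>,
  so there are only finitely many such zeros.\<close>

lemma finite_cone:
  fixes co :: "'g \<Rightarrow> ('n::finite \<Rightarrow> nat) \<Rightarrow> complex"
  assumes fill: "fills (insert g0 G) deg co N" and N: "N \<ge> 1"
    and g0: "deg g0 = 1" "\<And>x. form 1 (co g0) x = x k0"
  shows "\<exists>A. finite A \<and> (\<forall>x. (\<forall>g\<in>G. form (deg g) (co g) x = 0) \<longrightarrow> x \<noteq> (\<lambda>_. 0) \<longrightarrow> (\<exists>a\<in>A. \<exists>t. x = (\<lambda>k. t * a k)))"
proof -
  define Z where "Z = {x. x k0 = 1 \<and> (\<forall>g\<in>G. form (deg g) (co g) x = 0)}"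
  have fin: "finite ((\<lambda>x. x k) ` Z)" for k
  proof (rule ccontr)
    assume "\<not> ?thesis"
    then obtain T where T: "T \<subseteq> (\<lambda>x. x k) ` Z" "finite T" "card T = Suc (card (exps (N - 1) :: ('n \<Rightarrow> nat) set))"
      by (meson infinite_arbitrarily_large)
    then have "\<forall>v\<in>T. \<exists>x. x \<in> Z \<and> x k = v" by auto
    then obtain x where x: "\<And>v. v \<in> T \<Longrightarrow> x v \<in> Z" "\<And>v. v \<in> T \<Longrightarrow> x v k = v" by metis
    obtain c where c: "\<exists>v\<in>T. c v \<noteq> 0" "\<forall>b\<in>exps (N - 1). (\<Sum>v\<in>T. c v * xpow b (x v)) = 0"
      using homogeneous_solution[of "exps (N - 1) :: ('n \<Rightarrow> nat) set" T "\<lambda>b v. xpow b (x v)"] T by auto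
    have pow: "\<forall>b\<in>exps (N - 1). (\<Sum>v\<in>T. c v * v ^ r * xpow b (x v)) = 0" for r
    proof (induction r)
      case (Suc r)
      define \<mu> where "\<mu> a = (\<Sum>v\<in>T. c v * v ^ r * xpow a (x v))" for a :: "'n \<Rightarrow> nat"
      have "annih (insert g0 G) deg co N \<mu>"
        unfolding annih_def
      proof (intro ballI)
        fix g and m :: "'n \<Rightarrow> nat" assume g: "g \<in> insert g0 G" and m: "m \<in> exps (N - deg g)"
        have "(\<Sum>a\<in>exps (deg g). co g a * \<mu> (\<lambda>k. a k + m k)) =
            (\<Sum>a\<in>exps (deg g). \<Sum>v\<in>T. c v * v ^ r * xpow m (x v) * (co g a * xpow a (x v)))"
          unfolding \<mu>_def sum_distrib_left by (intro sum.cong refl) (simp add: xpow_add mult_ac)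
        also have "\<dots> = (\<Sum>v\<in>T. c v * v ^ r * xpow m (x v) * form (deg g) (co g) (x v))"
          unfolding form_def sum_distrib_left by (rule sum.swap)
        also have "\<dots> = 0"
        proof (cases "g = g0")
          case True
          then have "(\<Sum>v\<in>T. c v * v ^ r * xpow m (x v) * form (deg g) (co g) (x v)) = (\<Sum>v\<in>T. c v * v ^ r * xpow m (x v))"
            using x(1) g0 by (intro sum.cong) (auto simp: Z_def)
          with Suc m True g0 show ?thesis by simp
        next
          case False
          then show ?thesis using g x(1) by (intro sum.neutral) (auto simp: Z_def)
        qed
        finally show "(\<Sum>a\<in>exps (deg g). co g a * \<mu> (\<lambda>k. a k + m k)) = 0" .
      qed
      then have \<mu>: "\<And>a. a \<in> exps N \<Longrightarrow> \<mu> a = 0" using fill by (auto simp: fills_def)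
      show ?case
      proof
        fix b :: "'n \<Rightarrow> nat" assume b: "b \<in> exps (N - 1)"
        have "(\<lambda>l. b l + 1 * unitv k l) \<in> exps N"
          using exps_add[OF b unitv_exps[of 1 k]] N by simp
        then have "\<mu> (\<lambda>l. b l + 1 * unitv k l) = 0" by (rule \<mu>)
        moreover have "\<mu> (\<lambda>l. b l + 1 * unitv k l) = (\<Sum>v\<in>T. c v * v ^ Suc r * xpow b (x v))"
          unfolding \<mu>_def xpow_add xpow_unitv using x(2) by (intro sum.cong refl) (simp add: mult_ac)
        ultimately show "(\<Sum>v\<in>T. c v * v ^ Suc r * xpow b (x v)) = 0" by simp
      qed
    qed (use c(2) in simp)
    have "(\<Sum>v\<in>T. c v * v ^ r) = 0" for r
    proof -
      have "(\<Sum>v\<in>T. c v * v ^ r * xpow (\<lambda>l. (N - 1) * unitv k0 l) (x v)) = 0"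
        using pow unitv_exps by blast
      moreover have "(\<Sum>v\<in>T. c v * v ^ r * xpow (\<lambda>l. (N - 1) * unitv k0 l) (x v)) = (\<Sum>v\<in>T. c v * v ^ r)"
        using x(1) by (intro sum.cong refl) (simp add: xpow_unitv Z_def)
      ultimately show ?thesis by simp
    qed
    with vandermonde_zero[OF T(2)] c(1) show False by blast
  qed
  have "Z \<subseteq> PiE UNIV (\<lambda>k. (\<lambda>x. x k) ` Z)" by auto
  then have "finite Z" by (rule finite_subset) (intro finite_PiE fin, simp)
  moreover have "\<exists>a\<in>Z. \<exists>t. x = (\<lambda>k. t * a k)"
    if x: "\<And>g. g \<in> G \<Longrightarrow> form (deg g) (co g) x = 0" "x \<noteq> (\<lambda>_. 0)" for x
  proof -
    have x0: "x k0 \<noteq> 0"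
    proof
      assume "x k0 = 0"
      with x(1) g0 have "annih (insert g0 G) deg co N (\<lambda>a. xpow a x)" by (intro annih_point) auto
      with fill have "xpow (\<lambda>l. N * unitv k l) x = 0" for k using unitv_exps unfolding fills_def by blast
      then have "x k = 0" for k using N by (simp add: xpow_unitv)
      with x(2) show False by (simp add: fun_eq_iff)
    qed
    have "form (deg g) (co g) (\<lambda>k. (1 / x k0) * x k) = 0" if "g \<in> G" for g
      using x(1)[OF that] by (simp only: form_scale) simp
    with x0 have "(\<lambda>k. (1 / x k0) * x k) \<in> Z" by (auto simp: Z_def)
    moreover have "x = (\<lambda>k. x k0 * ((1 / x k0) * x k))" using x0 by (simp add: fun_eq_iff)
    ultimately show ?thesis by (intro bexI[of _ "\<lambda>k. (1 / x k0) * x k"] exI[of _ "x k0"])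
  qed
  ultimately show ?thesis by (intro exI[of _ Z]) blast
qed

text \<open>To annihilate the ideal is a system of linear equations in the values of the functional, with coefficients
  that are polynomials in the parameters.\<close>

lemma fills_open:
  fixes \<rho>\<^sub>0 :: "'v \<Rightarrow> 'b::field" and co :: "'g \<Rightarrow> ('n::finite \<Rightarrow> nat) \<Rightarrow> 'v pexp"
  assumes G: "finite G" "\<And>g. g \<in> G \<Longrightarrow> deg g \<le> N"
    and fill: "fills G deg (\<lambda>g a. pev \<rho>\<^sub>0 (co g a)) N"
  shows "\<exists>\<delta>. pev \<rho>\<^sub>0 \<delta> \<noteq> 0 \<and> (\<forall>\<rho> :: 'v \<Rightarrow> 'a::field. pev \<rho> \<delta> \<noteq> 0 \<longrightarrow> fills G deg (\<lambda>g a. pev \<rho> (co g a)) N)"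
proof -
  define I where "I = Sigma G (\<lambda>g. exps (N - deg g) :: ('n \<Rightarrow> nat) set)"
  define r where "r = (\<lambda>(g, m) j. if \<forall>k. m k \<le> j k then co g (\<lambda>k. j k - m k) else Con 0)"
  have ker: "ker \<rho> r I (exps N) = Collect (annih G deg (\<lambda>g a. pev \<rho> (co g a)) N)" for \<rho> :: "'v \<Rightarrow> 'c::field"
  proof -
    have "(\<Sum>j\<in>exps N. pev \<rho> (r (g, m) j) * \<mu> j) = (\<Sum>a\<in>exps (deg g). pev \<rho> (co g a) * \<mu> (\<lambda>k. a k + m k))"
      if g: "g \<in> G" and m: "m \<in> exps (N - deg g)" for g and m :: "'n \<Rightarrow> nat" and \<mu> :: "('n \<Rightarrow> nat) \<Rightarrow> 'c"
    proof -
      have "(\<Sum>j\<in>exps N. pev \<rho> (r (g, m) j) * \<mu> j) = (\<Sum>j\<in>{j\<in>exps N. \<forall>k. m k \<le> j k}. pev \<rho> (co g (\<lambda>k. j k - m k)) * \<mu> j)"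
        by (rule sum.mono_neutral_cong_right) (auto simp: r_def)
      also have "\<dots> = (\<Sum>a\<in>exps (deg g). pev \<rho> (co g a) * \<mu> (\<lambda>k. a k + m k))"
      proof (rule sum.reindex_bij_witness[where i = "\<lambda>a k. a k + m k" and j = "\<lambda>j k. j k - m k"])
        fix j assume j: "j \<in> {j\<in>exps N. \<forall>k. m k \<le> j k}"
        then have "sum j UNIV = N" "sum m UNIV = N - deg g" using m by (auto simp: exps_def)
        then show "(\<lambda>k. j k - m k) \<in> exps (deg g)"
          using j G(2)[OF g] by (simp add: exps_def sum_subtractf_nat)
      next
        fix a :: "'n \<Rightarrow> nat" assume a: "a \<in> exps (deg g)"
        show "(\<lambda>k. a k + m k) \<in> {j\<in>exps N. \<forall>k. m k \<le> j k}"
          using exps_add[OF a m] G(2)[OF g] by simp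
      qed auto
      finally show ?thesis .
    qed
    then show ?thesis unfolding ker_def annih_def I_def by auto
  qed
  have "finite I" unfolding I_def by (intro finite_SigmaI G(1) finite_exps)
  moreover have "\<mu> j = 0" if "\<mu> \<in> ker \<rho>\<^sub>0 r I (exps N)" "j \<in> exps N" for \<mu> j
    using fill that by (auto simp: ker fills_def)
  ultimately have "\<exists>\<delta>. pev \<rho>\<^sub>0 \<delta> \<noteq> 0 \<and> (\<forall>\<rho> :: 'v \<Rightarrow> 'a. pev \<rho> \<delta> \<noteq> 0 \<longrightarrow> (\<forall>c\<in>ker \<rho> r I (exps N). \<forall>j\<in>exps N. c j = 0))"
    by (intro trivial_kernel_open) auto
  then show ?thesis by (simp add: ker fills_def)
qed

text \<open>A monomial of degree \<open>CARD('n) * n\<close> is divisible by the \<open>n\<close>-th power of some variable.\<close>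

lemma fills_powers:
  fixes co :: "'g \<Rightarrow> ('n::finite \<Rightarrow> nat) \<Rightarrow> 'a::comm_ring_1"
  assumes deg: "\<And>g. g \<in> G \<Longrightarrow> deg g \<le> n"
    and pow: "\<And>k \<mu>. annih G deg co n \<mu> \<Longrightarrow> \<mu> (\<lambda>l. n * unitv k l) = 0"
  shows "fills G deg co (CARD('n) * n)"
  unfolding fills_def
proof (intro allI impI ballI)
  let ?N = "CARD('n) * n"
  fix \<mu> :: "('n \<Rightarrow> nat) \<Rightarrow> 'a" and a :: "'n \<Rightarrow> nat" assume \<mu>: "annih G deg co ?N \<mu>" and a: "a \<in> exps ?N"
  have "\<exists>k. n \<le> a k"
  proof (rule ccontr)
    assume "\<not> ?thesis"
    then have *: "a k < n" for k by (simp add: not_le)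
    have "sum a UNIV < (\<Sum>k\<in>(UNIV :: 'n set). n)" by (rule sum_strict_mono) (use * in auto)
    with a show False by (simp add: exps_def)
  qed
  then obtain k where k: "n \<le> a k" by blast
  define m where "m = (\<lambda>l. a l - n * unitv k l)"
  have am: "a = (\<lambda>l. n * unitv k l + m l)" using k by (auto simp: m_def unitv_def fun_eq_iff)
  have m: "m \<in> exps (?N - n)"
  proof -
    have "sum a UNIV = n + sum m UNIV"
      by (subst am) (use unitv_exps[of n k] in \<open>simp add: sum.distrib exps_def\<close>)
    with a show ?thesis by (simp add: exps_def)
  qed
  have N: "n \<le> ?N" using a k exps_le[OF a, of k] by linarith
  have "annih G deg co n (\<lambda>l. \<mu> (\<lambda>k. l k + m k))"
    unfolding annih_def
  proof (intro ballI)
    fix g and m' :: "'n \<Rightarrow> nat" assume g: "g \<in> G" and m': "m' \<in> exps (n - deg g)"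
    have "(\<lambda>k. m' k + m k) \<in> exps (?N - deg g)" using exps_add[OF m' m] deg[OF g] N by simp
    from bspec[OF bspec[OF \<mu>[unfolded annih_def] g] this]
    have "(\<Sum>a\<in>exps (deg g). co g a * \<mu> (\<lambda>k. a k + (m' k + m k))) = 0" .
    then show "(\<Sum>a\<in>exps (deg g). co g a * \<mu> (\<lambda>k. a k + m' k + m k)) = 0" by (simp add: add.assoc)
  qed
  from pow[OF this, of k] show "\<mu> a = 0" using am by simp
qed

text \<open>The equations for a form of degree \<open>d\<close> to have multiplicity at least \<open>m\<close> at a point with
  parametric coordinates: the Hasse derivatives of order \<open>m - 1\<close> vanish.\<close>

definition hasse_row :: "('n \<Rightarrow> 'v pexp) \<Rightarrow> ('n::finite \<Rightarrow> nat) \<Rightarrow> ('n \<Rightarrow> nat) \<Rightarrow> 'v pexp" where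
  "hasse_row x b a = Mul (Con (int (\<Prod>k\<in>UNIV. a k choose b k))) (Prod (\<lambda>k. Pow (x k) (a k - b k)) UNIV)"

lemma hasse_row: "(\<Sum>a\<in>exps d. pev \<rho> (hasse_row x b a) * c a) = hasse d c b (\<lambda>k. pev \<rho> (x k))"
  unfolding hasse_def hasse_row_def
  by (intro sum.cong refl) (simp only: pev.simps pev_Prod[OF finite] pev_Pow xpow_def of_int_of_nat_eq mult_ac)

section \<open>The field with 29 elements\<close>

text \<open>The prime 29 is congruent to 1 modulo 7, so that the field contains the seventh roots of unity, the powers of 7.\<close>

typedef F29 = "{0..<29::int}" by auto

setup_lifting type_definition_F29

instantiation F29 :: field
begin

lift_definition zero_F29 :: F29 is 0 by simp
lift_definition one_F29 :: F29 is 1 by simp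
lift_definition plus_F29 :: "F29 \<Rightarrow> F29 \<Rightarrow> F29" is "\<lambda>x y. (x + y) mod 29" by simp
lift_definition minus_F29 :: "F29 \<Rightarrow> F29 \<Rightarrow> F29" is "\<lambda>x y. (x - y) mod 29" by simp
lift_definition uminus_F29 :: "F29 \<Rightarrow> F29" is "\<lambda>x. (- x) mod 29" by simp
lift_definition times_F29 :: "F29 \<Rightarrow> F29 \<Rightarrow> F29" is "\<lambda>x y. (x * y) mod 29" by simp
lift_definition inverse_F29 :: "F29 \<Rightarrow> F29" is "\<lambda>x. x ^ 27 mod 29" by simp
lift_definition divide_F29 :: "F29 \<Rightarrow> F29 \<Rightarrow> F29" is "\<lambda>x y. (x * (y ^ 27 mod 29)) mod 29" by simp

lemma fermat29: "(x::int) \<in> {0..<29} \<Longrightarrow> x \<noteq> 0 \<Longrightarrow> x ^ 27 mod 29 * x mod 29 = 1"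
proof -
  assume "x \<in> {0..<29}" "x \<noteq> 0"
  then have "x \<in> set [1..28]" by auto
  moreover have "[1..28::int] = [1, 2, 3, 4, 5, 6, 7, 8, 9, 10, 11, 12, 13, 14, 15, 16, 17, 18, 19, 20, 21, 22, 23, 24, 25, 26, 27, 28]" by (simp add: upto.simps)
  moreover have "list_all (\<lambda>x. x ^ 27 mod 29 * x mod 29 = (1::int)) [1, 2, 3, 4, 5, 6, 7, 8, 9, 10, 11, 12, 13, 14, 15, 16, 17, 18, 19, 20, 21, 22, 23, 24, 25, 26, 27, 28]" by simp
  ultimately show ?thesis unfolding list_all_iff by (metis (no_types, lifting))
qed

instance
proof
  fix a b c :: F29
  show "a + b + c = a + (b + c)" by transfer (simp add: mod_simps algebra_simps)
  show "a + b = b + a" by transfer (simp add: algebra_simps)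
  show "0 + a = a" by transfer simp
  show "- a + a = 0" by transfer (simp add: mod_simps)
  show "a - b = a + - b" by transfer (simp add: mod_simps)
  show "a * b * c = a * (b * c)" by transfer (simp add: mod_simps algebra_simps)
  show "a * b = b * a" by transfer (simp add: algebra_simps)
  show "1 * a = a" by transfer simp
  show "(a + b) * c = a * c + b * c" by transfer (simp add: mod_simps algebra_simps)
  show "(0::F29) \<noteq> 1" by transfer simp
  show "a \<noteq> 0 \<Longrightarrow> inverse a * a = 1" by transfer (use fermat29 in auto)
  show "a div b = a * inverse b" by transfer simp
  show "inverse (0::F29) = 0" by transfer simp
qed

end

abbreviation red :: "int \<Rightarrow> F29" where "red \<equiv> of_int"

lemma Rep_red: "Rep_F29 (red z) = z mod 29"
proof -
  have nat: "Rep_F29 (of_nat n) = int n mod 29" for n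
    by (induction n) (simp_all add: zero_F29.rep_eq plus_F29.rep_eq one_F29.rep_eq mod_simps algebra_simps)
  show ?thesis
  proof (cases z)
    case (nonneg n)
    then show ?thesis by (simp add: nat)
  next
    case (neg n)
    have "red z = - of_nat (Suc n)" by (simp add: neg)
    then show ?thesis by (simp only: uminus_F29.rep_eq nat neg) (simp add: mod_simps)
  qed
qed

lemma red_mod [simp]: "red (z mod 29) = red z"
  by (simp add: Rep_F29_inject[symmetric] Rep_red)

lemma red_eq_0: "red z = 0 \<longleftrightarrow> z mod 29 = 0"
  by (simp add: Rep_F29_inject[symmetric] Rep_red zero_F29.rep_eq)

section \<open>Arithmetic with residues\<close>

text \<open>Residues are represented by the integers from 0 to 28. The operations are evaluated by tables of rewrite
  rules, so that the large computations below are rewriting with ground equations only.\<close>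

definition mulm :: "int \<Rightarrow> int \<Rightarrow> int" where "mulm x y = (x * y) mod 29"
definition subm :: "int \<Rightarrow> int \<Rightarrow> int" where "subm x y = (x - y) mod 29"
definition addm :: "int \<Rightarrow> int \<Rightarrow> int" where "addm x y = (x + y) mod 29"
definition invm :: "int \<Rightarrow> int" where "invm x = x ^ 27 mod 29"
definition nz :: "int \<Rightarrow> bool" where "nz x \<longleftrightarrow> x mod 29 \<noteq> 0"
text \<open>One factor of the Hasse derivative of order \<open>b\<close> of the monomial with exponent \<open>a\<close>, at the coordinate \<open>v\<close>.\<close>

definition cell :: "int \<Rightarrow> int \<Rightarrow> int \<Rightarrow> int" where
  "cell v b a = int (nat a choose nat b) * v ^ (nat a - nat b) mod 29"
definition shift :: "int \<Rightarrow> 'x \<Rightarrow> 'x list \<Rightarrow> 'x list" where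
  "shift k z xs = replicate (nat k) z @ xs"

lemma mulm_all: "list_all (\<lambda>i. list_all (\<lambda>j. mulm i j = i * j mod 29) [0, 1, 2, 3, 4, 5, 6, 7, 8, 9, 10, 11, 12, 13, 14, 15, 16, 17, 18, 19, 20, 21, 22, 23, 24, 25, 26, 27, 28]) [0, 1, 2, 3, 4, 5, 6, 7, 8, 9, 10, 11, 12, 13, 14, 15, 16, 17, 18, 19, 20, 21, 22, 23, 24, 25, 26, 27, 28]"
  by (simp add: mulm_def)
lemma subm_all: "list_all (\<lambda>i. list_all (\<lambda>j. subm i j = (i - j) mod 29) [0, 1, 2, 3, 4, 5, 6, 7, 8, 9, 10, 11, 12, 13, 14, 15, 16, 17, 18, 19, 20, 21, 22, 23, 24, 25, 26, 27, 28]) [0, 1, 2, 3, 4, 5, 6, 7, 8, 9, 10, 11, 12, 13, 14, 15, 16, 17, 18, 19, 20, 21, 22, 23, 24, 25, 26, 27, 28]"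
  by (simp add: subm_def)
lemma addm_all: "list_all (\<lambda>i. list_all (\<lambda>j. addm i j = (i + j) mod 29) [0, 1, 2, 3, 4, 5, 6, 7, 8, 9, 10, 11, 12, 13, 14, 15, 16, 17, 18, 19, 20, 21, 22, 23, 24, 25, 26, 27, 28]) [0, 1, 2, 3, 4, 5, 6, 7, 8, 9, 10, 11, 12, 13, 14, 15, 16, 17, 18, 19, 20, 21, 22, 23, 24, 25, 26, 27, 28]"
  by (simp add: addm_def)
lemma invm_all: "list_all (\<lambda>i. invm i = i ^ 27 mod 29) [0, 1, 2, 3, 4, 5, 6, 7, 8, 9, 10, 11, 12, 13, 14, 15, 16, 17, 18, 19, 20, 21, 22, 23, 24, 25, 26, 27, 28]"
  by (simp add: invm_def)
lemma nz_all: "list_all (\<lambda>i. nz i = (i \<noteq> 0)) [0, 1, 2, 3, 4, 5, 6, 7, 8, 9, 10, 11, 12, 13, 14, 15, 16, 17, 18, 19, 20, 21, 22, 23, 24, 25, 26, 27, 28]"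
  by (simp add: nz_def)
lemma cell_all: "list_all (\<lambda>v. list_all (\<lambda>b. list_all (\<lambda>a. cell v b a =
    int (nat a choose nat b) * v ^ (nat a - nat b) mod 29) [0, 1, 2, 3, 4, 5, 6, 7, 8]) [0, 1, 2, 3, 4])
    [1, 3, 4, 9, 25]"
  by (simp add: cell_def)
lemma shift_0: "shift 0 z xs = xs" by (simp add: shift_def)
lemma shift_pos: "0 < k \<Longrightarrow> shift k z xs = z # shift (k - 1) z xs"
proof -
  assume "0 < k"
  then have "nat k = Suc (nat (k - 1))" by simp
  then show ?thesis by (simp add: shift_def)
qed
lemma shift_all: "list_all (\<lambda>k. \<forall>(z::'x) xs. 0 < k \<longrightarrow> shift k z xs = z # shift (k - 1) z xs)
    [1, 2, 3, 4, 5, 6, 7, 8, 9, 10, 11, 12, 13, 14, 15, 16, 17, 18]"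
  by (simp add: list_all_iff shift_pos del: list.pred_inject)

lemma binomial_tab:
  "(0 :: nat) choose 2 = 0" "(Suc 0 :: nat) choose 2 = 0" "(2 :: nat) choose 2 = 1"
  "(3 :: nat) choose 2 = 3" "(4 :: nat) choose 2 = 6" "(5 :: nat) choose 2 = 10"
  "(6 :: nat) choose 2 = 15" "(7 :: nat) choose 2 = 21" "(8 :: nat) choose 2 = 28"
  "(0 :: nat) choose 3 = 0" "(Suc 0 :: nat) choose 3 = 0" "(2 :: nat) choose 3 = 0"
  "(3 :: nat) choose 3 = 1" "(4 :: nat) choose 3 = 4" "(5 :: nat) choose 3 = 10"
  "(6 :: nat) choose 3 = 20" "(7 :: nat) choose 3 = 35" "(8 :: nat) choose 3 = 56"
  "(0 :: nat) choose 4 = 0" "(Suc 0 :: nat) choose 4 = 0" "(2 :: nat) choose 4 = 0"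
  "(3 :: nat) choose 4 = 0" "(4 :: nat) choose 4 = 1" "(5 :: nat) choose 4 = 5"
  "(6 :: nat) choose 4 = 15" "(7 :: nat) choose 4 = 35" "(8 :: nat) choose 4 = 70"
  by (simp_all add: numeral_eq_Suc)

lemmas mulm_tab = mulm_all[simplified]
lemmas subm_tab = subm_all[simplified]
lemmas addm_tab = addm_all[simplified]
lemmas invm_tab = invm_all[simplified]
lemmas nz_tab = nz_all[simplified]
lemmas cell_tab = cell_all[simplified, simplified binomial_tab, simplified]
lemmas shift_tab = shift_0 shift_all[simplified]

lemma red_mulm [simp]: "red (mulm x y) = red x * red y" by (simp add: mulm_def)
lemma red_subm [simp]: "red (subm x y) = red x - red y" by (simp add: subm_def)
lemma red_addm [simp]: "red (addm x y) = red x + red y" by (simp add: addm_def)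

lemma red_nz: "nz x \<longleftrightarrow> red x \<noteq> 0"
  by (simp add: nz_def red_eq_0)

lemma red_invm: "nz x \<Longrightarrow> red (invm x) * red x = 1"
proof -
  assume "nz x"
  have "red (invm x) * red x = red (((x mod 29) ^ 27 mod 29 * (x mod 29)) mod 29)"
    by (simp add: invm_def power_mod)
  also have "\<dots> = 1" using fermat29[of "x mod 29"] \<open>nz x\<close> by (simp add: nz_def)
  finally show ?thesis .
qed

text \<open>Gaussian elimination, with the head of the first row as pivot in each step, certifies that a
  linear map is onto.\<close>

fun axpy :: "int \<Rightarrow> int list \<Rightarrow> int list \<Rightarrow> int list" where
  "axpy f (x # xs) (y # ys) = subm y (mulm f x) # axpy f xs ys"
| "axpy f [] ys = []"
| "axpy f xs [] = []"

fun elim :: "int \<Rightarrow> int list \<Rightarrow> int list list \<Rightarrow> int list list" where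
  "elim i t ((h # s) # rs) = axpy (mulm h i) t s # elim i t rs"
| "elim i t [] = []"
| "elim i t ([] # rs) = [] # elim i t rs"

lemma length_elim [simp]: "length (elim i t rs) = length rs"
  by (induction i t rs rule: elim.induct) auto

function fullrank :: "int list list \<Rightarrow> bool" where
  "fullrank [] = True"
| "fullrank ([] # rs) = False"
| "fullrank ((h # t) # rs) = (nz h \<and> fullrank (elim (invm h) t rs))"
  by pat_completeness auto
termination by (relation "Wellfounded.measure length") auto

fun dotm :: "int list \<Rightarrow> int list \<Rightarrow> int" where
  "dotm (x # xs) (y # ys) = addm (mulm x y) (dotm xs ys)"
| "dotm [] ys = 0"
| "dotm xs [] = 0"

fun dotF :: "int list \<Rightarrow> F29 list \<Rightarrow> F29" where
  "dotF (x # xs) (c # cs) = red x * c + dotF xs cs"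
| "dotF [] cs = 0"
| "dotF xs [] = 0"

lemma dotm: "red (dotm xs ys) = dotF xs (map red ys)"
  by (induction xs ys rule: dotm.induct) (auto simp: red_nz)

lemma dotF_axpy: "length xs = n \<Longrightarrow> length ys = n \<Longrightarrow> length cs = n \<Longrightarrow>
    dotF (axpy f xs ys) cs = dotF ys cs - red f * dotF xs cs"
proof (induction f xs ys arbitrary: cs n rule: axpy.induct)
  case (1 f x xs y ys)
  then obtain c cs' where "cs = c # cs'" by (cases cs) auto
  with 1 show ?case by (auto simp: algebra_simps)
qed auto

lemma length_axpy: "length (axpy f xs ys) = min (length xs) (length ys)"
  by (induction f xs ys rule: axpy.induct) auto

lemma length_rows_elim:
  "\<forall>r\<in>set rs. length r = Suc (length t) \<Longrightarrow> \<forall>r\<in>set (elim i t rs). length r = length t"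
  by (induction i t rs rule: elim.induct) (auto simp: length_axpy)

lemma fullrank_onto:
  assumes "fullrank M" "\<forall>r\<in>set M. length r = n" "length ds = length M"
  shows "\<exists>cs. length cs = n \<and> map (\<lambda>r. dotF r cs) M = ds"
  using assms
proof (induction M arbitrary: n ds rule: fullrank.induct)
  case 1
  then show ?case by (intro exI[of _ "replicate n 0"]) simp
next
  case (3 h t rs)
  obtain d es where ds: "ds = d # es" "length es = length rs" using "3.prems"(3) by (cases ds) auto
  define m where "m = length t"
  have n: "n = Suc m" using "3.prems"(2) by (simp add: m_def)
  have nz: "nz h" using "3.prems"(1) by simp
  let ?E = "elim (invm h) t rs"
  have rs: "\<forall>r\<in>set rs. length r = Suc m" using "3.prems"(2) n by simp
  have rows: "\<forall>r\<in>set ?E. length r = m"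
    using length_rows_elim[of rs t "invm h"] rs by (simp add: m_def)
  define fs where "fs = map2 (\<lambda>r e. e - red (hd r) * red (invm h) * d) rs es"
  have "length fs = length ?E" using ds by (simp add: fs_def)
  with "3.IH" nz rows "3.prems"(1) obtain cs where cs: "length cs = m" "map (\<lambda>r. dotF r cs) ?E = fs"
    by (metis fullrank.simps(3))
  define c0 where "c0 = red (invm h) * (d - dotF t cs)"
  have c0: "red h * c0 + dotF t cs = d"
    using red_invm[OF nz] unfolding c0_def by (metis add.commute diff_add_cancel mult.assoc mult.commute mult_1)
  have *: "map (\<lambda>r. dotF r (c0 # cs)) rs = es"
    if "map (\<lambda>r. dotF r cs) (elim (invm h) t rs) = map2 (\<lambda>r e. e - red (hd r) * red (invm h) * d) rs es"
      "\<forall>r\<in>set rs. length r = Suc m" "length es = length rs" for rs es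
    using that
  proof (induction rs arbitrary: es)
    case (Cons r rs)
    then obtain h' s e es' where r: "r = h' # s" "length s = m" and es: "es = e # es'"
      by (cases r; cases es) auto
    have "dotF (axpy (mulm h' (invm h)) t s) cs = e - red h' * red (invm h) * d"
      using Cons.prems(1) by (simp add: r es)
    moreover have "dotF (axpy (mulm h' (invm h)) t s) cs = dotF s cs - red h' * red (invm h) * dotF t cs"
      using dotF_axpy[of t m s cs "mulm h' (invm h)"] r(2) cs(1) by (auto simp: m_def red_nz)
    ultimately have "dotF s cs = e - red h' * c0"
      by (simp add: c0_def algebra_simps)
    moreover have "map (\<lambda>r. dotF r (c0 # cs)) rs = es'" using Cons by (auto simp: r es)
    ultimately show ?case by (simp add: r es)
  qed simp
  have "map (\<lambda>r. dotF r (c0 # cs)) rs = es" using *[OF _ rs ds(2)] cs(2) by (simp add: fs_def)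
  then show ?case using cs(1) n ds c0 by (intro exI[of _ "c0 # cs"]) simp
qed auto

text \<open>The matrix of Hasse derivatives of monomials at a point \<open>vs\<close>.\<close>

fun entry :: "int list \<Rightarrow> int list \<Rightarrow> int list \<Rightarrow> int" where
  "entry (v # vs) (b # bs) (a # as) = mulm (cell v b a) (entry vs bs as)"
| "entry [] bs as = 1"
| "entry vs [] as = 1"
| "entry vs bs [] = 1"

fun entries :: "int list \<Rightarrow> int list \<Rightarrow> int list list \<Rightarrow> int list" where
  "entries vs b [] = []"
| "entries vs b (a # as) = entry vs b a # entries vs b as"

fun hmat :: "int list \<Rightarrow> int list list \<Rightarrow> int list list \<Rightarrow> int list list" where
  "hmat vs [] as = []"
| "hmat vs (b # bs) as = entries vs b as # hmat vs bs as"

fun annihilates :: "int list list \<Rightarrow> int list \<Rightarrow> bool" where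
  "annihilates [] f = True"
| "annihilates (r # rs) f = (\<not> nz (dotm r f) \<and> annihilates rs f)"

definition check :: "int list list \<Rightarrow> int list \<Rightarrow> bool" where
  "check M f \<longleftrightarrow> fullrank M \<and> annihilates M f"

lemma entries_map: "entries vs b as = map (entry vs b) as"
  by (induction as) auto

lemma hmat_map: "hmat vs bs as = map (\<lambda>b. entries vs b as) bs"
  by (induction bs) auto

lemma annihilates_iff: "annihilates M f \<longleftrightarrow> (\<forall>r\<in>set M. dotF r (map red f) = 0)"
  by (induction M) (auto simp: red_nz dotm)

lemmas check_simps = check_def fullrank.simps elim.simps axpy.simps dotm.simps entry.simps entries.simps
  hmat.simps annihilates.simps append.simps if_True if_False simp_thms mulm_tab subm_tab addm_tab invm_tab
  nz_tab cell_tab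

text \<open>Representatives of the two orbits of seven points.\<close>

definition pu :: "int list" where "pu = [1, 1, 1, 1, 1]"
definition pv :: "int list" where "pv = [1, 25, 3, 9, 4]"

definition cubics :: "int list list" where
  "cubics = [[0, 0, 0, 0, 3], [0, 0, 0, 1, 2], [0, 0, 0, 2, 1], [0, 0, 0, 3, 0], [0, 0, 1, 0, 2], [0, 0, 1,
    1, 1], [0, 0, 1, 2, 0], [0, 0, 2, 0, 1], [0, 0, 2, 1, 0], [0, 0, 3, 0, 0], [0, 1, 0, 0, 2], [0,
    1, 0, 1, 1], [0, 1, 0, 2, 0], [0, 1, 1, 0, 1], [0, 1, 1, 1, 0], [0, 1, 2, 0, 0], [0, 2, 0, 0,
    1], [0, 2, 0, 1, 0], [0, 2, 1, 0, 0], [0, 3, 0, 0, 0], [1, 0, 0, 0, 2], [1, 0, 0, 1, 1], [1, 0,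
    0, 2, 0], [1, 0, 1, 0, 1], [1, 0, 1, 1, 0], [1, 0, 2, 0, 0], [1, 1, 0, 0, 1], [1, 1, 0, 1, 0],
    [1, 1, 1, 0, 0], [1, 2, 0, 0, 0], [2, 0, 0, 0, 1], [2, 0, 0, 1, 0], [2, 0, 1, 0, 0], [2, 1, 0,
    0, 0], [3, 0, 0, 0, 0]]"

text \<open>The exponents \<open>a\<close> of degree 8, divided into classes by the residue \<open>a 1 + 6 * a 2 + 2 * a 3 + 5 * a 4\<close>
  modulo 7, which are the eigenspaces of the cyclic group. Within a class they are ordered in such a way that
  elimination meets a nonzero pivot at each step.\<close>

definition A0 :: "int list list" where
  "A0 =
    [[0, 0, 0, 4, 4], [0, 0, 1, 2, 5], [0, 0, 2, 0, 6], [0, 0, 3, 5, 0], [0, 0, 5, 1, 2], [0, 0, 4,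
    3, 1], [0, 1, 0, 5, 2], [0, 1, 1, 3, 3], [0, 1, 2, 1, 4], [0, 1, 5, 2, 0], [0, 1, 6, 0, 1], [0,
    2, 0, 6, 0], [0, 2, 1, 4, 1], [0, 2, 3, 0, 3], [0, 3, 0, 0, 5], [0, 3, 2, 3, 0], [0, 4, 0, 1,
    3], [0, 5, 0, 2, 1], [0, 5, 1, 0, 2], [1, 0, 0, 0, 7], [1, 0, 0, 7, 0], [1, 0, 1, 5, 1], [1, 0,
    2, 3, 2], [1, 0, 7, 0, 0], [1, 1, 0, 1, 5], [1, 1, 2, 4, 0], [1, 1, 3, 2, 1], [1, 2, 0, 2, 3],
    [1, 2, 1, 0, 4], [1, 7, 0, 0, 0], [2, 0, 0, 3, 3], [2, 0, 1, 1, 4], [2, 0, 4, 2, 0], [2, 1, 0,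
    4, 1], [3, 0, 1, 4, 0], [0, 2, 2, 2, 2], [0, 3, 3, 1, 1], [0, 4, 4, 0, 0], [0, 6, 1, 1, 0], [1,
    0, 3, 1, 3], [1, 1, 4, 0, 2], [1, 2, 4, 1, 0], [1, 3, 0, 3, 1], [1, 3, 1, 1, 2], [1, 4, 1, 2,
    0], [1, 4, 2, 0, 1], [2, 0, 5, 0, 1], [2, 1, 1, 2, 2], [2, 1, 2, 0, 3], [2, 2, 1, 3, 0], [2, 2,
    2, 1, 1], [2, 3, 3, 0, 0], [2, 4, 0, 0, 2], [2, 5, 0, 1, 0], [3, 0, 2, 2, 1], [3, 0, 3, 0, 2],
    [3, 1, 0, 0, 4], [3, 1, 3, 1, 0], [3, 2, 0, 1, 2], [3, 3, 0, 2, 0], [3, 3, 1, 0, 1], [4, 0, 0,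
    2, 2], [4, 0, 1, 0, 3], [4, 1, 0, 3, 0], [4, 1, 1, 1, 1], [4, 2, 2, 0, 0], [5, 0, 2, 1, 0], [6,
    0, 0, 1, 1], [5, 2, 0, 0, 1], [6, 1, 1, 0, 0], [8, 0, 0, 0, 0]]"

definition A1 :: "int list list" where
  "A1 =
    [[0, 0, 1, 4, 3], [0, 0, 0, 6, 2], [0, 0, 2, 2, 4], [0, 0, 3, 0, 5], [0, 1, 0, 0, 7], [0, 0, 6,
    1, 1], [0, 0, 5, 3, 0], [0, 1, 1, 5, 1], [0, 1, 0, 7, 0], [0, 1, 2, 3, 2], [0, 1, 7, 0, 0], [0,
    2, 0, 1, 5], [0, 2, 2, 4, 0], [0, 2, 3, 2, 1], [0, 3, 0, 2, 3], [0, 3, 1, 0, 4], [0, 3, 4, 1,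
    0], [0, 4, 1, 1, 2], [0, 5, 2, 0, 1], [0, 8, 0, 0, 0], [1, 0, 0, 2, 5], [1, 0, 1, 0, 6], [1, 0,
    2, 5, 0], [1, 0, 3, 3, 1], [1, 0, 4, 1, 2], [1, 1, 0, 3, 3], [1, 1, 1, 1, 4], [1, 2, 0, 4, 1],
    [1, 1, 4, 2, 0], [1, 5, 0, 0, 2], [2, 0, 0, 5, 1], [2, 0, 1, 3, 2], [2, 0, 6, 0, 0], [2, 1, 1,
    4, 0], [3, 0, 0, 1, 4], [0, 1, 3, 1, 3], [0, 2, 4, 0, 2], [0, 4, 0, 3, 1], [0, 5, 1, 2, 0], [1,
    1, 5, 0, 1], [1, 2, 1, 2, 2], [1, 2, 2, 0, 3], [1, 3, 1, 3, 0], [1, 3, 2, 1, 1], [1, 4, 3, 0,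
    0], [1, 6, 0, 1, 0], [2, 0, 2, 1, 3], [2, 1, 2, 2, 1], [2, 2, 0, 0, 4], [2, 1, 3, 0, 2], [2, 2,
    3, 1, 0], [2, 3, 0, 1, 2], [2, 4, 0, 2, 0], [2, 4, 1, 0, 1], [3, 0, 3, 2, 0], [3, 0, 4, 0, 1],
    [3, 1, 0, 2, 2], [3, 2, 0, 3, 0], [3, 1, 1, 0, 3], [3, 2, 1, 1, 1], [3, 3, 2, 0, 0], [4, 0, 0,
    4, 0], [4, 0, 1, 2, 1], [4, 0, 2, 0, 2], [4, 1, 2, 1, 0], [4, 3, 0, 0, 1], [5, 0, 0, 0, 3], [5,
    1, 0, 1, 1], [5, 2, 1, 0, 0], [6, 0, 1, 1, 0], [7, 1, 0, 0, 0]]"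

definition A2 :: "int list list" where
  "A2 =
    [[0, 0, 0, 1, 7], [0, 0, 2, 4, 2], [0, 0, 1, 6, 1], [0, 0, 0, 8, 0], [0, 0, 3, 2, 3], [0, 1, 0,
    2, 5], [0, 1, 1, 0, 6], [0, 1, 2, 5, 0], [0, 0, 7, 1, 0], [0, 1, 3, 3, 1], [0, 1, 4, 1, 2], [0,
    2, 0, 3, 3], [0, 2, 1, 1, 4], [0, 2, 4, 2, 0], [0, 2, 5, 0, 1], [0, 3, 0, 4, 1], [0, 6, 0, 0,
    2], [0, 3, 2, 0, 3], [0, 7, 0, 1, 0], [1, 0, 0, 4, 3], [1, 0, 1, 2, 4], [1, 0, 2, 0, 5], [1, 0,
    4, 3, 0], [1, 0, 5, 1, 1], [1, 1, 0, 5, 1], [1, 1, 1, 3, 2], [1, 1, 6, 0, 0], [1, 2, 1, 4, 0],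
    [1, 3, 0, 0, 4], [1, 5, 1, 0, 1], [2, 0, 0, 0, 6], [2, 0, 1, 5, 0], [2, 0, 2, 3, 1], [2, 1, 0,
    1, 4], [3, 0, 0, 3, 2], [0, 0, 4, 0, 4], [0, 3, 1, 2, 2], [0, 4, 1, 3, 0], [0, 4, 2, 1, 1], [0,
    5, 3, 0, 0], [1, 1, 2, 1, 3], [1, 2, 2, 2, 1], [1, 2, 3, 0, 2], [1, 3, 3, 1, 0], [1, 4, 0, 1,
    2], [1, 5, 0, 2, 0], [2, 0, 3, 1, 2], [2, 1, 3, 2, 0], [2, 1, 4, 0, 1], [2, 2, 0, 2, 2], [2, 2,
    1, 0, 3], [2, 3, 0, 3, 0], [2, 3, 1, 1, 1], [2, 4, 2, 0, 0], [3, 0, 1, 1, 3], [3, 0, 5, 0, 0],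
    [3, 1, 0, 4, 0], [3, 1, 1, 2, 1], [3, 1, 2, 0, 2], [3, 2, 2, 1, 0], [3, 4, 0, 0, 1], [4, 0, 2,
    2, 0], [4, 0, 3, 0, 1], [4, 1, 0, 0, 3], [4, 2, 0, 1, 1], [5, 0, 0, 2, 1], [4, 3, 1, 0, 0], [5,
    0, 1, 0, 2], [5, 1, 1, 1, 0], [6, 2, 0, 0, 0], [7, 0, 0, 1, 0]]"

definition A3 :: "int list list" where
  "A3 =
    [[0, 0, 0, 3, 5], [0, 0, 1, 1, 6], [0, 0, 3, 4, 1], [0, 0, 2, 6, 0], [0, 0, 4, 2, 2], [0, 0, 5,
    0, 3], [0, 1, 0, 4, 3], [0, 1, 1, 2, 4], [0, 1, 2, 0, 5], [0, 1, 4, 3, 0], [0, 1, 5, 1, 1], [0,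
    2, 0, 5, 1], [0, 2, 1, 3, 2], [0, 2, 2, 1, 3], [0, 2, 6, 0, 0], [0, 3, 1, 4, 0], [0, 4, 0, 0,
    4], [0, 5, 0, 1, 2], [0, 6, 1, 0, 1], [1, 0, 0, 6, 1], [1, 0, 1, 4, 2], [1, 0, 2, 2, 3], [1, 0,
    6, 1, 0], [1, 1, 0, 0, 6], [1, 1, 1, 5, 0], [1, 1, 2, 3, 1], [1, 2, 0, 1, 4], [1, 2, 3, 2, 0],
    [1, 3, 1, 0, 3], [2, 0, 0, 2, 4], [2, 0, 1, 0, 5], [2, 0, 3, 3, 0], [2, 1, 0, 3, 2], [2, 5, 0,
    0, 1], [3, 0, 0, 5, 0], [0, 3, 3, 0, 2], [0, 3, 2, 2, 1], [0, 4, 3, 1, 0], [0, 6, 0, 2, 0], [1,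
    0, 3, 0, 4], [1, 1, 3, 1, 2], [1, 2, 4, 0, 1], [1, 3, 0, 2, 2], [1, 4, 0, 3, 0], [1, 4, 1, 1,
    1], [1, 5, 2, 0, 0], [2, 0, 4, 1, 1], [2, 1, 1, 1, 3], [2, 1, 5, 0, 0], [2, 2, 0, 4, 0], [2, 2,
    1, 2, 1], [2, 2, 2, 0, 2], [2, 3, 2, 1, 0], [3, 0, 1, 3, 1], [3, 0, 2, 1, 2], [3, 1, 2, 2, 0],
    [3, 1, 3, 0, 1], [3, 2, 0, 0, 3], [3, 3, 0, 1, 1], [3, 4, 1, 0, 0], [4, 0, 0, 1, 3], [4, 0, 4,
    0, 0], [4, 1, 0, 2, 1], [4, 1, 1, 0, 2], [4, 2, 1, 1, 0], [5, 0, 1, 2, 0], [5, 0, 2, 0, 1], [5,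
    3, 0, 0, 0], [6, 0, 0, 0, 2], [6, 1, 0, 1, 0]]"

definition A4 :: "int list list" where
  "A4 =
    [[0, 0, 0, 5, 3], [0, 0, 1, 3, 4], [0, 0, 2, 1, 5], [0, 0, 4, 4, 0], [0, 0, 6, 0, 2], [0, 0, 5,
    2, 1], [0, 1, 0, 6, 1], [0, 1, 1, 4, 2], [0, 1, 2, 2, 3], [0, 1, 3, 0, 4], [0, 1, 6, 1, 0], [0,
    2, 0, 0, 6], [0, 2, 1, 5, 0], [0, 2, 2, 3, 1], [0, 3, 0, 1, 4], [0, 3, 3, 2, 0], [0, 4, 0, 2,
    2], [0, 4, 1, 0, 3], [0, 5, 1, 1, 1], [1, 0, 0, 1, 6], [1, 0, 1, 6, 0], [1, 0, 2, 4, 1], [1, 0,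
    3, 2, 2], [1, 1, 1, 0, 5], [1, 1, 0, 2, 4], [1, 1, 4, 1, 1], [1, 1, 3, 3, 0], [1, 2, 0, 3, 2],
    [1, 6, 0, 0, 1], [2, 0, 0, 4, 2], [2, 0, 1, 2, 3], [2, 1, 0, 5, 0], [2, 0, 5, 1, 0], [2, 3, 0,
    0, 3], [3, 0, 0, 0, 5], [0, 2, 3, 1, 2], [0, 3, 4, 0, 1], [0, 5, 0, 3, 0], [0, 6, 2, 0, 0], [1,
    0, 4, 0, 3], [1, 2, 1, 1, 3], [1, 2, 5, 0, 0], [1, 3, 0, 4, 0], [1, 3, 1, 2, 1], [1, 3, 2, 0,
    2], [1, 4, 2, 1, 0], [2, 0, 2, 0, 4], [2, 1, 1, 3, 1], [2, 1, 2, 1, 2], [2, 2, 2, 2, 0], [2, 2,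
    3, 0, 1], [2, 4, 0, 1, 1], [2, 5, 1, 0, 0], [3, 0, 2, 3, 0], [3, 0, 3, 1, 1], [3, 1, 0, 1, 3],
    [3, 1, 4, 0, 0], [3, 2, 0, 2, 1], [3, 2, 1, 0, 2], [3, 3, 1, 1, 0], [4, 0, 0, 3, 1], [4, 0, 1,
    1, 2], [4, 1, 1, 2, 0], [4, 1, 2, 0, 1], [4, 4, 0, 0, 0], [5, 0, 3, 0, 0], [5, 2, 0, 1, 0], [5,
    1, 0, 0, 2], [6, 0, 0, 2, 0], [6, 0, 1, 0, 1]]"

definition A5 :: "int list list" where
  "A5 =
    [[0, 0, 0, 0, 8], [0, 0, 1, 5, 2], [0, 0, 0, 7, 1], [0, 0, 2, 3, 3], [0, 0, 3, 1, 4], [0, 1, 0,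
    1, 6], [0, 0, 6, 2, 0], [0, 0, 7, 0, 1], [0, 1, 1, 6, 0], [0, 1, 2, 4, 1], [0, 1, 3, 2, 2], [0,
    2, 0, 2, 4], [0, 2, 1, 0, 5], [0, 2, 3, 3, 0], [0, 2, 4, 1, 1], [0, 3, 0, 3, 2], [0, 3, 1, 1,
    3], [0, 4, 2, 0, 2], [0, 7, 0, 0, 1], [1, 0, 0, 3, 4], [1, 0, 1, 1, 5], [1, 0, 3, 4, 0], [1, 0,
    4, 2, 1], [1, 0, 5, 0, 2], [1, 1, 0, 4, 2], [1, 1, 1, 2, 3], [1, 1, 5, 1, 0], [1, 2, 0, 5, 0],
    [1, 5, 0, 1, 1], [1, 4, 0, 0, 3], [2, 0, 1, 4, 1], [2, 0, 0, 6, 0], [2, 1, 0, 0, 5], [2, 1, 2,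
    3, 0], [3, 0, 0, 2, 3], [0, 1, 4, 0, 3], [0, 3, 5, 0, 0], [0, 4, 0, 4, 0], [0, 4, 1, 2, 1], [0,
    5, 2, 1, 0], [1, 1, 2, 0, 4], [1, 2, 1, 3, 1], [1, 2, 2, 1, 2], [1, 3, 2, 2, 0], [1, 3, 3, 0,
    1], [1, 6, 1, 0, 0], [2, 0, 2, 2, 2], [2, 0, 3, 0, 3], [2, 1, 3, 1, 1], [2, 2, 0, 1, 3], [2, 2,
    4, 0, 0], [2, 3, 0, 2, 1], [2, 3, 1, 0, 2], [2, 4, 1, 1, 0], [3, 0, 1, 0, 4], [3, 0, 4, 1, 0],
    [3, 1, 0, 3, 1], [3, 1, 1, 1, 2], [3, 2, 1, 2, 0], [3, 2, 2, 0, 1], [3, 5, 0, 0, 0], [4, 0, 1,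
    3, 0], [4, 0, 2, 1, 1], [4, 1, 3, 0, 0], [4, 2, 0, 0, 2], [4, 3, 0, 1, 0], [5, 0, 0, 1, 2], [5,
    1, 0, 2, 0], [5, 1, 1, 0, 1], [6, 0, 2, 0, 0], [7, 0, 0, 0, 1]]"

definition A6 :: "int list list" where
  "A6 =
    [[0, 0, 0, 2, 6], [0, 0, 1, 0, 7], [0, 0, 2, 5, 1], [0, 0, 1, 7, 0], [0, 0, 3, 3, 2], [0, 0, 4,
    1, 3], [0, 1, 0, 3, 4], [0, 1, 1, 1, 5], [0, 1, 3, 4, 0], [0, 0, 8, 0, 0], [0, 1, 4, 2, 1], [0,
    2, 0, 4, 2], [0, 1, 5, 0, 2], [0, 2, 1, 2, 3], [0, 2, 2, 0, 4], [0, 2, 5, 1, 0], [0, 5, 0, 0,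
    3], [0, 6, 0, 1, 1], [0, 3, 0, 5, 0], [0, 7, 1, 0, 0], [1, 0, 0, 5, 2], [1, 0, 1, 3, 3], [1, 0,
    2, 1, 4], [1, 0, 6, 0, 1], [1, 0, 5, 2, 0], [1, 1, 0, 6, 0], [1, 1, 1, 4, 1], [1, 2, 0, 0, 5],
    [1, 2, 2, 3, 0], [1, 3, 0, 1, 3], [2, 0, 0, 1, 5], [2, 0, 2, 4, 0], [2, 0, 3, 2, 1], [2, 1, 0,
    2, 3], [3, 0, 0, 4, 1], [0, 3, 1, 3, 1], [0, 3, 2, 1, 2], [0, 4, 3, 0, 1], [0, 4, 2, 2, 0], [1,
    1, 2, 2, 2], [1, 1, 3, 0, 3], [1, 3, 4, 0, 0], [1, 2, 3, 1, 1], [1, 4, 0, 2, 1], [1, 4, 1, 0,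
    2], [1, 5, 1, 1, 0], [2, 0, 4, 0, 2], [2, 1, 1, 0, 4], [2, 1, 4, 1, 0], [2, 2, 0, 3, 1], [2, 2,
    1, 1, 2], [2, 3, 1, 2, 0], [2, 3, 2, 0, 1], [2, 6, 0, 0, 0], [3, 0, 1, 2, 2], [3, 0, 2, 0, 3],
    [3, 1, 1, 3, 0], [3, 1, 2, 1, 1], [3, 2, 3, 0, 0], [3, 3, 0, 0, 2], [3, 4, 0, 1, 0], [4, 0, 0,
    0, 4], [4, 0, 3, 1, 0], [4, 1, 0, 1, 2], [4, 2, 0, 2, 0], [4, 2, 1, 0, 1], [5, 0, 0, 3, 0], [5,
    0, 1, 1, 1], [5, 1, 2, 0, 0], [6, 1, 0, 0, 1], [7, 0, 1, 0, 0]]"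


text \<open>The octics with quadruple points at the 14 points, in the eigenspaces that contain one.\<close>

definition f0 :: "int list" where
  "f0 =
    [24, 0, 0, 0, 0, 0, 0, 22, 0, 0, 0, 0, 0, 0, 0, 0, 0, 0, 0, 0, 0, 0, 0, 0, 0, 0, 0, 0, 0, 0, 27,
    0, 0, 0, 0, 13, 4, 25, 0, 0, 0, 0, 0, 0, 0, 0, 0, 24, 0, 0, 20, 12, 0, 0, 0, 0, 0, 0, 0, 0, 0,
    20, 0, 0, 14, 1, 0, 11, 0, 14, 1]"

definition f1 :: "int list" where
  "f1 =
    [10, 25, 8, 13, 6, 3, 4, 20, 0, 0, 28, 11, 11, 2, 17, 6, 5, 25, 5, 27, 15, 10, 28, 20, 5, 5, 26,
    18, 17, 3, 15, 9, 12, 18, 1, 26, 26, 20, 20, 10, 6, 2, 18, 27, 0, 5, 27, 16, 15, 1, 6, 7, 7, 0,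
    16, 6, 7, 14, 26, 12, 12, 15, 18, 13, 3, 12, 23, 5, 27, 22, 1]"

definition f2 :: "int list" where
  "f2 =
    [13, 1, 5, 18, 15, 14, 23, 11, 9, 10, 6, 8, 20, 25, 10, 0, 21, 14, 9, 4, 28, 23, 13, 17, 6, 5,
    25, 21, 12, 24, 6, 25, 18, 19, 10, 11, 9, 17, 25, 18, 14, 13, 28, 18, 19, 13, 5, 11, 17, 4, 27,
    23, 19, 14, 19, 5, 1, 27, 4, 7, 24, 25, 9, 19, 14, 25, 22, 27, 23, 28, 1]"

definition f5 :: "int list" where
  "f5 =
    [12, 23, 26, 10, 4, 24, 12, 19, 22, 6, 21, 18, 7, 16, 25, 7, 25, 23, 26, 15, 5, 19, 14, 10, 5,
    19, 28, 19, 22, 13, 8, 5, 11, 26, 26, 26, 4, 27, 14, 22, 18, 15, 12, 13, 14, 7, 16, 3, 10, 20,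
    7, 14, 10, 4, 28, 25, 28, 8, 15, 1, 16, 15, 13, 27, 28, 27, 17, 10, 11, 5, 1]"

definition f6 :: "int list" where
  "f6 =
    [28, 26, 11, 26, 19, 4, 3, 24, 15, 19, 16, 8, 26, 0, 10, 0, 2, 25, 0, 15, 23, 21, 0, 22, 20, 0,
    10, 6, 22, 8, 24, 6, 25, 24, 16, 10, 20, 16, 13, 26, 14, 26, 7, 16, 11, 26, 15, 20, 10, 16, 5,
    0, 8, 14, 18, 27, 5, 13, 16, 0, 1, 5, 18, 28, 21, 7, 0, 21, 26, 2, 1]"


lemma check0: "check (hmat pu cubics A0 @ hmat pv cubics A0) f0"
  by (simp only: A0_def f0_def pu_def pv_def cubics_def check_simps)

lemma check1: "check (hmat pu cubics A1 @ hmat pv cubics A1) f1"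
  by (simp only: A1_def f1_def pu_def pv_def cubics_def check_simps)

lemma check2: "check (hmat pu cubics A2 @ hmat pv cubics A2) f2"
  by (simp only: A2_def f2_def pu_def pv_def cubics_def check_simps)

lemma check3: "fullrank (hmat pu cubics A3 @ hmat pv cubics A3)"
  by (simp only: A3_def pu_def pv_def cubics_def check_simps)

lemma check4: "fullrank (hmat pu cubics A4 @ hmat pv cubics A4)"
  by (simp only: A4_def pu_def pv_def cubics_def check_simps)

lemma check5: "check (hmat pu cubics A5 @ hmat pv cubics A5) f5"
  by (simp only: A5_def f5_def pu_def pv_def cubics_def check_simps)

lemma check6: "check (hmat pu cubics A6 @ hmat pv cubics A6) f6"
  by (simp only: A6_def f6_def pu_def pv_def cubics_def check_simps)

section \<open>Polynomials in three variables as nested lists of coefficients\<close>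

fun add1 :: "int list \<Rightarrow> int list \<Rightarrow> int list" where
  "add1 (x # xs) (y # ys) = addm x y # add1 xs ys"
| "add1 [] ys = ys"
| "add1 xs [] = xs"

fun add2 :: "int list list \<Rightarrow> int list list \<Rightarrow> int list list" where
  "add2 (x # xs) (y # ys) = add1 x y # add2 xs ys"
| "add2 [] ys = ys"
| "add2 xs [] = xs"

fun add3 :: "int list list list \<Rightarrow> int list list list \<Rightarrow> int list list list" where
  "add3 (x # xs) (y # ys) = add2 x y # add3 xs ys"
| "add3 [] ys = ys"
| "add3 xs [] = xs"

fun sc1 :: "int \<Rightarrow> int list \<Rightarrow> int list" where
  "sc1 c [] = []"
| "sc1 c (x # xs) = mulm c x # sc1 c xs"

fun sc2 :: "int \<Rightarrow> int list list \<Rightarrow> int list list" where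
  "sc2 c [] = []"
| "sc2 c (x # xs) = sc1 c x # sc2 c xs"

fun sc3 :: "int \<Rightarrow> int list list list \<Rightarrow> int list list list" where
  "sc3 c [] = []"
| "sc3 c (x # xs) = sc2 c x # sc3 c xs"

fun shift1 :: "int \<Rightarrow> int list list \<Rightarrow> int list list" where
  "shift1 k [] = []"
| "shift1 k (x # xs) = shift k 0 x # shift1 k xs"

fun shift2 :: "int \<Rightarrow> int \<Rightarrow> int list list list \<Rightarrow> int list list list" where
  "shift2 j k [] = []"
| "shift2 j k (x # xs) = shift j [] (shift1 k x) # shift2 j k xs"

definition place :: "int list \<Rightarrow> int list list list \<Rightarrow> int list list list" where
  "place a P = shift (a ! 1) [] (shift2 (a ! 2) (a ! 3) P)"

lemma place_simp: "place [a, i, j, k, l] P = shift i [] (shift2 j k P)"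
  by (simp add: place_def)

text \<open>The product of the polynomial \<open>P\<close> with \<open>\<Sum> x * (monomial a)\<close>, the sum over the corresponding entries
  of the two lists.\<close>

fun times :: "int list list list \<Rightarrow> int list list \<Rightarrow> int list \<Rightarrow> int list list list" where
  "times P (a # as) (x # xs) = add3 (place a (sc3 x P)) (times P as xs)"
| "times P [] xs = []"
| "times P as [] = []"

fun combination :: "(int list list list \<times> int list list \<times> int list) list \<Rightarrow> int list list list" where
  "combination [] = []"
| "combination ((P, A, f) # cs) = add3 (times P A f) (combination cs)"

fun zero1 :: "int list \<Rightarrow> bool" where
  "zero1 [] = True"
| "zero1 (x # xs) = (\<not> nz x \<and> zero1 xs)"

fun zero2 :: "int list list \<Rightarrow> bool" where
  "zero2 [] = True"
| "zero2 (x # xs) = (zero1 x \<and> zero2 xs)"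

fun zero3 :: "int list list list \<Rightarrow> bool" where
  "zero3 [] = True"
| "zero3 (x # xs) = (zero2 x \<and> zero3 xs)"

fun below1 :: "nat \<Rightarrow> int list \<Rightarrow> bool" where
  "below1 n [] = True"
| "below1 0 (x # xs) = False"
| "below1 (Suc n) (x # xs) = below1 n xs"

fun below2 :: "nat \<Rightarrow> int list list \<Rightarrow> bool" where
  "below2 n [] = True"
| "below2 0 (x # xs) = False"
| "below2 (Suc n) (x # xs) = (below1 (Suc n) x \<and> below2 n xs)"

fun below3 :: "nat \<Rightarrow> int list list list \<Rightarrow> bool" where
  "below3 n [] = True"
| "below3 0 (x # xs) = False"
| "below3 (Suc n) (x # xs) = (below2 (Suc n) x \<and> below3 n xs)"

text \<open>A functional, given by its values on monomials, applied to a polynomial.\<close>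

fun pr1 :: "(nat \<Rightarrow> F29) \<Rightarrow> int list \<Rightarrow> F29" where
  "pr1 f [] = 0"
| "pr1 f (x # xs) = red x * f 0 + pr1 (\<lambda>n. f (Suc n)) xs"

fun pr2 :: "(nat \<Rightarrow> nat \<Rightarrow> F29) \<Rightarrow> int list list \<Rightarrow> F29" where
  "pr2 f [] = 0"
| "pr2 f (x # xs) = pr1 (f 0) x + pr2 (\<lambda>n. f (Suc n)) xs"

fun pr3 :: "(nat \<Rightarrow> nat \<Rightarrow> nat \<Rightarrow> F29) \<Rightarrow> int list list list \<Rightarrow> F29" where
  "pr3 f [] = 0"
| "pr3 f (x # xs) = pr2 (f 0) x + pr3 (\<lambda>n. f (Suc n)) xs"

lemma pr1_add: "pr1 f (add1 p q) = pr1 f p + pr1 f q"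
  by (induction p q arbitrary: f rule: add1.induct) (auto simp: algebra_simps)
lemma pr2_add: "pr2 f (add2 p q) = pr2 f p + pr2 f q"
  by (induction p q arbitrary: f rule: add2.induct) (auto simp: algebra_simps pr1_add)
lemma pr3_add: "pr3 f (add3 p q) = pr3 f p + pr3 f q"
  by (induction p q arbitrary: f rule: add3.induct) (auto simp: algebra_simps pr2_add)

lemma pr1_sc: "pr1 f (sc1 c p) = red c * pr1 f p"
  by (induction p arbitrary: f) (auto simp: algebra_simps)
lemma pr2_sc: "pr2 f (sc2 c p) = red c * pr2 f p"
  by (induction p arbitrary: f) (auto simp: algebra_simps pr1_sc)
lemma pr3_sc: "pr3 f (sc3 c p) = red c * pr3 f p"
  by (induction p arbitrary: f) (auto simp: algebra_simps pr2_sc)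

lemma pr1_zero: "zero1 p \<Longrightarrow> pr1 f p = 0"
  by (induction p arbitrary: f) (auto simp: red_nz)
lemma pr2_zero: "zero2 p \<Longrightarrow> pr2 f p = 0"
  by (induction p arbitrary: f) (auto simp: pr1_zero)
lemma pr3_zero: "zero3 p \<Longrightarrow> pr3 f p = 0"
  by (induction p arbitrary: f) (auto simp: pr2_zero)

lemma pr1_replicate: "pr1 f (replicate m 0 @ p) = pr1 (\<lambda>n. f (n + m)) p"
  by (induction m arbitrary: f) auto
lemma pr2_replicate: "pr2 f (replicate m [] @ p) = pr2 (\<lambda>n. f (n + m)) p"
  by (induction m arbitrary: f) auto
lemma pr3_replicate: "pr3 f (replicate m [] @ p) = pr3 (\<lambda>n. f (n + m)) p"
  by (induction m arbitrary: f) auto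

lemma pr2_shift1: "pr2 f (shift1 k p) = pr2 (\<lambda>i n. f i (n + nat k)) p"
  by (induction p arbitrary: f) (auto simp: shift_def pr1_replicate)
lemma pr3_shift2: "pr3 f (shift2 j k p) = pr3 (\<lambda>i n m. f i (n + nat j) (m + nat k)) p"
  by (induction p arbitrary: f) (auto simp: shift_def pr2_replicate pr2_shift1)

lemma pr3_place: "pr3 f (place a p) = pr3 (\<lambda>i j k. f (i + nat (a ! 1)) (j + nat (a ! 2)) (k + nat (a ! 3))) p"
  by (simp add: place_def shift_def pr3_replicate pr3_shift2)

lemma pr1_vanish: "below1 n p \<Longrightarrow> (\<And>i. i < n \<Longrightarrow> f i = 0) \<Longrightarrow> pr1 f p = 0"
  by (induction n p arbitrary: f rule: below1.induct) auto
lemma pr2_vanish: "below2 n p \<Longrightarrow> (\<And>i j. i + j < n \<Longrightarrow> f i j = 0) \<Longrightarrow> pr2 f p = 0"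
proof (induction n p arbitrary: f rule: below2.induct)
  case (3 n x xs)
  have "pr1 (f 0) x = 0" using 3(2,3) by (intro pr1_vanish[of "Suc n"]) auto
  moreover have "pr2 (\<lambda>n. f (Suc n)) xs = 0" using 3(2,3) by (intro 3(1)) auto
  ultimately show ?case by simp
qed auto
lemma pr3_vanish: "below3 n p \<Longrightarrow> (\<And>i j k. i + j + k < n \<Longrightarrow> f i j k = 0) \<Longrightarrow> pr3 f p = 0"
proof (induction n p arbitrary: f rule: below3.induct)
  case (3 n x xs)
  have "pr2 (f 0) x = 0" using 3(2,3) by (intro pr2_vanish[of "Suc n"]) auto
  moreover have "pr3 (\<lambda>n. f (Suc n)) xs = 0" using 3(2,3) by (intro 3(1)) auto
  ultimately show ?case by simp
qed auto

lemma pr1_lin: "pr1 (\<lambda>i. c * f i + g i) p = c * pr1 f p + pr1 g p"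
  by (induction p arbitrary: f g) (auto simp: algebra_simps)
lemma pr2_lin: "pr2 (\<lambda>i j. c * f i j + g i j) p = c * pr2 f p + pr2 g p"
proof (induction p arbitrary: f g)
  case (Cons x p)
  show ?case by (simp only: pr2.simps pr1_lin Cons) (simp add: algebra_simps)
qed simp
lemma pr3_lin: "pr3 (\<lambda>i j k. c * f i j k + g i j k) p = c * pr3 f p + pr3 g p"
proof (induction p arbitrary: f g)
  case (Cons x p)
  show ?case by (simp only: pr3.simps pr2_lin Cons) (simp add: algebra_simps)
qed simp

lemma pr1_0: "pr1 (\<lambda>i. 0) p = 0" by (induction p) auto
lemma pr2_0: "pr2 (\<lambda>i j. 0) p = 0" by (induction p) (auto simp: pr1_0)
lemma pr3_0: "pr3 (\<lambda>i j k. 0) p = 0" by (induction p) (auto simp: pr2_0)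

fun lsum :: "('a \<Rightarrow> F29) \<Rightarrow> 'a list \<Rightarrow> F29 list \<Rightarrow> F29" where
  "lsum g (a # as) (x # xs) = x * g a + lsum g as xs"
| "lsum g [] xs = 0"
| "lsum g as [] = 0"

lemma pr3_times: "pr3 \<nu> (times P as xs) =
    pr3 (\<lambda>i j k. lsum (\<lambda>a. \<nu> (i + nat (a ! 1)) (j + nat (a ! 2)) (k + nat (a ! 3))) as (map red xs)) P"
  by (induction P as xs rule: times.induct) (auto simp: pr3_add pr3_place pr3_sc pr3_lin pr3_0)

lemma pr3_combination:
  assumes "\<And>P A f. (P, A, f) \<in> set cs \<Longrightarrow> below3 n P \<and> (\<forall>i j k. i + j + k < n \<longrightarrow>
     lsum (\<lambda>a. \<nu> (i + nat (a ! 1)) (j + nat (a ! 2)) (k + nat (a ! 3))) A (map red f) = 0)"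
  shows "pr3 \<nu> (combination cs) = 0"
  using assms
proof (induction cs rule: combination.induct)
  case (2 P A f cs)
  have "pr3 \<nu> (times P A f) = 0"
    unfolding pr3_times using 2(2)[of P A f] by (intro pr3_vanish[of n]) auto
  moreover have "pr3 \<nu> (combination cs) = 0" using 2(2) by (intro 2(1)) (meson list.set_intros(2))
  ultimately show ?case by (simp add: pr3_add)
qed auto

text \<open>The combination equals the target monomial, since 28 is \<open>-1\<close>. A functional that annihilates the multiples
  of the forms therefore annihilates the target.\<close>

lemma certificate:
  assumes "zero3 (add3 (place t [[[28]]]) (combination cs))"
    and "\<And>P A f. (P, A, f) \<in> set cs \<Longrightarrow> below3 n P \<and> (\<forall>i j k. i + j + k < n \<longrightarrow>
     lsum (\<lambda>a. \<nu> (i + nat (a ! 1)) (j + nat (a ! 2)) (k + nat (a ! 3))) A (map red f) = 0)"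
  shows "\<nu> (nat (t ! 1)) (nat (t ! 2)) (nat (t ! 3)) = 0"
proof -
  have "pr3 \<nu> (place t [[[28]]]) = 0"
    using pr3_zero[OF assms(1), of \<nu>] pr3_combination[of cs n \<nu>, OF assms(2)] by (simp add: pr3_add)
  moreover have "red 28 \<noteq> 0" unfolding red_eq_0 by simp
  ultimately show ?thesis by (simp add: pr3_place)
qed

section \<open>Forms as lists of coefficients\<close>

lemma dotF_entries: "dotF (entries vs b as) cs = lsum (\<lambda>a. red (entry vs b a)) as cs"
  by (induction "\<lambda>a. red (entry vs b a)" as cs rule: lsum.induct) (auto simp: mult.commute)

lemma lsum_cong: "(\<And>a. a \<in> set as \<Longrightarrow> g a = h a) \<Longrightarrow> lsum g as xs = lsum h as xs"
  by (induction g as xs rule: lsum.induct) auto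

lemma lsum_nonzero: "lsum g as xs \<noteq> 0 \<Longrightarrow> \<exists>a\<in>set as. g a \<noteq> 0"
  by (induction g as xs rule: lsum.induct) auto

lemma lsum_sum: "(\<Sum>s\<in>S. lsum (g s) as xs) = lsum (\<lambda>a. \<Sum>s\<in>S. g s a) as xs"
  by (induction "\<lambda>a. \<Sum>s\<in>S. g s a" as xs rule: lsum.induct) (auto simp: sum.distrib sum_distrib_left)

lemma lsum_mult: "lsum g as xs * c = lsum (\<lambda>a. g a * c) as xs"
  by (induction g as xs rule: lsum.induct) (auto simp: algebra_simps)

lemma red_entry: "length vs = 5 \<Longrightarrow> length b = 5 \<Longrightarrow> length a = 5 \<Longrightarrow>
    red (entry vs b a) = (\<Prod>k<5. of_nat (nat (a ! k) choose nat (b ! k)) * red (vs ! k) ^ (nat (a ! k) - nat (b ! k)))"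
proof -
  have cell: "red (cell v b a) = of_nat (nat a choose nat b) * red v ^ (nat a - nat b)" for v b a
    by (simp add: cell_def)
  assume "length vs = 5" "length b = 5" "length a = 5"
  then obtain v0 v1 v2 v3 v4 b0 b1 b2 b3 b4 a0 a1 a2 a3 a4 where
    "vs = [v0, v1, v2, v3, v4]" "b = [b0, b1, b2, b3, b4]" "a = [a0, a1, a2, a3, a4]"
    by (auto simp: eval_nat_numeral length_Suc_conv)
  then show ?thesis by (simp add: eval_nat_numeral cell mult.assoc)
qed

definition good :: "int \<Rightarrow> int \<Rightarrow> int list \<Rightarrow> bool" where
  "good N \<kappa> a \<longleftrightarrow> length a = 5 \<and> list_all (\<lambda>x. 0 \<le> x) a \<and> sum_list a = N \<and>
     (a ! 1 + 6 * a ! 2 + 2 * a ! 3 + 5 * a ! 4) mod 7 = \<kappa>"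

locale coordinates =
  fixes ix :: "'n::finite \<Rightarrow> nat"
  assumes ix: "bij_betw ix UNIV {..<5}"
begin

lemma sum5: "(\<Sum>k\<in>UNIV. f (ix k)) = (\<Sum>k<5. f k)"
  by (rule sum.reindex_bij_betw[OF ix])

lemma prod5: "(\<Prod>k\<in>UNIV. f (ix k)) = (\<Prod>k<5. f k)"
  by (rule prod.reindex_bij_betw[OF ix])

lemma ix_less [simp]: "ix k < 5"
  using ix by (auto simp: bij_betw_def)

lemma card_index: "CARD('n) = 5"
  using bij_betw_same_card[OF ix] by simp

definition vl :: "int list \<Rightarrow> 'n \<Rightarrow> nat" where
  "vl a k = nat (a ! ix k)"

definition wt :: "('n \<Rightarrow> nat) \<Rightarrow> nat" where
  "wt a = (\<Sum>k\<in>UNIV. [0, 1, 6, 2, 5] ! ix k * a k)"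

lemma wt_add: "wt (\<lambda>k. a k + b k) = wt a + wt b"
  by (simp add: wt_def algebra_simps sum.distrib)

lemma good_exps:
  assumes "good N \<kappa> a"
  shows "vl a \<in> exps (nat N)" "int (wt (vl a)) mod 7 = \<kappa>"
proof -
  obtain a0 a1 a2 a3 a4 where a: "a = [a0, a1, a2, a3, a4]"
    using assms by (auto simp: good_def eval_nat_numeral length_Suc_conv)
  have "sum (vl a) UNIV = (\<Sum>k<5. nat (a ! k))" unfolding vl_def by (rule sum5)
  then show "vl a \<in> exps (nat N)" using assms by (auto simp: exps_def a good_def eval_nat_numeral nat_add_distrib)
  have "wt (vl a) = (\<Sum>k<5. [0, 1, 6, 2, 5] ! k * nat (a ! k))"
    unfolding vl_def wt_def by (rule sum5[of "\<lambda>k. [0, 1, 6, 2, 5] ! k * nat (a ! k)"])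
  then have "int (wt (vl a)) = a1 + 6 * a2 + 2 * a3 + 5 * a4"
    using assms by (simp add: a good_def eval_nat_numeral)
  then show "int (wt (vl a)) mod 7 = \<kappa>" using assms by (simp add: a good_def)
qed

definition lc :: "int list list \<Rightarrow> F29 list \<Rightarrow> ('n \<Rightarrow> nat) \<Rightarrow> F29" where
  "lc A x b = lsum (\<lambda>a. if vl a = b then 1 else 0) A x"

lemma lc_sum:
  assumes "\<forall>a\<in>set A. vl a \<in> exps d"
  shows "(\<Sum>b\<in>exps d. lc A x b * g b) = lsum (\<lambda>a. g (vl a)) A x"
proof -
  have "(\<Sum>b\<in>exps d. lc A x b * g b) = lsum (\<lambda>a. \<Sum>b\<in>exps d. (if vl a = b then 1 else 0) * g b) A x"
    unfolding lc_def lsum_mult by (rule lsum_sum)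
  also have "\<dots> = lsum (\<lambda>a. g (vl a)) A x"
    using assms by (intro lsum_cong) (simp add: if_distrib[of "\<lambda>x. x * _"] cong: if_cong)
  finally show ?thesis .
qed

lemma lc_nonzero: "lc A x b \<noteq> 0 \<Longrightarrow> \<exists>a\<in>set A. b = vl a"
  unfolding lc_def by (drule lsum_nonzero) (auto split: if_splits)

text \<open>Sums over all exponents are matched with the lists on which the certificates are computed.\<close>

lemma hasse_lc:
  assumes "\<forall>a\<in>set A. good N \<kappa> a" "length vs = 5" "length b = 5"
  shows "hasse (nat N) (lc A x) (vl b) (\<lambda>k. red (vs ! ix k)) = dotF (entries vs b A) x"
proof -
  have "of_nat (\<Prod>k\<in>UNIV. vl a k choose vl b k) * xpow (\<lambda>k. vl a k - vl b k) (\<lambda>k. red (vs ! ix k)) = red (entry vs b a)"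
    if "a \<in> set A" for a
  proof -
    have "length a = 5" using assms that by (auto simp: good_def)
    show ?thesis
      unfolding red_entry[OF assms(2,3) \<open>length a = 5\<close>] xpow_def vl_def of_nat_prod prod.distrib[symmetric]
      by (rule prod5[of "\<lambda>k. of_nat (nat (a ! k) choose nat (b ! k)) * red (vs ! k) ^ (nat (a ! k) - nat (b ! k))"])
  qed
  then have "lsum (\<lambda>a. of_nat (\<Prod>k\<in>UNIV. vl a k choose vl b k) * xpow (\<lambda>k. vl a k - vl b k) (\<lambda>k. red (vs ! ix k))) A x
      = dotF (entries vs b A) x"
    unfolding dotF_entries by (intro lsum_cong)
  then show ?thesis
    unfolding hasse_def using assms(1) good_exps(1) by (subst lc_sum) auto
qed

text \<open>The cyclic group of order 7, which is generated by the diagonal matrix with entries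
  \<open>7 ^ wt\<close>, acts on forms. The Hasse derivatives at the points of an orbit are, on an eigenspace of this
  action, proportional to those at a single point.\<close>

abbreviation twist :: "nat \<Rightarrow> ('n \<Rightarrow> F29) \<Rightarrow> 'n \<Rightarrow> F29" where
  "twist m x \<equiv> \<lambda>k. red 7 ^ (m * [0, 1, 6, 2, 5] ! ix k) * x k"

lemma seven: "red 7 ^ 7 = 1"
proof -
  have "red (7 ^ 7 mod 29) = 1" by simp
  then show ?thesis by (simp only: red_mod) simp
qed

lemma seven_mod: "a mod 7 = b mod 7 \<Longrightarrow> red 7 ^ a = red 7 ^ b"
proof -
  have "red 7 ^ a = red 7 ^ (a mod 7)" for a
  proof -
    have "red 7 ^ a = red 7 ^ (7 * (a div 7) + a mod 7)" by simp
    also have "\<dots> = red 7 ^ (a mod 7)" unfolding power_add power_mult seven by simp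
    finally show ?thesis .
  qed
  then show "a mod 7 = b mod 7 \<Longrightarrow> ?thesis" by metis
qed

lemma xpow_twist: "xpow a (twist m x) = red 7 ^ (m * wt a) * xpow a x"
  by (simp add: xpow_def wt_def power_mult_distrib prod.distrib power_sum[symmetric] power_mult[symmetric] sum_distrib_left mult_ac)

lemma hasse_twist:
  assumes "\<And>a. c a \<noteq> 0 \<Longrightarrow> wt a mod 7 = \<kappa>"
  shows "hasse d c b (twist m x) = red 7 ^ (m * (\<kappa> + 6 * wt b)) * hasse d c b x"
  unfolding hasse_def sum_distrib_left
proof (intro sum.cong refl)
  fix a
  show "c a * (of_nat (\<Prod>k\<in>UNIV. a k choose b k) * xpow (\<lambda>k. a k - b k) (twist m x)) =
      red 7 ^ (m * (\<kappa> + 6 * wt b)) * (c a * (of_nat (\<Prod>k\<in>UNIV. a k choose b k) * xpow (\<lambda>k. a k - b k) x))"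
  proof (cases "c a = 0 \<or> (\<exists>k. a k < b k)")
    case True
    then have "c a = 0 \<or> (\<Prod>k\<in>UNIV. a k choose b k) = 0"
    proof
      assume "\<exists>k. a k < b k"
      then obtain k where "a k < b k" by blast
      then have "(\<Prod>k\<in>UNIV. a k choose b k) = 0" by (intro prod_zero bexI[of _ k]) (simp_all add: binomial_eq_0)
      then show ?thesis ..
    qed simp
    then show ?thesis
    proof
      assume "(\<Prod>k\<in>UNIV. a k choose b k) = 0"
      show ?thesis unfolding \<open>(\<Prod>k\<in>UNIV. a k choose b k) = 0\<close> by simp
    qed simp
  next
    case False
    then have ab: "\<And>k. b k \<le> a k" "c a \<noteq> 0" by (auto simp: not_less)
    define e where "e = (\<lambda>k. a k - b k)"
    have a: "a = (\<lambda>k. e k + b k)" using ab(1) by (simp add: e_def)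
    have "wt a = wt e + wt b" by (subst a) (rule wt_add)
    then have "\<kappa> = (wt e + wt b) mod 7" using assms[OF ab(2)] by simp
    then have "(\<kappa> + 6 * wt b) mod 7 = (wt e + wt b + 6 * wt b) mod 7" by (simp only: mod_add_left_eq)
    also have "\<dots> = (wt e + 7 * wt b) mod 7" by (simp add: algebra_simps)
    also have "\<dots> = wt e mod 7" by simp
    finally have "wt (\<lambda>k. a k - b k) mod 7 = (\<kappa> + 6 * wt b) mod 7" by (simp only: e_def)
    then have "(m * wt (\<lambda>k. a k - b k)) mod 7 = (m * (\<kappa> + 6 * wt b)) mod 7" by (rule mod_mult_cong[OF refl])
    from seven_mod[OF this] show ?thesis unfolding xpow_twist by simp
  qed
qed

text \<open>Orthogonality of the characters of the cyclic group.\<close>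

lemma character_sum:
  assumes "m < 7" "l < 7"
  shows "(\<Sum>\<kappa><7. red 7 ^ (m * (\<kappa> + s)) * red 7 ^ (6 * l * (\<kappa> + s))) = (if m = l then 7 else 0)"
proof -
  define z where "z = red 7 ^ (m + 6 * l)"
  have "(\<Sum>\<kappa><7. red 7 ^ (m * (\<kappa> + s)) * red 7 ^ (6 * l * (\<kappa> + s))) = (\<Sum>\<kappa><7. z ^ (\<kappa> + s))"
    by (simp add: z_def power_add[symmetric] power_mult[symmetric] algebra_simps)
  also have "\<dots> = z ^ s * (\<Sum>\<kappa><7. z ^ \<kappa>)" by (simp add: power_add sum_distrib_left mult.commute)
  finally have sum: "(\<Sum>\<kappa><7. red 7 ^ (m * (\<kappa> + s)) * red 7 ^ (6 * l * (\<kappa> + s))) = z ^ s * (\<Sum>\<kappa><7. z ^ \<kappa>)" .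
  show ?thesis
  proof (cases "m = l")
    case True
    then have "z = red 7 ^ (7 * l)" by (simp add: z_def)
    then have "z = 1" by (simp only: power_mult seven power_one)
    with True show ?thesis unfolding sum by simp
  next
    case False
    have z7: "z ^ 7 = 1" 
      by (simp only: z_def power_mult[symmetric] mult.commute[of _ "7::nat"]) (simp only: power_mult seven power_one)
    have "z \<noteq> 1"
    proof
      assume z: "z = 1"
      have ne: "red 7 ^ k \<noteq> 1" if "k \<in> {1..6}" for k
      proof -
        have "k = 1 \<or> k = 2 \<or> k = 3 \<or> k = 4 \<or> k = 5 \<or> k = 6" using that by auto
        then have "(7 ^ k - 1) mod 29 \<noteq> (0::int)" by (elim disjE) simp_all
        then have "red (7 ^ k - 1) \<noteq> 0" unfolding red_eq_0 .
        then show ?thesis by simp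
      qed
      have "z = red 7 ^ ((m + 6 * l) mod 7)" unfolding z_def by (rule seven_mod) simp
      moreover have "(m + 6 * l) mod 7 \<in> {1..6}"
      proof -
        have "(m + 6 * l) mod 7 \<noteq> 0"
        proof
          assume "(m + 6 * l) mod 7 = 0"
          then obtain q where q: "m + 6 * l = 7 * q" by (auto simp: mod_eq_0_iff_dvd)
          then have "\<not> q < l" "\<not> l < q" using assms by linarith+
          with q False show False by simp
        qed
        moreover have "(m + 6 * l) mod 7 < 7" by simp
        ultimately show ?thesis unfolding atLeastAtMost_iff by linarith
      qed
      ultimately show False using ne z by metis
    qed
    moreover have "(z - 1) * (\<Sum>\<kappa><7. z ^ \<kappa>) = z ^ 7 - 1" by (simp add: power_diff_1_eq)
    ultimately have "(\<Sum>\<kappa><7. z ^ \<kappa>) = 0" using z7 by simp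
    with False show ?thesis unfolding sum by simp
  qed
qed

end

section \<open>The certificates\<close>

text \<open>The monomials of the five octics in which the first variable does not occur: the certificates are
  computed modulo this variable.\<close>

definition B0 :: "int list list" where
  "B0 = [[0, 0, 0, 4, 4], [0, 0, 1, 2, 5], [0, 0, 2, 0, 6], [0, 0, 3, 5, 0], [0, 0, 5, 1, 2], [0, 0, 4,
    3, 1], [0, 1, 0, 5, 2], [0, 1, 1, 3, 3], [0, 1, 2, 1, 4], [0, 1, 5, 2, 0], [0, 1, 6, 0, 1], [0,
    2, 0, 6, 0], [0, 2, 1, 4, 1], [0, 2, 3, 0, 3], [0, 3, 0, 0, 5], [0, 3, 2, 3, 0], [0, 4, 0, 1,
    3], [0, 5, 0, 2, 1], [0, 5, 1, 0, 2], [0, 2, 2, 2, 2], [0, 3, 3, 1, 1], [0, 4, 4, 0, 0], [0, 6,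
    1, 1, 0]]"

definition g0 :: "int list" where
  "g0 = [24, 0, 0, 0, 0, 0, 0, 22, 0, 0, 0, 0, 0, 0, 0, 0, 0, 0, 0, 13, 4, 25, 0]"

definition B1 :: "int list list" where
  "B1 = [[0, 0, 1, 4, 3], [0, 0, 0, 6, 2], [0, 0, 2, 2, 4], [0, 0, 3, 0, 5], [0, 1, 0, 0, 7], [0, 0, 6,
    1, 1], [0, 0, 5, 3, 0], [0, 1, 1, 5, 1], [0, 1, 0, 7, 0], [0, 1, 2, 3, 2], [0, 1, 7, 0, 0], [0,
    2, 0, 1, 5], [0, 2, 2, 4, 0], [0, 2, 3, 2, 1], [0, 3, 0, 2, 3], [0, 3, 1, 0, 4], [0, 3, 4, 1,
    0], [0, 4, 1, 1, 2], [0, 5, 2, 0, 1], [0, 8, 0, 0, 0], [0, 1, 3, 1, 3], [0, 2, 4, 0, 2], [0, 4,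
    0, 3, 1], [0, 5, 1, 2, 0]]"

definition g1 :: "int list" where
  "g1 = [10, 25, 8, 13, 6, 3, 4, 20, 0, 0, 28, 11, 11, 2, 17, 6, 5, 25, 5, 27, 26, 26, 20, 20]"

definition B2 :: "int list list" where
  "B2 = [[0, 0, 0, 1, 7], [0, 0, 2, 4, 2], [0, 0, 1, 6, 1], [0, 0, 0, 8, 0], [0, 0, 3, 2, 3], [0, 1, 0,
    2, 5], [0, 1, 1, 0, 6], [0, 1, 2, 5, 0], [0, 0, 7, 1, 0], [0, 1, 3, 3, 1], [0, 1, 4, 1, 2], [0,
    2, 0, 3, 3], [0, 2, 1, 1, 4], [0, 2, 4, 2, 0], [0, 2, 5, 0, 1], [0, 3, 0, 4, 1], [0, 6, 0, 0,
    2], [0, 3, 2, 0, 3], [0, 7, 0, 1, 0], [0, 0, 4, 0, 4], [0, 3, 1, 2, 2], [0, 4, 1, 3, 0], [0, 4,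
    2, 1, 1], [0, 5, 3, 0, 0]]"

definition g2 :: "int list" where
  "g2 = [13, 1, 5, 18, 15, 14, 23, 11, 9, 10, 6, 8, 20, 25, 10, 0, 21, 14, 9, 11, 9, 17, 25, 18]"

definition B5 :: "int list list" where
  "B5 = [[0, 0, 0, 0, 8], [0, 0, 1, 5, 2], [0, 0, 0, 7, 1], [0, 0, 2, 3, 3], [0, 0, 3, 1, 4], [0, 1, 0,
    1, 6], [0, 0, 6, 2, 0], [0, 0, 7, 0, 1], [0, 1, 1, 6, 0], [0, 1, 2, 4, 1], [0, 1, 3, 2, 2], [0,
    2, 0, 2, 4], [0, 2, 1, 0, 5], [0, 2, 3, 3, 0], [0, 2, 4, 1, 1], [0, 3, 0, 3, 2], [0, 3, 1, 1,
    3], [0, 4, 2, 0, 2], [0, 7, 0, 0, 1], [0, 1, 4, 0, 3], [0, 3, 5, 0, 0], [0, 4, 0, 4, 0], [0, 4,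
    1, 2, 1], [0, 5, 2, 1, 0]]"

definition g5 :: "int list" where
  "g5 = [12, 23, 26, 10, 4, 24, 12, 19, 22, 6, 21, 18, 7, 16, 25, 7, 25, 23, 26, 26, 4, 27, 14, 22]"

definition B6 :: "int list list" where
  "B6 = [[0, 0, 0, 2, 6], [0, 0, 1, 0, 7], [0, 0, 2, 5, 1], [0, 0, 1, 7, 0], [0, 0, 3, 3, 2], [0, 0, 4,
    1, 3], [0, 1, 0, 3, 4], [0, 1, 1, 1, 5], [0, 1, 3, 4, 0], [0, 0, 8, 0, 0], [0, 1, 4, 2, 1], [0,
    2, 0, 4, 2], [0, 1, 5, 0, 2], [0, 2, 1, 2, 3], [0, 2, 2, 0, 4], [0, 2, 5, 1, 0], [0, 5, 0, 0,
    3], [0, 6, 0, 1, 1], [0, 3, 0, 5, 0], [0, 7, 1, 0, 0], [0, 3, 1, 3, 1], [0, 3, 2, 1, 2], [0, 4,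
    3, 0, 1], [0, 4, 2, 2, 0]]"

definition g6 :: "int list" where
  "g6 = [28, 26, 11, 26, 19, 4, 3, 24, 15, 19, 16, 8, 26, 0, 10, 0, 2, 25, 0, 15, 10, 20, 16, 13]"

lemma restrict0: "filter (\<lambda>(a, x). hd a = 0) (zip A0 f0) = zip B0 g0" "length B0 = length g0"
  by (simp_all add: A0_def f0_def B0_def g0_def)

lemma restrict1: "filter (\<lambda>(a, x). hd a = 0) (zip A1 f1) = zip B1 g1" "length B1 = length g1"
  by (simp_all add: A1_def f1_def B1_def g1_def)

lemma restrict2: "filter (\<lambda>(a, x). hd a = 0) (zip A2 f2) = zip B2 g2" "length B2 = length g2"
  by (simp_all add: A2_def f2_def B2_def g2_def)

lemma restrict5: "filter (\<lambda>(a, x). hd a = 0) (zip A5 f5) = zip B5 g5" "length B5 = length g5"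
  by (simp_all add: A5_def f5_def B5_def g5_def)

lemma restrict6: "filter (\<lambda>(a, x). hd a = 0) (zip A6 f6) = zip B6 g6" "length B6 = length g6"
  by (simp_all add: A6_def f6_def B6_def g6_def)

lemma good0: "list_all (good 8 0) A0"
  by (simp add: A0_def good_def)

lemma good1: "list_all (good 8 1) A1"
  by (simp add: A1_def good_def)

lemma good2: "list_all (good 8 2) A2"
  by (simp add: A2_def good_def)

lemma good3: "list_all (good 8 3) A3"
  by (simp add: A3_def good_def)

lemma good4: "list_all (good 8 4) A4"
  by (simp add: A4_def good_def)

lemma good5: "list_all (good 8 5) A5"
  by (simp add: A5_def good_def)

lemma good6: "list_all (good 8 6) A6"
  by (simp add: A6_def good_def)

text \<open>The quartic monomials in the last three variables.\<close>

definition qmon :: "int list list" where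
  "qmon = [[0, 0, 0, 0, 4], [0, 0, 0, 1, 3], [0, 0, 0, 2, 2], [0, 0, 0, 3, 1], [0, 0, 0, 4, 0], [0, 0, 1,
    0, 3], [0, 0, 1, 1, 2], [0, 0, 1, 2, 1], [0, 0, 1, 3, 0], [0, 0, 2, 0, 2], [0, 0, 2, 1, 1], [0,
    0, 2, 2, 0], [0, 0, 3, 0, 1], [0, 0, 3, 1, 0], [0, 0, 4, 0, 0]]"

fun quartic :: "int list \<Rightarrow> int list list \<Rightarrow> int list \<Rightarrow> int list list \<Rightarrow> int list" where
  "quartic vs A f [] = []"
| "quartic vs A f (b # bs) = dotm (entries vs b A) f # quartic vs A f bs"

lemma quartic_u0: "quartic pu A0 f0 qmon =
    [24, 9, 28, 9, 24, 22, 8, 8, 22, 13, 26, 13, 4, 4, 25]"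
  by (simp only: quartic.simps qmon_def A0_def f0_def pu_def check_simps)

lemma quartic_u1: "quartic pu A1 f1 qmon =
    [2, 28, 19, 20, 8, 26, 20, 21, 23, 4, 10, 14, 19, 20, 0]"
  by (simp only: quartic.simps qmon_def A1_def f1_def pu_def check_simps)

lemma quartic_u2: "quartic pu A2 f2 qmon =
    [5, 0, 10, 8, 6, 14, 19, 7, 19, 28, 4, 6, 25, 13, 23]"
  by (simp only: quartic.simps qmon_def A2_def f2_def pu_def check_simps)

lemma quartic_u5: "quartic pu A5 f5 qmon =
    [6, 20, 22, 18, 24, 21, 16, 20, 26, 20, 22, 0, 3, 5, 21]"
  by (simp only: quartic.simps qmon_def A5_def f5_def pu_def check_simps)

lemma quartic_u6: "quartic pu A6 f6 qmon =
    [14, 19, 12, 7, 4, 22, 21, 18, 27, 9, 3, 19, 15, 22, 18]"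
  by (simp only: quartic.simps qmon_def A6_def f6_def pu_def check_simps)

lemma quartic_v0: "quartic pv A0 f0 qmon =
    [23, 28, 9, 22, 25, 25, 14, 3, 23, 28, 12, 22, 16, 20, 20]"
  by (simp only: quartic.simps qmon_def A0_def f0_def pv_def check_simps)

lemma quartic_v1: "quartic pv A1 f1 qmon =
    [1, 10, 13, 25, 21, 1, 14, 28, 2, 23, 15, 25, 22, 21, 12]"
  by (simp only: quartic.simps qmon_def A1_def f1_def pv_def check_simps)

lemma quartic_v2: "quartic pv A2 f2 qmon =
    [13, 24, 5, 5, 8, 22, 17, 15, 9, 27, 1, 1, 8, 10, 21]"
  by (simp only: quartic.simps qmon_def A2_def f2_def pv_def check_simps)

lemma quartic_v5: "quartic pv A5 f5 qmon =
    [25, 16, 19, 11, 6, 15, 2, 6, 7, 26, 6, 3, 12, 5, 12]"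
  by (simp only: quartic.simps qmon_def A5_def f5_def pv_def check_simps)

lemma quartic_v6: "quartic pv A6 f6 qmon =
    [28, 28, 6, 1, 10, 4, 3, 1, 21, 6, 20, 16, 8, 6, 18]"
  by (simp only: quartic.simps qmon_def A6_def f6_def pv_def check_simps)

lemmas certificate_simps = combination.simps times.simps place_simp shift1.simps shift2.simps sc1.simps sc2.simps
  sc3.simps add1.simps add2.simps add3.simps zero1.simps zero2.simps zero3.simps simp_thms mulm_tab addm_tab
  nz_tab shift_tab

lemmas below_simps = below1.simps below2.simps below3.simps eval_nat_numeral BitM.simps list.pred_inject prod.case simp_thms

text \<open>Multipliers of degree 10 which combine the five octics to \<open>x\<^sub>1 ^ 18\<close>, modulo \<open>x\<^sub>0\<close>. They are dehomogenised with
  respect to the last variable. The certificates for the other variables follow.\<close>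

definition cP1 :: "(int list list list \<times> int list list \<times> int list) list" where
  "cP1 =
    [([[[0, 0, 0, 0, 0, 0, 9], [0, 0, 0, 0, 11], [0, 0, 20], [1, 0, 0, 0, 0, 0, 0, 6], [0, 0, 0, 0, 0,
      9], [0, 0, 0, 23], [0, 23], [], [], [], [11]], [[7, 0, 0, 0, 0, 0, 0, 1], [0, 0, 0, 0, 0, 6],
      [0, 0, 0, 26], [], [], [0, 0, 0, 0, 10], [0, 0, 25], [8]], [[0, 21, 0, 0, 0, 0, 0, 0, 9], [],
      [0, 0, 0, 0, 4], [0, 0, 12], [22], [], [], [0, 12]], [[0, 0, 26], [], [0, 0, 0, 0, 0, 19], [0,
      0, 0, 19]], [[0, 0, 0, 8], [0, 7], [], [], [0, 0, 14], [9]], [[0, 0, 0, 0, 17], [0, 0, 18],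
      [11]], [[], [0, 0, 0, 21], [0, 8]], [[], [], [], [10]], [[3]], [[0, 3]]],
      B0, g0),
     ([[[0, 0, 0, 0, 22], [0, 0, 23, 0, 0, 0, 0, 0, 0, 26], [28, 0, 0, 0, 0, 0, 0, 12], [0, 0, 0, 0,
      0, 7], [0, 0, 0, 2], [0, 1], [], [], [0, 0, 1], [17]], [[], [0, 0, 0, 4], [0, 1], [0, 0, 0, 0,
      0, 0, 27], [0, 0, 0, 0, 1], [0, 0, 18], [9]], [[0, 0, 0, 0, 0, 0, 7], [0, 0, 0, 0, 14], [0, 0,
      1], [8], [], [0, 0, 0, 2], [0, 9]], [[25, 0, 0, 0, 0, 0, 0, 13], [0, 0, 0, 0, 0, 20], [0, 0, 0,
      25], [0, 11], [], [], [], [2]], [[0, 17], [], [0, 0, 0, 0, 5], [0, 0, 2]], [[0, 0, 4], [23]],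
      [[0, 0, 0, 19], [0, 7]], [[], [0, 0, 24], [6]], [], [], [[14]]],
      B1, g1),
     ([[[0, 0, 0, 0, 0, 0, 0, 0, 0, 14], [8, 0, 0, 0, 0, 0, 0, 27], [0, 0, 0, 0, 0, 17], [0, 0, 0,
      15], [0, 28], [], [0, 0, 0, 0, 22], [0, 0, 15], [25]], [[], [0, 18, 0, 0, 0, 0, 0, 0, 10], [0,
      0, 0, 0, 0, 0, 12], [0, 0, 0, 0, 5], [0, 0, 14], [13], [], [], [0, 11]], [[0, 0, 0, 0, 9], [0,
      0, 7], [3], [0, 0, 0, 0, 0, 12], [0, 0, 0, 27]], [[0, 0, 0, 0, 0, 13], [0, 0, 0, 21], [], [],
      [], [0, 0, 23], [19]], [[0, 0, 0, 0, 0, 0, 19], [0, 0, 0, 0, 5], [0, 0, 6], [10]], [[18], [],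
      [0, 0, 0, 19], [0, 10]], [[0, 7]], [[0, 0, 15], [11]]],
      B2, g2),
     ([[[0, 0, 0, 11, 0, 0, 0, 0, 0, 0, 26], [0, 5, 0, 0, 0, 0, 0, 0, 22], [0, 0, 0, 0, 0, 0, 28], [0,
      0, 0, 0, 28], [0, 0, 18], [20], [], [0, 0, 0, 17]], [[0, 0, 0, 0, 7], [0, 0, 10], [6, 0, 0, 0,
      0, 0, 0, 25], [0, 0, 0, 0, 0, 25], [0, 0, 0, 24], [0, 14], [], [], [], [26]], [[0, 0, 0, 0, 0,
      24], [0, 0, 0, 22], [0, 2], [], [], [0, 0, 5], [23]], [[0, 0, 0, 0, 0, 0, 10], [0, 0, 0, 0, 5],
      [0, 0, 19], [5], [], [], [0, 20]], [[2], [0, 0, 0, 0, 0, 1], [0, 0, 0, 23], [0, 25]], [[0, 27],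
      [], [], [0, 0, 10]], [[0, 0, 19], [22]]],
      B5, g5),
     ([[[0, 16, 0, 0, 0, 0, 0, 0, 9], [0, 0, 0, 0, 0, 0, 9], [0, 0, 0, 0, 5], [0, 0, 14], [18], [],
      [0, 0, 0, 21], [0, 16]], [[0, 0, 0, 0, 0, 0, 0, 0, 0, 9], [6, 0, 0, 0, 0, 0, 0, 3], [0, 0, 0, 0,
      0, 26], [0, 0, 0, 25], [], [], [], [0, 0, 12], [10]], [[0, 0, 0, 21], [0, 14], [0, 0, 0, 0, 0,
      0, 20], [0, 0, 0, 0, 16], [0, 0, 18], [20]], [[0, 0, 0, 0, 22], [0, 0, 14], [24], [], [0, 0, 0,
      26], [0, 19]], [[0, 0, 0, 0, 0, 1], [0, 0, 0, 14], [0, 8]], [[], [0, 0, 0, 0, 5], [0, 0, 6]]],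
      B6, g6)]"

lemma cP1: "zero3 (add3 (place [0, 18, 0, 0, 0] [[[28]]]) (combination cP1))"
  by (simp only: cP1_def B0_def g0_def B1_def g1_def B2_def g2_def B5_def g5_def B6_def g6_def certificate_simps)

lemma cP1_below: "list_all (\<lambda>(P, A, f). below3 11 P) cP1" "map snd cP1 = [(B0, g0), (B1, g1), (B2, g2), (B5, g5), (B6, g6)]"
  by (simp_all only: cP1_def below_simps list.map snd_conv)

definition cP2 :: "(int list list list \<times> int list list \<times> int list) list" where
  "cP2 =
    [([[[0, 0, 0, 0, 24], [0, 0, 5, 0, 0, 0, 0, 0, 0, 15], [9, 0, 0, 0, 0, 0, 0, 24], [0, 0, 0, 0, 0,
      6], [0, 0, 0, 16], [0, 21], [], [], [0, 0, 24], [25]], [[0, 0, 0, 0, 0, 14], [0, 0, 0, 9], [0,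
      3], [0, 0, 0, 0, 0, 0, 9], [0, 0, 0, 0, 13], [0, 0, 10], [27]], [[0, 0, 0, 0, 0, 0, 3], [0, 0,
      0, 0, 23], [0, 0, 9], [1], [], [0, 0, 0, 12], [0, 19]], [[11, 0, 0, 0, 0, 0, 0, 27], [0, 0, 0,
      0, 0, 18], [], [0, 23], [], [], [], [14]], [[0, 27], [], [0, 0, 0, 0, 9], [0, 0, 10], [20]],
      [[0, 0, 27], [11], [], [], [0, 13]], [[0, 0, 0, 20], [0, 25]], [[], [0, 0, 27], [17]]],
      B0, g0),
     ([[[0, 0, 17, 0, 0, 0, 0, 0, 0, 11], [25, 0, 0, 0, 0, 0, 0, 16], [0, 0, 0, 0, 0, 15], [0, 0, 0,
      8], [0, 14], [], [0, 0, 0, 0, 12], [0, 0, 1], [13]], [[0, 0, 0, 2], [0, 27, 0, 0, 0, 0, 0, 0,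
      3], [0, 0, 0, 0, 0, 0, 5], [0, 0, 0, 0, 7], [0, 0, 13], [6], [], [], [0, 15]], [[0, 0, 0, 0,
      12], [0, 0, 26], [6], [0, 0, 0, 0, 0, 10], [0, 0, 0, 18], [0, 28]], [[0, 0, 0, 0, 0, 24], [0, 0,
      0, 12], [0, 1], [], [], [0, 0, 13], [10]], [[0, 0, 0, 0, 0, 0, 26], [0, 0, 0, 0, 11], [0, 0, 2],
      [5]], [[26], [], [0, 0, 0, 23], [0, 22]], [[0, 8]]],
      B1, g1),
     ([[[17, 0, 0, 0, 0, 0, 0, 23], [0, 0, 0, 0, 0, 5], [], [0, 1], [0, 0, 0, 0, 0, 0, 21], [0, 0, 0,
      0, 17], [], [15]], [[0, 21, 0, 0, 0, 0, 0, 0, 28], [0, 0, 0, 0, 0, 0, 20], [0, 0, 0, 0, 18], [0,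
      0, 21], [7], [], [0, 0, 0, 8], [0, 11]], [[0, 0, 15], [16, 0, 0, 0, 0, 0, 0, 10], [0, 0, 0, 0,
      0, 17], [0, 0, 0, 12], [0, 8], [], [], [], [4]], [[0, 0, 0, 9], [0, 18], [], [0, 0, 0, 0, 9],
      [0, 0, 17], [19]], [[0, 0, 0, 0, 1], [0, 0, 26], [26]], [[0, 0, 0, 0, 0, 9], [0, 0, 0, 28], [0,
      11]], [[], [], [0, 0, 1], [21]], [[5]]],
      B2, g2),
     ([[[0, 13, 0, 0, 0, 0, 0, 0, 17], [0, 0, 0, 0, 0, 0, 13], [0, 0, 0, 0, 3], [0, 0, 21], [17], [0,
      0, 0, 0, 0, 12], [0, 0, 0, 26], [0, 5]], [[0, 0, 22, 0, 0, 0, 0, 0, 0, 23], [25, 0, 0, 0, 0, 0,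
      0, 21], [0, 0, 0, 0, 0, 18], [0, 0, 0, 28], [0, 26], [], [], [0, 0, 15], [15]], [[0, 0, 0, 11],
      [0, 20], [0, 0, 0, 0, 0, 0, 14], [0, 0, 0, 0, 19], [0, 0, 21], [17]], [[0, 0, 0, 0, 21], [0, 0,
      27], [2], [], [0, 0, 0, 1], [0, 13]], [[0, 0, 0, 0, 0, 4], [0, 0, 0, 2], [0, 27]], [[], [0, 0,
      0, 0, 20], [0, 0, 27], [11]], [[8]]],
      B5, g5),
     ([[[0, 0, 0, 0, 0, 0, 2], [0, 0, 0, 0, 6], [0, 0, 13], [26, 0, 0, 0, 0, 0, 0, 10], [0, 0, 0, 0,
      0, 12], [0, 0, 0, 3], [0, 17], [], [], [], [26]], [[0, 0, 0, 0, 0, 0, 0, 23], [0, 0, 0, 0, 0,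
      28], [0, 0, 0, 4], [0, 22], [], [0, 0, 0, 0, 11], [0, 0, 27], [2]], [[0, 7, 0, 0, 0, 0, 0, 0,
      16], [0, 0, 0, 0, 0, 0, 14], [0, 0, 0, 0, 2], [0, 0, 6], [13], [], [], [0, 5]], [[0, 0, 20],
      [21], [0, 0, 0, 0, 0, 1], [0, 0, 0, 6], [0, 24]], [[0, 0, 0, 28], [0, 26]], [[0, 0, 0, 0, 20],
      [0, 0, 17], [10]], [[], [0, 0, 0, 16]]],
      B6, g6)]"

lemma cP2: "zero3 (add3 (place [0, 0, 18, 0, 0] [[[28]]]) (combination cP2))"
  by (simp only: cP2_def B0_def g0_def B1_def g1_def B2_def g2_def B5_def g5_def B6_def g6_def certificate_simps)

lemma cP2_below: "list_all (\<lambda>(P, A, f). below3 11 P) cP2" "map snd cP2 = [(B0, g0), (B1, g1), (B2, g2), (B5, g5), (B6, g6)]"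
  by (simp_all only: cP2_def below_simps list.map snd_conv)

definition cP3 :: "(int list list list \<times> int list list \<times> int list) list" where
  "cP3 =
    [([[[12], [0, 0, 0, 0, 0, 16], [], [0, 7], [0, 0, 0, 0, 0, 0, 11], [0, 0, 0, 0, 12], [0, 0, 5],
      [27]], [[0, 27, 0, 0, 0, 0, 0, 0, 17], [0, 0, 0, 0, 0, 0, 1], [0, 0, 0, 0, 20], [0, 0, 17], [7],
      [], [0, 0, 0, 8], [0, 25]], [[0, 0, 12], [11, 0, 0, 0, 0, 0, 0, 20], [0, 0, 0, 0, 0, 21], [0, 0,
      0, 14], [0, 8], [], [], [], [22]], [[0, 0, 0, 5], [0, 22], [], [0, 0, 0, 0, 26], [0, 0, 23],
      [3]], [[0, 0, 0, 0, 17], [0, 0, 26], [7], [], [], [0, 16]], [[0, 0, 0, 0, 0, 15], [0, 0, 0, 8],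
      [0, 27]], [[], [], [0, 0, 23], [11]], [[21]], [[0, 18]]],
      B0, g0),
     ([[[0, 0, 0, 0, 0, 17], [0, 0, 0, 1], [0, 10, 0, 0, 0, 0, 0, 0, 22], [0, 0, 0, 0, 0, 0, 26], [0,
      0, 0, 0, 23], [0, 0, 25], [26], [], [], [0, 17]], [[0, 0, 0, 0, 0, 0, 2], [], [0, 0, 8], [4],
      [0, 0, 0, 0, 0, 3], [0, 0, 0, 3], [0, 19]], [[7, 0, 0, 0, 0, 0, 0, 11], [0, 0, 0, 0, 0, 26], [0,
      0, 0, 16], [0, 11], [], [], [0, 0, 9], [17]], [[0, 10], [0, 0, 0, 0, 0, 0, 1], [0, 0, 0, 0, 27],
      [0, 0, 5], [7]], [[0, 0, 17], [22], [], [0, 0, 0, 22]], [[0, 0, 0, 6], [0, 1]], [[0, 0, 0, 0,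
      6], [0, 0, 24], [28]]],
      B1, g1),
     ([[[0, 0, 0, 17, 0, 0, 0, 0, 0, 0, 21], [0, 11, 0, 0, 0, 0, 0, 0, 19], [0, 0, 0, 0, 0, 0, 19],
      [0, 0, 0, 0, 19], [0, 0, 3], [8], [], [0, 0, 0, 24], [0, 27]], [[0, 0, 0, 0, 9], [0, 0, 6], [2,
      0, 0, 0, 0, 0, 0, 25], [0, 0, 0, 0, 0, 18], [0, 0, 0, 19], [0, 3], [], [], [], [2]], [[0, 0, 0,
      0, 0, 4], [0, 0, 0, 22], [0, 18], [], [0, 0, 0, 0, 5], [0, 0, 6], [19]], [[0, 0, 0, 0, 0, 0,
      25], [0, 0, 0, 0, 25], [0, 0, 11], [5], [], [], [0, 7]], [[12], [0, 0, 0, 0, 0, 20], [0, 0, 0,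
      13], [0, 14]], [[0, 28], [], [], [0, 0, 26]], [[0, 0, 26], [25]], [[0, 0, 0, 11], [0, 15]]],
      B2, g2),
     ([[[0, 0, 0, 0, 4], [0, 0, 1, 0, 0, 0, 0, 0, 0, 27], [27, 0, 0, 0, 0, 0, 0, 7], [0, 0, 0, 0, 0,
      1], [0, 0, 0, 17], [0, 26], [], [], [0, 0, 20], [21]], [[0, 0, 0, 0, 0, 11], [0, 0, 0, 7], [0,
      20], [0, 0, 0, 0, 0, 0, 2], [0, 0, 0, 0, 16], [0, 0, 7], [26]], [[0, 0, 0, 0, 0, 0, 4], [0, 0,
      0, 0, 13], [0, 0, 13], [24], [], [0, 0, 0, 1], [0, 28]], [[11, 0, 0, 0, 0, 0, 0, 5], [0, 0, 0,
      0, 0, 5], [0, 0, 0, 21], [0, 28], [], [], [], [13]], [[0, 14], [], [0, 0, 0, 0, 13], [0, 0,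
      14]], [[0, 0, 13], [20]], [[0, 0, 0, 6], [0, 15]], [[], [], [20]]],
      B5, g5),
     ([[[0, 0, 6, 0, 0, 0, 0, 0, 0, 6], [21, 0, 0, 0, 0, 0, 0, 7], [0, 0, 0, 0, 0, 9], [0, 0, 0, 15],
      [0, 6], [], [0, 0, 0, 0, 6], [0, 0, 23], [8]], [[0, 0, 0, 17], [0, 26, 0, 0, 0, 0, 0, 0, 19],
      [0, 0, 0, 0, 0, 0, 1], [0, 0, 0, 0, 8], [0, 0, 14], [20], [], [], [0, 3]], [[0, 0, 0, 0, 9], [0,
      0, 12], [12], [0, 0, 0, 0, 0, 22], [0, 0, 0, 15], [0, 9]], [[0, 0, 0, 0, 0, 1], [0, 0, 0, 8],
      [0, 9], [], [], [0, 0, 28], [16]], [[0, 0, 0, 0, 0, 0, 16], [0, 0, 0, 0, 6], [0, 0, 5], [10]],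
      [[28], [], [0, 0, 0, 7]]],
      B6, g6)]"

lemma cP3: "zero3 (add3 (place [0, 0, 0, 18, 0] [[[28]]]) (combination cP3))"
  by (simp only: cP3_def B0_def g0_def B1_def g1_def B2_def g2_def B5_def g5_def B6_def g6_def certificate_simps)

lemma cP3_below: "list_all (\<lambda>(P, A, f). below3 11 P) cP3" "map snd cP3 = [(B0, g0), (B1, g1), (B2, g2), (B5, g5), (B6, g6)]"
  by (simp_all only: cP3_def below_simps list.map snd_conv)

definition cP4 :: "(int list list list \<times> int list list \<times> int list) list" where
  "cP4 =
    [([[[0, 0, 0, 3, 0, 0, 0, 0, 0, 0, 5], [0, 18, 0, 0, 0, 0, 0, 0, 20], [0, 0, 0, 0, 0, 0, 15], [0,
      0, 0, 0, 6], [0, 0, 28], [15], [], [0, 0, 0, 2], [0, 5]], [[0, 0, 0, 0, 3], [0, 0, 3], [20, 0,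
      0, 0, 0, 0, 0, 11], [0, 0, 0, 0, 0, 28], [0, 0, 0, 5], [], [], [], [], [13]], [[0, 0, 0, 0, 0,
      27], [0, 0, 0, 28], [0, 17], [], [0, 0, 0, 0, 25], [0, 0, 28], [4]], [[0, 0, 0, 0, 0, 0, 3], [0,
      0, 0, 0, 3], [0, 0, 25], [], [], [], [0, 17]], [[15], [0, 0, 0, 0, 0, 23], [0, 0, 0, 10], [0,
      6]], [[0, 16], [], [], [0, 0, 19], [25]], [[0, 0, 17], [19]], [[0, 0, 0, 10], [0, 23]], [[], [],
      [3]]],
      B0, g0),
     ([[[0, 15], [0, 0, 0, 0, 0, 0, 14], [0, 0, 0, 0, 17], [0, 0, 27], [12], [0, 0, 0, 0, 0, 23], [0,
      0, 0, 6], [0, 2]], [[], [20, 0, 0, 0, 0, 0, 0, 26], [0, 0, 0, 0, 0, 9], [0, 0, 0, 12], [0, 2],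
      [], [], [0, 0, 3], [7]], [[0, 0, 0, 19], [0, 10], [0, 0, 0, 0, 0, 0, 3], [0, 0, 0, 0, 6], [0, 0,
      1], [2]], [[0, 0, 0, 0, 24], [0, 0, 14], [12], [], [0, 0, 0, 17], [0, 8]], [[0, 0, 0, 0, 0, 17],
      [0, 0, 0, 28], [0, 6]], [[], [0, 0, 0, 0, 22], [0, 0, 24], [19]], [[], [], [], [0, 3]]],
      B1, g1),
     ([[[], [], [0, 0, 12], [1], [0, 0, 0, 0, 0, 1], [0, 0, 0, 26], [0, 20], [], [], [], [26]], [[1,
      0, 0, 0, 0, 0, 0, 5], [0, 0, 0, 0, 0, 15], [0, 0, 0, 8], [0, 25], [], [0, 0, 0, 0, 9], [0, 0,
      19], [4]], [[0, 28], [0, 0, 0, 0, 0, 0, 3], [0, 0, 0, 0, 9], [0, 0, 22], [23], [], [], [0, 8]],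
      [[0, 0, 21], [27], [0, 0, 0, 0, 0, 22], [0, 0, 0, 16]], [[0, 0, 0, 25], [0, 16]], [[0, 0, 0, 0,
      13], [0, 0, 5], [26]], [[], [0, 0, 0, 13], [0, 1]], [[], [], [], [20]]],
      B2, g2),
     ([[[17, 0, 0, 0, 0, 0, 0, 11], [0, 0, 0, 0, 0, 7], [0, 0, 0, 24], [0, 12], [0, 0, 0, 0, 0, 0, 8],
      [0, 0, 0, 0, 14], [0, 0, 16], [21]], [[0, 13, 0, 0, 0, 0, 0, 0, 1], [0, 0, 0, 0, 0, 0, 1], [0,
      0, 0, 0, 18], [0, 0, 14], [4], [], [0, 0, 0, 10], [0, 1]], [[0, 0, 6], [23, 0, 0, 0, 0, 0, 0,
      17], [0, 0, 0, 0, 0, 8], [0, 0, 0, 13], [0, 20], [], [], [], [12]], [[0, 0, 0, 8], [0, 14], [],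
      [0, 0, 0, 0, 25], [0, 0, 28], [2]], [[0, 0, 0, 0, 6], [], [18]], [[], [0, 0, 0, 26], [0, 16]],
      [[], [], [0, 0, 25], [21]]],
      B5, g5),
     ([[[0, 0, 0, 0, 0, 6], [0, 0, 0, 24], [0, 24], [0, 0, 0, 0, 0, 0, 27], [0, 0, 0, 0, 22], [0, 0,
      17], [25], [], [], [0, 6]], [[0, 0, 0, 0, 0, 0, 4], [0, 0, 0, 0, 17], [0, 0, 27], [5], [0, 0, 0,
      0, 0, 16], [0, 0, 0, 18], [0, 27]], [[15, 0, 0, 0, 0, 0, 0, 18], [0, 0, 0, 0, 0, 2], [0, 0, 0,
      13], [0, 9], [], [], [0, 0, 8], [22]], [[0, 27], [0, 0, 0, 0, 0, 0, 15], [0, 0, 0, 0, 10], [0,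
      0, 23], [14]], [[0, 0, 21], [21], [], [0, 0, 0, 13]], [[0, 0, 0, 6], [0, 16]], [[0, 0, 0, 0,
      28], [0, 0, 25]]],
      B6, g6)]"

lemma cP4: "zero3 (add3 (place [0, 0, 0, 0, 18] [[[28]]]) (combination cP4))"
  by (simp only: cP4_def B0_def g0_def B1_def g1_def B2_def g2_def B5_def g5_def B6_def g6_def certificate_simps)

lemma cP4_below: "list_all (\<lambda>(P, A, f). below3 11 P) cP4" "map snd cP4 = [(B0, g0), (B1, g1), (B2, g2), (B5, g5), (B6, g6)]"
  by (simp_all only: cP4_def below_simps list.map snd_conv)

text \<open>Quadratic multipliers which combine the leading quartics at \<open>pu\<close>, modulo \<open>x\<^sub>0\<close> and \<open>x\<^sub>1\<close>, to
  \<open>x\<^sub>2 ^ 6\<close>. The other certificates of this kind are for the remaining variables, and for \<open>pv\<close>.\<close>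

definition cU2 :: "(int list list list \<times> int list list \<times> int list) list" where
  "cU2 =
    [([[[8, 1, 17], [23, 5], [8]]],
      qmon, quartic pu A0 f0 qmon),
     ([[[23, 2, 26], [12, 4], [7]]],
      qmon, quartic pu A1 f1 qmon),
     ([[[27, 8, 15], [13, 8], [25]]],
      qmon, quartic pu A2 f2 qmon),
     ([[[20, 17, 11], [4, 28], [17]]],
      qmon, quartic pu A5 f5 qmon),
     ([[[0, 20, 4], [8]]],
      qmon, quartic pu A6 f6 qmon)]"

lemma cU2: "zero3 (add3 (place [0, 0, 6, 0, 0] [[[28]]]) (combination cU2))"
  unfolding cU2_def quartic_u0 quartic_u1 quartic_u2 quartic_u5 quartic_u6
  by (simp only: qmon_def certificate_simps)

lemma cU2_below: "list_all (\<lambda>(P, A, f). below3 3 P) cU2" "map snd cU2 = [(qmon, quartic pu A0 f0 qmon), (qmon, quartic pu A1 f1 qmon), (qmon, quartic pu A2 f2 qmon), (qmon, quartic pu A5 f5 qmon), (qmon, quartic pu A6 f6 qmon)]"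
  by (simp_all only: cU2_def below_simps list.map snd_conv)

definition cU3 :: "(int list list list \<times> int list list \<times> int list) list" where
  "cU3 =
    [([[[19, 24, 11], [6, 8], [24]]],
      qmon, quartic pu A0 f0 qmon),
     ([[[26, 13, 11], [7, 19], [20]]],
      qmon, quartic pu A1 f1 qmon),
     ([[[24, 7, 12], [17, 19], [4]]],
      qmon, quartic pu A2 f2 qmon),
     ([[[6, 23, 15], [27, 1], [14]]],
      qmon, quartic pu A5 f5 qmon),
     ([[[23, 25], [4]]],
      qmon, quartic pu A6 f6 qmon)]"

lemma cU3: "zero3 (add3 (place [0, 0, 0, 6, 0] [[[28]]]) (combination cU3))"
  unfolding cU3_def quartic_u0 quartic_u1 quartic_u2 quartic_u5 quartic_u6
  by (simp only: qmon_def certificate_simps)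

lemma cU3_below: "list_all (\<lambda>(P, A, f). below3 3 P) cU3" "map snd cU3 = [(qmon, quartic pu A0 f0 qmon), (qmon, quartic pu A1 f1 qmon), (qmon, quartic pu A2 f2 qmon), (qmon, quartic pu A5 f5 qmon), (qmon, quartic pu A6 f6 qmon)]"
  by (simp_all only: cU3_def below_simps list.map snd_conv)

definition cU4 :: "(int list list list \<times> int list list \<times> int list) list" where
  "cU4 =
    [([[[7, 22, 1], [19, 28], [16]]],
      qmon, quartic pu A0 f0 qmon),
     ([[[18, 27, 7], [11, 19], [17]]],
      qmon, quartic pu A1 f1 qmon),
     ([[[28, 17, 15], [4, 5], [19]]],
      qmon, quartic pu A2 f2 qmon),
     ([[[19, 9, 18], [2, 18], [14]]],
      qmon, quartic pu A5 f5 qmon),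
     ([[[15, 20, 9], [11]]],
      qmon, quartic pu A6 f6 qmon)]"

lemma cU4: "zero3 (add3 (place [0, 0, 0, 0, 6] [[[28]]]) (combination cU4))"
  unfolding cU4_def quartic_u0 quartic_u1 quartic_u2 quartic_u5 quartic_u6
  by (simp only: qmon_def certificate_simps)

lemma cU4_below: "list_all (\<lambda>(P, A, f). below3 3 P) cU4" "map snd cU4 = [(qmon, quartic pu A0 f0 qmon), (qmon, quartic pu A1 f1 qmon), (qmon, quartic pu A2 f2 qmon), (qmon, quartic pu A5 f5 qmon), (qmon, quartic pu A6 f6 qmon)]"
  by (simp_all only: cU4_def below_simps list.map snd_conv)

definition cV2 :: "(int list list list \<times> int list list \<times> int list) list" where
  "cV2 =
    [([[[4, 18, 23], [10, 12], [12]]],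
      qmon, quartic pv A0 f0 qmon),
     ([[[22, 26, 27], [8, 14], [24]]],
      qmon, quartic pv A1 f1 qmon),
     ([[[22, 19, 20], [3, 4], [11]]],
      qmon, quartic pv A2 f2 qmon),
     ([[[26, 25, 19], [2, 8], [19]]],
      qmon, quartic pv A5 f5 qmon),
     ([[[6, 1, 15], [13]]],
      qmon, quartic pv A6 f6 qmon)]"

lemma cV2: "zero3 (add3 (place [0, 0, 6, 0, 0] [[[28]]]) (combination cV2))"
  unfolding cV2_def quartic_v0 quartic_v1 quartic_v2 quartic_v5 quartic_v6
  by (simp only: qmon_def certificate_simps)

lemma cV2_below: "list_all (\<lambda>(P, A, f). below3 3 P) cV2" "map snd cV2 = [(qmon, quartic pv A0 f0 qmon), (qmon, quartic pv A1 f1 qmon), (qmon, quartic pv A2 f2 qmon), (qmon, quartic pv A5 f5 qmon), (qmon, quartic pv A6 f6 qmon)]"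
  by (simp_all only: cV2_def below_simps list.map snd_conv)

definition cV3 :: "(int list list list \<times> int list list \<times> int list) list" where
  "cV3 =
    [([[[8, 16, 25], [19, 23], [27]]],
      qmon, quartic pv A0 f0 qmon),
     ([[[22, 13, 26], [27, 9], [16]]],
      qmon, quartic pv A1 f1 qmon),
     ([[[2, 26, 18], [25, 26], [28]]],
      qmon, quartic pv A2 f2 qmon),
     ([[[5, 18, 12], [5, 21], [6]]],
      qmon, quartic pv A5 f5 qmon),
     ([[[9, 21, 18], [15]]],
      qmon, quartic pv A6 f6 qmon)]"

lemma cV3: "zero3 (add3 (place [0, 0, 0, 6, 0] [[[28]]]) (combination cV3))"
  unfolding cV3_def quartic_v0 quartic_v1 quartic_v2 quartic_v5 quartic_v6
  by (simp only: qmon_def certificate_simps)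

lemma cV3_below: "list_all (\<lambda>(P, A, f). below3 3 P) cV3" "map snd cV3 = [(qmon, quartic pv A0 f0 qmon), (qmon, quartic pv A1 f1 qmon), (qmon, quartic pv A2 f2 qmon), (qmon, quartic pv A5 f5 qmon), (qmon, quartic pv A6 f6 qmon)]"
  by (simp_all only: cV3_def below_simps list.map snd_conv)

definition cV4 :: "(int list list list \<times> int list list \<times> int list) list" where
  "cV4 =
    [([[[4, 16, 9], [26, 22], [6]]],
      qmon, quartic pv A0 f0 qmon),
     ([[[19, 27, 21], [25, 19], [27]]],
      qmon, quartic pv A1 f1 qmon),
     ([[[14, 24, 4], [23, 27], [2]]],
      qmon, quartic pv A2 f2 qmon),
     ([[[6, 2, 27], [1, 23], [3]]],
      qmon, quartic pv A5 f5 qmon),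
     ([[[7, 5, 1], [13]]],
      qmon, quartic pv A6 f6 qmon)]"

lemma cV4: "zero3 (add3 (place [0, 0, 0, 0, 6] [[[28]]]) (combination cV4))"
  unfolding cV4_def quartic_v0 quartic_v1 quartic_v2 quartic_v5 quartic_v6
  by (simp only: qmon_def certificate_simps)

lemma cV4_below: "list_all (\<lambda>(P, A, f). below3 3 P) cV4" "map snd cV4 = [(qmon, quartic pv A0 f0 qmon), (qmon, quartic pv A1 f1 qmon), (qmon, quartic pv A2 f2 qmon), (qmon, quartic pv A5 f5 qmon), (qmon, quartic pv A6 f6 qmon)]"
  by (simp_all only: cV4_def below_simps list.map snd_conv)

section \<open>The special configuration\<close>

lemma cubics_complete:
  assumes "length l = 5" "list_all (\<lambda>x. 0 \<le> x) l" "sum_list l = (3::int)"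
  shows "l \<in> set cubics"
proof -
  obtain a b c d e where l: "l = [a, b, c, d, e]"
    using assms(1) by (auto simp: eval_nat_numeral length_Suc_conv)
  have range: "x = 0 \<or> x = 1 \<or> x = 2 \<or> x = 3" if "0 \<le> x" "x \<le> 3" for x :: int
    using that by linarith
  have "e = 3 - a - b - c - d" "a + b + c + d \<le> 3"
    and "a = 0 \<or> a = 1 \<or> a = 2 \<or> a = 3" "b = 0 \<or> b = 1 \<or> b = 2 \<or> b = 3"
      "c = 0 \<or> c = 1 \<or> c = 2 \<or> c = 3" "d = 0 \<or> d = 1 \<or> d = 2 \<or> d = 3"
    using assms(2,3) by (auto simp: l intro!: range)
  then show ?thesis unfolding l by (elim disjE; simp add: cubics_def)
qed

lemma qmon_complete:
  assumes "0 \<le> c" "0 \<le> d" "0 \<le> e" "c + d + e = (4::int)"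
  shows "[0, 0, c, d, e] \<in> set qmon"
proof -
  have range: "x = 0 \<or> x = 1 \<or> x = 2 \<or> x = 3 \<or> x = 4" if "0 \<le> x" "x \<le> 4" for x :: int
    using that by linarith
  have "e = 4 - c - d" "c + d \<le> 4" "c = 0 \<or> c = 1 \<or> c = 2 \<or> c = 3 \<or> c = 4" "d = 0 \<or> d = 1 \<or> d = 2 \<or> d = 3 \<or> d = 4"
    using assms by (auto intro!: range)
  then show ?thesis by (elim disjE; simp add: qmon_def)
qed

lemma cubics_sound: "list_all (\<lambda>l. length l = 5 \<and> list_all (\<lambda>x. 0 \<le> x) l \<and> sum_list l = 3) cubics"
  by (simp add: cubics_def)

lemma qmon_sound: "list_all (\<lambda>l. length l = 5 \<and> list_all (\<lambda>x. 0 \<le> x) l \<and> sum_list l = 4 \<and> l ! 0 = 0 \<and> l ! 1 = 0) qmon"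
  and qmon_distinct: "distinct qmon"
  by (simp_all add: qmon_def)

definition family :: "(int list list \<times> int list) list" where
  "family = [(A0, f0), (A1, f1), (A2, f2), (A5, f5), (A6, f6)]"

lemma family_cases: "(A, f) \<in> set family \<Longrightarrow> A = A0 \<and> f = f0 \<or> A = A1 \<and> f = f1 \<or> A = A2 \<and> f = f2 \<or> A = A5 \<and> f = f5 \<or> A = A6 \<and> f = f6"
  by (simp add: family_def)

lemma family_good: "(A, f) \<in> set family \<Longrightarrow> \<exists>\<kappa>. list_all (good 8 (int \<kappa>)) A"
proof -
  have *: "\<exists>\<kappa>. list_all (good 8 (int \<kappa>)) A0" "\<exists>\<kappa>. list_all (good 8 (int \<kappa>)) A1" "\<exists>\<kappa>. list_all (good 8 (int \<kappa>)) A2" "\<exists>\<kappa>. list_all (good 8 (int \<kappa>)) A5" "\<exists>\<kappa>. list_all (good 8 (int \<kappa>)) A6"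
    using good0 good1 good2 good5 good6
    by (metis of_nat_0 of_nat_1 of_nat_numeral)+
  show "(A, f) \<in> set family \<Longrightarrow> ?thesis"
    by (drule family_cases) (elim disjE conjE; simp only: *)
qed

lemma family_check: "(A, f) \<in> set family \<Longrightarrow> annihilates (hmat pu cubics A @ hmat pv cubics A) f"
proof -
  note * = check0 check1 check2 check5 check6
  show "(A, f) \<in> set family \<Longrightarrow> ?thesis"
    by (drule family_cases) (elim disjE conjE; simp only: *[unfolded check_def])
qed

lemma eigenspace_fullrank:
  assumes "\<kappa> < 7"
  shows "\<exists>A. list_all (good 8 (int \<kappa>)) A \<and> fullrank (hmat pu cubics A @ hmat pv cubics A)"
proof -
  have "\<kappa> = 0 \<or> \<kappa> = 1 \<or> \<kappa> = 2 \<or> \<kappa> = 3 \<or> \<kappa> = 4 \<or> \<kappa> = 5 \<or> \<kappa> = 6" using assms by linarith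
  moreover note * = check0[unfolded check_def, THEN conjunct1] check1[unfolded check_def, THEN conjunct1]
    check2[unfolded check_def, THEN conjunct1] check3 check4
    check5[unfolded check_def, THEN conjunct1] check6[unfolded check_def, THEN conjunct1]
  have "\<exists>A. list_all (good 8 0) A \<and> fullrank (hmat pu cubics A @ hmat pv cubics A)"
    "\<exists>A. list_all (good 8 1) A \<and> fullrank (hmat pu cubics A @ hmat pv cubics A)"
    "\<exists>A. list_all (good 8 2) A \<and> fullrank (hmat pu cubics A @ hmat pv cubics A)"
    "\<exists>A. list_all (good 8 3) A \<and> fullrank (hmat pu cubics A @ hmat pv cubics A)"
    "\<exists>A. list_all (good 8 4) A \<and> fullrank (hmat pu cubics A @ hmat pv cubics A)"
    "\<exists>A. list_all (good 8 5) A \<and> fullrank (hmat pu cubics A @ hmat pv cubics A)"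
    "\<exists>A. list_all (good 8 6) A \<and> fullrank (hmat pu cubics A @ hmat pv cubics A)"
    by (rule exI, rule conjI, rule good0 good1 good2 good3 good4 good5 good6, rule *)+
  ultimately show ?thesis by (elim disjE; simp only: of_nat_0 of_nat_1 of_nat_numeral)
qed

lemma lsum_zip: "lsum G A (map red f) = (\<Sum>(a, x)\<leftarrow>zip A f. red x * G a)"
  by (induction A f rule: list_induct2') auto

lemma lsum_filter:
  assumes f: "filter (\<lambda>(a, x). hd a = 0) (zip A f) = zip B g" and G: "\<And>a. a \<in> set A \<Longrightarrow> hd a \<noteq> (0::int) \<Longrightarrow> G a = 0"
  shows "lsum G A (map red f) = lsum G B (map red g)"
proof -
  have *: "sum_list (map (\<lambda>(a, x). red x * G a) (filter (\<lambda>(a, x). hd a = 0) xs)) = sum_list (map (\<lambda>(a, x). red x * G a) xs)"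
    if "\<And>a x. (a, x) \<in> set xs \<Longrightarrow> hd a \<noteq> 0 \<Longrightarrow> G a = 0" for xs
    using that
  proof (induction xs)
    case (Cons p xs)
    obtain a x where p: "p = (a, x)" by force
    have "hd a \<noteq> 0 \<Longrightarrow> G a = 0" by (rule Cons.prems[of a x]) (simp_all add: p)
    moreover have "sum_list (map (\<lambda>(a, x). red x * G a) (filter (\<lambda>(a, x). hd a = 0) xs)) = sum_list (map (\<lambda>(a, x). red x * G a) xs)"
      by (rule Cons.IH) (rule Cons.prems[OF list.set_intros(2)])
    ultimately show ?case by (cases "hd a = 0") (simp_all add: p)
  qed simp
  have "sum_list (map (\<lambda>(a, x). red x * G a) (filter (\<lambda>(a, x). hd a = 0) (zip A f))) = sum_list (map (\<lambda>(a, x). red x * G a) (zip A f))"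
    by (rule *, rule G) (auto dest: set_zip_leftD)
  then show ?thesis unfolding lsum_zip by (simp only: f)
qed

lemma zip_members:
  assumes f: "filter (\<lambda>(a, x). hd a = 0) (zip A f) = zip B g" and "length B = length g" "b \<in> set B"
  shows "b \<in> set A \<and> hd b = (0::int)"
proof -
  from assms(2,3) obtain x where "(b, x) \<in> set (zip B g)" by (metis in_set_impl_in_set_zip1)
  then have "(b, x) \<in> set (filter (\<lambda>(a, x). hd a = 0) (zip A f))" unfolding f .
  then show ?thesis by (auto dest: set_zip_leftD)
qed

lemma lsum_map: "distinct bs \<Longrightarrow> lsum G bs (map T bs) = (\<Sum>b\<in>set bs. T b * G b)"
  by (induction bs) auto

lemma quartic_map: "quartic vs A f bs = map (\<lambda>b. dotm (entries vs b A) f) bs"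
  by (induction bs) auto

lemma family_restrict:
  assumes "(B, g) \<in> set [(B0, g0), (B1, g1), (B2, g2), (B5, g5), (B6, g6)]"
  shows "\<exists>A f. (A, f) \<in> set family \<and> filter (\<lambda>(a, x). hd a = 0) (zip A f) = zip B g \<and> length B = length g"
proof -
  have *: "(A0, f0) \<in> set family" "(A1, f1) \<in> set family" "(A2, f2) \<in> set family" "(A5, f5) \<in> set family" "(A6, f6) \<in> set family"
    by (simp_all add: family_def)
  note r = restrict0 restrict1 restrict2 restrict5 restrict6
  have "B = B0 \<and> g = g0 \<or> B = B1 \<and> g = g1 \<or> B = B2 \<and> g = g2 \<or> B = B5 \<and> g = g5 \<or> B = B6 \<and> g = g6" using assms by simp
  then show ?thesis
    by (elim disjE conjE) (hypsubst, intro exI conjI, (rule *), (rule r), (rule r))+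
qed

lemma less_5: "n < 5 \<Longrightarrow> n = 0 \<or> n = 1 \<or> n = 2 \<or> n = 3 \<or> n = (4::nat)"
  by linarith

lemma list_5: "length l = 5 \<Longrightarrow> \<exists>a b c d e. l = [a, b, c, d, e]"
  by (auto simp: eval_nat_numeral length_Suc_conv)

context coordinates
begin

definition kk :: "nat \<Rightarrow> 'n" where "kk = inv_into UNIV ix"

lemma ix_kk: "j < 5 \<Longrightarrow> ix (kk j) = j"
  using bij_betw_inv_into_right[OF ix, of j] by (simp add: kk_def)

lemma kk_ix: "kk (ix k) = k"
  using bij_betw_inv_into_left[OF ix, of k] by (simp add: kk_def)

lemma vl_exps: "length l = 5 \<Longrightarrow> list_all (\<lambda>x. 0 \<le> x) l \<Longrightarrow> sum_list l = N \<Longrightarrow> vl l \<in> exps (nat N)"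
  by (rule good_exps(1)[of N "(l ! 1 + 6 * l ! 2 + 2 * l ! 3 + 5 * l ! 4) mod 7"]) (simp add: good_def)

lemma exps_vl:
  assumes "a \<in> exps d"
  shows "\<exists>l. length l = 5 \<and> list_all (\<lambda>x. 0 \<le> x) l \<and> sum_list l = int d \<and> vl l = a \<and> (\<forall>j<5. l ! j = int (a (kk j)))"
proof -
  let ?l = "[int (a (kk 0)), int (a (kk 1)), int (a (kk 2)), int (a (kk 3)), int (a (kk 4))]"
  have nth: "?l ! j = int (a (kk j))" if "j < 5" for j using less_5[OF that] by auto
  have "vl ?l = a" unfolding vl_def by (intro ext) (simp only: nth[OF ix_less] kk_ix nat_int)
  moreover have "sum a UNIV = (\<Sum>j<5. a (kk j))" using sum5[of "\<lambda>j. a (kk j)"] by (simp only: kk_ix)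
  then have "sum_list ?l = int d" using assms by (simp add: exps_def eval_nat_numeral)
  ultimately show ?thesis using nth by (intro exI[of _ ?l]) simp
qed

lemma exps_3: "exps 3 = vl ` set cubics"
proof
  show "vl ` set cubics \<subseteq> exps 3" using cubics_sound vl_exps[of _ 3] by (auto simp: list_all_iff)
  show "exps 3 \<subseteq> vl ` set cubics" using exps_vl[of _ 3] cubics_complete by fastforce
qed

lemma vl_inj: "inj_on vl {l. length l = 5 \<and> list_all (\<lambda>x. 0 \<le> x) l}"
proof (rule inj_onI)
  fix l l' assume l: "l \<in> {l. length l = 5 \<and> list_all (\<lambda>x. 0 \<le> x) l}" "l' \<in> {l. length l = 5 \<and> list_all (\<lambda>x. 0 \<le> x) l}" "vl l = vl l'"
  show "l = l'"
  proof (rule nth_equalityI)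
    fix j assume "j < length l"
    then have j: "j < 5" using l by simp
    from l(3) have "nat (l ! ix (kk j)) = nat (l' ! ix (kk j))" unfolding vl_def by metis
    moreover have "0 \<le> l ! j" "0 \<le> l' ! j" using j l(1,2) by (auto simp: list_all_length)
    ultimately show "l ! j = l' ! j" using j by (metis ix_kk nat_0_le)
  qed (use l in auto)
qed

lemma hasse_sum: "hasse d (\<lambda>a. \<Sum>s\<in>S. c s a) b x = (\<Sum>s\<in>S. hasse d (c s) b x)"
  unfolding hasse_def sum_distrib_right by (rule sum.swap)

lemma good_wt: "list_all (good 8 (int \<kappa>)) A \<Longrightarrow> lc A x a \<noteq> 0 \<Longrightarrow> wt a mod 7 = \<kappa>"
proof -
  assume "list_all (good 8 (int \<kappa>)) A" "lc A x a \<noteq> 0"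
  then have "int (wt a) mod 7 = int \<kappa>" using lc_nonzero[of A x a] good_exps(2) by (auto simp: list_all_iff)
  then have "int (wt a mod 7) = int \<kappa>" by (simp add: zmod_int)
  then show ?thesis by simp
qed

abbreviation point :: "int list \<Rightarrow> 'n \<Rightarrow> F29" where "point vs \<equiv> \<lambda>k. red (vs ! ix k)"

text \<open>On forms of a single eigenspace the derivatives at one point of each orbit determine those at the others,
  so this is a system of only 70 equations.\<close>

lemma eigenspace_onto:
  assumes "\<kappa> < 7"
  shows "\<exists>c. (\<forall>a. c a \<noteq> 0 \<longrightarrow> wt a mod 7 = \<kappa>) \<and>
    (\<forall>b\<in>exps 3. hasse 8 c b (point pu) = D False b \<and> hasse 8 c b (point pv) = D True b)"
proof -
  obtain A where A: "list_all (good 8 (int \<kappa>)) A" and rank: "fullrank (hmat pu cubics A @ hmat pv cubics A)"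
    using eigenspace_fullrank[OF assms] by blast
  let ?M = "hmat pu cubics A @ hmat pv cubics A"
  let ?ds = "map (\<lambda>b. D False (vl b)) cubics @ map (\<lambda>b. D True (vl b)) cubics"
  have "\<forall>r\<in>set ?M. length r = length A" by (auto simp: hmat_map entries_map)
  moreover have "length ?ds = length ?M" by (simp add: hmat_map)
  ultimately obtain cs where "map (\<lambda>r. dotF r cs) ?M = ?ds"
    using fullrank_onto[OF rank, of "length A" ?ds] by blast
  then have cs: "dotF (entries pu b A) cs = D False (vl b)" "dotF (entries pv b A) cs = D True (vl b)"
    if "b \<in> set cubics" for b
    using that by (auto simp: hmat_map)
  have good: "\<forall>a\<in>set A. good 8 (int \<kappa>) a" using A by (simp add: list_all_iff)
  have "length pu = 5" "length pv = 5" by (simp_all add: pu_def pv_def)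
  then have "hasse 8 (lc A cs) (vl b) (point pu) = D False (vl b) \<and> hasse 8 (lc A cs) (vl b) (point pv) = D True (vl b)"
    if "b \<in> set cubics" for b
    using hasse_lc[OF good, of pu b cs] hasse_lc[OF good, of pv b cs] cs[OF that] that cubics_sound by (auto simp: list_all_iff)
  then show ?thesis using good_wt[OF A] by (intro exI[of _ "lc A cs"]) (auto simp: exps_3)
qed

text \<open>Soundness of the certificates: a functional that annihilates the multiples of the forms in the
  certificate, all of which do not involve the first coordinate, annihilates the target monomial.\<close>

lemma certificate_sound:
  assumes cert: "zero3 (add3 (place t [[[28]]]) (combination cs))"
    and below: "list_all (\<lambda>(P, A, f). below3 (Suc e) P) cs"
    and deg: "\<And>B g a. (B, g) \<in> set (map snd cs) \<Longrightarrow> a \<in> set B \<Longrightarrow>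
      length a = 5 \<and> list_all (\<lambda>x. 0 \<le> x) a \<and> sum_list a = int d \<and> a ! 0 = 0"
    and ann: "\<And>B g m. (B, g) \<in> set (map snd cs) \<Longrightarrow> m \<in> exps e \<Longrightarrow>
      lsum (\<lambda>a. \<mu> (\<lambda>k. vl a k + m k)) B (map red g) = 0"
    and t: "length t = 5" "list_all (\<lambda>x. 0 \<le> x) t" "sum_list t = int (d + e)" "t ! 0 = 0"
  shows "\<mu> (vl t) = 0"
proof -
  define \<nu> where "\<nu> i j k = \<mu> (vl [0, int i, int j, int k, int (d + e) - int i - int j - int k])" for i j k
  have van: "lsum (\<lambda>a. \<nu> (i + nat (a ! 1)) (j + nat (a ! 2)) (k + nat (a ! 3))) B (map red g) = 0"
    if cs: "(P, B, g) \<in> set cs" and ijk: "i + j + k < Suc e" for P B g i j k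
  proof -
    let ?m = "[0, int i, int j, int k, int e - int i - int j - int k]"
    have Bg: "(B, g) \<in> set (map snd cs)" using cs by force
    have "vl ?m \<in> exps (nat (int e))" by (rule vl_exps) (use ijk in auto)
    then have m: "vl ?m \<in> exps e" by simp
    have "lsum (\<lambda>a. \<nu> (i + nat (a ! 1)) (j + nat (a ! 2)) (k + nat (a ! 3))) B (map red g) =
        lsum (\<lambda>a. \<mu> (\<lambda>k. vl a k + vl ?m k)) B (map red g)"
    proof (rule lsum_cong)
      fix a assume "a \<in> set B"
      from deg[OF Bg this] obtain a1 a2 a3 a4 where a: "a = [0, a1, a2, a3, a4]"
          "0 \<le> a1" "0 \<le> a2" "0 \<le> a3" "0 \<le> a4" "a1 + a2 + a3 + a4 = int d"
        by (auto dest!: list_5)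
      have "vl [0, int (i + nat a1), int (j + nat a2), int (k + nat a3), int (d + e) - int (i + nat a1) - int (j + nat a2) - int (k + nat a3)] l
          = vl a l + vl ?m l" for l
        using less_5[OF ix_less[of l]] a ijk unfolding vl_def by auto
      then have "vl [0, int (i + nat a1), int (j + nat a2), int (k + nat a3), int (d + e) - int (i + nat a1) - int (j + nat a2) - int (k + nat a3)]
          = (\<lambda>l. vl a l + vl ?m l)" by (rule ext)
      moreover have "a ! 1 = a1" "a ! 2 = a2" "a ! 3 = a3" by (simp_all add: a(1))
      ultimately show "\<nu> (i + nat (a ! 1)) (j + nat (a ! 2)) (k + nat (a ! 3)) = \<mu> (\<lambda>k. vl a k + vl ?m k)"
        by (simp only: \<nu>_def)
    qed
    with ann[OF Bg m] show ?thesis by simp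
  qed
  have "\<nu> (nat (t ! 1)) (nat (t ! 2)) (nat (t ! 3)) = 0"
    by (rule certificate[OF cert, of "Suc e"]) (use below van in \<open>auto simp: list_all_iff\<close>)
  moreover obtain t1 t2 t3 t4 where "t = [0, t1, t2, t3, t4]" "0 \<le> t1" "0 \<le> t2" "0 \<le> t3" "0 \<le> t4" "t1 + t2 + t3 + t4 = int (d + e)"
    using t by (auto dest!: list_5)
  moreover from this have "int (d + e) - t1 - t2 - t3 = t4" by linarith
  ultimately show ?thesis by (simp add: \<nu>_def)
qed

abbreviation eig :: "int list list \<Rightarrow> int list \<Rightarrow> ('n \<Rightarrow> nat) \<Rightarrow> F29" where
  "eig A f \<equiv> lc A (map red f)"

lemma vl_pure:
  "vl [int N, 0, 0, 0, 0] = (\<lambda>l. N * unitv (kk 0) l)" "vl [0, int N, 0, 0, 0] = (\<lambda>l. N * unitv (kk 1) l)"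
  "vl [0, 0, int N, 0, 0] = (\<lambda>l. N * unitv (kk 2) l)" "vl [0, 0, 0, int N, 0] = (\<lambda>l. N * unitv (kk 3) l)"
  "vl [0, 0, 0, 0, int N] = (\<lambda>l. N * unitv (kk 4) l)"
proof -
  have "vl ((replicate 5 0)[j := int N]) l = N * unitv (kk j) l" if "j < 5" for j l
    using that ix_kk[OF that] kk_ix[of l] unfolding vl_def unitv_def by (auto simp: nth_list_update)
  from this[of 0] this[of 1] this[of 2] this[of 3] this[of 4]
  show "vl [int N, 0, 0, 0, 0] = (\<lambda>l. N * unitv (kk 0) l)" "vl [0, int N, 0, 0, 0] = (\<lambda>l. N * unitv (kk 1) l)"
    "vl [0, 0, int N, 0, 0] = (\<lambda>l. N * unitv (kk 2) l)" "vl [0, 0, 0, int N, 0] = (\<lambda>l. N * unitv (kk 3) l)"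
    "vl [0, 0, 0, 0, int N] = (\<lambda>l. N * unitv (kk 4) l)"
    by (simp_all add: fun_eq_iff eval_nat_numeral)
qed

lemma powers_base:
  fixes \<mu> :: "('n \<Rightarrow> nat) \<Rightarrow> F29"
  assumes coord: "\<And>a. a \<in> exps 18 \<Longrightarrow> 0 < a (kk 0) \<Longrightarrow> \<mu> a = 0"
    and ann: "\<And>A f m. (A, f) \<in> set family \<Longrightarrow> m \<in> exps 10 \<Longrightarrow> (\<Sum>a\<in>exps 8. eig A f a * \<mu> (\<lambda>k. a k + m k)) = 0"
  shows "\<mu> (\<lambda>l. 18 * unitv k l) = 0"
proof -
  let ?R = "[(B0, g0), (B1, g1), (B2, g2), (B5, g5), (B6, g6)]"
  note R = family_restrict
  have good: "length a = 5 \<and> list_all (\<lambda>x. 0 \<le> x) a \<and> sum_list a = int 8" if "(A, f) \<in> set family" "a \<in> set A" for A f a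
    using family_good[OF that(1)] that(2) by (auto simp: list_all_iff good_def)
  have deg: "length a = 5 \<and> list_all (\<lambda>x. 0 \<le> x) a \<and> sum_list a = int 8 \<and> a ! 0 = 0" if Bg: "(B, g) \<in> set ?R" and a: "a \<in> set B" for B g a
  proof -
    obtain A f where A: "(A, f) \<in> set family" "filter (\<lambda>(a, x). hd a = 0) (zip A f) = zip B g" "length B = length g"
      using R[OF Bg] by blast
    have "a \<in> set A" "hd a = 0" using zip_members[OF A(2,3) a] by auto
    moreover from this have g: "length a = 5 \<and> list_all (\<lambda>x. 0 \<le> x) a \<and> sum_list a = int 8" by (intro good[OF A(1)])
    moreover have "a ! 0 = hd a" by (rule hd_conv_nth[symmetric]) (use g in auto)
    ultimately show ?thesis by simp
  qed
  have ann': "lsum (\<lambda>a. \<mu> (\<lambda>k. vl a k + m k)) B (map red g) = 0" if Bg: "(B, g) \<in> set ?R" and m: "m \<in> exps 10" for B g m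
  proof -
    obtain A f where A: "(A, f) \<in> set family" "filter (\<lambda>(a, x). hd a = 0) (zip A f) = zip B g" using R[OF Bg] by blast
    have exps: "\<forall>a\<in>set A. vl a \<in> exps 8" using good[OF A(1)] vl_exps[of _ 8] by simp
    have "\<mu> (\<lambda>k. vl a k + m k) = 0" if a: "a \<in> set A" "hd a \<noteq> 0" for a
    proof (rule coord)
      show "(\<lambda>k. vl a k + m k) \<in> exps 18" using exps_add[OF _ m, of "vl a" 8] exps a(1) by simp
      have "0 < a ! 0" using good[OF A(1) a(1)] a(2) by (cases a) auto
      then show "0 < vl a (kk 0) + m (kk 0)" by (simp add: vl_def ix_kk)
    qed
    from lsum_filter[OF A(2), of "\<lambda>a. \<mu> (\<lambda>k. vl a k + m k)", OF this]
    have "lsum (\<lambda>a. \<mu> (\<lambda>k. vl a k + m k)) B (map red g) = lsum (\<lambda>a. \<mu> (\<lambda>k. vl a k + m k)) A (map red f)" by simp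
    also have "\<dots> = (\<Sum>a\<in>exps 8. eig A f a * \<mu> (\<lambda>k. a k + m k))" by (rule lc_sum[OF exps, symmetric])
    finally show ?thesis using ann[OF A(1) m] by simp
  qed
  have cert: "\<mu> (vl t) = 0"
    if "zero3 (add3 (place t [[[28]]]) (combination cs))" "list_all (\<lambda>(P, A, f). below3 11 P) cs" "map snd cs = ?R"
      "length t = 5" "list_all (\<lambda>x. 0 \<le> x) t" "sum_list t = int (8 + 10)" "t ! 0 = 0" for t cs
    by (rule certificate_sound[where d = 8 and e = 10 and cs = cs])
      (use that deg ann' in \<open>simp_all only: that(3) eval_nat_numeral\<close>)
  have "\<mu> (vl [0, int 18, 0, 0, 0]) = 0" "\<mu> (vl [0, 0, int 18, 0, 0]) = 0"
    "\<mu> (vl [0, 0, 0, int 18, 0]) = 0" "\<mu> (vl [0, 0, 0, 0, int 18]) = 0"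
    using cert[OF _ cP1_below] cert[OF _ cP2_below] cert[OF _ cP3_below] cert[OF _ cP4_below] cP1 cP2 cP3 cP4 by simp_all
  moreover have "\<mu> (\<lambda>l. 18 * unitv (kk 0) l) = 0" by (rule coord[OF unitv_exps]) (simp add: unitv_def)
  ultimately show ?thesis
    using less_5[OF ix_less[of k]] kk_ix[of k] unfolding vl_pure by metis
qed

text \<open>At the two representatives of the orbits the leading quartics are the lists in the certificates.\<close>

lemma powers_exceptional_seed:
  fixes \<mu> :: "('n \<Rightarrow> nat) \<Rightarrow> F29"
  assumes vs: "vs = pu \<or> vs = pv"
    and coord: "\<And>a. a \<in> exps 6 \<Longrightarrow> 0 < a (kk 0) \<or> 0 < a (kk 1) \<Longrightarrow> \<mu> a = 0"
    and ann: "\<And>A f m. (A, f) \<in> set family \<Longrightarrow> m \<in> exps 2 \<Longrightarrow>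
      (\<Sum>b\<in>exps 4. hasse 8 (eig A f) b (point vs) * \<mu> (\<lambda>k. b k + m k)) = 0"
  shows "\<mu> (\<lambda>l. 6 * unitv k l) = 0"
proof -
  let ?R = "map (\<lambda>(A, f). (qmon, quartic vs A f qmon)) family"
  have len: "length vs = 5" using vs by (auto simp: pu_def pv_def)
  have ann': "lsum (\<lambda>a. \<mu> (\<lambda>k. vl a k + m k)) B (map red g) = 0" if Bg: "(B, g) \<in> set ?R" and m: "m \<in> exps 2" for B g m
  proof -
    from Bg obtain A f where A: "(A, f) \<in> set family" "B = qmon" "g = quartic vs A f qmon" by auto
    obtain \<kappa> where good: "\<forall>a\<in>set A. good 8 (int \<kappa>) a" using family_good[OF A(1)] by (auto simp: list_all_iff)
    let ?T = "\<lambda>b. hasse 8 (eig A f) b (point vs)"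
    have T: "red (dotm (entries vs b A) f) = ?T (vl b)" if "b \<in> set qmon" for b
      using hasse_lc[OF good len, of b "map red f"] that qmon_sound by (auto simp: list_all_iff dotm)
    have "map red g = map (\<lambda>b. ?T (vl b)) qmon" unfolding A(3) quartic_map using T by simp
    then have "lsum (\<lambda>a. \<mu> (\<lambda>k. vl a k + m k)) B (map red g) = (\<Sum>b\<in>set qmon. ?T (vl b) * \<mu> (\<lambda>k. vl b k + m k))"
      unfolding A(2) by (simp add: lsum_map[OF qmon_distinct])
    also have "\<dots> = (\<Sum>b\<in>vl ` set qmon. ?T b * \<mu> (\<lambda>k. b k + m k))"
      by (rule sum.reindex[symmetric, unfolded o_def], rule inj_on_subset[OF vl_inj]) (use qmon_sound in \<open>auto simp: list_all_iff\<close>)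
    also have "\<dots> = (\<Sum>b\<in>exps 4. ?T b * \<mu> (\<lambda>k. b k + m k))"
    proof (rule sum.mono_neutral_left)
      show "vl ` set qmon \<subseteq> exps 4" using qmon_sound vl_exps[of _ 4] by (auto simp: list_all_iff)
      show "\<forall>b\<in>exps 4 - vl ` set qmon. ?T b * \<mu> (\<lambda>k. b k + m k) = 0"
      proof
        fix b :: "'n \<Rightarrow> nat" assume b: "b \<in> exps 4 - vl ` set qmon"
        then obtain l where l: "length l = 5" "list_all (\<lambda>x. 0 \<le> x) l" "sum_list l = int 4" "vl l = b" "\<forall>j<5. l ! j = int (b (kk j))"
          using exps_vl[of b 4] by blast
        have "0 < b (kk 0) \<or> 0 < b (kk 1)"
        proof (rule ccontr)
          assume "\<not> ?thesis"
          then have "l ! 0 = 0" "l ! 1 = 0" using l(5) by auto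
          with l(1-3) have "l \<in> set qmon" by (auto dest!: list_5 intro!: qmon_complete)
          with l(4) b show False by blast
        qed
        then have "\<mu> (\<lambda>k. b k + m k) = 0" using exps_add[of b 4 m 2] b m by (intro coord) auto
        then show "?T b * \<mu> (\<lambda>k. b k + m k) = 0" by simp
      qed
    qed simp
    finally show ?thesis using ann[OF A(1) m] by simp
  qed
  have deg: "length a = 5 \<and> list_all (\<lambda>x. 0 \<le> x) a \<and> sum_list a = int 4 \<and> a ! 0 = 0" if "(B, g) \<in> set ?R" "a \<in> set B" for B g a
    using that qmon_sound by (auto simp: list_all_iff)
  have cert: "\<mu> (vl t) = 0"
    if "zero3 (add3 (place t [[[28]]]) (combination cs))" "list_all (\<lambda>(P, A, f). below3 3 P) cs" "map snd cs = ?R"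
      "length t = 5" "list_all (\<lambda>x. 0 \<le> x) t" "sum_list t = int (4 + 2)" "t ! 0 = 0" for t cs
    by (rule certificate_sound[where d = 4 and e = 2 and cs = cs])
      (use that deg ann' in \<open>simp_all only: that(3) eval_nat_numeral\<close>)
  have "\<mu> (vl [0, 0, int 6, 0, 0]) = 0 \<and> \<mu> (vl [0, 0, 0, int 6, 0]) = 0 \<and> \<mu> (vl [0, 0, 0, 0, int 6]) = 0"
    using vs
  proof
    assume v: "vs = pu"
    show ?thesis
      using cert[OF _ cU2_below(1)] cert[OF _ cU3_below(1)] cert[OF _ cU4_below(1)] cU2_below(2) cU3_below(2) cU4_below(2) cU2 cU3 cU4
      by (simp add: v family_def)
  next
    assume v: "vs = pv"
    show ?thesis
      using cert[OF _ cV2_below(1)] cert[OF _ cV3_below(1)] cert[OF _ cV4_below(1)] cV2_below(2) cV3_below(2) cV4_below(2) cV2 cV3 cV4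
      by (simp add: v family_def)
  qed
  moreover have "\<mu> (\<lambda>l. 6 * unitv (kk 0) l) = 0" "\<mu> (\<lambda>l. 6 * unitv (kk 1) l) = 0"
    by (rule coord[OF unitv_exps], simp add: unitv_def)+
  ultimately show ?thesis
    using less_5[OF ix_less[of k]] kk_ix[of k] unfolding vl_pure by metis
qed

end

locale configuration = coordinates ix for ix :: "'n::finite \<Rightarrow> nat" +
  fixes h :: "'r::finite \<Rightarrow> nat"
  assumes h: "bij_betw h UNIV {..<14}"
begin

text \<open>The 14 points, with integer coordinates: \<open>h\<close> enumerates the indices, and the \<open>i\<close>-th point is the translate of the
  representative \<open>base i\<close> by the \<open>(h i mod 7)\<close>-th power of the diagonal matrix.\<close>

definition base :: "'r \<Rightarrow> int list" where
  "base i = (if h i < 7 then pu else pv)"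

definition Y :: "'r \<Rightarrow> 'n \<Rightarrow> int" where
  "Y i k = 7 ^ (h i mod 7 * [0, 1, 6, 2, 5] ! ix k) * base i ! ix k"

abbreviation y0 :: "'r \<Rightarrow> 'n \<Rightarrow> F29" where "y0 i \<equiv> \<lambda>k. red (Y i k)"

lemma y0: "y0 i = twist (h i mod 7) (point (base i))"
  by (simp only: Y_def of_int_mult of_int_power)

lemma seven_nz: "red 7 ^ k \<noteq> 0"
proof
  assume "red 7 ^ k = 0"
  then have "red 7 = 0" by (simp only: power_eq_0_iff)
  with seven show False by (metis power_eq_0_iff zero_neq_one zero_less_numeral power_zero_numeral)
qed

text \<open>The prescribed values are decomposed into characters of the cyclic group. The factor 25 is the inverse of 7
  modulo 29.\<close>

lemma onto_configuration: "\<exists>c. \<forall>i. \<forall>b\<in>exps 3. hasse 8 c b (y0 i) = d (i, b)"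
proof -
  define pt where "pt o' l = inv_into UNIV h (if o' then 7 + l else l)" for o' :: bool and l
  define D where "D \<kappa> o' b = red 25 * (\<Sum>l<7. red 7 ^ (6 * l * (\<kappa> + 6 * wt b)) * d (pt o' l, b))" for \<kappa> o' and b :: "'n \<Rightarrow> nat"
  have "\<forall>\<kappa>. \<exists>c. \<kappa> < 7 \<longrightarrow> (\<forall>a. c a \<noteq> 0 \<longrightarrow> wt a mod 7 = \<kappa>) \<and>
    (\<forall>b\<in>exps 3. hasse 8 c b (point pu) = D \<kappa> False b \<and> hasse 8 c b (point pv) = D \<kappa> True b)"
    using eigenspace_onto by blast
  then have "\<exists>c. \<forall>\<kappa>. \<kappa> < 7 \<longrightarrow> (\<forall>a. c \<kappa> a \<noteq> 0 \<longrightarrow> wt a mod 7 = \<kappa>) \<and>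
    (\<forall>b\<in>exps 3. hasse 8 (c \<kappa>) b (point pu) = D \<kappa> False b \<and> hasse 8 (c \<kappa>) b (point pv) = D \<kappa> True b)"
    by (rule choice)
  then obtain c where c0: "\<forall>\<kappa>. \<kappa> < 7 \<longrightarrow> (\<forall>a. c \<kappa> a \<noteq> 0 \<longrightarrow> wt a mod 7 = \<kappa>) \<and>
    (\<forall>b\<in>exps 3. hasse 8 (c \<kappa>) b (point pu) = D \<kappa> False b \<and> hasse 8 (c \<kappa>) b (point pv) = D \<kappa> True b)" ..
  have c: "c \<kappa> a \<noteq> 0 \<Longrightarrow> wt a mod 7 = \<kappa>"
    "b \<in> exps 3 \<Longrightarrow> hasse 8 (c \<kappa>) b (point pu) = D \<kappa> False b"
    "b \<in> exps 3 \<Longrightarrow> hasse 8 (c \<kappa>) b (point pv) = D \<kappa> True b" if "\<kappa> < 7" for \<kappa> a b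
    using c0 that by simp_all
  have "hasse 8 (\<lambda>a. \<Sum>\<kappa><7. c \<kappa> a) b (y0 i) = d (i, b)" if b: "b \<in> exps 3" for i b
  proof -
    let ?m = "h i mod 7" and ?o = "\<not> h i < 7" and ?s = "6 * wt b"
    have "h i < 14" using h by (auto simp: bij_betw_def)
    then have "(if ?o then 7 + ?m else ?m) = h i" by (auto simp: le_mod_geq not_less)
    then have pt: "pt ?o ?m = i" unfolding pt_def using bij_betw_inv_into_left[OF h, of i] by simp
    have base: "hasse 8 (c \<kappa>) b (point (base i)) = D \<kappa> ?o b" if "\<kappa> < 7" for \<kappa>
      using c(2,3)[OF that b] by (simp add: base_def)
    have "hasse 8 (\<lambda>a. \<Sum>\<kappa><7. c \<kappa> a) b (y0 i) = (\<Sum>\<kappa><7. hasse 8 (c \<kappa>) b (y0 i))" by (rule hasse_sum)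
    also have "\<dots> = (\<Sum>\<kappa><7. red 7 ^ (?m * (\<kappa> + ?s)) * D \<kappa> ?o b)"
    proof (rule sum.cong[OF refl])
      fix \<kappa> :: nat assume "\<kappa> \<in> {..<7}"
      then have k: "\<kappa> < 7" by simp
      show "hasse 8 (c \<kappa>) b (y0 i) = red 7 ^ (?m * (\<kappa> + ?s)) * D \<kappa> ?o b"
        unfolding y0 base[OF k, symmetric] by (rule hasse_twist) (rule c(1)[OF k])
    qed
    also have "\<dots> = (\<Sum>\<kappa><7. \<Sum>l<7. red 25 * d (pt ?o l, b) * (red 7 ^ (?m * (\<kappa> + ?s)) * red 7 ^ (6 * l * (\<kappa> + ?s))))"
      unfolding D_def sum_distrib_left by (intro sum.cong refl) (simp only: mult_ac)
    also have "\<dots> = (\<Sum>l<7. red 25 * d (pt ?o l, b) * (\<Sum>\<kappa><7. red 7 ^ (?m * (\<kappa> + ?s)) * red 7 ^ (6 * l * (\<kappa> + ?s))))"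
      unfolding sum_distrib_left by (rule sum.swap)
    also have "\<dots> = (\<Sum>l<7. red 25 * d (pt ?o l, b) * (if ?m = l then 7 else 0))"
      by (intro sum.cong refl arg_cong2[of _ _ _ _ "\<lambda>x y. x * y"] character_sum) auto
    also have "\<dots> = (\<Sum>l<7. if ?m = l then red 25 * d (pt ?o l, b) * 7 else 0)"
      by (intro sum.cong refl) simp
    also have "\<dots> = red 25 * d (pt ?o ?m, b) * 7" by (simp only: sum.delta' finite_lessThan lessThan_iff) simp
    also have "\<dots> = red (175 mod 29) * d (i, b)" unfolding pt red_mod by simp
    finally show ?thesis by simp
  qed
  then show ?thesis by blast
qed

lemma eig_ker:
  assumes "(A, f) \<in> set family" "b \<in> exps 3"
  shows "hasse 8 (eig A f) b (y0 i) = 0"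
proof -
  obtain \<kappa> where k: "list_all (good 8 (int \<kappa>)) A" using family_good[OF assms(1)] by blast
  then have good: "\<forall>a\<in>set A. good 8 (int \<kappa>) a" by (simp add: list_all_iff)
  obtain l where l: "l \<in> set cubics" "b = vl l" using assms(2) by (auto simp: exps_3)
  have "length l = 5" "length (base i) = 5" using l cubics_sound by (auto simp: list_all_iff base_def pu_def pv_def)
  then have "hasse 8 (eig A f) b (point (base i)) = dotF (entries (base i) l A) (map red f)"
    using hasse_lc[OF good, of "base i" l "map red f"] by (simp add: l)
  also have "\<dots> = 0"
    using family_check[OF assms(1)] l(1) by (auto simp: annihilates_iff hmat_map base_def)
  finally show ?thesis unfolding y0 using hasse_twist[of "eig A f" \<kappa>, OF good_wt[OF k]] by simp
qed

text \<open>The leading forms at a translated point are obtained from those at the representative by a diagonal change of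
  coordinates, which is transferred to the functional.\<close>

lemma powers_exceptional:
  fixes \<mu> :: "('n \<Rightarrow> nat) \<Rightarrow> F29"
  assumes coord: "\<And>a. a \<in> exps 6 \<Longrightarrow> 0 < a (kk 0) \<or> 0 < a (kk 1) \<Longrightarrow> \<mu> a = 0"
    and ann: "\<And>A f m. (A, f) \<in> set family \<Longrightarrow> m \<in> exps 2 \<Longrightarrow>
      (\<Sum>b\<in>exps 4. hasse 8 (eig A f) b (y0 i) * \<mu> (\<lambda>k. b k + m k)) = 0"
  shows "\<mu> (\<lambda>l. 6 * unitv k l) = 0"
proof -
  let ?m = "h i mod 7"
  define \<mu>' where "\<mu>' a = red 7 ^ (6 * ?m * wt a) * \<mu> a" for a :: "'n \<Rightarrow> nat"
  have "\<mu>' (\<lambda>l. 6 * unitv k l) = 0"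
  proof (rule powers_exceptional_seed[of "base i"])
    show "base i = pu \<or> base i = pv" by (simp add: base_def)
    show "\<mu>' a = 0" if "a \<in> exps 6" "0 < a (kk 0) \<or> 0 < a (kk 1)" for a using coord[OF that] by (simp add: \<mu>'_def)
    fix A f and m :: "'n \<Rightarrow> nat" assume A: "(A, f) \<in> set family" and m: "m \<in> exps 2"
    obtain \<kappa> where k: "list_all (good 8 (int \<kappa>)) A" using family_good[OF A] by blast
    have "red 7 ^ (?m * \<kappa>) * (\<Sum>b\<in>exps 4. hasse 8 (eig A f) b (point (base i)) * \<mu>' (\<lambda>k. b k + m k)) =
        red 7 ^ (6 * ?m * wt m) * (\<Sum>b\<in>exps 4. hasse 8 (eig A f) b (y0 i) * \<mu> (\<lambda>k. b k + m k))"
      unfolding sum_distrib_left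
    proof (intro sum.cong refl)
      fix b :: "'n \<Rightarrow> nat"
      have "hasse 8 (eig A f) b (y0 i) = red 7 ^ (?m * \<kappa>) * red 7 ^ (6 * ?m * wt b) * hasse 8 (eig A f) b (point (base i))"
        unfolding y0 power_add[symmetric] by (subst hasse_twist[OF good_wt[OF k]]) (simp_all only: algebra_simps)
      moreover have "\<mu>' (\<lambda>k. b k + m k) = red 7 ^ (6 * ?m * wt b) * red 7 ^ (6 * ?m * wt m) * \<mu> (\<lambda>k. b k + m k)"
        unfolding \<mu>'_def wt_add power_add[symmetric] distrib_left ..
      ultimately show "red 7 ^ (?m * \<kappa>) * (hasse 8 (eig A f) b (point (base i)) * \<mu>' (\<lambda>k. b k + m k)) =
          red 7 ^ (6 * ?m * wt m) * (hasse 8 (eig A f) b (y0 i) * \<mu> (\<lambda>k. b k + m k))"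
        by (simp only: mult_ac)
    qed
    also have "\<dots> = 0" using ann[OF A m] by simp
    finally show "(\<Sum>b\<in>exps 4. hasse 8 (eig A f) b (point (base i)) * \<mu>' (\<lambda>k. b k + m k)) = 0"
      using seven_nz by (simp only: mult_eq_0_iff simp_thms)
  qed
  then show ?thesis using seven_nz by (simp only: \<mu>'_def mult_eq_0_iff simp_thms)
qed

end

section \<open>The octics through general quadruple points\<close>

text \<open>Generators of ideals: forms of degree \<open>d\<close>, indexed by \<open>Inl\<close>, and coordinates, indexed by \<open>Inr\<close>.\<close>

definition gdeg :: "nat \<Rightarrow> 'j + 'n \<Rightarrow> nat" where
  "gdeg d g = (case g of Inl _ \<Rightarrow> d | Inr _ \<Rightarrow> 1)"

definition gco :: "('j \<Rightarrow> ('n \<Rightarrow> nat) \<Rightarrow> 'v pexp) \<Rightarrow> 'j + 'n \<Rightarrow> ('n \<Rightarrow> nat) \<Rightarrow> 'v pexp" where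
  "gco co g a = (case g of Inl b \<Rightarrow> co b a | Inr l \<Rightarrow> Con (if a = unitv l then 1 else 0))"

lemma gdeg_simps [simp]: "gdeg d (Inl b) = d" "gdeg d (Inr l) = 1"
  by (simp_all add: gdeg_def)

lemma pev_gco [simp]: "pev \<rho> (gco co (Inl b) a) = pev \<rho> (co b a)"
  "pev \<rho> (gco co (Inr l) a) = (if a = unitv l then 1 else 0)"
  by (simp_all add: gco_def)

lemma unitv_exps_1: "unitv l \<in> exps 1"
  using unitv_exps[of 1 l] by simp

lemma form_coordinate: "form 1 (\<lambda>a. pev \<rho> (gco co (Inr l) a)) x = x l"
proof -
  have "form 1 (\<lambda>a. pev \<rho> (gco co (Inr l) a)) x = (\<Sum>a\<in>exps 1. if a = unitv l then xpow a x else 0)"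
    unfolding form_def by (intro sum.cong refl) simp
  also have "\<dots> = xpow (unitv l) x" using unitv_exps_1[of l] by simp
  also have "\<dots> = x l" using xpow_unitv[of 1 l x] by simp
  finally show ?thesis .
qed

lemma annih_coordinate:
  fixes G :: "('j + 'n::finite) set"
  assumes "annih G (gdeg d) (\<lambda>g a. pev \<rho> (gco co g a)) N \<mu>" "Inr l \<in> G" "a \<in> exps N" "0 < a l"
  shows "\<mu> a = 0"
proof -
  define m :: "'n \<Rightarrow> nat" where "m = (\<lambda>k. a k - unitv l k)"
  have am: "a = (\<lambda>k. unitv l k + m k)" using assms(4) by (auto simp: m_def unitv_def fun_eq_iff)
  have "sum a UNIV = sum (unitv l) UNIV + sum m UNIV" by (subst am) (simp add: sum.distrib)
  then have "m \<in> exps (N - 1)" using assms(3) unitv_exps_1[of l] by (simp add: exps_def)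
  then have m: "m \<in> exps (N - gdeg d (Inr l :: 'j + 'n))" by simp
  have "(\<Sum>a\<in>exps 1. pev \<rho> (gco co (Inr l) a) * \<mu> (\<lambda>k. a k + m k)) = 0"
    using bspec[OF bspec[OF assms(1)[unfolded annih_def] assms(2)] m] by simp
  moreover have "(\<Sum>a\<in>exps 1. pev \<rho> (gco co (Inr l) a) * \<mu> (\<lambda>k. a k + m k)) =
      (\<Sum>a\<in>exps 1. if a = unitv l then \<mu> (\<lambda>k. a k + m k) else 0)"
    by (intro sum.cong refl) simp
  moreover have "\<dots> = \<mu> (\<lambda>k. unitv l k + m k)" using unitv_exps_1[of l] by simp
  ultimately show ?thesis using am by simp
qed

lemma hasse_cong: "(\<And>a. a \<in> exps d \<Longrightarrow> c a = c' a) \<Longrightarrow> hasse d c b x = hasse d c' b x"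
  unfolding hasse_def by (intro sum.cong refl) simp

lemma hasse_lincomb: "hasse d (\<lambda>a. \<Sum>s\<in>S. t s * c s a) b x = (\<Sum>s\<in>S. t s * hasse d (c s) b x)"
proof -
  have "hasse d (\<lambda>a. \<Sum>s\<in>S. t s * c s a) b x =
      (\<Sum>a\<in>exps d. \<Sum>s\<in>S. t s * (c s a * (of_nat (\<Prod>k\<in>UNIV. a k choose b k) * xpow (\<lambda>k. a k - b k) x)))"
    unfolding hasse_def sum_distrib_right by (simp only: mult.assoc)
  then show ?thesis unfolding hasse_def sum_distrib_left by (subst (asm) sum.swap)
qed

lemma hasse_scale:
  fixes x :: "'n::finite \<Rightarrow> 'a::comm_ring_1"
  assumes b: "b \<in> exps j"
  shows "hasse d c b (\<lambda>k. t * x k) = t ^ (d - j) * hasse d c b x"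
  unfolding hasse_def sum_distrib_left
proof (intro sum.cong refl)
  fix a :: "'n \<Rightarrow> nat" assume a: "a \<in> exps d"
  show "c a * (of_nat (\<Prod>k\<in>UNIV. a k choose b k) * xpow (\<lambda>k. a k - b k) (\<lambda>k. t * x k)) =
      t ^ (d - j) * (c a * (of_nat (\<Prod>k\<in>UNIV. a k choose b k) * xpow (\<lambda>k. a k - b k) x))"
  proof (cases "\<exists>k. a k < b k")
    case True
    then obtain k where "a k < b k" by blast
    then have z: "(\<Prod>k\<in>UNIV. a k choose b k) = 0" by (intro prod_zero bexI[of _ k]) (simp_all add: binomial_eq_0)
    show ?thesis unfolding z by simp
  next
    case False
    then have "sum (\<lambda>k. a k - b k) UNIV = sum a UNIV - sum b UNIV" by (intro sum_subtractf_nat) (simp add: not_less)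
    then have "(\<lambda>k. a k - b k) \<in> exps (d - j)" using a b by (simp add: exps_def)
    then have x: "xpow (\<lambda>k. a k - b k) (\<lambda>k. t * x k) = t ^ (d - j) * xpow (\<lambda>k. a k - b k) x" by (rule xpow_scale)
    show ?thesis unfolding x by (simp only: mult_ac)
  qed
qed

text \<open>The leading form of a form at a point of multiplicity \<open>m\<close> is a function on the tangent space,
  that is, on the quotient by the line of the point.\<close>

lemma tay_shift:
  fixes x w :: "'n::finite \<Rightarrow> complex"
  assumes zero: "\<And>j w. j < m \<Longrightarrow> tay d c j x w = 0" and m: "m \<le> d"
  shows "tay d c m x (\<lambda>k. w k - s * x k) = tay d c m x w"
proof -
  define u where "u j = tay d c j x (\<lambda>k. w k - s * x k)" for j
  define v where "v j = tay d c j x w" for j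
  define P where "P = (\<Sum>j\<in>{m..d}. monom (u j) (d - j))"
  define Q where "Q = (\<Sum>j\<in>{m..d}. smult (v j) ([:- s, 1:] ^ (d - j)))"
  have restrict: "(\<Sum>j\<le>d. f j) = (\<Sum>j\<in>{m..d}. f j)" if "\<And>j. j < m \<Longrightarrow> f j = 0" for f :: "nat \<Rightarrow> complex"
    using that by (intro sum.mono_neutral_right) auto
  have "poly P t = poly Q t" for t
  proof -
    have "poly P t = (\<Sum>j\<in>{m..d}. t ^ (d - j) * 1 ^ j * u j)"
      unfolding P_def poly_sum by (intro sum.cong refl) (simp add: poly_monom)
    also have "\<dots> = (\<Sum>j\<le>d. t ^ (d - j) * 1 ^ j * u j)" by (rule restrict[symmetric]) (simp add: u_def zero)
    also have "\<dots> = form d c (\<lambda>k. t * x k + 1 * (w k - s * x k))" unfolding u_def by (rule form_tay[symmetric])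
    also have "(\<lambda>k. t * x k + 1 * (w k - s * x k)) = (\<lambda>k. (t - s) * x k + 1 * w k)" by (simp add: algebra_simps)
    also have "form d c (\<lambda>k. (t - s) * x k + 1 * w k) = (\<Sum>j\<le>d. (t - s) ^ (d - j) * 1 ^ j * v j)"
      unfolding v_def by (rule form_tay)
    also have "\<dots> = (\<Sum>j\<in>{m..d}. (t - s) ^ (d - j) * 1 ^ j * v j)" by (rule restrict) (simp add: v_def zero)
    also have "\<dots> = poly Q t" unfolding Q_def poly_sum by (intro sum.cong refl) simp
    finally show ?thesis .
  qed
  then have "P = Q" by (simp add: poly_eq_poly_eq_iff[symmetric] fun_eq_iff)
  moreover have "coeff P (d - m) = u m"
  proof -
    have "coeff P (d - m) = (\<Sum>j\<in>{m..d}. if j = m then u j else 0)"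
      unfolding P_def coeff_sum using m by (intro sum.cong refl) auto
    then show ?thesis using m by simp
  qed
  moreover have "coeff Q (d - m) = v m"
  proof -
    have "coeff Q (d - m) = (\<Sum>j\<in>{m..d}. if j = m then v j else 0)"
      unfolding Q_def coeff_sum
    proof (intro sum.cong refl)
      fix j assume j: "j \<in> {m..d}"
      show "coeff (smult (v j) ([:- s, 1:] ^ (d - j))) (d - m) = (if j = m then v j else 0)"
      proof (cases "j = m")
        case True
        then show ?thesis by (simp add: coeff_linear_power)
      next
        case False
        then have "degree ([:- s, 1:] ^ (d - j)) < d - m" using j by (simp add: degree_linear_power, linarith)
        then have "coeff ([:- s, 1:] ^ (d - j)) (d - m) = 0" by (rule coeff_eq_0)
        with False show ?thesis by simp
      qed
    qed
    then show ?thesis using m by simp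
  qed
  ultimately show ?thesis by (simp add: u_def v_def)
qed

lemma tpoly_pev: "tpoly (\<lambda>y. pev (\<lambda>(i, k). y i $ k) e)"
  by (induction e) (auto simp: split_beta)

lemma card_exps: "card (exps d :: ('n::finite \<Rightarrow> nat) set) = (d + CARD('n) - 1) choose d"
proof -
  obtain xs :: "'n list" where xs: "set xs = UNIV" "distinct xs" using finite_distinct_list[OF finite] by blast
  then have len: "length xs = CARD('n)" using distinct_card by fastforce
  have "bij_betw (\<lambda>a. map a xs) (exps d) {l. length l = CARD('n) \<and> sum_list l = d}"
  proof (rule bij_betw_byWitness[where f' = "\<lambda>l k. the (map_of (zip xs l) k)"])
    show "\<forall>a\<in>exps d. (\<lambda>k. the (map_of (zip xs (map a xs)) k)) = a"
      using xs by (simp add: map_of_zip_map)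
    show "\<forall>l\<in>{l. length l = CARD('n) \<and> sum_list l = d}. map (\<lambda>k. the (map_of (zip xs l) k)) xs = l"
      using xs len by (auto intro!: nth_equalityI simp: map_of_zip_nth)
    show "(\<lambda>a. map a xs) ` exps d \<subseteq> {l. length l = CARD('n) \<and> sum_list l = d}"
      using xs len by (auto simp: exps_def sum_list_distinct_conv_sum_set)
    show "(\<lambda>l k. the (map_of (zip xs l) k)) ` {l. length l = CARD('n) \<and> sum_list l = d} \<subseteq> exps d"
    proof
      fix a assume "a \<in> (\<lambda>l k. the (map_of (zip xs l) k)) ` {l. length l = CARD('n) \<and> sum_list l = d}"
      then obtain l where l: "length l = CARD('n)" "sum_list l = d" "a = (\<lambda>k. the (map_of (zip xs l) k))" by blast
      have "map a xs = l" using xs len l by (auto intro!: nth_equalityI simp: map_of_zip_nth)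
      then have "sum a (set xs) = d" using l(2) xs(2) by (metis sum_list_distinct_conv_sum_set)
      then show "a \<in> exps d" using xs(1) by (simp add: exps_def)
    qed
  qed
  then have "card (exps d :: ('n \<Rightarrow> nat) set) = card {l. length l = CARD('n) \<and> sum_list l = d}" by (rule bij_betw_same_card)
  then show ?thesis by (simp only: card_length_sum_list)
qed

definition row :: "'r \<times> ('n::finite \<Rightarrow> nat) \<Rightarrow> ('n \<Rightarrow> nat) \<Rightarrow> ('r \<times> 'n) pexp" where
  "row = (\<lambda>(i, b). hasse_row (\<lambda>k. Par (i, k)) b)"

lemma row: "(\<Sum>a\<in>exps d. pev \<rho> (row (i, b) a) * c a) = hasse d c b (\<lambda>k. \<rho> (i, k))"
  by (simp only: row_def prod.case hasse_row pev.simps)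

abbreviation octics :: "('r \<times> 'n::finite \<Rightarrow> 'a::field) \<Rightarrow> (('n \<Rightarrow> nat) \<Rightarrow> 'a) set" where
  "octics \<rho> \<equiv> ker \<rho> row (UNIV \<times> exps 3) (exps 8)"

lemma octics_iff: "c \<in> octics \<rho> \<longleftrightarrow> (\<forall>i. \<forall>b\<in>exps 3. hasse 8 c b (\<lambda>k. \<rho> (i, k)) = 0)"
  by (simp only: ker_def mem_Collect_eq split_paired_Ball_Sigma row) simp

text \<open>The leading form, of degree 4, of the octic \<open>k b\<close> at the point \<open>i\<close>.\<close>

definition leading :: "('j \<Rightarrow> ('n::finite \<Rightarrow> nat) \<Rightarrow> ('r \<times> 'n) pexp) \<Rightarrow> 'r \<Rightarrow> 'j \<Rightarrow> ('n \<Rightarrow> nat) \<Rightarrow> ('r \<times> 'n) pexp" where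
  "leading k i b c = Sum (\<lambda>a. Mul (row (i, c) a) (k b a)) (exps 8)"

lemma pev_leading: "pev \<rho> (leading k i b c) = hasse 8 (\<lambda>a. pev \<rho> (k b a)) c (\<lambda>l. \<rho> (i, l))"
  unfolding leading_def pev_Sum[OF finite_exps] pev.simps by (rule row)

context configuration
begin

text \<open>Each property holds at the special configuration modulo 29 and therefore where some
  polynomial expression does not vanish. The product of these expressions is nonzero modulo 29 at the configuration,
  hence nonzero at the complex points with the same integer coordinates.\<close>

lemma general_octics:
  "\<exists>\<delta> :: ('r \<times> 'n) pexp. pev (\<lambda>(i, k). complex_of_int (Y i k)) \<delta> \<noteq> 0 \<and>
    (\<forall>\<rho>. pev \<rho> \<delta> \<noteq> (0::complex) \<longrightarrow>
      onto \<rho> row (UNIV \<times> exps 3) (exps 8) \<and>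
      (\<exists>(B :: ('n \<Rightarrow> nat) set) k. finite B \<and> card B = 5 \<and> (\<forall>c\<in>octics \<rho>. spanned \<rho> k B (exps 8) c)) \<and>
      (\<exists>A. finite A \<and> (\<forall>x. (\<forall>c\<in>octics \<rho>. form 8 c x = 0) \<longrightarrow> x \<noteq> (\<lambda>_. 0) \<longrightarrow> (\<exists>a\<in>A. \<exists>t. x = (\<lambda>k. t * a k)))) \<and>
      (\<forall>i. \<exists>A. finite A \<and> (\<forall>x. x (kk 0) = 0 \<longrightarrow> (\<forall>c\<in>octics \<rho>. form 4 (\<lambda>b. hasse 8 c b (\<lambda>k. \<rho> (i, k))) x = 0) \<longrightarrow>
         x \<noteq> (\<lambda>_. 0) \<longrightarrow> (\<exists>a\<in>A. \<exists>t. x = (\<lambda>k. t * a k)))) \<and>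
      (\<forall>i. \<rho> (i, kk 0) \<noteq> 0))"
proof -
  define \<rho>\<^sub>0 :: "'r \<times> 'n \<Rightarrow> F29" where "\<rho>\<^sub>0 = (\<lambda>v. of_int (case v of (i, k) \<Rightarrow> Y i k))"
  have rho0: "(\<lambda>k. \<rho>\<^sub>0 (i, k)) = y0 i" for i by (simp add: \<rho>\<^sub>0_def)
  let ?I = "(UNIV :: 'r set) \<times> (exps 3 :: ('n \<Rightarrow> nat) set)" and ?J = "exps 8 :: ('n \<Rightarrow> nat) set"
  have fin: "finite ?I" "finite ?J" by auto
  obtain B :: "('n \<Rightarrow> nat) set" and k \<delta>\<^sub>1 where B: "finite B" and d1: "pev \<rho>\<^sub>0 \<delta>\<^sub>1 \<noteq> 0"
    and "\<forall>b\<in>B. (\<lambda>j. pev \<rho>\<^sub>0 (k b j)) \<in> ker \<rho>\<^sub>0 row ?I ?J"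
    and "\<forall>t. (\<forall>j\<in>?J. (\<Sum>b\<in>B. t b * pev \<rho>\<^sub>0 (k b j)) = 0) \<longrightarrow> (\<forall>b\<in>B. t b = 0)"
    and span0: "\<forall>c\<in>ker \<rho>\<^sub>0 row ?I ?J. spanned \<rho>\<^sub>0 k B ?J c"
    and span: "\<forall>\<rho> :: 'r \<times> 'n \<Rightarrow> complex. pev \<rho> \<delta>\<^sub>1 \<noteq> 0 \<longrightarrow> (\<forall>c\<in>ker \<rho> row ?I ?J. spanned \<rho> k B ?J c)"
    and on: "onto \<rho>\<^sub>0 row ?I ?J \<longrightarrow> card B + card ?I = card ?J \<and>
        (\<forall>\<rho> :: 'r \<times> 'n \<Rightarrow> complex. \<forall>b\<in>B. (\<lambda>j. pev \<rho> (k b j)) \<in> ker \<rho> row ?I ?J) \<and>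
        (\<forall>\<rho> :: 'r \<times> 'n \<Rightarrow> complex. pev \<rho> \<delta>\<^sub>1 \<noteq> 0 \<longrightarrow> onto \<rho> row ?I ?J)"
    using elimination[OF fin, where ?\<rho>\<^sub>0 = \<rho>\<^sub>0 and r = row and 'a = complex]
    by (elim exE conjE) (rule that; assumption)
  have "onto \<rho>\<^sub>0 row ?I ?J"
    unfolding onto_def
  proof
    fix d :: "'r \<times> ('n \<Rightarrow> nat) \<Rightarrow> F29"
    obtain c where "\<forall>i. \<forall>b\<in>exps 3. hasse 8 c b (y0 i) = d (i, b)" using onto_configuration[of d] by blast
    then have "\<forall>(i, b)\<in>?I. (\<Sum>j\<in>?J. pev \<rho>\<^sub>0 (row (i, b) j) * c j) = d (i, b)" unfolding row rho0 by auto
    then show "\<exists>c. \<forall>i\<in>?I. (\<Sum>j\<in>?J. pev \<rho>\<^sub>0 (row i j) * c j) = d i" by (intro exI[of _ c]) auto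
  qed
  note on = on[THEN mp, OF this]
  have "CARD('r) = 14" using bij_betw_same_card[OF h] by simp
  then have cardB: "card B = 5"
    using on unfolding card_cartesian_product card_exps card_index by (simp add: eval_nat_numeral)
  have eig_span: "spanned \<rho>\<^sub>0 k B ?J (eig A f)" if "(A, f) \<in> set family" for A f
  proof -
    have "eig A f \<in> octics \<rho>\<^sub>0" unfolding octics_iff rho0 using eig_ker[OF that] by blast
    with span0 show ?thesis by blast
  qed
  let ?G = "Inl ` B :: (('n \<Rightarrow> nat) + 'n) set"
  let ?P = "insert (Inr (kk 0)) ?G"
  let ?E = "insert (Inr (kk 1)) (insert (Inr (kk 0)) ?G)"
  have "fills ?P (gdeg 8) (\<lambda>g a. pev \<rho>\<^sub>0 (gco k g a)) (CARD('n) * 18)"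
  proof (rule fills_powers)
    show "gdeg 8 g \<le> 18" if "g \<in> ?P" for g using that by auto
    fix l and \<mu> :: "('n \<Rightarrow> nat) \<Rightarrow> F29"
    assume \<mu>: "annih ?P (gdeg 8) (\<lambda>g a. pev \<rho>\<^sub>0 (gco k g a)) 18 \<mu>"
    show "\<mu> (\<lambda>n. 18 * unitv l n) = 0"
    proof (rule powers_base)
      show "\<mu> a = 0" if "a \<in> exps 18" "0 < a (kk 0)" for a by (rule annih_coordinate[OF \<mu> _ that]) simp
      fix A f and m :: "'n \<Rightarrow> nat" assume A: "(A, f) \<in> set family" and m: "m \<in> exps 10"
      obtain t where t: "\<forall>j\<in>?J. eig A f j = (\<Sum>b\<in>B. t b * pev \<rho>\<^sub>0 (k b j))" using eig_span[OF A] unfolding spanned_def by blast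
      have "(\<Sum>a\<in>exps 8. pev \<rho>\<^sub>0 (k b a) * \<mu> (\<lambda>k. a k + m k)) = 0" if "b \<in> B" for b
      proof -
        have g: "Inl b \<in> ?P" using that by simp
        have "m \<in> exps (18 - gdeg 8 (Inl b :: ('n \<Rightarrow> nat) + 'n))" using m by simp
        from bspec[OF bspec[OF \<mu>[unfolded annih_def] g] this] show ?thesis by simp
      qed
      then have "0 = (\<Sum>b\<in>B. t b * (\<Sum>a\<in>exps 8. pev \<rho>\<^sub>0 (k b a) * \<mu> (\<lambda>k. a k + m k)))" by simp
      also have "\<dots> = (\<Sum>a\<in>exps 8. \<Sum>b\<in>B. t b * pev \<rho>\<^sub>0 (k b a) * \<mu> (\<lambda>k. a k + m k))"
        unfolding sum_distrib_left mult.assoc by (rule sum.swap)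
      also have "\<dots> = (\<Sum>a\<in>exps 8. eig A f a * \<mu> (\<lambda>k. a k + m k))"
        using t by (intro sum.cong refl) (simp add: sum_distrib_right)
      finally show "(\<Sum>a\<in>exps 8. eig A f a * \<mu> (\<lambda>k. a k + m k)) = 0" by simp
    qed
  qed
  then have "\<exists>\<delta>. pev \<rho>\<^sub>0 \<delta> \<noteq> 0 \<and> (\<forall>\<rho> :: 'r \<times> 'n \<Rightarrow> complex. pev \<rho> \<delta> \<noteq> 0 \<longrightarrow> fills ?P (gdeg 8) (\<lambda>g a. pev \<rho> (gco k g a)) (CARD('n) * 18))"
    by (rule fills_open[rotated 2]) (use B in \<open>auto simp: card_index\<close>)
  then obtain \<delta>\<^sub>2 where d2: "pev \<rho>\<^sub>0 \<delta>\<^sub>2 \<noteq> 0"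
    and P: "\<forall>\<rho> :: 'r \<times> 'n \<Rightarrow> complex. pev \<rho> \<delta>\<^sub>2 \<noteq> 0 \<longrightarrow> fills ?P (gdeg 8) (\<lambda>g a. pev \<rho> (gco k g a)) (CARD('n) * 18)"
    by (elim exE conjE) (rule that; assumption)
  have "\<exists>\<delta>. pev \<rho>\<^sub>0 \<delta> \<noteq> 0 \<and> (\<forall>\<rho> :: 'r \<times> 'n \<Rightarrow> complex. pev \<rho> \<delta> \<noteq> 0 \<longrightarrow> fills ?E (gdeg 4) (\<lambda>g a. pev \<rho> (gco (leading k i) g a)) (CARD('n) * 6))" for i
  proof -
    have "fills ?E (gdeg 4) (\<lambda>g a. pev \<rho>\<^sub>0 (gco (leading k i) g a)) (CARD('n) * 6)"
    proof (rule fills_powers)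
      show "gdeg 4 g \<le> 6" if "g \<in> ?E" for g using that by auto
      fix l and \<mu> :: "('n \<Rightarrow> nat) \<Rightarrow> F29"
      assume \<mu>: "annih ?E (gdeg 4) (\<lambda>g a. pev \<rho>\<^sub>0 (gco (leading k i) g a)) 6 \<mu>"
      show "\<mu> (\<lambda>n. 6 * unitv l n) = 0"
      proof (rule powers_exceptional[where i = i])
        show "\<mu> a = 0" if a: "a \<in> exps 6" "0 < a (kk 0) \<or> 0 < a (kk 1)" for a
          using a(2) by (elim disjE; intro annih_coordinate[OF \<mu> _ a(1)]) auto
        fix A f and m :: "'n \<Rightarrow> nat" assume A: "(A, f) \<in> set family" and m: "m \<in> exps 2"
        obtain t where t: "\<forall>j\<in>?J. eig A f j = (\<Sum>b\<in>B. t b * pev \<rho>\<^sub>0 (k b j))" using eig_span[OF A] unfolding spanned_def by blast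
        let ?T = "\<lambda>b c. hasse 8 (\<lambda>a. pev \<rho>\<^sub>0 (k b a)) c (y0 i)"
        have T: "hasse 8 (eig A f) c (y0 i) = (\<Sum>b\<in>B. t b * ?T b c)" for c
          unfolding hasse_lincomb[symmetric] by (rule hasse_cong) (use t in blast)
        have "(\<Sum>c\<in>exps 4. ?T b c * \<mu> (\<lambda>k. c k + m k)) = 0" if "b \<in> B" for b
        proof -
          have g: "Inl b \<in> ?E" using that by simp
          have "m \<in> exps (6 - gdeg 4 (Inl b :: ('n \<Rightarrow> nat) + 'n))" using m by simp
          from bspec[OF bspec[OF \<mu>[unfolded annih_def] g] this] show ?thesis by (simp add: pev_leading rho0)
        qed
        then have "0 = (\<Sum>b\<in>B. t b * (\<Sum>c\<in>exps 4. ?T b c * \<mu> (\<lambda>k. c k + m k)))" by simp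
        also have "\<dots> = (\<Sum>c\<in>exps 4. \<Sum>b\<in>B. t b * ?T b c * \<mu> (\<lambda>k. c k + m k))"
          unfolding sum_distrib_left mult.assoc by (rule sum.swap)
        also have "\<dots> = (\<Sum>c\<in>exps 4. hasse 8 (eig A f) c (y0 i) * \<mu> (\<lambda>k. c k + m k))"
          unfolding T sum_distrib_right ..
        finally show "(\<Sum>c\<in>exps 4. hasse 8 (eig A f) c (y0 i) * \<mu> (\<lambda>k. c k + m k)) = 0" by simp
      qed
    qed
    then show ?thesis by (rule fills_open[rotated 2]) (use B in \<open>auto simp: card_index\<close>)
  qed
  then have "\<forall>i. \<exists>\<delta>. pev \<rho>\<^sub>0 \<delta> \<noteq> 0 \<and> (\<forall>\<rho> :: 'r \<times> 'n \<Rightarrow> complex. pev \<rho> \<delta> \<noteq> 0 \<longrightarrow> fills ?E (gdeg 4) (\<lambda>g a. pev \<rho> (gco (leading k i) g a)) (CARD('n) * 6))" ..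
  then have "\<exists>\<epsilon>. \<forall>i. pev \<rho>\<^sub>0 (\<epsilon> i) \<noteq> 0 \<and> (\<forall>\<rho> :: 'r \<times> 'n \<Rightarrow> complex. pev \<rho> (\<epsilon> i) \<noteq> 0 \<longrightarrow> fills ?E (gdeg 4) (\<lambda>g a. pev \<rho> (gco (leading k i) g a)) (CARD('n) * 6))"
    by (rule choice)
  then obtain \<epsilon> where \<epsilon>: "\<forall>i. pev \<rho>\<^sub>0 (\<epsilon> i) \<noteq> 0 \<and> (\<forall>\<rho> :: 'r \<times> 'n \<Rightarrow> complex. pev \<rho> (\<epsilon> i) \<noteq> 0 \<longrightarrow> fills ?E (gdeg 4) (\<lambda>g a. pev \<rho> (gco (leading k i) g a)) (CARD('n) * 6))" ..
  define \<delta> where "\<delta> = Mul (Mul \<delta>\<^sub>1 \<delta>\<^sub>2) (Mul (Prod \<epsilon> UNIV) (Prod (\<lambda>i. Par (i, kk 0)) UNIV))"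
  have Y1: "Y i (kk 0) = 1" for i by (simp add: Y_def ix_kk base_def pu_def pv_def)
  have "pev \<rho>\<^sub>0 \<delta> \<noteq> 0" using d1 d2 \<epsilon> by (simp add: \<delta>_def \<rho>\<^sub>0_def Y1)
  then have "red (pev (\<lambda>v. case v of (i, k) \<Rightarrow> Y i k) \<delta>) \<noteq> 0" unfolding \<rho>\<^sub>0_def pev_of_int .
  then have "pev (\<lambda>v. case v of (i, k) \<Rightarrow> Y i k) \<delta> \<noteq> 0" by (metis of_int_0)
  then have "pev (\<lambda>v. complex_of_int (case v of (i, k) \<Rightarrow> Y i k)) \<delta> \<noteq> 0" unfolding pev_of_int by simp
  then have "pev (\<lambda>(i, k). complex_of_int (Y i k)) \<delta> \<noteq> 0" by (simp add: split_def)
  moreover have "onto \<rho> row ?I ?J \<and>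
      (\<exists>(B :: ('n \<Rightarrow> nat) set) k. finite B \<and> card B = 5 \<and> (\<forall>c\<in>octics \<rho>. spanned \<rho> k B (exps 8) c)) \<and>
      (\<exists>A. finite A \<and> (\<forall>x. (\<forall>c\<in>octics \<rho>. form 8 c x = 0) \<longrightarrow> x \<noteq> (\<lambda>_. 0) \<longrightarrow> (\<exists>a\<in>A. \<exists>t. x = (\<lambda>k. t * a k)))) \<and>
      (\<forall>i. \<exists>A. finite A \<and> (\<forall>x. x (kk 0) = 0 \<longrightarrow> (\<forall>c\<in>octics \<rho>. form 4 (\<lambda>b. hasse 8 c b (\<lambda>k. \<rho> (i, k))) x = 0) \<longrightarrow>
         x \<noteq> (\<lambda>_. 0) \<longrightarrow> (\<exists>a\<in>A. \<exists>t. x = (\<lambda>k. t * a k)))) \<and>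
      (\<forall>i. \<rho> (i, kk 0) \<noteq> 0)" if \<delta>: "pev \<rho> \<delta> \<noteq> (0::complex)" for \<rho>
  proof (intro conjI)
    have nz: "pev \<rho> \<delta>\<^sub>1 \<noteq> 0" "pev \<rho> \<delta>\<^sub>2 \<noteq> 0" "pev \<rho> (\<epsilon> i) \<noteq> 0" "\<rho> (i, kk 0) \<noteq> 0" for i
      using \<delta> by (auto simp: \<delta>_def)
    have mem: "(\<lambda>j. pev \<rho> (k b j)) \<in> octics \<rho>" if "b \<in> B" for b using on that by blast
    show "onto \<rho> row ?I ?J" using on nz(1) by blast
    show "\<exists>(B :: ('n \<Rightarrow> nat) set) k. finite B \<and> card B = 5 \<and> (\<forall>c\<in>octics \<rho>. spanned \<rho> k B (exps 8) c)"
      using B cardB span nz(1) by (intro exI[of _ B] exI[of _ k]) simp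
    show "\<forall>i. \<rho> (i, kk 0) \<noteq> 0" using nz by simp
    have "1 \<le> CARD('n) * 18" by (simp add: card_index)
    from finite_cone[OF P[rule_format, OF nz(2)] this, of "kk 0", OF gdeg_simps(2) form_coordinate]
    obtain A where A: "finite A" "\<forall>x. (\<forall>g\<in>?G. form (gdeg 8 g) (\<lambda>a. pev \<rho> (gco k g a)) x = 0) \<longrightarrow> x \<noteq> (\<lambda>_. 0) \<longrightarrow> (\<exists>a\<in>A. \<exists>t. x = (\<lambda>k. t * a k))"
      by (elim exE conjE) (rule that; assumption)
    show "\<exists>A. finite A \<and> (\<forall>x. (\<forall>c\<in>octics \<rho>. form 8 c x = 0) \<longrightarrow> x \<noteq> (\<lambda>_. 0) \<longrightarrow> (\<exists>a\<in>A. \<exists>t. x = (\<lambda>k. t * a k)))"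
    proof (rule exI[of _ A], intro conjI A(1) allI impI)
      fix x :: "'n \<Rightarrow> complex" assume x: "\<forall>c\<in>octics \<rho>. form 8 c x = 0" "x \<noteq> (\<lambda>_. 0)"
      have "\<forall>g\<in>?G. form (gdeg 8 g) (\<lambda>a. pev \<rho> (gco k g a)) x = 0" using x(1) mem by auto
      with A(2) x(2) show "\<exists>a\<in>A. \<exists>t. x = (\<lambda>k. t * a k)" by blast
    qed
    show "\<forall>i. \<exists>A. finite A \<and> (\<forall>x. x (kk 0) = 0 \<longrightarrow> (\<forall>c\<in>octics \<rho>. form 4 (\<lambda>b. hasse 8 c b (\<lambda>k. \<rho> (i, k))) x = 0) \<longrightarrow>
         x \<noteq> (\<lambda>_. 0) \<longrightarrow> (\<exists>a\<in>A. \<exists>t. x = (\<lambda>k. t * a k)))"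
    proof
      fix i
      have F: "fills ?E (gdeg 4) (\<lambda>g a. pev \<rho> (gco (leading k i) g a)) (CARD('n) * 6)" using \<epsilon> nz(3) by blast
      have "1 \<le> CARD('n) * 6" by (simp add: card_index)
      from finite_cone[OF F this, of "kk 1", OF gdeg_simps(2) form_coordinate]
      obtain A where A: "finite A" "\<forall>x. (\<forall>g\<in>insert (Inr (kk 0)) ?G. form (gdeg 4 g) (\<lambda>a. pev \<rho> (gco (leading k i) g a)) x = 0) \<longrightarrow> x \<noteq> (\<lambda>_. 0) \<longrightarrow> (\<exists>a\<in>A. \<exists>t. x = (\<lambda>k. t * a k))"
        by (elim exE conjE) (rule that; assumption)
      show "\<exists>A. finite A \<and> (\<forall>x. x (kk 0) = 0 \<longrightarrow> (\<forall>c\<in>octics \<rho>. form 4 (\<lambda>b. hasse 8 c b (\<lambda>k. \<rho> (i, k))) x = 0) \<longrightarrow>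
         x \<noteq> (\<lambda>_. 0) \<longrightarrow> (\<exists>a\<in>A. \<exists>t. x = (\<lambda>k. t * a k)))"
      proof (rule exI[of _ A], intro conjI A(1) allI impI)
        fix x :: "'n \<Rightarrow> complex"
        assume x: "x (kk 0) = 0" "\<forall>c\<in>octics \<rho>. form 4 (\<lambda>b. hasse 8 c b (\<lambda>k. \<rho> (i, k))) x = 0" "x \<noteq> (\<lambda>_. 0)"
        have "form 4 (\<lambda>a. pev \<rho> (leading k i b a)) x = 0" if "b \<in> B" for b
          using bspec[OF x(2) mem[OF that]] by (simp only: pev_leading)
        moreover have "form (gdeg 4 (Inr (kk 0) :: ('n \<Rightarrow> nat) + 'n)) (\<lambda>a. pev \<rho> (gco (leading k i) (Inr (kk 0)) a)) x = 0"
          unfolding gdeg_simps form_coordinate by (rule x(1))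
        ultimately have "\<forall>g\<in>insert (Inr (kk 0)) ?G. form (gdeg 4 g) (\<lambda>a. pev \<rho> (gco (leading k i) g a)) x = 0"
          by (auto simp only: ball_simps gdeg_simps pev_gco)
        with A(2) x(3) show "\<exists>a\<in>A. \<exists>t. x = (\<lambda>k. t * a k)" by blast
      qed
    qed
  qed
  ultimately show ?thesis by (intro exI[of _ \<delta>]) blast
qed

end

lemma proj_space_span:
  assumes "L \<in> proj_space" "v \<in> L" "v \<noteq> 0"
  shows "L = vec.span {v}"
proof -
  have s: "vec.subspace L" "vec.dim L = 1" using assms(1) by (auto simp: proj_space_def)
  moreover have "vec.dim (vec.span {v}) = 1" using assms vec.dim_span_eq_card_independent[of "{v}"] by simp
  moreover have "vec.span {v} \<subseteq> L" using assms(2) s(1) by (simp add: vec.span_minimal)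
  ultimately show ?thesis using vec.subspace_dim_equal[of "vec.span {v}" L] by (simp add: vec.subspace_span)
qed

context configuration
begin

text \<open>Surjectivity of the system already implies that the points are distinct, since the derivatives at
  proportional vectors are proportional.\<close>

lemma general_points:
  fixes p :: "'r \<Rightarrow> (complex ^ 'n) set"
  assumes p: "p \<in> proj_tuples" and y: "y \<in> tprod p"
    and y_nz: "\<forall>i. y i $ kk 0 \<noteq> 0"
    and on: "onto (\<lambda>(i, k). y i $ k) row (UNIV \<times> exps 3) (exps 8)"
    and B: "finite B" "card B = 5" "\<forall>c\<in>octics (\<lambda>(i, k). y i $ k). spanned (\<lambda>(i, k). y i $ k) co B (exps 8) c"
    and A: "finite A" "\<forall>x. (\<forall>c\<in>octics (\<lambda>(i, k). y i $ k). form 8 c x = 0) \<longrightarrow> x \<noteq> (\<lambda>_. 0) \<longrightarrow> (\<exists>a\<in>A. \<exists>t. x = (\<lambda>k. t * a k))"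
    and E: "\<forall>i. \<exists>A. finite A \<and> (\<forall>x. x (kk 0) = 0 \<longrightarrow> (\<forall>c\<in>octics (\<lambda>(i, k). y i $ k). form 4 (\<lambda>b. hasse 8 c b (\<lambda>k. y i $ k)) x = 0) \<longrightarrow>
         x \<noteq> (\<lambda>_. 0) \<longrightarrow> (\<exists>a\<in>A. \<exists>t. x = (\<lambda>k. t * a k)))"
  shows "inj p" "h0 p (8, \<lambda>_. 4) \<le> 5" "krull_dim (subtopology (zariski (blowup p)) (base_locus p (8, \<lambda>_. 4))) \<le> 0"
proof -
  let ?\<rho> = "\<lambda>(i, k). y i $ k"
  have nz: "y i \<noteq> 0" for i using y_nz by (metis zero_index)
  have span: "p i = vec.span {y i}" for i
    using p y nz[of i] by (intro proj_space_span) (auto simp: proj_tuples_def tprod_def)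
  have sep: "y i \<notin> p j" if "i \<noteq> j" for i j
  proof
    assume "y i \<in> p j"
    then obtain t where t: "y i = t *s y j" unfolding span vec.span_singleton by auto
    let ?d = "\<lambda>(l, b). if l = i then 1 else 0 :: complex"
    obtain c where c: "\<forall>z\<in>(UNIV :: 'r set) \<times> (exps 3 :: ('n \<Rightarrow> nat) set). (\<Sum>a\<in>exps 8. pev ?\<rho> (row z a) * c a) = ?d z"
      using on unfolding onto_def by blast
    have val: "hasse 8 c b (\<lambda>k. y l $ k) = (if l = i then 1 else 0)" if "b \<in> exps 3" for l b
    proof -
      have "(l, b) \<in> UNIV \<times> exps 3" using that by simp
      from bspec[OF c this] show ?thesis unfolding row by simp
    qed
    have b: "(\<lambda>l. 3 * unitv (kk 0) l) \<in> exps 3" by (rule unitv_exps)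
    have "(\<lambda>k. y i $ k) = (\<lambda>k. t * y j $ k)" by (simp add: t)
    then have "hasse 8 c (\<lambda>l. 3 * unitv (kk 0) l) (\<lambda>k. y i $ k) = t ^ 5 * hasse 8 c (\<lambda>l. 3 * unitv (kk 0) l) (\<lambda>k. y j $ k)"
      using hasse_scale[OF b, of 8 c t "\<lambda>k. y j $ k"] by simp
    then show False using val[OF b] that by simp
  qed
  interpret blown_points y p
    by unfold_locales (rule span, rule nz, erule sep)
  have self: "y i \<in> p i" for i unfolding span by (rule vec.span_base) simp
  show "inj p" using sep self by (intro injI) metis
  have octics: "forms_with_mult 8 (\<lambda>_. 4) = octics ?\<rho>"
  proof (intro set_eqI iffI)
    fix c assume c: "c \<in> forms_with_mult 8 (\<lambda>_. 4)"
    show "c \<in> octics ?\<rho>" unfolding octics_iff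
    proof (intro allI ballI)
      fix i and b :: "'n \<Rightarrow> nat" assume b: "b \<in> exps 3"
      have "form 3 (\<lambda>b. hasse 8 c b (\<lambda>k. y i $ k)) w = 0" for w
        using c unfolding forms_with_mult_def tay_def by simp
      from form_zero_coeffs[OF this b] show "hasse 8 c b (\<lambda>k. ?\<rho> (i, k)) = 0" by simp
    qed
  next
    fix c assume "c \<in> octics ?\<rho>"
    then have c: "hasse 8 c b (\<lambda>k. y i $ k) = 0" if "b \<in> exps 3" for i b using that by (simp add: octics_iff)
    show "c \<in> forms_with_mult 8 (\<lambda>_. 4)" unfolding forms_with_mult_def tay_def
    proof (intro CollectI allI impI)
      fix i and j :: nat and w :: "'n \<Rightarrow> complex" assume j: "j < 4" "j \<le> 8"
      have "hasse 8 c b (\<lambda>k. y i $ k) = 0" if "b \<in> exps j" for b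
        by (rule hasse_descend[of 3 8 c _ j]) (use c j that in auto)
      then show "form j (\<lambda>b. hasse 8 c b (\<lambda>k. y i $ k)) w = 0" by (simp add: form_def)
    qed
  qed
  have "h0 p (8, \<lambda>_. 4) \<le> card B"
  proof (rule h0_le)
    show "\<exists>t. \<forall>a\<in>exps 8. c a = (\<Sum>b\<in>B. t b * pev ?\<rho> (co b a))" if "c \<in> forms_with_mult 8 (\<lambda>_. 4)" for c
      using B(3) that unfolding octics spanned_def by blast
  qed (use B card_index in auto)
  then show "h0 p (8, \<lambda>_. 4) \<le> 5" using B(2) by simp
  from E have "\<exists>A. \<forall>i. finite (A i) \<and> (\<forall>x. x (kk 0) = 0 \<longrightarrow> (\<forall>c\<in>octics ?\<rho>. form 4 (\<lambda>b. hasse 8 c b (\<lambda>k. y i $ k)) x = 0) \<longrightarrow>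
         x \<noteq> (\<lambda>_. 0) \<longrightarrow> (\<exists>a\<in>A i. \<exists>t. x = (\<lambda>k. t * a k)))" by (rule choice)
  then obtain A' where A': "\<forall>i. finite (A' i) \<and> (\<forall>x. x (kk 0) = 0 \<longrightarrow> (\<forall>c\<in>octics ?\<rho>. form 4 (\<lambda>b. hasse 8 c b (\<lambda>k. y i $ k)) x = 0) \<longrightarrow>
         x \<noteq> (\<lambda>_. 0) \<longrightarrow> (\<exists>a\<in>A' i. \<exists>t. x = (\<lambda>k. t * a k)))" ..
  have fin: "finite (base_locus p (8, \<lambda>_. 4))"
  proof (rule base_locus_finite[where ?A0.0 = "(\<lambda>a. \<chi> k. a k) ` A" and ?A1.0 = "\<lambda>i. (\<lambda>a. \<chi> k. a k) ` A' i"])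
    show "(4::nat) \<le> 8" by simp
    show "finite ((\<lambda>a. \<chi> k. a k) ` A)" using A(1) by simp
    show "finite ((\<lambda>a. \<chi> k. a k) ` A' i)" for i using A' by simp
    show "\<exists>a\<in>(\<lambda>a. \<chi> k. a k) ` A. x \<in> vec.span {a}"
      if x: "off x" "\<And>c. c \<in> forms_with_mult 8 (\<lambda>_. 4) \<Longrightarrow> form 8 c (\<lambda>k. x $ k) = 0" for x
    proof -
      have "x \<noteq> 0" using x(1) vec.span_zero unfolding off_def span by metis
      then have "(\<lambda>k. x $ k) \<noteq> (\<lambda>_. 0)" by (auto simp: fun_eq_iff vec_eq_iff)
      moreover have "\<forall>c\<in>octics ?\<rho>. form 8 c (\<lambda>k. x $ k) = 0" using x(2) unfolding octics by blast
      ultimately obtain a t where a: "a \<in> A" "(\<lambda>k. x $ k) = (\<lambda>k. t * a k)" using A(2) by blast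
      then have "x = t *s (\<chi> k. a k)" by (simp add: vec_eq_iff fun_eq_iff)
      then have "x \<in> vec.span {\<chi> k. a k}" unfolding vec.span_singleton by blast
      with a(1) show ?thesis by blast
    qed
    show "\<exists>a\<in>(\<lambda>a. \<chi> k. a k) ` A' i. w \<in> vec.span {y i, a}"
      if w: "w \<notin> p i" "\<And>c. c \<in> forms_with_mult 8 (\<lambda>_. 4) \<Longrightarrow> tay 8 c 4 (\<lambda>k. y i $ k) (\<lambda>k. w $ k) = 0" for i w
    proof -
      \<comment> \<open>the representative of the tangent direction \<open>w\<close> whose coordinate \<open>kk 0\<close> vanishes\<close>
      define s where "s = w $ kk 0 / y i $ kk 0"
      define x where "x = (\<lambda>k. w $ k - s * y i $ k)"
      have wx: "w = (\<chi> k. x k) + s *s y i" by (simp add: x_def vec_eq_iff)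
      have "x (kk 0) = 0" using y_nz by (simp add: x_def s_def)
      moreover have "x \<noteq> (\<lambda>_. 0)"
      proof
        assume "x = (\<lambda>_. 0)"
        then have "w = s *s y i" by (simp add: x_def fun_eq_iff vec_eq_iff)
        with w(1) show False unfolding span vec.span_singleton by blast
      qed
      moreover have "\<forall>c\<in>octics ?\<rho>. form 4 (\<lambda>b. hasse 8 c b (\<lambda>k. y i $ k)) x = 0"
      proof
        fix c assume "c \<in> octics ?\<rho>"
        then have c: "c \<in> forms_with_mult 8 (\<lambda>_. 4)" unfolding octics .
        then have "tay 8 c j (\<lambda>k. y i $ k) w' = 0" if "j < 4" for j w' using that unfolding forms_with_mult_def by simp
        then have "tay 8 c 4 (\<lambda>k. y i $ k) x = tay 8 c 4 (\<lambda>k. y i $ k) (\<lambda>k. w $ k)" unfolding x_def by (rule tay_shift) simp_all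
        then show "form 4 (\<lambda>b. hasse 8 c b (\<lambda>k. y i $ k)) x = 0" using w(2)[OF c] by (simp add: tay_def)
      qed
      ultimately obtain a t where a: "a \<in> A' i" "x = (\<lambda>k. t * a k)" using A' by blast
      have "w = t *s (\<chi> k. a k) + s *s y i" unfolding wx a(2) by (simp add: vec_eq_iff)
      moreover have "t *s (\<chi> k. a k) + s *s y i \<in> vec.span {y i, \<chi> k. a k}"
        by (intro vec.span_add vec.span_scale vec.span_base) auto
      ultimately show ?thesis using a(1) by blast
    qed
  qed
  show "krull_dim (subtopology (zariski (blowup p)) (base_locus p (8, \<lambda>_. 4))) \<le> 0"
    by (rule krull_dim_finite[OF fin]) (auto simp: base_locus_def)
qed

end

theorem proposition6p2:
  fixes D :: "14 divisor"
  assumes "D = (2, \<lambda>_. 1)"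
  shows "\<exists>W :: (14 \<Rightarrow> (complex ^ 5) set) set.
    openin (zariski proj_tuples) W \<and> W \<noteq> {} \<and>
    (\<forall>p\<in>W. inj p \<and>
       \<not> special p (multiple 4 D) \<and>
       krull_dim (subtopology (zariski (blowup p)) (base_locus p (multiple 4 D))) \<le> 0)"
proof -
  obtain ix :: "5 \<Rightarrow> nat" where ix: "bij_betw ix UNIV {0..<CARD(5)}" using ex_bij_betw_finite_nat[OF finite] by blast
  obtain h :: "14 \<Rightarrow> nat" where h: "bij_betw h UNIV {0..<CARD(14)}" using ex_bij_betw_finite_nat[OF finite] by blast
  interpret configuration ix h
    by unfold_locales (use ix h in \<open>simp_all add: atLeast0LessThan\<close>)
  obtain \<delta> :: "(14 \<times> 5) pexp" where \<delta>: "pev (\<lambda>(i, k). complex_of_int (Y i k)) \<delta> \<noteq> 0"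
    and gen: "\<forall>\<rho>. pev \<rho> \<delta> \<noteq> (0::complex) \<longrightarrow>
      onto \<rho> row (UNIV \<times> exps 3) (exps 8) \<and>
      (\<exists>(B :: (5 \<Rightarrow> nat) set) k. finite B \<and> card B = 5 \<and> (\<forall>c\<in>octics \<rho>. spanned \<rho> k B (exps 8) c)) \<and>
      (\<exists>A. finite A \<and> (\<forall>x. (\<forall>c\<in>octics \<rho>. form 8 c x = 0) \<longrightarrow> x \<noteq> (\<lambda>_. 0) \<longrightarrow> (\<exists>a\<in>A. \<exists>t. x = (\<lambda>k. t * a k)))) \<and>
      (\<forall>i. \<exists>A. finite A \<and> (\<forall>x. x (kk 0) = 0 \<longrightarrow> (\<forall>c\<in>octics \<rho>. form 4 (\<lambda>b. hasse 8 c b (\<lambda>k. \<rho> (i, k))) x = 0) \<longrightarrow>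
         x \<noteq> (\<lambda>_. 0) \<longrightarrow> (\<exists>a\<in>A. \<exists>t. x = (\<lambda>k. t * a k)))) \<and>
      (\<forall>i. \<rho> (i, kk 0) \<noteq> 0)"
    using general_octics by (elim exE conjE) (rule that; assumption)
  let ?f = "\<lambda>y :: 14 \<Rightarrow> complex ^ 5. pev (\<lambda>(i, k). y i $ k) \<delta>"
  let ?W = "nv proj_tuples ?f"
  have "openin (zariski proj_tuples) ?W" by (intro openin_nv tpoly_pev)
  moreover have "?W \<noteq> {}"
  proof -
    define y :: "14 \<Rightarrow> complex ^ 5" where "y = (\<lambda>i. \<chi> k. of_int (Y i k))"
    have y: "?f y \<noteq> 0" using \<delta> by (simp add: y_def)
    from gen[rule_format, OF y, THEN conjunct2, THEN conjunct2, THEN conjunct2, THEN conjunct2]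
    have "y i $ kk 0 \<noteq> 0" for i by simp
    then have "y i \<noteq> 0" for i by (metis zero_index)
    then have "vec.dim (vec.span {y i}) = 1" for i using vec.dim_span_eq_card_independent[of "{y i}"] by simp
    then have "(\<lambda>i. vec.span {y i}) \<in> proj_tuples" by (simp add: proj_tuples_def proj_space_def vec.subspace_span)
    moreover have "y \<in> tprod (\<lambda>i. vec.span {y i})" by (simp add: tprod_def vec.span_base)
    ultimately show ?thesis using y unfolding nv_def by blast
  qed
  moreover have "inj p \<and> \<not> special p (multiple 4 D) \<and>
       krull_dim (subtopology (zariski (blowup p)) (base_locus p (multiple 4 D))) \<le> 0" if "p \<in> ?W" for p
  proof -
    from that obtain y where y: "p \<in> proj_tuples" "y \<in> tprod p" "?f y \<noteq> 0" unfolding nv_def by blast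
    let ?\<rho> = "\<lambda>(i, k). y i $ k"
    note g = gen[rule_format, OF y(3)]
    obtain B :: "(5 \<Rightarrow> nat) set" and co where B: "finite B" "card B = 5" "\<forall>c\<in>octics ?\<rho>. spanned ?\<rho> co B (exps 8) c"
      using g[THEN conjunct2, THEN conjunct1] by (elim exE conjE) (rule that; assumption)
    obtain A where A: "finite A" "\<forall>x. (\<forall>c\<in>octics ?\<rho>. form 8 c x = 0) \<longrightarrow> x \<noteq> (\<lambda>_. 0) \<longrightarrow> (\<exists>a\<in>A. \<exists>t. x = (\<lambda>k. t * a k))"
      using g[THEN conjunct2, THEN conjunct2, THEN conjunct1] by (elim exE conjE) (rule that; assumption)
    note E = g[THEN conjunct2, THEN conjunct2, THEN conjunct2, THEN conjunct1, unfolded prod.case]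
      and N = g[THEN conjunct2, THEN conjunct2, THEN conjunct2, THEN conjunct2, unfolded prod.case]
    note pts = general_points[OF y(1,2) N g[THEN conjunct1] B A E]
    have D: "multiple 4 D = (8, \<lambda>_. 4)" by (simp add: multiple_def assms)
    have "virtual_dim 4 (8, \<lambda>_ :: 14. 4) = 4" by (simp add: virtual_dim_def eval_nat_numeral)
    then have "\<not> special p (8, \<lambda>_. 4)" using pts(2) by (simp add: special_def dim_linear_system_def expected_dim_def)
    with pts(1,3) show ?thesis by (simp only: D simp_thms)
  qed
  ultimately show ?thesis by (intro exI[of _ ?W]) blast
qed

end
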